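(* Let $m,n\geq 2$ and $k\in[0,n-1]$. If the Structural Property $\mathcal{P}(n,1,k)$ holds (i.e. for the group $C_n\oplus C_n$ and this $k$), then the Structural Property $\mathcal{P}(n,m,k)$ holds (i.e. for the group $C_n\oplus C_{mn}$ and the same $k$).
   Context: For $n\geq 1$, $C_n$ denotes a cyclic group of order $n$. For $x,y\in\mathbb Z$, $[x,y]=\{z\in\mathbb Z: x\le z\le y\}$. A basis of $G=C_n\oplus C_{mn}$ ($n\ge 2$) is an ordered pair $(e_1,e_2)$ with $G=\langle e_1\rangle\oplus\langle e_2\rangle$. A sequence over an abelian group $G$ is a finite unordered list of elements (a multiset), written multiplicatively $S=g_1\cdot\ldots\cdot g_\ell$; $|S|=\ell$ is its length; $g^{[t]}$ denotes $g$ repeated $t$ times and $\prod^\bullet$ denotes concatenation of sequences; $\sigma(S)=g_1+\dots+g_\ell$; $\Sigma_{\le N}(S)$ is the set of sums $\sigma(T)$ over all subsequences $T$ of $S$ with $1\le |T|\le N$. $\mathrm{ord}(g)$ is the order of $g$. Structural Property $\mathcal P(n,m,k)$ (for $n\ge 2$, $m\ge1$, $G=C_n\oplus C_{mn}$, $k\in[0,n-1]$): for every sequence $S$ over $G$ with $|S|=mn+n-2+k$ and $0\notin\Sigma_{\le mn+n-1-k}(S)$, there exists either a basis $(e_1,e_2)$ of $G$ with $\mathrm{ord}(e_2)=mn$, or a generating set $\{g_1,g_2\}$ of $G$ with $\mathrm{ord}(g_1+g_2)=mn$, such that: 1. If $k=0$, then the sequence $S\cdot g$, where $g=-\sigma(S)$,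 has one of the forms (a)–(d) listed in item 2. 2. If $k=1$, then $S$ has one of the forms: (a) $e_1^{[n-1]}\cdot\prod^\bullet_{i\in[1,mn]}(x_ie_1+e_2)$ with $x_i\in[0,n-1]$, $x_1+\dots+x_{mn}\equiv1\pmod n$; (b) $e_2^{[mn-1]}\cdot\prod^\bullet_{i\in[1,n]}(x_ie_2+e_1)$ with $x_i\in[0,mn-1]$, $x_1+\dots+x_n\equiv 1\pmod{mn}$; (c) $g_1^{[sn-1]}\cdot(g_1+g_2)^{[(m-s)n+1]}\cdot\prod^\bullet_{i\in[1,n-1]}(-x_ig_1+g_2)$ for some $s\in[1,m-1]$, $x_i\in[-1,n-2]$ with $x_1+\dots+x_{n-1}=0$ and $ng_2=0$; (d) $g_1^{[n-1]}\cdot(g_1+g_2)^{[(m-1)n+1]}\cdot\prod^\bullet_{i\in[1,n-1]}(-x_ig_1+g_2)$ with $x_i\in[-1,n-2]$, $x_1+\dots+x_{n-1}=0$. 3. If $k\in[2,n-2]$, then either (a) $S=e_1^{[n-1]}\cdot e_2^{[sn-1]}\cdot(e_1+e_2)^{[(m-s)n+k]}$ for some $s\in[1,m]$, or (b) $S=g_1^{[n-1]}\cdot g_2^{[n-1]}\cdot(g_1+g_2)^{[(m-1)n+k]}$. 4. If $k=n-1$, then either (a) $S=e_1^{[n-1]}\cdot e_2^{[sn-1]}\cdot(xe_1+e_2)^{[(m-s)n+n-1]}$ for some $s\in[1,m]$ and $x\in[1,n-1]$ with $\gcd(x,n)=1$, or (b) $S=g_1^{[n-1]}\cdot g_2^{[n-1]}\cdot(g_1+g_2)^{[(m-1)n+n-1]}$.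 Moreover, if $m=1$, then alternative (a) holds in each applicable item. *)

theory Defs
  imports Main "HOL-Library.Multiset"
begin

text \<open>The group G = C_n (+) C_(mn) is modelled concretely as the set of integer pairs
  [0,n-1] x [0,mn-1] with componentwise addition modulo n resp. mn.
  Sequences over G are multisets of elements of G.\<close>

definition grp :: "nat \<Rightarrow> nat \<Rightarrow> (int \<times> int) set" where
  "grp n m = {0..<int n} \<times> {0..<int (m * n)}"

definition red :: "nat \<Rightarrow> nat \<Rightarrow> int \<times> int \<Rightarrow> int \<times> int" where
  "red n m x = (fst x mod int n, snd x mod int (m * n))"

definition gadd :: "nat \<Rightarrow> nat \<Rightarrow> int \<times> int \<Rightarrow> int \<times> int \<Rightarrow> int \<times> int" where
  "gadd n m x y = red n m (fst x + fst y, snd x + snd y)"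

definition gsmul :: "nat \<Rightarrow> nat \<Rightarrow> int \<Rightarrow> int \<times> int \<Rightarrow> int \<times> int" where
  "gsmul n m a x = red n m (a * fst x, a * snd x)"

definition gneg :: "nat \<Rightarrow> nat \<Rightarrow> int \<times> int \<Rightarrow> int \<times> int" where
  "gneg n m x = gsmul n m (-1) x"

definition gsum :: "nat \<Rightarrow> nat \<Rightarrow> (int \<times> int) multiset \<Rightarrow> int \<times> int" where
  "gsum n m S = red n m (sum_mset (image_mset fst S), sum_mset (image_mset snd S))"

definition gord :: "nat \<Rightarrow> nat \<Rightarrow> int \<times> int \<Rightarrow> nat" where
  "gord n m g = (LEAST k::nat. k > 0 \<and> gsmul n m (int k) g = (0, 0))"

definition is_seq :: "nat \<Rightarrow> nat \<Rightarrow> (int \<times> int) multiset \<Rightarrow> bool" where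
  "is_seq n m S \<longleftrightarrow> set_mset S \<subseteq> grp n m"

definition sums_le :: "nat \<Rightarrow> nat \<Rightarrow> nat \<Rightarrow> (int \<times> int) multiset \<Rightarrow> (int \<times> int) set" where
  "sums_le n m N S = {gsum n m T | T. T \<subseteq># S \<and> 1 \<le> size T \<and> size T \<le> N}"

definition is_basis :: "nat \<Rightarrow> nat \<Rightarrow> int \<times> int \<Rightarrow> int \<times> int \<Rightarrow> bool" where
  "is_basis n m e1 e2 \<longleftrightarrow> e1 \<in> grp n m \<and> e2 \<in> grp n m \<and>
     bij_betw (\<lambda>(a, b). gadd n m (gsmul n m a e1) (gsmul n m b e2))
       ({0..<int (gord n m e1)} \<times> {0..<int (gord n m e2)}) (grp n m)"

definition is_genset :: "nat \<Rightarrow> nat \<Rightarrow> int \<times> int \<Rightarrow> int \<times> int \<Rightarrow> bool" where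
  "is_genset n m g1 g2 \<longleftrightarrow> g1 \<in> grp n m \<and> g2 \<in> grp n m \<and>
     (\<forall>x \<in> grp n m. \<exists>a b :: int. x = gadd n m (gsmul n m a g1) (gsmul n m b g2))"

definition basis_ok :: "nat \<Rightarrow> nat \<Rightarrow> int \<times> int \<Rightarrow> int \<times> int \<Rightarrow> bool" where
  "basis_ok n m e1 e2 \<longleftrightarrow> is_basis n m e1 e2 \<and> gord n m e2 = m * n"

definition genset_ok :: "nat \<Rightarrow> nat \<Rightarrow> int \<times> int \<Rightarrow> int \<times> int \<Rightarrow> bool" where
  "genset_ok n m g1 g2 \<longleftrightarrow> is_genset n m g1 g2 \<and> gord n m (gadd n m g1 g2) = m * n"

definition form2a :: "nat \<Rightarrow> nat \<Rightarrow> (int \<times> int) multiset \<Rightarrow> int \<times> int \<Rightarrow> int \<times> int \<Rightarrow> bool" where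
  "form2a n m S e1 e2 \<longleftrightarrow> basis_ok n m e1 e2 \<and>
    (\<exists>x :: nat \<Rightarrow> int. (\<forall>i \<in> {1..m * n}. 0 \<le> x i \<and> x i \<le> int n - 1) \<and>
       (\<Sum>i = 1..m * n. x i) mod int n = 1 mod int n \<and>
       S = replicate_mset (n - 1) e1 +
           image_mset (\<lambda>i. gadd n m (gsmul n m (x i) e1) e2) (mset_set {1..m * n}))"

definition form2b :: "nat \<Rightarrow> nat \<Rightarrow> (int \<times> int) multiset \<Rightarrow> int \<times> int \<Rightarrow> int \<times> int \<Rightarrow> bool" where
  "form2b n m S e1 e2 \<longleftrightarrow> basis_ok n m e1 e2 \<and>
    (\<exists>x :: nat \<Rightarrow> int. (\<forall>i \<in> {1..n}. 0 \<le> x i \<and> x i \<le> int (m * n) - 1) \<and>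
       (\<Sum>i = 1..n. x i) mod int (m * n) = 1 mod int (m * n) \<and>
       S = replicate_mset (m * n - 1) e2 +
           image_mset (\<lambda>i. gadd n m (gsmul n m (x i) e2) e1) (mset_set {1..n}))"

definition form2c :: "nat \<Rightarrow> nat \<Rightarrow> (int \<times> int) multiset \<Rightarrow> int \<times> int \<Rightarrow> int \<times> int \<Rightarrow> bool" where
  "form2c n m S g1 g2 \<longleftrightarrow> genset_ok n m g1 g2 \<and>
    (\<exists>s :: nat. \<exists>x :: nat \<Rightarrow> int. 1 \<le> s \<and> s \<le> m - 1 \<and>
       (\<forall>i \<in> {1..n - 1}. -1 \<le> x i \<and> x i \<le> int n - 2) \<and>
       (\<Sum>i = 1..n - 1. x i) = 0 \<and>
       gsmul n m (int n) g2 = (0, 0) \<and>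
       S = replicate_mset (s * n - 1) g1 + replicate_mset ((m - s) * n + 1) (gadd n m g1 g2) +
           image_mset (\<lambda>i. gadd n m (gsmul n m (- x i) g1) g2) (mset_set {1..n - 1}))"

definition form2d :: "nat \<Rightarrow> nat \<Rightarrow> (int \<times> int) multiset \<Rightarrow> int \<times> int \<Rightarrow> int \<times> int \<Rightarrow> bool" where
  "form2d n m S g1 g2 \<longleftrightarrow> genset_ok n m g1 g2 \<and>
    (\<exists>x :: nat \<Rightarrow> int.
       (\<forall>i \<in> {1..n - 1}. -1 \<le> x i \<and> x i \<le> int n - 2) \<and>
       (\<Sum>i = 1..n - 1. x i) = 0 \<and>
       S = replicate_mset (n - 1) g1 + replicate_mset ((m - 1) * n + 1) (gadd n m g1 g2) +
           image_mset (\<lambda>i. gadd n m (gsmul n m (- x i) g1) g2) (mset_set {1..n - 1}))"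

definition form3a :: "nat \<Rightarrow> nat \<Rightarrow> nat \<Rightarrow> (int \<times> int) multiset \<Rightarrow> int \<times> int \<Rightarrow> int \<times> int \<Rightarrow> bool" where
  "form3a n m k S e1 e2 \<longleftrightarrow> basis_ok n m e1 e2 \<and>
    (\<exists>s :: nat. 1 \<le> s \<and> s \<le> m \<and>
       S = replicate_mset (n - 1) e1 + replicate_mset (s * n - 1) e2 +
           replicate_mset ((m - s) * n + k) (gadd n m e1 e2))"

definition form3b :: "nat \<Rightarrow> nat \<Rightarrow> nat \<Rightarrow> (int \<times> int) multiset \<Rightarrow> int \<times> int \<Rightarrow> int \<times> int \<Rightarrow> bool" where
  "form3b n m k S g1 g2 \<longleftrightarrow> genset_ok n m g1 g2 \<and>
    S = replicate_mset (n - 1) g1 + replicate_mset (n - 1) g2 +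
        replicate_mset ((m - 1) * n + k) (gadd n m g1 g2)"

definition form4a :: "nat \<Rightarrow> nat \<Rightarrow> (int \<times> int) multiset \<Rightarrow> int \<times> int \<Rightarrow> int \<times> int \<Rightarrow> bool" where
  "form4a n m S e1 e2 \<longleftrightarrow> basis_ok n m e1 e2 \<and>
    (\<exists>s :: nat. \<exists>x :: int. 1 \<le> s \<and> s \<le> m \<and> 1 \<le> x \<and> x \<le> int n - 1 \<and> gcd x (int n) = 1 \<and>
       S = replicate_mset (n - 1) e1 + replicate_mset (s * n - 1) e2 +
           replicate_mset ((m - s) * n + n - 1) (gadd n m (gsmul n m x e1) e2))"

definition form4b :: "nat \<Rightarrow> nat \<Rightarrow> (int \<times> int) multiset \<Rightarrow> int \<times> int \<Rightarrow> int \<times> int \<Rightarrow> bool" where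
  "form4b n m S g1 g2 \<longleftrightarrow> genset_ok n m g1 g2 \<and>
    S = replicate_mset (n - 1) g1 + replicate_mset (n - 1) g2 +
        replicate_mset ((m - 1) * n + n - 1) (gadd n m g1 g2)"

text \<open>The alternative (a) is mandatory when m = 1 (the "Moreover" clause).\<close>
definition item2 :: "nat \<Rightarrow> nat \<Rightarrow> (int \<times> int) multiset \<Rightarrow> int \<times> int \<Rightarrow> int \<times> int \<Rightarrow> bool" where
  "item2 n m T a b \<longleftrightarrow> form2a n m T a b \<or>
     (m \<noteq> 1 \<and> (form2b n m T a b \<or> form2c n m T a b \<or> form2d n m T a b))"

definition structural_property :: "nat \<Rightarrow> nat \<Rightarrow> nat \<Rightarrow> bool" where
  "structural_property n m k \<longleftrightarrow>
    (\<forall>S. is_seq n m S \<and> size S = m * n + n - 2 + k \<and>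
         (0, 0) \<notin> sums_le n m (m * n + n - 1 - k) S \<longrightarrow>
       (\<exists>a b :: int \<times> int.
          (k = 0 \<longrightarrow> item2 n m (S + {# gneg n m (gsum n m S) #}) a b) \<and>
          (k = 1 \<longrightarrow> item2 n m S a b) \<and>
          (2 \<le> k \<and> k \<le> n - 2 \<longrightarrow> form3a n m k S a b \<or> (m \<noteq> 1 \<and> form3b n m k S a b)) \<and>
          (k = n - 1 \<longrightarrow> form4a n m S a b \<or> (m \<noteq> 1 \<and> form4b n m S a b))))"

end

theory Submission
  imports Defs "HOL-Number_Theory.Number_Theory" "HOL-Library.Product_Plus" "HOL-Library.Disjoint_Sets"
begin

text \<open>Reduce both coordinates modulo \<open>n\<close>, which maps the group onto \<open>C\<^sub>n \<oplus> C\<^sub>n\<close>. Split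
  off \<open>m - 1\<close> disjoint blocks of length \<open>n\<close> that are zero-sum after reduction. Their sums lie in the kernel, which is isomorphic
  to \<open>C\<^sub>m\<close> and form a zero-sum free sequence of length \<open>m - 1\<close>, so all of them equal one generator \<open>\<gamma>\<close>; the rest has
  length \<open>2n - 2 + k\<close> and is extremal for \<open>C\<^sub>n \<oplus> C\<^sub>n\<close>, hence of the form given by the hypothesis. As this holds for every
  choice of the blocks, exchanging terms between a block and the rest first extends the structure of the rest to the reduction
  of the whole sequence, and then determines the terms themselves, since exchanged zero-sums have the same sum.

  For \<open>k \<ge> 2\<close> the reduction has three values. For \<open>k = 1\<close> the rest has a center \<open>e\<close>: its terms are \<open>e\<close>
  and elements of a single coset of \<open>\<langle>e\<rangle>\<close>; the main step is that all pieces have a common center. The case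
  \<open>k = 0\<close> becomes \<open>k = 1\<close> after adding the term \<open>-\<sigma>(S)\<close>.\<close>

text \<open>All lengths come from two readings of the bound: \<open>m*n+n-1-k\<close> is
  \<open>(m-1)*n + (2*n-1-k)\<close> and also \<open>(m-2)*n + (3*n-1-k)\<close>. By the first, a
  zero-sum of length at most \<open>2*n-1-k\<close> in the rest would act as an m-th block, and m
  elements of C_m always contain a zero-sum. By the second, inside the union of one block and the
  rest every zero-sum of length up to \<open>3*n-1-k\<close>, not only up to \<open>n\<close>, may
  replace the block and so has the same sum. The hypothesis offers only one value of
  \<open>k\<close>. Hence the constants of C_n + C_n are derived independently of it, and for
  \<open>2 \<le> k \<le> n-2\<close> the existence of zero-sums of length at most
  \<open>2*n-1-k\<close> is extracted from the hypothesis itself. The obstacle for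
  \<open>k = 1\<close> is that the rest may have two centers, with different blocks favouring
  different ones. Three are impossible for \<open>n \<ge> 3\<close> by counting. For
  \<open>n = 2\<close> this count fails, but there \<open>k = 1\<close> is also \<open>n - 1\<close>
  and the three-valued argument applies.\<close>

section \<open>Zero-sum constants of \<open>C\<^sub>n \<oplus> C\<^sub>n\<close>\<close>

text \<open>\<open>deglt d f\<close> says that \<open>f\<close> has degree below \<open>d\<close> in the sense of finite differences; this replaces multivariate
  polynomials in the proof of Olson's theorem for \<open>C\<^sub>p\<^sup>3\<close>.\<close>

fun deglt :: "nat \<Rightarrow> ('v::ab_group_add \<Rightarrow> int) \<Rightarrow> bool" where
  "deglt 0 f \<longleftrightarrow> (\<forall>x. f x = 0)"
| "deglt (Suc d) f \<longleftrightarrow> (\<forall>v. deglt d (\<lambda>x. f x - f (x + v)))"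

lemma deglt_zero: "deglt d (\<lambda>x. 0)"
  by (induction d) auto

lemma deglt_add: "deglt d f \<Longrightarrow> deglt d h \<Longrightarrow> deglt d (\<lambda>x. f x + h x)"
proof (induction d arbitrary: f h)
  case (Suc d)
  have "deglt d (\<lambda>x. (f x - f (x + v)) + (h x - h (x + v)))" for v
    using Suc.prems by (intro Suc.IH) auto
  then show ?case by (simp add: algebra_simps)
qed auto

lemma deglt_shift: "deglt d f \<Longrightarrow> deglt d (\<lambda>x. f (x + v))"
proof (induction d arbitrary: f)
  case (Suc d)
  have "deglt d (\<lambda>x. f (x + v) - f (x + v + w))" for w
    using Suc.IH[of "\<lambda>x. f x - f (x + w)"] Suc.prems by simp
  then show ?case by (simp add: add_ac)
qed auto

text \<open>Discrete product rule: the difference of \<open>f * h\<close> in direction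
  \<open>v\<close> is \<open>(f - f') * h + f' * (h - h')\<close>, where the prime denotes the
  shift. In each summand one factor has lost a degree, so induction on \<open>a + b\<close> applies.
  The successors are there because \<open>deglt (Suc d)\<close> means degree at most
  \<open>d\<close>.\<close>

lemma deglt_mult:
  "deglt (Suc a) f \<Longrightarrow> deglt (Suc b) h \<Longrightarrow> deglt (Suc (a + b)) (\<lambda>x. f x * h x)"
proof (induction "a + b" arbitrary: a b f h rule: less_induct)
  case less
  have "deglt (a + b) (\<lambda>x. f x * h x - f (x + v) * h (x + v))" for v
  proof -
    have 1: "deglt (a + b) (\<lambda>x. (f x - f (x + v)) * h x)"
    proof (cases a)
      case 0
      then have "f x - f (x + v) = 0" for x using less.prems(1) by simp
      then have "(\<lambda>x. (f x - f (x + v)) * h x) = (\<lambda>x. 0)" by (simp only: mult_zero_left)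
      then show ?thesis by (simp only: deglt_zero)
    next
      case (Suc a')
      then show ?thesis using less.hyps[of a' b "\<lambda>x. f x - f (x + v)" h] less.prems by simp
    qed
    have 2: "deglt (a + b) (\<lambda>x. f (x + v) * (h x - h (x + v)))"
    proof (cases b)
      case 0
      then have "h x - h (x + v) = 0" for x using less.prems(2) by simp
      then have "(\<lambda>x. f (x + v) * (h x - h (x + v))) = (\<lambda>x. 0)" by (simp only: mult_zero_right)
      then show ?thesis by (simp only: deglt_zero)
    next
      case (Suc b')
      have "deglt (Suc b') (\<lambda>x. h x - h (x + v))" using less.prems(2) Suc by simp
      then show ?thesis
        using less.hyps[of a b' "\<lambda>x. f (x + v)" "\<lambda>x. h x - h (x + v)"] deglt_shift[OF less.prems(1)] Suc
        by (simp del: deglt.simps)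
    qed
    have "(\<lambda>x. f x * h x - f (x + v) * h (x + v))
        = (\<lambda>x. (f x - f (x + v)) * h x + f (x + v) * (h x - h (x + v)))"
      by (simp add: algebra_simps)
    then show ?thesis using deglt_add[OF 1 2] by simp
  qed
  then show ?case by simp
qed

lemma deglt_const: "deglt (Suc 0) (\<lambda>x. c)"
  by simp

lemma deglt_linear:
  assumes "\<And>x y. f (x + y) = f x + f y"
  shows "deglt (Suc (Suc 0)) f"
  by (auto simp: assms)

lemma deglt_power: "deglt (Suc (Suc 0)) f \<Longrightarrow> deglt (Suc d) (\<lambda>x. f x ^ d)"
proof (induction d)
  case (Suc d)
  then show ?case using deglt_mult[of "Suc 0" f d "\<lambda>x. f x ^ d"] by (simp del: deglt.simps)
qed (simp add: deglt_const)

lemma deglt_mono: "deglt d f \<Longrightarrow> d \<le> d' \<Longrightarrow> deglt d' f"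
proof (induction d arbitrary: d' f)
  case 0
  then have "f = (\<lambda>x. 0)" by auto
  then show ?case by (simp add: deglt_zero)
next
  case (Suc d)
  then obtain d'' where "d' = Suc d''" "d \<le> d''" by (cases d') auto
  then show ?case using Suc by auto
qed

text \<open>Pairing \<open>J\<close> with \<open>insert i J\<close> turns the sum over subsets of
  \<open>insert i I\<close> into the same sum over subsets of \<open>I\<close> for the difference of
  \<open>f\<close> in direction \<open>v i\<close>. After \<open>card I\<close> differences nothing
  of \<open>f\<close> is left.\<close>

lemma alternating_sum_eq_0:
  fixes v :: "'i \<Rightarrow> 'v::ab_group_add"
  assumes "finite I" "deglt (card I) f"
  shows "(\<Sum>J\<in>Pow I. (-1) ^ card J * f (sum v J)) = 0"
  using assms
proof (induction I arbitrary: f rule: finite_induct)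
  case (insert i I)
  have inj: "inj_on (insert i) (Pow I)" using insert.hyps by (auto simp: inj_on_def)
  have "(\<Sum>J\<in>Pow (insert i I). (-1) ^ card J * f (sum v J))
      = (\<Sum>J\<in>Pow I. (-1) ^ card J * f (sum v J)) + (\<Sum>J\<in>insert i ` Pow I. (-1) ^ card J * f (sum v J))"
    unfolding Pow_insert using insert.hyps by (intro sum.union_disjoint) auto
  also have "(\<Sum>J\<in>insert i ` Pow I. (-1) ^ card J * f (sum v J))
      = (\<Sum>J\<in>Pow I. (-1) ^ card (insert i J) * f (sum v (insert i J)))"
    by (simp add: sum.reindex[OF inj])
  also have "\<dots> = (\<Sum>J\<in>Pow I. - ((-1) ^ card J * f (sum v J + v i)))"
  proof (rule sum.cong)
    fix J assume "J \<in> Pow I"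
    then have "finite J" "i \<notin> J" using insert.hyps finite_subset by auto
    then show "(-1) ^ card (insert i J) * f (sum v (insert i J)) = - ((-1) ^ card J * f (sum v J + v i))"
      by (simp add: add.commute)
  qed auto
  also have "(\<Sum>J\<in>Pow I. (-1) ^ card J * f (sum v J)) + \<dots>
      = (\<Sum>J\<in>Pow I. (-1) ^ card J * (\<lambda>x. f x - f (x + v i)) (sum v J))"
    by (simp add: sum.distrib[symmetric] algebra_simps)
  also have "\<dots> = 0" using insert by (intro insert.IH) auto
  finally show ?case .
qed simp

lemma fermat_int:
  assumes "prime p" "\<not> int p dvd a"
  shows "int p dvd 1 - a ^ (p - 1)"
proof -
  define b where "b = nat (a mod int p)"
  have p: "p > 0" using assms prime_gt_0_nat by auto
  have ib: "int b = a mod int p" using p by (simp add: b_def)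
  have "\<not> p dvd b"
  proof
    assume "p dvd b"
    then have "int p dvd a mod int p" using ib by (metis int_dvd_int_iff)
    then show False using assms(2) by (simp add: dvd_mod_iff)
  qed
  then have "[b ^ (p - 1) = 1] (mod p)" using fermat_theorem assms(1) by blast
  then have "[int b ^ (p - 1) = 1] (mod int p)" by (metis cong_int_iff of_nat_1 of_nat_power)
  moreover have "[a ^ (p - 1) = int b ^ (p - 1)] (mod int p)"
    unfolding ib by (intro cong_pow) (simp add: cong_def)
  ultimately have "[1 = a ^ (p - 1)] (mod int p)" by (meson cong_sym cong_trans)
  then show ?thesis by (simp add: cong_iff_dvd_diff)
qed

text \<open>\<open>F\<close> is modulo \<open>p\<close> the indicator function of the zero of C_p^3
  and has degree at most \<open>3(p-1)\<close>, which is below \<open>card I\<close>. Hence its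
  alternating sum over the subsets of \<open>I\<close> vanishes. Without a nonempty zero-sum only
  the empty subset would contribute modulo \<open>p\<close>, with value 1.\<close>

lemma davenport_cube:
  fixes a b c :: "'i \<Rightarrow> int"
  assumes p: "prime p" and fin: "finite I" and card: "card I \<ge> 3 * p - 2"
  shows "\<exists>J\<subseteq>I. J \<noteq> {} \<and> int p dvd sum a J \<and> int p dvd sum b J \<and> int p dvd sum c J"
proof (rule ccontr)
  assume neg: "\<not> ?thesis"
  define v where "v i = (a i, b i, c i)" for i
  define F :: "int \<times> int \<times> int \<Rightarrow> int" where
    "F x = (1 - fst x ^ (p - 1)) * ((1 - fst (snd x) ^ (p - 1)) * (1 - snd (snd x) ^ (p - 1)))" for x
  have p1: "p \<ge> 2" using p prime_ge_2_nat by auto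
  have minus: "deglt (Suc (p - 1)) (\<lambda>x. 1 - f x ^ (p - 1))"
    if lin: "\<And>x y. f (x + y) = f x + f y" for f :: "int \<times> int \<times> int \<Rightarrow> int"
  proof -
    have "deglt (Suc (p - 1)) (\<lambda>x. f x ^ (p - 1))" by (intro deglt_power deglt_linear lin)
    moreover have "deglt (Suc (p - 1)) (\<lambda>x::int \<times> int \<times> int. - 1)"
      by (rule deglt_mono[OF deglt_const]) simp
    ultimately have "deglt (Suc (0 + (p - 1))) (\<lambda>x. (-1) * f x ^ (p - 1))"
      by (intro deglt_mult deglt_const) auto
    then have "deglt (Suc (p - 1)) (\<lambda>x. 1 + (-1) * f x ^ (p - 1))"
      by (intro deglt_add deglt_mono[OF deglt_const]) (auto simp del: deglt.simps)
    then show ?thesis by (simp del: deglt.simps)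
  qed
  have "deglt (Suc ((p - 1) + ((p - 1) + (p - 1)))) F"
    unfolding F_def by (intro deglt_mult minus) auto
  moreover have "Suc ((p - 1) + ((p - 1) + (p - 1))) \<le> card I" using card p1 by linarith
  ultimately have "deglt (card I) F" using deglt_mono by blast
  then have "(\<Sum>J\<in>Pow I. (-1) ^ card J * F (sum v J)) = 0" by (rule alternating_sum_eq_0[OF fin])
  moreover have "(\<Sum>J\<in>Pow I. (-1) ^ card J * F (sum v J))
      = F 0 + (\<Sum>J\<in>Pow I - {{}}. (-1) ^ card J * F (sum v J))"
    using fin by (subst sum.remove[of "Pow I" "{}"]) auto
  moreover have "F 0 = 1" using p1 by (simp add: F_def power_0_left)
  moreover have "int p dvd (\<Sum>J\<in>Pow I - {{}}. (-1) ^ card J * F (sum v J))"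
  proof (rule dvd_sum)
    fix J assume J: "J \<in> Pow I - {{}}"
    have s: "fst (sum v J) = sum a J" "fst (snd (sum v J)) = sum b J" "snd (snd (sum v J)) = sum c J"
      by (simp_all add: fst_sum snd_sum v_def)
    have "\<not> (int p dvd sum a J \<and> int p dvd sum b J \<and> int p dvd sum c J)" using neg J by auto
    then have "int p dvd F (sum v J)"
      unfolding F_def s using fermat_int[OF p] by (meson dvd_mult dvd_mult2)
    then show "int p dvd (-1) ^ card J * F (sum v J)" by (rule dvd_mult)
  qed
  ultimately have "int p dvd 1"
    by (metis (no_types, lifting) add_eq_0_iff dvd_minus_iff)
  then show False using p1 by simp
qed

section \<open>Short zero-sums over C_n + C_n for arbitrary n\<close>

definition zs :: "nat \<Rightarrow> ('i \<Rightarrow> int) \<Rightarrow> ('i \<Rightarrow> int) \<Rightarrow> 'i set \<Rightarrow> bool" where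
  "zs n p q A \<longleftrightarrow> A \<noteq> {} \<and> int n dvd sum p A \<and> int n dvd sum q A"

text \<open>The upper bound 3n-2 for eta(C_n + C_n) and, below, 2n-1 for the Davenport constant.
  Indices are natural numbers so that in the induction over \<open>n\<close> the bounds can be
  applied to numbered blocks.\<close>

definition eta_bound :: "nat \<Rightarrow> bool" where
  "eta_bound n \<longleftrightarrow> (\<forall>(p::nat \<Rightarrow> int) q I. finite I \<longrightarrow> 3 * n - 2 \<le> card I \<longrightarrow>
     (\<exists>J\<subseteq>I. zs n p q J \<and> card J \<le> n))"

definition davenport_bound :: "nat \<Rightarrow> bool" where
  "davenport_bound n \<longleftrightarrow> (\<forall>(p::nat \<Rightarrow> int) q I. finite I \<longrightarrow> 2 * n - 1 \<le> card I \<longrightarrow>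
     (\<exists>J\<subseteq>I. zs n p q J))"

lemma eta_boundD:
  fixes p q :: "nat \<Rightarrow> int"
  assumes "eta_bound n" "finite I" "3 * n - 2 \<le> card I"
  obtains J where "J \<subseteq> I" "zs n p q J" "card J \<le> n"
  using assms unfolding eta_bound_def by blast

lemma davenport_boundD:
  fixes p q :: "nat \<Rightarrow> int"
  assumes "davenport_bound n" "finite I" "2 * n - 1 \<le> card I"
  obtains J where "J \<subseteq> I" "zs n p q J"
  using assms unfolding davenport_bound_def by blast

lemma zs_Diff:
  assumes "zs n p q A" "zs n p q B" "B \<subseteq> A" "B \<noteq> A" "finite A"
  shows "zs n p q (A - B)"
  using assms by (auto simp: zs_def sum_diff)

lemma zs_Un:
  assumes "zs n p q A" "zs n p q B" "A \<inter> B = {}" "finite A" "finite B"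
  shows "zs n p q (A \<union> B)"
  using assms by (auto simp: zs_def sum.union_disjoint)

text \<open>Padding with \<open>p-1\<close> dummy terms that have 1 in the third coordinate, where
  the given terms have 0, reaches the \<open>3p-2\<close> terms of the theorem for C_p^3. The number
  of dummies in a zero-sum is divisible by \<open>p\<close>, hence none is used.\<close>

lemma davenport_bound_prime:
  assumes p: "prime p" shows "davenport_bound p"
  unfolding davenport_bound_def
proof (intro allI impI)
  fix f g :: "nat \<Rightarrow> int" and I :: "nat set"
  assume fin: "finite I" and card: "2 * p - 1 \<le> card I"
  have p1: "p \<ge> 2" using p prime_ge_2_nat by auto
  define I' where "I' = Inl ` I \<union> Inr ` {..<p - 1}"
  have "card I' = card I + (p - 1)"
    unfolding I'_def using fin by (subst card_Un_disjoint) (auto simp: card_image inj_on_def)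
  then have "3 * p - 2 \<le> card I'" using card p1 by linarith
  moreover have "finite I'" using fin by (simp add: I'_def)
  ultimately obtain J where J: "J \<subseteq> I'" "J \<noteq> {}" "int p dvd sum (case_sum f (\<lambda>_. 0)) J"
    "int p dvd sum (case_sum g (\<lambda>_. 0)) J" "int p dvd sum (case_sum (\<lambda>_. 0) (\<lambda>_. 1)) J"
    using davenport_cube[OF p, of I' "case_sum f (\<lambda>_. 0)" "case_sum g (\<lambda>_. 0)" "case_sum (\<lambda>_. 0) (\<lambda>_. 1)"]
    by blast
  define A where "A = {i. Inl i \<in> J}" define B where "B = {i. Inr i \<in> J}"
  have JAB: "J = Inl ` A \<union> Inr ` B" unfolding A_def B_def
    by (auto simp: image_iff) (metis old.sum.exhaust)
  have AB: "A \<subseteq> I" "B \<subseteq> {..<p - 1}" using J(1) by (auto simp: A_def B_def I'_def)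
  have fAB: "finite A" "finite B" using AB fin finite_subset by auto
  have split: "sum h J = sum (h \<circ> Inl) A + sum (h \<circ> Inr) B" for h :: "_ \<Rightarrow> int"
    unfolding JAB using fAB by (subst sum.union_disjoint) (auto simp: sum.reindex inj_on_def)
  have "int p dvd int (card B)" using J(5) by (simp add: split o_def)
  moreover have "card B \<le> p - 1" using card_mono[OF _ AB(2)] by simp
  ultimately have "card B = 0" using p1 by (auto simp: int_dvd_int_iff dest: dvd_imp_le)
  then have "B = {}" using fAB by simp
  then have "zs p f g A" using J(2-4) JAB split[of "case_sum f (\<lambda>_. 0)"] split[of "case_sum g (\<lambda>_. 0)"]
    by (auto simp: zs_def o_def)
  then show "\<exists>J\<subseteq>I. zs p f g J" using AB by blast
qed

text \<open>A third coordinate constantly 1 makes the length of the zero-sum a multiple of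
  \<open>p\<close>, so \<open>p\<close> or \<open>2p\<close>. In the second case the Davenport
  bound, applied after one term is set aside, splits it into two zero-sums, and one of them has
  length at most \<open>p\<close>.\<close>

lemma eta_bound_prime:
  assumes p: "prime p" shows "eta_bound p"
  unfolding eta_bound_def
proof (intro allI impI)
  fix f g :: "nat \<Rightarrow> int" and I :: "nat set"
  assume fin: "finite I" and "3 * p - 2 \<le> card I"
  have p1: "p \<ge> 2" using p prime_ge_2_nat by auto
  obtain I0 where I0: "I0 \<subseteq> I" "card I0 = 3 * p - 2"
    by (rule obtain_subset_with_card_n[OF \<open>3 * p - 2 \<le> card I\<close>])
  have fin0: "finite I0" using I0 fin finite_subset by blast
  obtain J where J: "J \<subseteq> I0" "J \<noteq> {}" "int p dvd sum f J" "int p dvd sum g J" "int p dvd sum (\<lambda>_. 1) J"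
    using davenport_cube[OF p fin0, of f g "\<lambda>_. 1"] I0 by auto
  have fJ: "finite J" using J fin0 finite_subset by blast
  have zsJ: "zs p f g J" using J by (simp add: zs_def)
  have "p dvd card J" using J(5) by (simp add: int_dvd_int_iff)
  moreover have "card J \<le> 3 * p - 2" using J(1) I0 fin0 card_mono by metis
  moreover have "card J > 0" using J fJ by auto
  ultimately have "card J = p \<or> card J = 2 * p"
  proof -
    obtain t where t: "card J = p * t" using \<open>p dvd card J\<close> by auto
    have "t \<noteq> 0" using t \<open>card J > 0\<close> by auto
    have "t < 3"
    proof (rule ccontr)
      assume "\<not> t < 3"
      then have "p * 3 \<le> p * t" by simp
      then show False using t \<open>card J \<le> 3 * p - 2\<close> p1 by linarith
    qed
    then have "t = 1 \<or> t = 2" using \<open>t \<noteq> 0\<close> by auto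
    then show ?thesis using t by auto
  qed
  then show "\<exists>J\<subseteq>I. zs p f g J \<and> card J \<le> p"
  proof
    assume "card J = p"
    then show ?thesis using zsJ J I0 by blast
  next
    assume c: "card J = 2 * p"
    obtain j where j: "j \<in> J" using J by auto
    have "2 * p - 1 \<le> card (J - {j})" using c j fJ by simp
    then obtain A where A: "A \<subseteq> J - {j}" "zs p f g A"
      using davenport_boundD[OF davenport_bound_prime[OF p], of "J - {j}" f g] fJ by blast
    then have B: "zs p f g (J - A)" using zs_Diff[OF zsJ, of A] fJ j by auto
    have "card (J - A) = 2 * p - card A" using A c fJ
      by (metis Diff_subset card_Diff_subset finite_subset subset_trans)
    then have "card A \<le> p \<or> card (J - A) \<le> p" by linarith
    then show ?thesis using A B J I0 by (meson Diff_subset subset_trans)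
  qed
qed

text \<open>Greedy choice: before each extraction at least \<open>3n-2\<close> terms are still free,
  and each block uses up at most \<open>n\<close> of them.\<close>

lemma extract_blocks:
  fixes p q :: "nat \<Rightarrow> int"
  assumes eta: "eta_bound n" and fin: "finite I" and n: "n \<ge> 1"
    and card: "t * n + (2 * n - 2) \<le> card I"
  shows "\<exists>B. disjoint_family_on B {..<t} \<and> (\<forall>i<t. B i \<subseteq> I \<and> zs n p q (B i) \<and> card (B i) \<le> n)"
  using card
proof (induction t)
  case (Suc t)
  then obtain B where B: "disjoint_family_on B {..<t}" "\<forall>i<t. B i \<subseteq> I \<and> zs n p q (B i) \<and> card (B i) \<le> n"
    by auto
  let ?U = "\<Union>i<t. B i"
  have fB: "finite (B i)" if "i < t" for i using B(2) that fin finite_subset by blast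
  have "card ?U \<le> (\<Sum>i<t. card (B i))" by (rule card_UN_le) simp
  also have "\<dots> \<le> t * n" using B(2) sum_bounded_above[of "{..<t}" "\<lambda>i. card (B i)" n] by auto
  finally have "card ?U \<le> t * n" .
  moreover have "card (I - ?U) = card I - card ?U"
    using B(2) fB by (intro card_Diff_subset) auto
  ultimately have "3 * n - 2 \<le> card (I - ?U)" using Suc.prems n by simp
  then obtain J where J: "J \<subseteq> I - ?U" "zs n p q J" "card J \<le> n"
    using eta_boundD[OF eta, of "I - ?U" p q] fin by blast
  show ?case
  proof (intro exI conjI)
    show "disjoint_family_on (B(t := J)) {..<Suc t}"
      using B(1) J(1) by (auto simp: disjoint_family_on_def lessThan_Suc)
    show "\<forall>i<Suc t. (B(t := J)) i \<subseteq> I \<and> zs n p q ((B(t := J)) i) \<and> card ((B(t := J)) i) \<le> n"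
      using B(2) J by (auto simp: less_Suc_eq)
  qed
qed (auto simp: disjoint_family_on_def)

lemma zs_UN:
  assumes "finite T" "T \<noteq> {}" "disjoint_family_on B T" "\<forall>i\<in>T. finite (B i) \<and> B i \<noteq> {}"
    and "int n dvd (\<Sum>i\<in>T. sum p (B i))" "int n dvd (\<Sum>i\<in>T. sum q (B i))"
  shows "zs n p q (\<Union>i\<in>T. B i)"
proof -
  have "sum h (\<Union>i\<in>T. B i) = (\<Sum>i\<in>T. sum h (B i))" for h :: "_ \<Rightarrow> int"
    using assms by (intro sum.UNION_disjoint) (auto simp: disjoint_family_on_def)
  then show ?thesis using assms by (auto simp: zs_def)
qed

text \<open>The inductive step of both bounds: a block sum divisible by \<open>a\<close>, divided by
  \<open>a\<close>, is a term modulo \<open>b\<close>, and a zero-sum of these terms modulo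
  \<open>b\<close> is a zero-sum of the blocks modulo \<open>a * b\<close>.\<close>

lemma zs_blocks_mult:
  assumes a: "a \<ge> 1" and B: "disjoint_family_on B T" "\<forall>i\<in>T. finite (B i) \<and> zs a p q (B i)"
    and J: "J \<subseteq> T" "finite J" "zs b (\<lambda>i. sum p (B i) div int a) (\<lambda>i. sum q (B i) div int a) J"
  shows "zs (a * b) p q (\<Union>i\<in>J. B i)"
proof (rule zs_UN)
  have *: "int (a * b) dvd (\<Sum>i\<in>J. sum h (B i))"
    if "\<forall>i\<in>J. int a dvd sum h (B i)" "int b dvd (\<Sum>i\<in>J. sum h (B i) div int a)" for h :: "_ \<Rightarrow> int"
  proof -
    have "(\<Sum>i\<in>J. sum h (B i)) = int a * (\<Sum>i\<in>J. sum h (B i) div int a)"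
      unfolding sum_distrib_left using that(1) by (intro sum.cong) auto
    then show ?thesis using that(2) by (simp add: mult_dvd_mono)
  qed
  show "int (a * b) dvd (\<Sum>i\<in>J. sum p (B i))" "int (a * b) dvd (\<Sum>i\<in>J. sum q (B i))"
    by (rule *; use B J in \<open>auto simp: zs_def\<close>)+
qed (use B J in \<open>auto simp: zs_def disjoint_family_on_def\<close>)

lemma eta_bound_mult:
  assumes a: "eta_bound a" "a \<ge> 1" and b: "eta_bound b" "b \<ge> 1"
  shows "eta_bound (a * b)"
  unfolding eta_bound_def
proof (intro allI impI)
  fix p q :: "nat \<Rightarrow> int" and I :: "nat set"
  assume fin: "finite I" and card: "3 * (a * b) - 2 \<le> card I"
  have "(3 * b - 2) * a + (2 * a - 2) = 3 * (a * b) - 2"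
  proof -
    obtain a' b' where "a = Suc a'" "b = Suc b'" using a b by (metis Suc_le_D One_nat_def)
    then show ?thesis by (simp add: algebra_simps)
  qed
  then obtain B where B: "disjoint_family_on B {..<3 * b - 2}"
    "\<forall>i<3 * b - 2. B i \<subseteq> I \<and> zs a p q (B i) \<and> card (B i) \<le> a"
    using extract_blocks[OF a(1) fin a(2), of "3 * b - 2" p q] card by auto
  obtain J where J: "J \<subseteq> {..<3 * b - 2}" "zs b (\<lambda>i. sum p (B i) div int a) (\<lambda>i. sum q (B i) div int a) J"
    "card J \<le> b"
    using eta_boundD[OF b(1), of "{..<3 * b - 2}" "\<lambda>i. sum p (B i) div int a" "\<lambda>i. sum q (B i) div int a"]
    by auto
  have "zs (a * b) p q (\<Union>i\<in>J. B i)"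
  proof (rule zs_blocks_mult[OF a(2) B(1)])
    show "\<forall>i\<in>{..<3 * b - 2}. finite (B i) \<and> zs a p q (B i)"
      using B(2) fin finite_subset by blast
    show "finite J" using J(1) finite_subset by blast
  qed (use J in auto)
  moreover have "card (\<Union>i\<in>J. B i) \<le> a * b"
  proof -
    have "card (\<Union>i\<in>J. B i) \<le> (\<Sum>i\<in>J. card (B i))" using J finite_subset by (intro card_UN_le) blast
    also have "\<dots> \<le> card J * a" using B(2) J(1) sum_bounded_above[of J "\<lambda>i. card (B i)" a] by auto
    also have "\<dots> \<le> b * a" using J(3) by simp
    finally show ?thesis by (simp add: mult.commute)
  qed
  moreover have "(\<Union>i\<in>J. B i) \<subseteq> I" using B J by auto
  ultimately show "\<exists>J\<subseteq>I. zs (a * b) p q J \<and> card J \<le> a * b" by blast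
qed

text \<open>Short blocks alone are one too few: \<open>2b-2\<close> blocks of length at most
  \<open>a\<close> leave \<open>2a-1\<close> terms, and the Davenport bound modulo \<open>a\<close>
  supplies the last block, whose length does not matter.\<close>

lemma davenport_bound_mult:
  assumes a: "eta_bound a" "davenport_bound a" "a \<ge> 1" and b: "davenport_bound b" "b \<ge> 1"
  shows "davenport_bound (a * b)"
  unfolding davenport_bound_def
proof (intro allI impI)
  fix p q :: "nat \<Rightarrow> int" and I :: "nat set"
  assume fin: "finite I" and card: "2 * (a * b) - 1 \<le> card I"
  obtain a' b' where ab: "a = Suc a'" "b = Suc b'" using a b by (metis Suc_le_D One_nat_def)
  let ?t = "2 * b - 2"
  have "?t * a + (2 * a - 2) \<le> card I" using card ab by (simp add: algebra_simps)
  then obtain B where B: "disjoint_family_on B {..<?t}"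
    "\<forall>i<?t. B i \<subseteq> I \<and> zs a p q (B i) \<and> card (B i) \<le> a"
    using extract_blocks[OF a(1) fin a(3), of ?t p q] by auto
  let ?U = "\<Union>i<?t. B i"
  have fB: "finite (B i)" if "i < ?t" for i using B(2) that fin finite_subset by blast
  have "card ?U \<le> (\<Sum>i<?t. card (B i))" by (rule card_UN_le) simp
  also have "\<dots> \<le> ?t * a" using B(2) sum_bounded_above[of "{..<?t}" "\<lambda>i. card (B i)" a] by auto
  finally have "card ?U \<le> ?t * a" .
  moreover have "card (I - ?U) = card I - card ?U"
    using B(2) fB by (intro card_Diff_subset) auto
  ultimately have "2 * a - 1 \<le> card (I - ?U)" using card ab by (simp add: algebra_simps)
  then obtain A where A: "A \<subseteq> I - ?U" "zs a p q A"
    using davenport_boundD[OF a(2), of "I - ?U" p q] fin by blast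
  let ?B = "B(?t := A)"
  have B': "disjoint_family_on ?B {..<Suc ?t}"
    using B(1) A(1) by (auto simp: disjoint_family_on_def lessThan_Suc)
  have B'': "\<forall>i<Suc ?t. ?B i \<subseteq> I \<and> zs a p q (?B i)"
    using B(2) A by (auto simp: less_Suc_eq)
  have "2 * b - 1 \<le> card {..<Suc ?t}" using b(2) by simp
  then obtain J where J: "J \<subseteq> {..<Suc ?t}"
    "zs b (\<lambda>i. sum p (?B i) div int a) (\<lambda>i. sum q (?B i) div int a) J"
    using davenport_boundD[OF b(1), of "{..<Suc ?t}" "\<lambda>i. sum p (?B i) div int a" "\<lambda>i. sum q (?B i) div int a"]
    by blast
  have "zs (a * b) p q (\<Union>i\<in>J. ?B i)"
  proof (rule zs_blocks_mult[OF a(3) B'])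
    show "\<forall>i\<in>{..<Suc ?t}. finite (?B i) \<and> zs a p q (?B i)"
      using B'' fin finite_subset by blast
    show "finite J" using J(1) finite_subset by blast
  qed (use J in auto)
  moreover have "(\<Union>i\<in>J. ?B i) \<subseteq> I" using B'' J by blast
  ultimately show "\<exists>J\<subseteq>I. zs (a * b) p q J" by blast
qed

lemma eta_davenport_bound: "n \<ge> 1 \<Longrightarrow> eta_bound n \<and> davenport_bound n"
proof (induction n rule: less_induct)
  case (less n)
  show ?case
  proof (cases "n = 1")
    case True
    have "zs 1 p q I" if "card I \<ge> 1" for p q :: "nat \<Rightarrow> int" and I using that by (auto simp: zs_def)
    moreover have "\<exists>J\<subseteq>I. zs 1 p q J \<and> card J \<le> 1" if c1: "card I \<ge> 1" for p q :: "nat \<Rightarrow> int" and I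
    proof -
      obtain J where "J \<subseteq> I" "card J = 1" by (rule obtain_subset_with_card_n[OF c1])
      then show ?thesis by (auto simp: zs_def intro!: exI[of _ J])
    qed
    ultimately show ?thesis unfolding True eta_bound_def davenport_bound_def by auto
  next
    case False
    then obtain p b where pb: "prime p" "n = p * b" using prime_factor_nat by (metis dvdE)
    then have b1: "b \<ge> 1" using less.prems by (cases b) auto
    moreover have "b < n" using pb(2) prime_gt_1_nat[OF pb(1)] b1 by simp
    moreover have "p \<ge> 1" using pb prime_ge_1_nat by blast
    ultimately show ?thesis
      using less.IH[of b] unfolding pb(2) by (blast intro: eta_bound_mult davenport_bound_mult
          eta_bound_prime[OF pb(1)] davenport_bound_prime[OF pb(1)])
  qed
qed

text \<open>Deduced from eta: the given terms get second coordinate 1 and \<open>n-1\<close> dummies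
  \<open>(1, 0)\<close> are added. In a zero-sum of length at most \<open>n\<close> the number of
  given terms is a multiple of \<open>n\<close>. It is not 0, since fewer than \<open>n\<close>
  dummies are no zero-sum; so it is \<open>n\<close>, and no room is left for dummies.\<close>

lemma erdos_ginzburg_ziv:
  fixes x :: "nat \<Rightarrow> int"
  assumes n: "n \<ge> 1" and fin: "finite I" and card: "2 * n - 1 \<le> card I"
  shows "\<exists>J\<subseteq>I. card J = n \<and> int n dvd sum x J"
proof -
  define M where "M = Suc (Max (insert 0 I))"
  have M: "i < M" if "i \<in> I" for i unfolding M_def using that fin by (simp add: less_Suc_eq_le)
  define I' where "I' = I \<union> {M..<M + (n - 1)}"
  have "I \<inter> {M..<M + (n - 1)} = {}" using M by (meson atLeastLessThan_iff disjoint_iff not_le)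
  then have "card I' = card I + (n - 1)" unfolding I'_def using fin by (simp add: card_Un_disjoint)
  then have cI: "3 * n - 2 \<le> card I'" using card n by linarith
  have "finite I'" using fin by (simp add: I'_def)
  obtain J where J: "J \<subseteq> I'" "card J \<le> n"
    and zsJ: "zs n (\<lambda>i. if i < M then x i else 1) (\<lambda>i. if i < M then 1 else 0) J"
    by (rule eta_boundD[OF conjunct1[OF eta_davenport_bound[OF n]] \<open>finite I'\<close> cI])
  define A where "A = J \<inter> I" define C where "C = J - I"
  have fJ: "finite J" using J \<open>finite I'\<close> finite_subset by blast
  have J_split: "J = A \<union> C" "A \<inter> C = {}" "finite A" "finite C" using fJ by (auto simp: A_def C_def)
  have C: "C \<subseteq> {M..<M + (n - 1)}" using J by (auto simp: C_def I'_def)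
  have A: "i < M" if "i \<in> A" for i using that M by (auto simp: A_def)
  have C': "\<not> i < M" if "i \<in> C" for i using that C by auto
  have split: "(\<Sum>i\<in>J. if i < M then f i else h i) = sum f A + sum h C" for f h :: "nat \<Rightarrow> int"
  proof -
    have "(\<Sum>i\<in>J. if i < M then f i else h i)
        = (\<Sum>i\<in>A. if i < M then f i else h i) + (\<Sum>i\<in>C. if i < M then f i else h i)"
      unfolding J_split(1) by (rule sum.union_disjoint) (use J_split in auto)
    also have "(\<Sum>i\<in>A. if i < M then f i else h i) = sum f A" using A by (intro sum.cong) auto
    also have "(\<Sum>i\<in>C. if i < M then f i else h i) = sum h C" using C' by (intro sum.cong) auto
    finally show ?thesis .
  qed
  have dA: "n dvd card A" and sumx: "int n dvd sum x A + int (card C)"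
    using zsJ unfolding zs_def split by (simp_all add: int_dvd_int_iff)
  have "card C \<le> n - 1" using card_mono[OF _ C] by simp
  have "card A + card C \<le> n" using J(2) J_split card_Un_disjoint by metis
  show ?thesis
  proof (cases "card A = 0")
    case True
    then have "A = {}" using J_split by simp
    then have "n dvd card C" using sumx by (simp add: int_dvd_int_iff)
    then have "card C = 0" using \<open>card C \<le> n - 1\<close> n by (auto dest: dvd_imp_le)
    then show ?thesis using zsJ \<open>A = {}\<close> J_split by (auto simp: zs_def)
  next
    case False
    then have "n \<le> card A" using dA by (auto dest: dvd_imp_le)
    then have "card A = n" "card C = 0" using \<open>card A + card C \<le> n\<close> by auto
    then show ?thesis using sumx by (intro exI[of _ A]) (auto simp: A_def)
  qed
qed

section \<open>Zero-sum free sequences of length m-1 over C_m\<close>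

lemma partial_sum_residues:
  fixes a :: "nat \<Rightarrow> int"
  assumes m: "m \<ge> 1" and nz: "\<And>i j. i < j \<Longrightarrow> j < m \<Longrightarrow> \<not> int m dvd (\<Sum>l\<in>{i..<j}. a l)"
  shows "\<exists>k<m. [x = (\<Sum>l<k. a l)] (mod int m)"
proof -
  define f where "f k = nat ((\<Sum>l<k. a l) mod int m)" for k
  have inj: "inj_on f {..<m}"
  proof (rule linorder_inj_onI)
    fix i j assume ij: "i < j" "i \<in> {..<m}" "j \<in> {..<m}"
    show "f i \<noteq> f j"
    proof
      assume "f i = f j"
      then have "(\<Sum>l<i. a l) mod int m = (\<Sum>l<j. a l) mod int m"
        unfolding f_def using m by (simp add: nat_eq_iff2 split: if_splits)
      then have "int m dvd (\<Sum>l<j. a l) - (\<Sum>l<i. a l)" by (metis mod_eq_dvd_iff)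
      moreover have "(\<Sum>l<j. a l) - (\<Sum>l<i. a l) = (\<Sum>l\<in>{i..<j}. a l)"
        using ij sum_diff_nat_ivl[of 0 i j a] by (simp add: atLeast0LessThan)
      ultimately show False using nz ij by auto
    qed
  qed auto
  have "f ` {..<m} \<subseteq> {..<m}" using m by (auto simp: f_def nat_less_iff)
  then have "f ` {..<m} = {..<m}" using inj by (simp add: endo_inj_surj)
  moreover have "nat (x mod int m) \<in> {..<m}" using m by (auto simp: nat_less_iff)
  ultimately obtain k where "k < m" "f k = nat (x mod int m)" by (metis imageE lessThan_iff)
  then have "x mod int m = (\<Sum>l<k. a l) mod int m" unfolding f_def using m
    by (simp add: nat_eq_iff2 split: if_splits)
  then show ?thesis using \<open>k < m\<close> by (auto simp: cong_def)
qed

text \<open>Arranged with \<open>i\<close> first and \<open>j\<close> second, the terms have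
  \<open>m\<close> distinct partial sums, counting the empty one, so \<open>a j\<close> is among
  them. The empty sum would make \<open>a j\<close> zero; a sum of at least two terms contains
  \<open>a j\<close>, which cancels and leaves a zero-sum; so it is the sum consisting of
  \<open>a i\<close> alone.\<close>

lemma zero_sum_free_const:
  fixes a :: "'i \<Rightarrow> int"
  assumes m: "m \<ge> 1" and B: "finite B" "card B = m - 1"
    and nz: "\<And>A. A \<subseteq> B \<Longrightarrow> A \<noteq> {} \<Longrightarrow> \<not> int m dvd sum a A"
    and ij: "i \<in> B" "j \<in> B"
  shows "[a i = a j] (mod int m)"
proof (cases "i = j")
  case False
  have "card (B - {i, j}) = m - 3" using B ij False by (simp add: card_Diff_subset)
  have m3: "m \<ge> 3" using B ij False card_mono[of B "{i, j}"] by auto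
  obtain h0 where h0: "bij_betw h0 {..<m - 3} (B - {i, j})"
    using ex_bij_betw_nat_finite[of "B - {i, j}"] B \<open>card (B - {i, j}) = m - 3\<close>
    by (metis atLeast0LessThan finite_Diff)
  define h where "h k = (if k = 0 then i else if k = 1 then j else h0 (k - 2))" for k
  have h0B: "h0 k \<in> B - {i, j}" if "k < m - 3" for k using h0 that by (auto dest: bij_betwE)
  have inj: "inj_on h {..<m - 1}"
  proof (rule linorder_inj_onI)
    fix k l assume kl: "k < l" "k \<in> {..<m - 1}" "l \<in> {..<m - 1}"
    consider "k = 0" "l = 1" | "k \<le> 1" "l \<ge> 2" | "k \<ge> 2" "l \<ge> 2" using kl by linarith
    then show "h k \<noteq> h l"
    proof cases
      case 3
      then have "k - 2 \<noteq> l - 2" "k - 2 \<in> {..<m - 3}" "l - 2 \<in> {..<m - 3}" using kl by auto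
      then have "h0 (k - 2) \<noteq> h0 (l - 2)" using h0 unfolding bij_betw_def inj_on_def by blast
      then show ?thesis using 3 by (simp add: h_def)
    next
      case 2
      then have "l - 2 < m - 3" using kl m3 by auto
      then show ?thesis using 2 h0B[of "l - 2"] by (auto simp: h_def)
    qed (use False in \<open>auto simp: h_def\<close>)
  qed auto
  have hB: "h k \<in> B" if "k < m - 1" for k
  proof (cases "k \<le> 1")
    case False
    then have "k - 2 < m - 3" using that by auto
    then show ?thesis using False h0B[of "k - 2"] by (auto simp: h_def)
  qed (use ij in \<open>auto simp: h_def\<close>)
  have nz': "\<not> int m dvd (\<Sum>l\<in>K. a (h l))" if "K \<subseteq> {..<m - 1}" "K \<noteq> {}" for K
  proof -
    have "(\<Sum>l\<in>K. a (h l)) = sum a (h ` K)"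
      using inj_on_subset[OF inj that(1)] by (simp add: sum.reindex)
    then show ?thesis using nz[of "h ` K"] that hB by auto
  qed
  obtain k where k: "k < m" "[a j = (\<Sum>l<k. a (h l))] (mod int m)"
  proof -
    have "\<not> int m dvd (\<Sum>l\<in>{i..<j}. a (h l))" if "i < j" "j < m" for i j
      using that by (intro nz') auto
    then show ?thesis using partial_sum_residues[OF m, of "\<lambda>l. a (h l)" "a j"] that by blast
  qed
  have hj: "a j = a (h 1)" "a i = a (h 0)" by (auto simp: h_def)
  consider "k = 0" | "k = 1" | "k \<ge> 2" by linarith
  then show ?thesis
  proof cases
    case 1
    then have "int m dvd (\<Sum>l\<in>{1}. a (h l))" using k hj by (simp add: cong_iff_dvd_diff)
    moreover have "{1} \<subseteq> {..<m - 1}" using m3 by auto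
    ultimately show ?thesis using nz'[of "{1}"] by blast
  next
    case 2
    then show ?thesis using k hj by (simp add: cong_sym_eq)
  next
    case 3
    have "(\<Sum>l<k. a (h l)) = a (h 1) + (\<Sum>l\<in>{..<k} - {1}. a (h l))"
      using 3 by (intro sum.remove) auto
    then have "int m dvd (\<Sum>l\<in>{..<k} - {1}. a (h l))"
      using k hj by (simp add: cong_iff_dvd_diff)
    moreover have "0 \<in> {..<k} - {1::nat}" using 3 by auto
    moreover have "{..<k} - {1} \<subseteq> {..<m - 1}" using k by auto
    ultimately show ?thesis using nz'[of "{..<k} - {1}"] by blast
  qed
qed simp

text \<open>With a common divisor \<open>d > 1\<close> of \<open>a i\<close> and \<open>m\<close>,
  any \<open>m / d\<close> of the terms, which are all congruent, would add up to zero; there are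
  enough terms because \<open>m / d < m\<close>.\<close>

lemma zero_sum_free_coprime:
  fixes a :: "'i \<Rightarrow> int"
  assumes m: "m \<ge> 1" and B: "finite B" "card B = m - 1"
    and nz: "\<And>A. A \<subseteq> B \<Longrightarrow> A \<noteq> {} \<Longrightarrow> \<not> int m dvd sum a A"
    and i: "i \<in> B"
  shows "coprime (a i) (int m)"
proof (rule ccontr)
  assume "\<not> coprime (a i) (int m)"
  define d where "d = gcd (a i) (int m)"
  have "d > 0" unfolding d_def using m by (simp add: gcd_pos_int)
  moreover have "d \<noteq> 1" unfolding d_def using \<open>\<not> coprime (a i) (int m)\<close> coprime_iff_gcd_eq_1 by blast
  ultimately have d1: "d > 1" by linarith
  define t where "t = nat (int m div d)"
  have dm: "d * int t = int m" using m d1 by (simp add: t_def d_def pos_imp_zdiv_nonneg_iff)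
  have t1: "t \<ge> 1" using dm m by (cases t) auto
  have "t < m"
  proof -
    have "int t * 1 < int t * d" using d1 t1 by (intro mult_strict_left_mono) auto
    then show ?thesis using dm by (simp add: mult.commute)
  qed
  then have "t \<le> card B" using B by simp
  then obtain A where A: "A \<subseteq> B" "card A = t" by (rule obtain_subset_with_card_n)
  have "[sum a A = (\<Sum>_\<in>A. a i)] (mod int m)"
    using zero_sum_free_const[OF m B nz] A i by (intro cong_sum) auto
  then have "[sum a A = int t * a i] (mod int m)" using A by simp
  moreover have "int m dvd int t * a i"
  proof -
    have "d dvd a i" by (simp add: d_def)
    then show ?thesis using dm by (metis mult.commute mult_dvd_mono dvd_refl)
  qed
  ultimately have "int m dvd sum a A" by (metis cong_dvd_iff)
  moreover have "A \<noteq> {}" using A t1 by auto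
  ultimately show False using nz[OF A(1)] by blast
qed

lemma zero_sum_exists:
  fixes a :: "nat \<Rightarrow> int"
  assumes m: "m \<ge> 1"
  shows "\<exists>A\<subseteq>{..<m}. A \<noteq> {} \<and> int m dvd sum a A"
proof (rule ccontr)
  assume neg: "\<not> ?thesis"
  then have "\<exists>k<m. [- a (m - 1) = (\<Sum>l<k. a l)] (mod int m)"
    by (intro partial_sum_residues[OF m]) (metis atLeastLessThan_empty_iff2 ivl_subset lessThan_atLeast0 less_imp_le not_le zero_le)
  then obtain k where k: "k < m" "[- a (m - 1) = (\<Sum>l<k. a l)] (mod int m)" by blast
  then have "int m dvd (\<Sum>l<k. a l) + a (m - 1)"
    by (metis cong_iff_dvd_diff cong_sym diff_minus_eq_add)
  moreover have "sum a (insert (m - 1) {..<k}) = (\<Sum>l<k. a l) + a (m - 1)" using k by simp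
  moreover have "insert (m - 1) {..<k} \<subseteq> {..<m}" using k m by auto
  ultimately show False using neg by (metis insert_not_empty)
qed

lemma card_UN_bound:
  assumes "finite T" "\<And>i. i \<in> T \<Longrightarrow> card (B i) \<le> c"
  shows "card (\<Union>i\<in>T. B i) \<le> card T * c"
proof -
  have "card (\<Union>i\<in>T. B i) \<le> (\<Sum>i\<in>T. card (B i))" using assms by (intro card_UN_le)
  also have "\<dots> \<le> card T * c" using assms sum_bounded_above[of T "\<lambda>i. card (B i)" c] by auto
  finally show ?thesis .
qed

lemma cong_scale_iff:
  assumes "n > 0"
  shows "[int n * a = int n * b] (mod int (m * n)) \<longleftrightarrow> [a = b] (mod int m)"
proof -
  have "int n * a - int n * b = int n * (a - b)" by (simp add: right_diff_distrib)
  then show ?thesis using assms by (simp add: cong_iff_dvd_diff mult.commute[of "int m"])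
qed

section \<open>Splitting off zero-sum blocks\<close>

text \<open>The terms of the sequence are \<open>(p i, q i)\<close> for \<open>i \<in> L\<close>. The predicate \<open>zs n p q\<close> refers to the reduction
  modulo \<open>n\<close> in both coordinates; \<open>kap A\<close> is meaningful only for such zero-sums and represents, modulo \<open>m\<close>,
  the sum of \<open>A\<close> in the kernel of the reduction.\<close>

locale short_zs_free =
  fixes n m k :: nat and p q :: "nat \<Rightarrow> int" and L :: "nat set"
  assumes n2: "n \<ge> 2" and m2: "m \<ge> 2" and k1: "k \<ge> 1" and kn: "k \<le> n - 1"
    and finL: "finite L" and cardL: "card L = m * n + n - 2 + k"
    and noshort: "\<And>A. A \<subseteq> L \<Longrightarrow> A \<noteq> {} \<Longrightarrow> card A \<le> m * n + n - 1 - k \<Longrightarrow>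
      int n dvd sum p A \<Longrightarrow> \<not> int (m * n) dvd sum q A"
    and short_bound: "\<And>I. I \<subseteq> L \<Longrightarrow> 2 * n - 1 + k \<le> card I \<Longrightarrow>
      \<exists>J\<subseteq>I. zs n p q J \<and> card J \<le> 2 * n - 1 - k"
begin

definition kap :: "nat set \<Rightarrow> int" where "kap A = sum q A div int n"

definition fam :: "(nat \<Rightarrow> nat set) \<Rightarrow> nat \<Rightarrow> bool" where
  "fam B t \<longleftrightarrow> disjoint_family_on B {..<t} \<and> (\<forall>i<t. B i \<subseteq> L \<and> zs n p q (B i))"

text \<open>Exactly the sets to which the hypothesis on C_n + C_n applies: extremal length and no
  zero-sum of length at most \<open>2n-1-k\<close> after reduction.\<close>

definition good :: "nat set \<Rightarrow> bool" where
  "good R \<longleftrightarrow> R \<subseteq> L \<and> card R = 2 * n - 2 + k \<and> (\<forall>A\<subseteq>R. zs n p q A \<longrightarrow> 2 * n - 1 - k < card A)"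

text \<open>The bound as \<open>m-1\<close> blocks and a zero-sum of the rest, the bound as
  \<open>m-2\<close> blocks and a zero-sum in block and rest together, and the length of the
  sequence as \<open>m-1\<close> blocks and the rest.\<close>

lemma ar: "(m - 1) * n + (2 * n - 1 - k) = m * n + n - 1 - k"
  "(m - 2) * n + (3 * n - 1 - k) = m * n + n - 1 - k"
  "(m - 1) * n + (2 * n - 2 + k) = m * n + n - 2 + k"
proof -
  obtain m' where m': "m = Suc (Suc m')" using m2 by (metis Suc_le_D numeral_2_eq_2 Suc_le_mono)
  show "(m - 1) * n + (2 * n - 1 - k) = m * n + n - 1 - k"
    "(m - 2) * n + (3 * n - 1 - k) = m * n + n - 1 - k"
    "(m - 1) * n + (2 * n - 2 + k) = m * n + n - 2 + k"
    unfolding m' using n2 kn by (simp_all add: algebra_simps)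
qed

lemma finL': "A \<subseteq> L \<Longrightarrow> finite A"
  using finL finite_subset by blast

lemma kap_mult: "zs n p q A \<Longrightarrow> int n * kap A = sum q A"
  by (auto simp: zs_def kap_def)

lemma famD:
  assumes "fam B t"
  shows "i < t \<Longrightarrow> B i \<subseteq> L" "i < t \<Longrightarrow> zs n p q (B i)"
    and "i < t \<Longrightarrow> j < t \<Longrightarrow> i \<noteq> j \<Longrightarrow> B i \<inter> B j = {}"
  using assms by (auto simp: fam_def disjoint_family_on_def)

lemma famI:
  assumes "\<And>i. i < t \<Longrightarrow> B i \<subseteq> L" "\<And>i. i < t \<Longrightarrow> zs n p q (B i)"
    and "\<And>i j. i < t \<Longrightarrow> j < t \<Longrightarrow> i \<noteq> j \<Longrightarrow> B i \<inter> B j = {}"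
  shows "fam B t"
  using assms unfolding fam_def disjoint_family_on_def by blast

lemma fam_sum:
  fixes h :: "nat \<Rightarrow> int"
  assumes "fam B t" "T \<subseteq> {..<t}"
  shows "sum h (\<Union>i\<in>T. B i) = (\<Sum>i\<in>T. sum h (B i))"
proof (rule sum.UNION_disjoint)
  show "finite T" using assms finite_subset by blast
  show "\<forall>i\<in>T. finite (B i)" using assms famD(1)[OF assms(1)] finL' by blast
  show "\<forall>i\<in>T. \<forall>j\<in>T. i \<noteq> j \<longrightarrow> B i \<inter> B j = {}" using assms famD(3)[OF assms(1)] by blast
qed

text \<open>The union of the blocks in \<open>T\<close> has sum \<open>n\<close> times the sum of
  their \<open>kap\<close> values, so divisibility of the latter by \<open>m\<close> would produce a
  forbidden short zero-sum.\<close>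

lemma fam_subsum:
  assumes B: "fam B t" and T: "T \<subseteq> {..<t}" "T \<noteq> {}" and c: "card (\<Union>i\<in>T. B i) \<le> m * n + n - 1 - k"
  shows "\<not> int m dvd (\<Sum>i\<in>T. kap (B i))"
proof
  assume d: "int m dvd (\<Sum>i\<in>T. kap (B i))"
  have "sum q (\<Union>i\<in>T. B i) = (\<Sum>i\<in>T. int n * kap (B i))"
    unfolding fam_sum[OF B T(1)] using B T(1) by (intro sum.cong) (auto simp: kap_mult fam_def)
  then have "sum q (\<Union>i\<in>T. B i) = int n * (\<Sum>i\<in>T. kap (B i))" by (simp add: sum_distrib_left)
  then have "int (m * n) dvd sum q (\<Union>i\<in>T. B i)" using d by (simp add: mult.commute mult_dvd_mono)
  moreover have "int n dvd sum p (\<Union>i\<in>T. B i)"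
    unfolding fam_sum[OF B T(1)]
  proof (rule dvd_sum)
    fix i assume "i \<in> T"
    then have "i < t" using T(1) by auto
    then show "int n dvd sum p (B i)" using famD(2)[OF B] by (simp add: zs_def)
  qed
  moreover have "(\<Union>i\<in>T. B i) \<subseteq> L" "(\<Union>i\<in>T. B i) \<noteq> {}" using B T by (auto simp: fam_def zs_def)
  ultimately show False using noshort c by blast
qed

text \<open>Among \<open>m\<close> values modulo \<open>m\<close> some nonempty subset sums to zero,
  and the union of the corresponding blocks must then exceed the bound.\<close>

lemma fam_m:
  assumes B: "fam B m"
  shows "m * n + n - 1 - k < card (\<Union>i<m. B i)"
proof (rule ccontr)
  assume neg: "\<not> ?thesis"
  obtain T where T: "T \<subseteq> {..<m}" "T \<noteq> {}" "int m dvd (\<Sum>i\<in>T. kap (B i))"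
    using zero_sum_exists[of m "\<lambda>i. kap (B i)"] m2 by auto
  have "finite (\<Union>i<m. B i)" using B finL' by (auto simp: fam_def)
  then have "card (\<Union>i\<in>T. B i) \<le> card (\<Union>i<m. B i)" using T by (intro card_mono) auto
  then show False using fam_subsum[OF B T(1,2)] T(3) neg by linarith
qed

text \<open>As no union of blocks exceeds the bound, the \<open>m-1\<close> values of
  \<open>kap\<close> are zero-sum free over C_m, which at this length forces one repeated
  generator.\<close>

lemma fam_const:
  assumes B: "fam B (m - 1)" and c: "card (\<Union>i<m - 1. B i) \<le> m * n + n - 1 - k"
  shows "i < m - 1 \<Longrightarrow> j < m - 1 \<Longrightarrow> [kap (B i) = kap (B j)] (mod int m)"
    and "i < m - 1 \<Longrightarrow> coprime (kap (B i)) (int m)"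
proof -
  have "finite (\<Union>i<m - 1. B i)" using B finL' by (auto simp: fam_def)
  then have nz: "\<not> int m dvd (\<Sum>i\<in>T. kap (B i))" if "T \<subseteq> {..<m - 1}" "T \<noteq> {}" for T
  proof -
    have "card (\<Union>i\<in>T. B i) \<le> card (\<Union>i<m - 1. B i)" using that \<open>finite (\<Union>i<m - 1. B i)\<close>
      by (intro card_mono) auto
    then show ?thesis using fam_subsum[OF B that] c by linarith
  qed
  show "i < m - 1 \<Longrightarrow> j < m - 1 \<Longrightarrow> [kap (B i) = kap (B j)] (mod int m)"
    using zero_sum_free_const[of m "{..<m - 1}" "\<lambda>i. kap (B i)" i j] nz m2 by auto
  show "i < m - 1 \<Longrightarrow> coprime (kap (B i)) (int m)"
    using zero_sum_free_coprime[of m "{..<m - 1}" "\<lambda>i. kap (B i)" i] nz m2 by auto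
qed

lemma fam_upd:
  assumes "fam B t" "l < t" "W \<subseteq> L" "zs n p q W" "\<And>i. i < t \<Longrightarrow> i \<noteq> l \<Longrightarrow> W \<inter> B i = {}"
  shows "fam (B(l := W)) t"
proof (rule famI)
  fix i j assume ij: "i < t" "j < t" "i \<noteq> j"
  then show "(B(l := W)) i \<inter> (B(l := W)) j = {}"
    using famD(3)[OF assms(1) ij] assms(5)[of i] assms(5)[of j] by (auto simp: Int_commute)
qed (use famD(1,2)[OF assms(1)] assms(3,4) in auto)

lemma fam_Suc:
  assumes "fam B t" "W \<subseteq> L" "zs n p q W" "\<And>i. i < t \<Longrightarrow> W \<inter> B i = {}"
  shows "fam (B(t := W)) (Suc t)"
proof (rule famI)
  fix i j assume ij: "i < Suc t" "j < Suc t" "i \<noteq> j"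
  then show "(B(t := W)) i \<inter> (B(t := W)) j = {}"
    using famD(3)[OF assms(1), of i j] assms(4)[of i] assms(4)[of j] by (auto simp: Int_commute less_Suc_eq)
next
  fix i assume "i < Suc t"
  then show "(B(t := W)) i \<subseteq> L" "zs n p q ((B(t := W)) i)"
    using famD(1,2)[OF assms(1), of i] assms(2,3) by (auto simp: less_Suc_eq)
qed

lemma UN_upd: "l < t \<Longrightarrow> (\<Union>i<t. (B(l := W)) i) = W \<union> (\<Union>i\<in>{..<t} - {l}. B i)"
  by auto

text \<open>Two counts meet. A zero-sum of length at most \<open>2n-1-k\<close> in the rest would be
  an m-th block, so by \<open>short_bound\<close> the rest has at most \<open>2n-2+k\<close> terms;
  the blocks cover at most \<open>(m-1)n\<close> terms. Since the lengths add up exactly, both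
  estimates are equalities.\<close>

lemma fam_rest:
  assumes B: "fam B (m - 1)" and c: "\<And>i. i < m - 1 \<Longrightarrow> card (B i) \<le> n"
  shows "i < m - 1 \<Longrightarrow> card (B i) = n" and "good (L - (\<Union>i<m - 1. B i))"
proof -
  let ?U = "\<Union>i<m - 1. B i" let ?R = "L - ?U"
  have U: "?U \<subseteq> L" using B by (auto simp: fam_def)
  have cU: "card ?U \<le> (m - 1) * n" using card_UN_bound[of "{..<m - 1}" B n] c by auto
  have cR: "card ?R + card ?U = card L"
    using card_Diff_subset[OF finL'[OF U] U] card_mono[OF finL U] by linarith
  have short: "2 * n - 1 - k < card A" if A: "A \<subseteq> ?R" "zs n p q A" for A
  proof (rule ccontr)
    assume a: "\<not> ?thesis"
    have "fam (B(m - 1 := A)) (Suc (m - 1))" using A by (intro fam_Suc[OF B]) auto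
    then have F: "fam (B(m - 1 := A)) m" using m2 by simp
    have "(\<Union>i<m. (B(m - 1 := A)) i) = A \<union> ?U"
    proof -
      have m': "{..<m} = insert (m - 1) {..<m - 1}" using m2 by auto
      show ?thesis unfolding m' UN_insert by auto
    qed
    then have "card (\<Union>i<m. (B(m - 1 := A)) i) \<le> card A + card ?U" by (simp add: card_Un_le)
    then show False using fam_m[OF F] a cU ar(1) by linarith
  qed
  have "card ?R < 2 * n - 1 + k"
  proof (rule ccontr)
    assume "\<not> ?thesis"
    then obtain J where "J \<subseteq> ?R" "zs n p q J" "card J \<le> 2 * n - 1 - k"
      using short_bound[of ?R] by (meson Diff_subset leI)
    then show False using short[of J] by linarith
  qed
  then have eq: "card ?U = (m - 1) * n" "card ?R = 2 * n - 2 + k"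
    using cR cU cardL ar(3) n2 by linarith+
  then show "good ?R" using short by (auto simp: good_def)
  have "card ?U = (\<Sum>i<m - 1. card (B i))"
    using famD(1,3)[OF B] finL' by (intro card_UN_disjoint) blast+
  then have "(\<Sum>i<m - 1. card (B i)) = (\<Sum>i<m - 1. n)" using eq by simp
  then show "i < m - 1 \<Longrightarrow> card (B i) = n" for i
    using sum_mono_inv[of "\<lambda>i. card (B i)" "{..<m - 1}" "\<lambda>_. n" i] c by auto
qed

lemma ex_fam: "\<exists>B. fam B (m - 1) \<and> (\<forall>i<m - 1. card (B i) \<le> n)"
proof -
  have "(m - 1) * n + (2 * n - 2) \<le> card L" using cardL ar(3) by linarith
  then show ?thesis
    using extract_blocks[of n L "m - 1" p q] eta_davenport_bound[of n] n2 finL by (auto simp: fam_def)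
qed

definition eqv :: "nat \<Rightarrow> nat \<Rightarrow> bool" where
  "eqv i j \<longleftrightarrow> [p i = p j] (mod int n) \<and> [q i = q j] (mod int n)"

lemma eqv_refl [simp]: "eqv i i" by (simp add: eqv_def)
lemma eqv_sym: "eqv i j \<Longrightarrow> eqv j i" by (simp add: eqv_def cong_sym)
lemma eqv_trans: "eqv i j \<Longrightarrow> eqv j l \<Longrightarrow> eqv i l" using cong_trans by (auto simp: eqv_def)

lemma zs_swap:
  assumes "zs n p q (insert i K)" "eqv i j" "i \<notin> K" "j \<notin> K" "finite K"
  shows "zs n p q (insert j K)"
proof -
  have "[p i + sum p K = p j + sum p K] (mod int n)" "[q i + sum q K = q j + sum q K] (mod int n)"
    using assms(2) by (auto simp: eqv_def intro: cong_add)
  then show ?thesis using assms unfolding zs_def by (auto simp: cong_dvd_iff)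
qed

lemma zs_const:
  assumes "A \<noteq> {}" "\<And>i. i \<in> A \<Longrightarrow> eqv i j" "card A = n"
  shows "zs n p q A"
proof -
  have "[sum p A = (\<Sum>_\<in>A. p j)] (mod int n)" "[sum q A = (\<Sum>_\<in>A. q j)] (mod int n)"
    using assms(2) unfolding eqv_def by (intro cong_sum; blast)+
  then show ?thesis using assms by (auto simp: zs_def cong_dvd_iff)
qed

end

section \<open>Exchanging terms between one block and the rest\<close>

locale decomposition = short_zs_free +
  fixes B :: "nat \<Rightarrow> nat set"
  assumes fB: "fam B (m - 1)" and cB: "\<And>i. i < m - 1 \<Longrightarrow> card (B i) \<le> n"
begin

definition "R = L - (\<Union>i<m - 1. B i)"
definition "\<gamma> = kap (B 0)"

lemma goodR: "good R" unfolding R_def using fam_rest[OF fB cB] by blast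

lemma RL: "R \<subseteq> L" by (auto simp: R_def)

lemma BL: "i < m - 1 \<Longrightarrow> B i \<subseteq> L" "i < m - 1 \<Longrightarrow> zs n p q (B i)"
  using fB by (auto simp: fam_def)

lemma BR: "i < m - 1 \<Longrightarrow> B i \<inter> R = {}" by (auto simp: R_def)

lemma BB: "i < m - 1 \<Longrightarrow> j < m - 1 \<Longrightarrow> i \<noteq> j \<Longrightarrow> B i \<inter> B j = {}"
  using fB by (auto simp: fam_def disjoint_family_on_def)

lemma cardB: "i < m - 1 \<Longrightarrow> card (B i) = n" using fam_rest[OF fB cB] by blast

lemma cardR: "card R = 2 * n - 2 + k" using goodR by (simp add: good_def)

lemma cardBR: "l < m - 1 \<Longrightarrow> card (B l \<union> R) = 3 * n - 2 + k"
  using card_Un_disjoint[OF finL'[OF BL(1)] finL'[OF RL] BR, of l] cardB cardR n2 by simp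

lemma L_cover: "L = (\<Union>i<m - 1. B i) \<union> R" using BL(1) by (auto simp: R_def)

lemma kap_B: "i < m - 1 \<Longrightarrow> [kap (B i) = \<gamma>] (mod int m)" and cop_\<gamma>: "coprime \<gamma> (int m)"
proof -
  have "card (\<Union>i<m - 1. B i) \<le> (m - 1) * n" using card_UN_bound[of "{..<m - 1}" B n] cB by auto
  then have c: "card (\<Union>i<m - 1. B i) \<le> m * n + n - 1 - k" using ar(1) by linarith
  show "i < m - 1 \<Longrightarrow> [kap (B i) = \<gamma>] (mod int m)" "coprime \<gamma> (int m)"
    unfolding \<gamma>_def using fam_const[OF fB c] m2 by auto
qed

lemma not_dvd_\<gamma>: "\<not> int m dvd \<gamma>"
  using cop_\<gamma> m2 by (auto dest: coprime_common_divisor_int[of _ _ "int m"])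

lemma disj_other: "l < m - 1 \<Longrightarrow> W \<subseteq> B l \<union> R \<Longrightarrow> i < m - 1 \<Longrightarrow> i \<noteq> l \<Longrightarrow> W \<inter> B i = {}"
  using BB[of l i] BR[of i] by blast

text \<open>Makes the hypothesis applicable to many rests: whatever short zero-sum is found in one
  block and the rest can become the new block, and the leftover is again extremal.\<close>

lemma replace_block:
  assumes l: "l < m - 1" and W: "W \<subseteq> B l \<union> R" "zs n p q W" "card W \<le> n"
  shows "card W = n" and "good (B l \<union> R - W)"
    and "decomposition n m k p q L (B(l := W))"
proof -
  have F: "fam (B(l := W)) (m - 1)"
    using W BL(1)[OF l] RL by (intro fam_upd[OF fB l] disj_other[OF l]) auto
  have c: "card ((B(l := W)) i) \<le> n" if "i < m - 1" for i using cB that W by auto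
  show "card W = n" using fam_rest(1)[OF F c l] by simp
  have "L - (\<Union>i<m - 1. (B(l := W)) i) = B l \<union> R - W"
    unfolding UN_upd[OF l] using BL(1)[OF l] disj_other[OF l, of "B l \<union> R"] L_cover l by blast
  then show "good (B l \<union> R - W)" using fam_rest(2)[OF F c] by simp
  show "decomposition n m k p q L (B(l := W))"
    by unfold_locales (use F c in auto)
qed

lemma zs_card_ge: "l < m - 1 \<Longrightarrow> W \<subseteq> B l \<union> R \<Longrightarrow> zs n p q W \<Longrightarrow> n \<le> card W"
  using replace_block(1)[of l W] by linarith

text \<open>The set \<open>A\<close> may be longer than a block: together with \<open>m-2\<close>
  blocks of length at most \<open>n\<close> it still respects the bound, so \<open>kap A\<close>
  equals the common value. This is the source of the equations modulo \<open>m*n\<close>.\<close>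

lemma sum_q_block:
  assumes l: "l < m - 1" and A: "A \<subseteq> B l \<union> R" "zs n p q A" "card A \<le> 3 * n - 1 - k"
  shows "[sum q A = int n * \<gamma>] (mod int (m * n))"
proof -
  have F: "fam (B(l := A)) (m - 1)"
    using A BL(1)[OF l] RL by (intro fam_upd[OF fB l] disj_other[OF l]) auto
  have "card (\<Union>i<m - 1. (B(l := A)) i) \<le> card A + card (\<Union>i\<in>{..<m - 1} - {l}. B i)"
    unfolding UN_upd[OF l] by (rule card_Un_le)
  also have "card (\<Union>i\<in>{..<m - 1} - {l}. B i) \<le> card ({..<m - 1} - {l}) * n"
    using cB by (intro card_UN_bound) auto
  finally have "card (\<Union>i<m - 1. (B(l := A)) i) \<le> m * n + n - 1 - k"
    using A(3) l ar(2) by (simp add: numeral_2_eq_2)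
  note K = fam_const[OF F this]
  have "[kap A = \<gamma>] (mod int m)"
  \<comment> \<open>For \<open>m = 2\<close> there is no other block to compare with, but there is
    only one unit modulo 2.\<close>
  proof (cases "m = 2")
    case True
    then have "odd (kap A)" "odd \<gamma>" using K(2)[OF l] cop_\<gamma> by auto
    then show ?thesis using True by (simp add: cong_def odd_iff_mod_2_eq_one)
  next
    case False
    define l' where "l' = (if l = 0 then 1 else 0 :: nat)"
    have "l' < m - 1" "l' \<noteq> l" using m2 False by (auto simp: l'_def)
    then show ?thesis using K(1)[OF l, of l'] kap_B[of l'] by (auto intro: cong_trans)
  qed
  then have "[int n * kap A = int n * \<gamma>] (mod int (m * n))"
    using cong_scale_iff[of n] n2 by simp
  then show ?thesis using kap_mult[OF A(2)] by simp
qed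

lemma q_swap:
  assumes l: "l < m - 1" and K: "insert i K \<subseteq> B l \<union> R" "insert j K \<subseteq> B l \<union> R" "i \<notin> K" "j \<notin> K"
    and z: "zs n p q (insert i K)" and e: "eqv i j" and c: "card K + 1 \<le> 3 * n - 1 - k"
  shows "[q i = q j] (mod int (m * n))"
proof -
  have fK: "finite K" using K(1) BL(1)[OF l] RL finL' by (meson Un_least finite_insert subset_trans)
  have "[sum q (insert i K) = int n * \<gamma>] (mod int (m * n))"
    using c fK K z by (intro sum_q_block[OF l]) auto
  moreover have "[sum q (insert j K) = int n * \<gamma>] (mod int (m * n))"
    using c fK K zs_swap[OF z e K(3,4) fK] by (intro sum_q_block[OF l]) auto
  ultimately have "[q i + sum q K = q j + sum q K] (mod int (m * n))"
    using fK K by (simp add: cong_def)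
  then show ?thesis by (rule cong_add_rcancel[THEN iffD1])
qed

lemma block_rest_swap:
  assumes l: "l < m - 1" and i: "i \<in> B l" and j: "j \<in> R" and e: "eqv i j"
  shows "[q i = q j] (mod int (m * n))"
proof (rule q_swap[OF l, of i "B l - {i}" j])
  show "zs n p q (insert i (B l - {i}))" using BL(2)[OF l] i by (simp add: insert_absorb)
  have "card (B l - {i}) = n - 1" using cardB[OF l] i finL'[OF BL(1)[OF l]] by simp
  then show "card (B l - {i}) + 1 \<le> 3 * n - 1 - k" using kn n2 by linarith
qed (use i j e BR[OF l] in auto)

end

lemma unimodular_indep:
  fixes a b c d s t N :: int
  assumes "coprime (a * d - b * c) N" "N dvd s * a + t * b" "N dvd s * c + t * d"
  shows "N dvd s" "N dvd t"
proof -
  have "s * (a * d - b * c) = d * (s * a + t * b) - b * (s * c + t * d)" by (simp add: algebra_simps)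
  then have "N dvd s * (a * d - b * c)" using assms by (metis dvd_diff dvd_mult)
  then show "N dvd s" using assms(1) by (metis coprime_commute coprime_dvd_mult_left_iff)
  have "t * (a * d - b * c) = a * (s * c + t * d) - c * (s * a + t * b)" by (simp add: algebra_simps)
  then have "N dvd t * (a * d - b * c)" using assms by (metis dvd_diff dvd_mult)
  then show "N dvd t" using assms(1) by (metis coprime_commute coprime_dvd_mult_left_iff)
qed

lemma sum_cong_const:
  fixes f :: "'i \<Rightarrow> int"
  assumes "\<And>i. i \<in> A \<Longrightarrow> [f i = c] (mod N)"
  shows "[sum f A = int (card A) * c] (mod N)"
proof -
  have "[sum f A = (\<Sum>i\<in>A. c)] (mod N)" using assms by (intro cong_sum)
  then show ?thesis by simp
qed

lemma int_dvd_le: "int n dvd int a \<Longrightarrow> a < n \<Longrightarrow> a = 0"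
  by (auto simp: int_dvd_int_iff dest: dvd_imp_le)

section \<open>Sequences with three values: the case \<open>k \<ge> 2\<close>\<close>

context short_zs_free
begin

text \<open>The form 3(a) or 4(a) for the group with \<open>m = 1\<close>, where
  \<open>s = 1\<close>: the values are (a,c), (b,d) and \<open>x\<close> times the first plus the
  second, the first two being a basis modulo \<open>n\<close>. A value of \<open>x\<close> other
  than 1 can occur only for \<open>k = n - 1\<close>.\<close>

definition three :: "nat set \<Rightarrow> nat set \<Rightarrow> nat set \<Rightarrow> nat set \<Rightarrow> int \<Rightarrow> bool" where
  "three Q P1 P2 P3 x \<longleftrightarrow> Q = P1 \<union> P2 \<union> P3 \<and> P1 \<inter> P2 = {} \<and> P1 \<inter> P3 = {} \<and> P2 \<inter> P3 = {} \<and>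
     card P1 = n - 1 \<and> card P2 = n - 1 \<and> card P3 = k \<and>
     coprime x (int n) \<and> 1 \<le> x \<and> x \<le> int n - 1 \<and> (k \<noteq> n - 1 \<longrightarrow> x = 1) \<and>
     (\<exists>a b c d. coprime (a * d - b * c) (int n) \<and>
        (\<forall>i\<in>P1. [p i = a] (mod int n) \<and> [q i = c] (mod int n)) \<and>
        (\<forall>i\<in>P2. [p i = b] (mod int n) \<and> [q i = d] (mod int n)) \<and>
        (\<forall>i\<in>P3. [p i = x * a + b] (mod int n) \<and> [q i = x * c + d] (mod int n)))"

lemma threeD:
  assumes "three Q P1 P2 P3 x"
  shows "Q = P1 \<union> P2 \<union> P3" "P1 \<inter> P2 = {}" "P1 \<inter> P3 = {}" "P2 \<inter> P3 = {}"
    "card P1 = n - 1" "card P2 = n - 1" "card P3 = k"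
    "coprime x (int n)" "1 \<le> x" "x \<le> int n - 1" "k \<noteq> n - 1 \<Longrightarrow> x = 1"
    "finite P1" "finite P2" "finite P3" "P1 \<noteq> {}" "P2 \<noteq> {}" "P3 \<noteq> {}"
proof -
  show "Q = P1 \<union> P2 \<union> P3" "P1 \<inter> P2 = {}" "P1 \<inter> P3 = {}" "P2 \<inter> P3 = {}"
    "card P1 = n - 1" "card P2 = n - 1" "card P3 = k"
    "coprime x (int n)" "1 \<le> x" "x \<le> int n - 1" "k \<noteq> n - 1 \<Longrightarrow> x = 1"
    using assms unfolding three_def by blast+
  then show "finite P1" "finite P2" "finite P3" "P1 \<noteq> {}" "P2 \<noteq> {}" "P3 \<noteq> {}"
    using n2 k1 by (auto intro: card_ge_0_finite)
qed

lemma three_indep: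
  assumes t: "three Q P1 P2 P3 x" and u: "u \<in> P1" "v \<in> P2"
    and "int n dvd s * p u + t * p v" "int n dvd s * q u + t * q v"
  shows "int n dvd s" "int n dvd t"
proof -
  obtain a b c d where cop: "coprime (a * d - b * c) (int n)"
    and 1: "\<forall>i\<in>P1. [p i = a] (mod int n) \<and> [q i = c] (mod int n)"
    and 2: "\<forall>i\<in>P2. [p i = b] (mod int n) \<and> [q i = d] (mod int n)"
    using t unfolding three_def by blast
  have "[s * p u + t * p v = s * a + t * b] (mod int n)" "[s * q u + t * q v = s * c + t * d] (mod int n)"
    using 1 2 u by (auto intro!: cong_add cong_scalar_left)
  then have "int n dvd s * a + t * b" "int n dvd s * c + t * d"
    using assms(4,5) cong_dvd_iff by blast+
  then show "int n dvd s" "int n dvd t" using unimodular_indep[OF cop] by blast+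
qed

lemma three_det:
  assumes t: "three Q P1 P2 P3 x" and u: "u \<in> P1" "v \<in> P2"
  shows "coprime (p u * q v - p v * q u) (int n)"
proof -
  obtain a b c d where cop: "coprime (a * d - b * c) (int n)"
    and 1: "\<forall>i\<in>P1. [p i = a] (mod int n) \<and> [q i = c] (mod int n)"
    and 2: "\<forall>i\<in>P2. [p i = b] (mod int n) \<and> [q i = d] (mod int n)"
    using t unfolding three_def by blast
  have "[p u * q v - p v * q u = a * d - b * c] (mod int n)"
    using 1 2 u by (auto intro!: cong_diff cong_mult)
  then show ?thesis using cop cong_imp_coprime cong_sym by blast
qed

lemma three_eqv:
  assumes t: "three Q P1 P2 P3 x"
  shows "i \<in> P1 \<Longrightarrow> j \<in> P1 \<Longrightarrow> eqv i j" "i \<in> P2 \<Longrightarrow> j \<in> P2 \<Longrightarrow> eqv i j"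
    "i \<in> P3 \<Longrightarrow> j \<in> P3 \<Longrightarrow> eqv i j"
    and "u \<in> P1 \<Longrightarrow> v \<in> P2 \<Longrightarrow> w \<in> P3 \<Longrightarrow>
      [p w = x * p u + p v] (mod int n) \<and> [q w = x * q u + q v] (mod int n)"
proof -
  obtain a b c d where
    1: "\<forall>i\<in>P1. [p i = a] (mod int n) \<and> [q i = c] (mod int n)"
    and 2: "\<forall>i\<in>P2. [p i = b] (mod int n) \<and> [q i = d] (mod int n)"
    and 3: "\<forall>i\<in>P3. [p i = x * a + b] (mod int n) \<and> [q i = x * c + d] (mod int n)"
    using t unfolding three_def by blast
  show "i \<in> P1 \<Longrightarrow> j \<in> P1 \<Longrightarrow> eqv i j" "i \<in> P2 \<Longrightarrow> j \<in> P2 \<Longrightarrow> eqv i j"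
    "i \<in> P3 \<Longrightarrow> j \<in> P3 \<Longrightarrow> eqv i j"
    using 1 2 3 unfolding eqv_def by (meson cong_sym cong_trans)+
  show "[p w = x * p u + p v] (mod int n) \<and> [q w = x * q u + q v] (mod int n)"
    if "u \<in> P1" "v \<in> P2" "w \<in> P3"
  proof -
    have "[x * p u + p v = x * a + b] (mod int n)" "[x * q u + q v = x * c + d] (mod int n)"
      using 1 2 that by (auto intro!: cong_add cong_scalar_left)
    then show ?thesis using 3 that by (meson cong_sym cong_trans)
  qed
qed

lemma three_not_eqv:
  assumes t: "three Q P1 P2 P3 x" and uvw: "u \<in> P1" "v \<in> P2" "w \<in> P3"
  shows "\<not> eqv u v" "\<not> eqv u w" "\<not> eqv v w"
proof -
  note R = three_eqv(4)[OF t uvw]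
  have n1: "\<not> int n dvd 1" using n2 by auto
  show "\<not> eqv u v"
  proof
    assume "eqv u v"
    then have "int n dvd 1 * p u + (-1) * p v" "int n dvd 1 * q u + (-1) * q v"
      by (auto simp: eqv_def cong_iff_dvd_diff)
    then show False using three_indep(1)[OF t uvw(1,2)] n1 by blast
  qed
  show "\<not> eqv u w"
  proof
    assume "eqv u w"
    then have "[p u = x * p u + p v] (mod int n)" "[q u = x * q u + q v] (mod int n)"
      using R by (auto simp: eqv_def intro: cong_trans)
    then have "int n dvd (1 - x) * p u + (-1) * p v" "int n dvd (1 - x) * q u + (-1) * q v"
      by (auto simp: cong_iff_dvd_diff algebra_simps)
    then have "int n dvd - 1" using three_indep(2)[OF t uvw(1,2)] by blast
    then show False using n1 by simp
  qed
  show "\<not> eqv v w"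
  proof
    assume "eqv v w"
    then have "[p v = x * p u + p v] (mod int n)" "[q v = x * q u + q v] (mod int n)"
      using R by (auto simp: eqv_def intro: cong_trans)
    then have "int n dvd - (x * p u)" "int n dvd - (x * q u)"
      by (auto simp: cong_iff_dvd_diff)
    then have "int n dvd x * p u + 0 * p v" "int n dvd x * q u + 0 * q v" by auto
    then have "int n dvd x" using three_indep(1)[OF t uvw(1,2)] by blast
    then show False using threeD(9,10)[OF t] by (auto dest: zdvd_imp_le)
  qed
qed

lemma three_class:
  assumes t: "three Q P1 P2 P3 x" and j: "j \<in> Q"
  shows "j \<in> P1 \<Longrightarrow> {i\<in>Q. eqv i j} = P1" "j \<in> P2 \<Longrightarrow> {i\<in>Q. eqv i j} = P2" "j \<in> P3 \<Longrightarrow> {i\<in>Q. eqv i j} = P3"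
proof -
  note E = three_eqv(1-3)[OF t] note N = three_not_eqv[OF t] note D = threeD[OF t]
  obtain u v w where uvw: "u \<in> P1" "v \<in> P2" "w \<in> P3" using D(15,16,17) by blast
  have N12: "\<not> eqv i j'" "\<not> eqv j' i" if "i \<in> P1" "j' \<in> P2" for i j' using N(1)[OF that uvw(3)] eqv_sym by blast+
  have N13: "\<not> eqv i j'" "\<not> eqv j' i" if "i \<in> P1" "j' \<in> P3" for i j' using N(2)[OF that(1) uvw(2) that(2)] eqv_sym by blast+
  have N23: "\<not> eqv i j'" "\<not> eqv j' i" if "i \<in> P2" "j' \<in> P3" for i j' using N(3)[OF uvw(1) that] eqv_sym by blast+
  show "j \<in> P1 \<Longrightarrow> {i\<in>Q. eqv i j} = P1" unfolding D(1) using E(1) N12 N13 by blast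
  show "j \<in> P2 \<Longrightarrow> {i\<in>Q. eqv i j} = P2" unfolding D(1) using E(2) N12 N23 by blast
  show "j \<in> P3 \<Longrightarrow> {i\<in>Q. eqv i j} = P3" unfolding D(1) using E(3) N13 N23 by blast
qed

end

section \<open>Only three values occur after reduction\<close>

locale triple = decomposition +
  fixes R1 R2 R3 :: "nat set" and x :: int
  assumes kk: "k \<ge> 2 \<or> n = 2"
    and str: "\<And>Q. good Q \<Longrightarrow> \<exists>P1 P2 P3 y. three Q P1 P2 P3 y"
    and R: "three R R1 R2 R3 x"
begin

text \<open>\<open>W\<close> consists of the class \<open>Ru\<close> and one more term, which must
  be a copy of the same value. Exchanging \<open>W\<close> against the block leaves a rest with the
  classes of \<open>h\<close>, of \<open>Ru'\<close> and of \<open>R3\<close>, and the sizes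
  \<open>n-1\<close>, \<open>n-1\<close>, \<open>k\<close> together with the zero-sum condition on
  the block are contradictory.\<close>

lemma no_fourth_value:
  assumes l: "l < m - 1" and h: "h \<in> B l" and hR: "\<And>j. j \<in> R \<Longrightarrow> \<not> eqv h j"
    and W: "W \<subseteq> B l \<union> R" "zs n p q W" "card W \<le> n" "h \<notin> W"
    and U: "(Ru = R1 \<and> Ru' = R2) \<or> (Ru = R2 \<and> Ru' = R1)" "Ru \<subseteq> W" and k2: "k \<ge> 2"
  shows False
proof -
  let ?T = "B l"
  note D = threeD[OF R]
  have fT: "finite ?T" "finite R" using finL' BL(1)[OF l] RL by auto
  have Ru: "Ru \<subseteq> R" "Ru' \<subseteq> R" "R3 \<subseteq> R" "card Ru = n - 1" "card Ru' = n - 1" "Ru \<noteq> {}" "Ru' \<noteq> {}"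
    "Ru \<inter> Ru' = {}" "Ru \<inter> R3 = {}" "Ru' \<inter> R3 = {}" "R = Ru \<union> Ru' \<union> R3"
    using U(1) D by auto
  have fRu: "finite Ru" using Ru(1) fT finite_subset by blast
  obtain u u' j3 where uu: "u \<in> Ru" "u' \<in> Ru'" "j3 \<in> R3" using Ru D(17) by blast
  have eqRu: "eqv i u" if "i \<in> Ru" for i using U(1) uu(1) that three_eqv(1,2)[OF R] by auto
  have eqRu': "eqv i u'" if "i \<in> Ru'" for i using U(1) uu(2) that three_eqv(1,2)[OF R] by auto
  have eqR3: "eqv i j3" if "i \<in> R3" for i using uu(3) that three_eqv(3)[OF R] by auto
  have ne: "\<not> eqv u u'" "\<not> eqv u j3" "\<not> eqv u' j3"
    using U(1) uu three_not_eqv[OF R] eqv_sym by blast+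
  have fW: "finite W" using W(1) fT finite_subset by (meson finite_UnI)
  have cW: "card W = n" and gR: "good (?T \<union> R - W)" using replace_block[OF l W(1-3)] by auto
  have "card (W - Ru) = 1" using cW Ru(4) card_Diff_subset[OF fRu U(2)] n2 by simp
  then obtain w where w: "W - Ru = {w}" by (auto simp: card_1_singleton_iff)
  then have W_eq: "W = insert w Ru" "w \<notin> Ru" using U(2) by auto
  \<comment> \<open>The \<open>n-1\<close> copies of \<open>u\<close> in \<open>W\<close> sum to
    \<open>-u\<close>, so the remaining term is congruent to \<open>u\<close>.\<close>
  have "eqv w u"
  proof -
    have "[p w + sum p Ru = p w + int (card Ru) * p u] (mod int n)"
      "[q w + sum q Ru = q w + int (card Ru) * q u] (mod int n)"
      using eqRu by (auto intro!: cong_add sum_cong_const simp: eqv_def)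
    moreover have "int n dvd p w + sum p Ru" "int n dvd q w + sum q Ru"
      using W(2) W_eq fRu by (auto simp: zs_def)
    ultimately have "int n dvd p w + int (card Ru) * p u" "int n dvd q w + int (card Ru) * q u"
      using cong_dvd_iff by blast+
    moreover have "int (card Ru) = int n - 1" using Ru(4) n2 by simp
    ultimately have "int n dvd p w + (int n - 1) * p u - int n * p u" "int n dvd q w + (int n - 1) * q u - int n * q u"
      using dvd_diff dvd_triv_left by metis+
    then show ?thesis by (simp add: eqv_def cong_iff_dvd_diff algebra_simps)
  qed
  have "w \<notin> R"
  proof
    assume "w \<in> R"
    then have "w \<in> Ru' \<or> w \<in> R3" using W_eq Ru(11) by auto
    then have "eqv w u' \<or> eqv w j3" using eqRu' eqR3 by blast
    then show False using ne(1,2) eqv_trans[OF eqv_sym[OF \<open>eqv w u\<close>]] by blast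
  qed
  then have wT: "w \<in> ?T" using W_eq W(1) by auto
  let ?Q = "?T \<union> R - W"
  have Q_eq: "?Q = (?T - {w}) \<union> Ru' \<union> R3"
    using W_eq Ru(8,9,11) BR[OF l] wT by blast
  obtain P1 P2 P3 y where P: "three ?Q P1 P2 P3 y" using str[OF gR] by blast
  note DP = threeD[OF P] note CP = three_class[OF P]
  define C where "C j = {i\<in>?Q. eqv i j}" for j
  have inQ: "h \<in> ?Q" "u' \<in> ?Q" "j3 \<in> ?Q"
    using h W(4) uu Q_eq by auto
  have Ccases: "C j = P1 \<or> C j = P2 \<or> C j = P3" if "j \<in> ?Q" for j
    using that DP(1) CP[OF that] unfolding C_def by blast
  have Ccard: "card (C j) = n - 1 \<or> (card (C j) = k \<and> C j = P3)" if "j \<in> ?Q" for j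
    using Ccases[OF that] DP(5-7) by auto
  have Cself: "j \<in> C j" if "j \<in> ?Q" for j using that by (simp add: C_def)
  have "u \<in> R" "u' \<in> R" "j3 \<in> R" using Ru(1-3) uu by auto
  then have hne: "\<not> eqv h u" "\<not> eqv h u'" "\<not> eqv h j3" using hR by auto
  then have hne': "\<not> eqv u h" "\<not> eqv u' h" "\<not> eqv j3 h" using eqv_sym by blast+
  have Cneq: "C i \<noteq> C j" if "i \<in> ?Q" "\<not> eqv i j" for i j
    using Cself[OF that(1)] that(2) unfolding C_def by blast
  have Cne: "C h \<noteq> C u'" "C h \<noteq> C j3" "C u' \<noteq> C j3"
    using Cneq inQ hne ne by auto
  have fQ: "finite ?Q" using fT by auto
  have fC: "finite (C j)" for j unfolding C_def by (rule finite_subset[OF _ fQ]) auto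
  have RuC: "Ru' \<subseteq> C u'" using eqRu' Q_eq unfolding C_def by blast
  have Cu': "C u' = Ru'"
  proof -
    have "card (C u') \<le> n - 1" using Ccard[OF inQ(2)] kn by auto
    then show ?thesis using card_seteq[OF fC RuC] Ru(5) by simp
  qed
  have R3C: "R3 \<subseteq> C j3" using eqR3 Q_eq unfolding C_def by blast
  have TC: "?T - {w} \<subseteq> C h \<union> C j3"
  proof
    fix i assume i: "i \<in> ?T - {w}"
    then have iQ: "i \<in> ?Q" using Q_eq by auto
    have "C i \<in> {P1, P2, P3}" "C h \<in> {P1, P2, P3}" "C u' \<in> {P1, P2, P3}" "C j3 \<in> {P1, P2, P3}"
      using Ccases iQ inQ by auto
    then have "C i = C h \<or> C i = C u' \<or> C i = C j3" using Cne by blast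
    moreover have "C i \<noteq> C u'" using Cu' Cself[OF iQ] i BR[OF l] Ru(2) by blast
    ultimately show "i \<in> C h \<union> C j3" using Cself[OF iQ] by auto
  qed
  have ChT: "C h \<subseteq> ?T - {w}"
  proof
    fix i assume "i \<in> C h"
    then have "eqv i h" "i \<in> ?Q" by (auto simp: C_def)
    then have "i \<notin> R" using hR[of i] eqv_sym[of i h] by blast
    then show "i \<in> ?T - {w}" using \<open>i \<in> ?Q\<close> Q_eq Ru(2,3) by blast
  qed
  have zsT: "int n dvd f w + sum f (?T - {w})" if "f = p \<or> f = q" for f
    using BL(2)[OF l] that sum.remove[OF fT(1) wT, of f] by (auto simp: zs_def)
  have cT: "card (?T - {w}) = n - 1" using cardB[OF l] wT fT by simp
  show False
  \<comment> \<open>If the class of \<open>j3\<close> does not grow, all other terms of the block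
    are copies of \<open>h\<close>, and its sum forces \<open>w\<close> to be one too. If it grows
    to \<open>n-1\<close> terms, then \<open>h\<close> belongs to the class of size
    \<open>k\<close>, so \<open>h\<close> is \<open>u' + j3\<close> with
    \<open>j3 = u + u'\<close>.\<close>
  proof (cases "card (C j3) = k")
    case True
    then have "C j3 = R3" using card_seteq[OF fC R3C] D(7) by simp
    have all: "eqv i h" if i: "i \<in> ?T - {w}" for i
    proof -
      have "i \<notin> C j3" using \<open>C j3 = R3\<close> Ru(3) BR[OF l] i by blast
      then have "i \<in> C h" using TC i by blast
      then show ?thesis by (simp add: C_def)
    qed
    have "[p w + sum p (?T - {w}) = p w + int (card (?T - {w})) * p h] (mod int n)"
      "[q w + sum q (?T - {w}) = q w + int (card (?T - {w})) * q h] (mod int n)"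
      using all by (auto intro!: cong_add sum_cong_const simp: eqv_def)
    moreover have "int n dvd p w + sum p (?T - {w})" "int n dvd q w + sum q (?T - {w})"
      using zsT by auto
    ultimately have "int n dvd p w + int (card (?T - {w})) * p h" "int n dvd q w + int (card (?T - {w})) * q h"
      using cong_dvd_iff by blast+
    moreover have "int (card (?T - {w})) = int n - 1" using cT n2 by simp
    ultimately have "int n dvd p w + (int n - 1) * p h - int n * p h" "int n dvd q w + (int n - 1) * q h - int n * q h"
      using dvd_diff dvd_triv_left by metis+
    then have "eqv w h" by (simp add: eqv_def cong_iff_dvd_diff algebra_simps)
    then show False using hne'(1) eqv_trans[OF eqv_sym[OF \<open>eqv w u\<close>]] by blast
  next
    case False
    then have cj3: "card (C j3) = n - 1" "k \<noteq> n - 1" using Ccard[OF inQ(3)] by auto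
    have x1: "x = 1" "y = 1" using D(11) DP(11) cj3(2) by auto
    have j3P: "C j3 = P1 \<or> C j3 = P2" using Ccases[OF inQ(3)] DP(7) False by auto
    have u'P: "C u' = P1 \<or> C u' = P2" using Ccases[OF inQ(2)] DP(7) Cu' Ru(5) cj3(2) by auto
    have hP: "C h = P3" using Ccases[OF inQ(1)] Cne j3P u'P by auto
    have sh: "[p h = p u' + p j3] (mod int n)" "[q h = q u' + q j3] (mod int n)"
    proof -
      have "h \<in> P3" "u' \<in> P1 \<and> j3 \<in> P2 \<or> u' \<in> P2 \<and> j3 \<in> P1"
        using hP j3P u'P Cne(3) Cself[OF inQ(1)] Cself[OF inQ(2)] Cself[OF inQ(3)] by metis+
      then show "[p h = p u' + p j3] (mod int n)" "[q h = q u' + q j3] (mod int n)"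
        using three_eqv(4)[OF P, of u' j3 h] three_eqv(4)[OF P, of j3 u' h] x1 by (auto simp: add.commute)
    qed
    have s3: "[p j3 = p u + p u'] (mod int n)" "[q j3 = q u + q u'] (mod int n)"
      using three_eqv(4)[OF R, of u u' j3] three_eqv(4)[OF R, of u' u j3] x1 U(1) uu by (auto simp: add.commute)
    have "?T - {w} = (C j3 - R3) \<union> C h"
    proof
      show "?T - {w} \<subseteq> (C j3 - R3) \<union> C h" using TC BR[OF l] Ru(3) by blast
      have "C j3 - R3 \<subseteq> ?T - {w}"
      proof
        fix i assume i: "i \<in> C j3 - R3"
        then have "eqv i j3" by (simp add: C_def)
        then have "i \<notin> Ru'" using ne(3) eqRu'[of i] eqv_trans[OF eqv_sym[of i u']] by blast
        then show "i \<in> ?T - {w}" using i Q_eq unfolding C_def by blast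
      qed
      then show "(C j3 - R3) \<union> C h \<subseteq> ?T - {w}" using ChT by blast
    qed
    moreover have dis: "(C j3 - R3) \<inter> C h = {}" 
    proof -
      have "\<not> (eqv i j3 \<and> eqv i h)" for i using hne(3) eqv_trans[OF eqv_sym[of i h]] by blast
      then show ?thesis unfolding C_def by blast
    qed
    ultimately have sT: "sum f (?T - {w}) = sum f (C j3 - R3) + sum f (C h)" for f :: "nat \<Rightarrow> int"
      using fC by (simp add: sum.union_disjoint)
    have c1: "card (C j3 - R3) = n - 1 - k" "card (C h) = k"
      using card_Diff_subset[of R3 "C j3"] R3C D(7,14) cj3 hP DP(7) by auto
    \<comment> \<open>The block is \<open>w = u\<close>, \<open>n-1-k\<close> terms
      \<open>u + u'\<close> and \<open>k\<close> terms \<open>u + 2u'\<close>, in total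
      \<open>n u + (n-1+k) u'\<close>.\<close>
    have tot: "int n dvd int (n - 1 + k) * f u'"
      if f: "f = p \<or> f = q" for f
    proof -
      have dv: "int n dvd f w + (sum f (C j3 - R3) + sum f (C h))"
        using zsT[OF f] sT by simp
      have "[f w = f u] (mod int n)" using \<open>eqv w u\<close> f by (auto simp: eqv_def)
      moreover have "[sum f (C j3 - R3) = int (n - 1 - k) * f j3] (mod int n)"
        unfolding c1(1)[symmetric] using f by (intro sum_cong_const) (auto simp: C_def eqv_def)
      moreover have "[int (n - 1 - k) * f j3 = int (n - 1 - k) * (f u + f u')] (mod int n)"
        using s3 f by (intro cong_scalar_left) auto
      moreover have "[sum f (C h) = int k * f h] (mod int n)"
        unfolding c1(2)[symmetric] using f by (intro sum_cong_const) (auto simp: C_def eqv_def)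
      moreover have "[int k * f h = int k * (f u' + (f u + f u'))] (mod int n)"
      proof -
        have "[f h = f u' + f j3] (mod int n)" using sh f by auto
        moreover have "[f j3 = f u + f u'] (mod int n)" using s3 f by auto
        then have "[f u' + f j3 = f u' + (f u + f u')] (mod int n)" by (rule cong_add[OF cong_refl])
        ultimately show ?thesis by (meson cong_scalar_left cong_trans)
      qed
      ultimately have "[f w + (sum f (C j3 - R3) + sum f (C h))
          = f u + (int (n - 1 - k) * (f u + f u') + int k * (f u' + (f u + f u')))] (mod int n)"
        by (meson cong_add cong_trans)
      then have "int n dvd f u + (int (n - 1 - k) * (f u + f u') + int k * (f u' + (f u + f u')))"
        using dv cong_dvd_iff by blast
      moreover have "int (n - 1 - k) = int n - 1 - int k" "int (n - 1 + k) = int n - 1 + int k"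
        using kn n2 by (auto simp: of_nat_diff)
      ultimately have "int n dvd int n * f u + int (n - 1 + k) * f u'" by (simp add: algebra_simps)
      then show ?thesis by (simp add: dvd_add_right_iff)
    qed
    have "int n dvd int (n - 1 + k)"
    proof -
      have "int n dvd 0 * p u + int (n - 1 + k) * p u'" "int n dvd 0 * q u + int (n - 1 + k) * q u'"
        using tot by auto
      moreover have "int n dvd int (n - 1 + k) * p u' + 0 * p u" "int n dvd int (n - 1 + k) * q u' + 0 * q u"
        using tot by auto
      ultimately show ?thesis using U(1) uu three_indep[OF R] by blast
    qed
    then have "n dvd n - 1 + k" by (simp only: int_dvd_int_iff)
    moreover have "n - 1 + k = n + (k - 1)" using k2 n2 by linarith
    ultimately have "n dvd k - 1" by simp
    then show False using k2 kn n2 by (auto dest: dvd_imp_le)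
  qed
qed

text \<open>For \<open>k \<ge> 2\<close> the union of block and rest still has \<open>3n-2\<close>
  terms without \<open>h\<close> and one term of \<open>R3\<close>, so a zero-sum \<open>W\<close>
  of length at most \<open>n\<close> avoids both. The rest after the exchange contains these two
  values; if it also met both \<open>R1\<close> and \<open>R2\<close> it would have four. Hence
  \<open>W\<close> swallows \<open>R1\<close> or \<open>R2\<close>. For \<open>n = 2\<close> there
  are only three nonzero values at all.\<close>

lemma support:
  assumes l: "l < m - 1" and h: "h \<in> B l"
  shows "\<exists>j\<in>R. eqv h j"
proof (rule ccontr)
  assume neg: "\<not> ?thesis"
  note D = threeD[OF R]
  obtain r1 r2 r3 where r: "r1 \<in> R1" "r2 \<in> R2" "r3 \<in> R3" using D(15,16,17) by blast
  then have rR: "r1 \<in> R" "r2 \<in> R" "r3 \<in> R" using D(1) by auto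
  note ne = three_not_eqv[OF R r]
  show False
  proof (cases "n = 2")
    case True
    have nz: "\<not> (even (p i) \<and> even (q i))" if "i \<in> B l \<union> R" for i
      using zs_card_ge[OF l, of "{i}"] that True by (auto simp: zs_def)
    have "\<not> eqv h r1" "\<not> eqv h r2" "\<not> eqv h r3" using neg rR by auto
    moreover have "eqv i j \<longleftrightarrow> (even (p i) \<longleftrightarrow> even (p j)) \<and> (even (q i) \<longleftrightarrow> even (q j))" for i j
      unfolding eqv_def using True by (simp add: cong_iff_dvd_diff)
    ultimately show False using ne nz[of h] nz[of r1] nz[of r2] nz[of r3] h rR by auto
  next
    case False
    then have k2: "k \<ge> 2" using kk by auto
    let ?V = "B l \<union> R"
    have "h \<noteq> r3" using neg rR by auto
    then have "card (?V - {h, r3}) = 3 * n - 2 + k - 2"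
      using cardBR[OF l] h rR finL' BL(1)[OF l] RL by (subst card_Diff_subset) auto
    then have c: "3 * n - 2 \<le> card (?V - {h, r3})" using k2 by linarith
    have fin: "finite (?V - {h, r3})" using finL' BL(1)[OF l] RL by auto
    obtain W where W: "W \<subseteq> ?V - {h, r3}" "zs n p q W" "card W \<le> n"
      using eta_boundD[OF _ fin c, of p q] eta_davenport_bound[of n] n2 by auto
    have W': "W \<subseteq> ?V" "h \<notin> W" using W by auto
    obtain P1 P2 P3 y where P: "three (?V - W) P1 P2 P3 y"
      using str[OF replace_block(2)[OF l W'(1) W(2,3)]] by blast
    have "R1 \<subseteq> W \<or> R2 \<subseteq> W"
    proof (rule ccontr)
      assume "\<not> ?thesis"
      then obtain j1 j2 where j: "j1 \<in> R1" "j1 \<notin> W" "j2 \<in> R2" "j2 \<notin> W" by blast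
      then have "j1 \<in> ?V - W" "j2 \<in> ?V - W" "r3 \<in> ?V - W" "h \<in> ?V - W" using D(1) rR W W' h by auto
      moreover have "\<not> eqv j1 j2" "\<not> eqv j1 r3" "\<not> eqv j2 r3" using three_not_eqv[OF R] j r by blast+
      moreover have "\<not> eqv h j1" "\<not> eqv h j2" "\<not> eqv h r3" using neg D(1) j rR by auto
      ultimately show False using threeD(1)[OF P] three_eqv(1-3)[OF P] eqv_sym by (metis UnE)
    qed
    then show False
    proof
      assume "R1 \<subseteq> W"
      then show False using no_fourth_value[OF l h _ W'(1) W(2,3) W'(2), of R1 R2] neg k2 by blast
    next
      assume "R2 \<subseteq> W"
      then show False using no_fourth_value[OF l h _ W'(1) W(2,3) W'(2), of R2 R1] neg k2 by blast
    qed
  qed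
qed

text \<open>Let t1, t2, t3 count the three values in a block. Independence makes t1 + x t3 and t2 +
  t3 divisible by \<open>n\<close>, while t1 + t2 + t3 = n. So \<open>n\<close> divides t1, and if
  t1 = 0 also x t3, hence t3; one count is \<open>n\<close>.\<close>

lemma pure_block:
  assumes l: "l < m - 1" and r: "r1 \<in> R1" "r2 \<in> R2" "r3 \<in> R3"
  shows "(\<forall>i\<in>B l. eqv i r1) \<or> (\<forall>i\<in>B l. eqv i r2) \<or> (\<forall>i\<in>B l. eqv i r3)"
proof -
  let ?T = "B l"
  note D = threeD[OF R] note ne = three_not_eqv[OF R r]
  have fT: "finite ?T" using finL' BL(1)[OF l] by auto
  have some: "eqv i r1 \<or> eqv i r2 \<or> eqv i r3" if iT: "i \<in> ?T" for i
  proof -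
    obtain j where "j \<in> R" "eqv i j" using support[OF l iT] by blast
    moreover have "j \<in> R1 \<or> j \<in> R2 \<or> j \<in> R3" using \<open>j \<in> R\<close> D(1) by auto
    moreover have "j \<in> R1 \<Longrightarrow> eqv j r1" "j \<in> R2 \<Longrightarrow> eqv j r2" "j \<in> R3 \<Longrightarrow> eqv j r3"
      using three_eqv(1-3)[OF R] r by auto
    ultimately show ?thesis using eqv_trans[of i j] by auto
  qed
  define T1 where "T1 = {i\<in>?T. eqv i r1}" define T2 where "T2 = {i\<in>?T. eqv i r2}"
  define T3 where "T3 = {i\<in>?T. eqv i r3}"
  have T: "?T = T1 \<union> (T2 \<union> T3)" using some by (auto simp: T1_def T2_def T3_def)
  have dis: "T1 \<inter> (T2 \<union> T3) = {}" "T2 \<inter> T3 = {}"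
  proof -
    have "\<not> (eqv i r1 \<and> eqv i r2)" "\<not> (eqv i r1 \<and> eqv i r3)" "\<not> (eqv i r2 \<and> eqv i r3)" for i
      using ne eqv_trans[OF eqv_sym, of i _ _] by auto
    then show "T1 \<inter> (T2 \<union> T3) = {}" "T2 \<inter> T3 = {}" unfolding T1_def T2_def T3_def by auto
  qed
  have fin: "finite T1" "finite T2" "finite T3" using fT by (auto simp: T1_def T2_def T3_def)
  have sT: "sum f ?T = sum f T1 + (sum f T2 + sum f T3)" for f :: "nat \<Rightarrow> int"
    unfolding T using dis fin by (simp add: sum.union_disjoint)
  have cT: "card T1 + (card T2 + card T3) = n"
    using cardB[OF l] dis fin unfolding T by (simp add: card_Un_disjoint)
  have tot: "int n dvd (int (card T1) + int (card T3) * x) * f r1 + (int (card T2) + int (card T3)) * f r2"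
    if f: "f = p \<or> f = q" for f
  proof -
    have "[sum f T1 = int (card T1) * f r1] (mod int n)" "[sum f T2 = int (card T2) * f r2] (mod int n)"
      "[sum f T3 = int (card T3) * f r3] (mod int n)"
      using f by (auto intro!: sum_cong_const simp: T1_def T2_def T3_def eqv_def)
    moreover have "[int (card T3) * f r3 = int (card T3) * (x * f r1 + f r2)] (mod int n)"
      using three_eqv(4)[OF R r] f by (intro cong_scalar_left) auto
    ultimately have "[sum f ?T = int (card T1) * f r1 + (int (card T2) * f r2 + int (card T3) * (x * f r1 + f r2))] (mod int n)"
      unfolding sT by (meson cong_add cong_trans)
    moreover have "int n dvd sum f ?T" using BL(2)[OF l] f by (auto simp: zs_def)
    ultimately have "int n dvd int (card T1) * f r1 + (int (card T2) * f r2 + int (card T3) * (x * f r1 + f r2))"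
      using cong_dvd_iff by blast
    then show ?thesis by (simp add: algebra_simps)
  qed
  have d1: "int n dvd int (card T1) + int (card T3) * x" and d2: "int n dvd int (card T2) + int (card T3)"
    using three_indep[OF R r(1,2) tot[of p] tot[of q]] by auto
  have "int n dvd int n - (int (card T2) + int (card T3))" by (rule dvd_diff[OF dvd_refl d2])
  moreover have "int n - (int (card T2) + int (card T3)) = int (card T1)" using cT by linarith
  ultimately have "int n dvd int (card T1)" by simp
  then have "card T1 = 0 \<or> card T1 = n" using cT int_dvd_le[of n "card T1"] by linarith
  then show ?thesis
  proof
    assume "card T1 = n"
    then have "T2 = {}" "T3 = {}" using cT fin by auto
    then have "?T = T1" using T by blast
    then show ?thesis unfolding T1_def by blast
  next
    assume 0: "card T1 = 0"
    then have "int n dvd int (card T3) * x" using d1 by simp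
    then have "int n dvd int (card T3)" using coprime_dvd_mult_left_iff[of "int n" x] D(8) by (simp add: coprime_commute)
    then have "card T3 = 0 \<or> card T3 = n" using cT int_dvd_le[of n "card T3"] by linarith
    then have "(T1 = {} \<and> T3 = {}) \<or> (T1 = {} \<and> T2 = {})" using 0 cT fin by auto
    then have "?T = T2 \<or> ?T = T3" using T by blast
    then show ?thesis unfolding T2_def T3_def by blast
  qed
qed

end

section \<open>The three values in the full group\<close>

context short_zs_free
begin

text \<open>Equality in the full group, where \<open>eqv\<close> is only equality after
  reduction.\<close>

definition HH :: "nat \<Rightarrow> nat \<Rightarrow> bool" where
  "HH i j \<longleftrightarrow> [p i = p j] (mod int n) \<and> [q i = q j] (mod int (m * n))"

definition part3 :: "nat set \<Rightarrow> nat set \<Rightarrow> nat set \<Rightarrow> nat \<Rightarrow> nat \<Rightarrow> nat \<Rightarrow> bool" where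
  "part3 U V W u v w \<longleftrightarrow> L = U \<union> V \<union> W \<and> U \<inter> V = {} \<and> U \<inter> W = {} \<and> V \<inter> W = {} \<and>
     u \<in> U \<and> v \<in> V \<and> w \<in> W \<and> (\<forall>i\<in>U. HH i u) \<and> (\<forall>i\<in>V. HH i v) \<and> (\<forall>i\<in>W. HH i w) \<and>
     coprime (p u * q v - p v * q u) (int n)"

text \<open>Common normal form of 3(a) and 3(b), symmetric in the first two values so that the
  classes can be permuted freely. For \<open>a = b = 1\<close> it is 3(b). If one of
  \<open>a\<close>, \<open>b\<close> is larger, the value of the other class has order
  \<open>n\<close>, and the two values form a basis as in 3(a).\<close>

definition sum_form :: bool where
  "sum_form \<longleftrightarrow> (\<exists>U V W u v w a b c. part3 U V W u v w \<and>
     card U = a * n - 1 \<and> card V = b * n - 1 \<and> card W = c * n + k \<and> 1 \<le> a \<and> 1 \<le> b \<and> a + b + c = m + 1 \<and>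
     [p w = p u + p v] (mod int n) \<and> [q w = q u + q v] (mod int (m * n)) \<and>
     coprime (q u + q v) (int m) \<and>
     (2 \<le> a \<longrightarrow> int m dvd q v) \<and> (2 \<le> b \<longrightarrow> int m dvd q u))"

text \<open>The shape of 4(a). It is reached for \<open>2 \<le> x \<le> n-2\<close>; the extreme
  values of \<open>x\<close> lead to \<open>sum_form\<close>.\<close>

definition twist_form :: bool where
  "twist_form \<longleftrightarrow> k = n - 1 \<and> (\<exists>U V W u v w b c x. part3 U V W u v w \<and>
     card U = n - 1 \<and> card V = b * n - 1 \<and> card W = c * n + n - 1 \<and> 1 \<le> b \<and> b + c = m \<and>
     1 \<le> x \<and> x \<le> int n - 1 \<and> coprime x (int n) \<and>
     [p w = x * p u + p v] (mod int n) \<and> [q w = x * q u + q v] (mod int (m * n)) \<and>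
     int m dvd q u \<and> coprime (q v) (int m))"

end

context triple
begin

lemma m1: "0 < m - 1" using m2 by auto

lemma R_sub: "R1 \<subseteq> R" "R2 \<subseteq> R" "R3 \<subseteq> R" using threeD(1)[OF R] by auto

lemma triple_zs:
  assumes A: "A1 \<subseteq> R1" "A2 \<subseteq> R2" "A3 \<subseteq> R3" "A3 \<noteq> {}"
    and d: "int n dvd int (card A1) + int (card A3) * x" "int n dvd int (card A2) + int (card A3)"
  shows "zs n p q (A1 \<union> A2 \<union> A3)"
    and "\<And>f::nat \<Rightarrow> int. sum f (A1 \<union> A2 \<union> A3) = sum f A1 + sum f A2 + sum f A3"
proof -
  note D = threeD[OF R]
  obtain r1 r2 r3 where r: "r1 \<in> R1" "r2 \<in> R2" "r3 \<in> R3" using D(15,16,17) by blast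
  have fin: "finite A1" "finite A2" "finite A3" using A D(12-14) finite_subset by blast+
  have dis: "A1 \<inter> A2 = {}" "(A1 \<union> A2) \<inter> A3 = {}" using A D(2-4) by blast+
  show s: "sum f (A1 \<union> A2 \<union> A3) = sum f A1 + sum f A2 + sum f A3" for f :: "nat \<Rightarrow> int"
    using fin dis by (simp add: sum.union_disjoint)
  have "int n dvd sum f A1 + sum f A2 + sum f A3" if f: "f = p \<or> f = q" for f
  proof -
    have "[f i = f r1] (mod int n)" if "i \<in> A1" for i
      using f three_eqv(1)[OF R _ r(1)] A that by (auto simp: eqv_def)
    then have 1: "[sum f A1 = int (card A1) * f r1] (mod int n)" by (rule sum_cong_const)
    have "[f i = f r2] (mod int n)" if "i \<in> A2" for i
      using f three_eqv(2)[OF R _ r(2)] A that by (auto simp: eqv_def)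
    then have 2: "[sum f A2 = int (card A2) * f r2] (mod int n)" by (rule sum_cong_const)
    have "[f i = x * f r1 + f r2] (mod int n)" if "i \<in> A3" for i
      using f three_eqv(4)[OF R r(1,2)] A that by blast
    then have 3: "[sum f A3 = int (card A3) * (x * f r1 + f r2)] (mod int n)" by (rule sum_cong_const)
    have "[sum f A1 + sum f A2 + sum f A3 = int (card A1) * f r1 + int (card A2) * f r2
        + int (card A3) * (x * f r1 + f r2)] (mod int n)"
      by (intro cong_add 1 2 3)
    moreover have "int (card A1) * f r1 + int (card A2) * f r2 + int (card A3) * (x * f r1 + f r2)
        = (int (card A1) + int (card A3) * x) * f r1 + (int (card A2) + int (card A3)) * f r2"
      by (simp add: algebra_simps)
    ultimately show ?thesis using d by (simp add: cong_dvd_iff)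
  qed
  then show "zs n p q (A1 \<union> A2 \<union> A3)" using A(4) by (auto simp: zs_def s)
qed

lemma triple_q:
  assumes A: "A1 \<subseteq> R1" "A2 \<subseteq> R2" "A3 \<subseteq> R3" "A3 \<noteq> {}"
    and d: "int n dvd int (card A1) + int (card A3) * x" "int n dvd int (card A2) + int (card A3)"
    and c: "card A1 + card A2 + card A3 \<le> 3 * n - 1 - k"
  shows "[sum q A1 + sum q A2 + sum q A3 = int n * \<gamma>] (mod int (m * n))"
proof -
  have "card (A1 \<union> A2 \<union> A3) \<le> 3 * n - 1 - k"
    using c card_Un_le[of A1 A2] card_Un_le[of "A1 \<union> A2" A3] by linarith
  then show ?thesis
  proof -
    have "A1 \<union> A2 \<union> A3 \<subseteq> B 0 \<union> R" using A R_sub by blast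
    then show ?thesis
      using sum_q_block[OF m1 _ triple_zs(1)[OF A d]] \<open>card (A1 \<union> A2 \<union> A3) \<le> 3 * n - 1 - k\<close> triple_zs(2)[OF A d]
      by simp
  qed
qed

text \<open>The number of terms of \<open>R1\<close> that complete \<open>j\<close> terms of
  \<open>R3\<close> and \<open>n-j\<close> terms of \<open>R2\<close> to a zero-sum.\<close>

definition alpha :: "nat \<Rightarrow> nat" where "alpha j = nat ((- (int j * x)) mod int n)"

lemma alpha:
  assumes "1 \<le> j" "j \<le> k"
  shows "int n dvd int (alpha j) + int j * x" "1 \<le> alpha j" "alpha j \<le> n - 1"
proof -
  have i: "int (alpha j) = (- (int j * x)) mod int n" using n2 by (simp add: alpha_def)
  have "int n dvd (- (int j * x)) mod int n - (- (int j * x))" by (metis mod_eq_dvd_iff mod_mod_trivial)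
  then show d: "int n dvd int (alpha j) + int j * x" by (simp add: i)
  have "int (alpha j) < int n" using i n2 by simp
  then show "alpha j \<le> n - 1" by linarith
  show "1 \<le> alpha j"
  proof (rule ccontr)
    assume "\<not> 1 \<le> alpha j"
    then have "int n dvd int j * x" using d by (cases "alpha j") auto
    then have "int n dvd int j"
      using coprime_dvd_mult_left_iff[of "int n" x] threeD(8)[OF R] by (simp add: coprime_commute)
    then show False using int_dvd_le[of n j] assms kn n2 by linarith
  qed
qed

lemma triple_card: "1 \<le> j \<Longrightarrow> j \<le> k \<Longrightarrow> a \<le> n - 1 \<Longrightarrow> a + (n - j) + j \<le> 3 * n - 1 - k"
  using kn n2 by linarith

lemma ex_sub:
  assumes "finite S" "c \<le> card S" shows "\<exists>A\<subseteq>S. card A = c"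
  using obtain_subset_with_card_n[OF assms(2)] by metis

text \<open>An exchange of \<open>i\<close> and \<open>j\<close> needs a zero-sum inside
  \<open>R\<close> that uses some but not all terms of \<open>R1\<close>; then both variants have
  the prescribed sum.\<close>

lemma R1_const:
  assumes i: "i \<in> R1" "j \<in> R1"
  shows "[q i = q j] (mod int (m * n))"
proof (cases "i = j")
  case False
  note D = threeD[OF R]
  have "card {i, j} \<le> n - 1" using i D(5,12) by (metis card_mono empty_subsetI insert_subset)
  then have n3: "n \<ge> 3" using False by simp
  then have k2: "k \<ge> 2" using kk by auto
  \<comment> \<open>With one term of \<open>R3\<close> the zero-sum takes \<open>n - x\<close> terms
    of \<open>R1\<close>, which is at most \<open>n-2\<close> unless \<open>x = 1\<close>; in that
    case two terms of \<open>R3\<close> leave \<open>n-2\<close>.\<close>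
  define t where "t = (if x \<ge> 2 then 1 else 2 :: nat)"
  have t: "1 \<le> t" "t \<le> k" "t \<le> n - 1" using k2 kn by (auto simp: t_def)
  have a: "alpha t \<le> n - 2"
  proof (cases "x \<ge> 2")
    case True
    have "(- x) mod int n = int n - x" using D(9,10) by (simp add: zmod_zminus1_eq_if)
    then have "alpha 1 = nat (int n - x)" unfolding alpha_def by simp
    then show ?thesis using True D(10) by (simp add: t_def)
  next
    case False
    then have "x = 1" using D(9) by simp
    moreover have "(- 2) mod int n = int n - 2" using n3 by (simp add: zmod_zminus1_eq_if)
    ultimately have "alpha 2 = nat (int n - 2)" unfolding alpha_def by simp
    then show ?thesis using False by (simp add: t_def)
  qed
  have c: "card (R1 - {i, j}) = n - 3" using i False D(5,12) by (simp add: card_Diff_subset)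
  have "alpha t - 1 \<le> card (R1 - {i, j})" using c a by linarith
  then obtain K1 where K1: "K1 \<subseteq> R1 - {i, j}" "card K1 = alpha t - 1"
    using ex_sub[of "R1 - {i, j}" "alpha t - 1"] D(12) by (meson finite_Diff)
  obtain A2 where A2: "A2 \<subseteq> R2" "card A2 = n - t" using ex_sub[OF D(13), of "n - t"] D(6) diff_le_mono2[OF t(1), of n] by auto
  obtain A3 where A3: "A3 \<subseteq> R3" "card A3 = t" using ex_sub[OF D(14), of t] D(7) t by auto
  have fK: "finite K1" using K1 D(12) finite_subset by blast
  have dd: "int n dvd int (card (insert i K1)) + int (card A3) * x" "int n dvd int (card A2) + int (card A3)"
    and A3n: "A3 \<noteq> {}"
  proof -
    have "i \<notin> K1" using K1 by auto
    then have "card (insert i K1) = alpha t" using K1(2) fK alpha(2)[OF t(1,2)] by simp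
    then show "int n dvd int (card (insert i K1)) + int (card A3) * x" using alpha(1)[OF t(1,2)] A3 by simp
    have "int (card A2) + int (card A3) = int n" using A2 A3 t n2 by simp
    then show "int n dvd int (card A2) + int (card A3)" by simp
    show "A3 \<noteq> {}" using A3 t by auto
  qed
  have nK: "i \<notin> K1" "j \<notin> K1" using K1(1) by auto
  have sub: "insert i K1 \<subseteq> R1" "insert j K1 \<subseteq> R1" using K1(1) i by auto
  have dj: "card (insert j K1) = card (insert i K1)" using nK fK by simp
  have ci: "card (insert i K1) + card A2 + card A3 \<le> 3 * n - 1 - k"
    using triple_card[OF t(1,2), of "alpha t"] alpha(2,3)[OF t(1,2)] A2(2) A3(2) K1(2) nK(1) fK by simp
  have "[sum q (insert i K1) + sum q A2 + sum q A3 = int n * \<gamma>] (mod int (m * n))"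
    by (rule triple_q[OF sub(1) A2(1) A3(1) A3n dd ci])
  moreover have "[sum q (insert j K1) + sum q A2 + sum q A3 = int n * \<gamma>] (mod int (m * n))"
    by (rule triple_q[OF sub(2) A2(1) A3(1) A3n]) (use dd ci dj in simp_all)
  ultimately have "[q i + (sum q K1 + sum q A2 + sum q A3) = q j + (sum q K1 + sum q A2 + sum q A3)] (mod int (m * n))"
    using nK fK by (simp add: cong_def add.assoc)
  then show ?thesis by (rule cong_add_rcancel[THEN iffD1])
qed simp

lemma R2_const:
  assumes i: "i \<in> R2" "j \<in> R2"
  shows "[q i = q j] (mod int (m * n))"
proof (cases "i = j")
  case False
  note D = threeD[OF R]
  have "card {i, j} \<le> n - 1" using i D(6,13) by (metis card_mono empty_subsetI insert_subset)
  then have n3: "n \<ge> 3" using False by simp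
  then have k2: "k \<ge> 2" using kk by auto
  have t: "1 \<le> (2::nat)" "2 \<le> k" using k2 by auto
  have c: "card (R2 - {i, j}) = n - 3" using i False D(6,13) by (simp add: card_Diff_subset)
  obtain K1 where K1: "K1 \<subseteq> R2 - {i, j}" "card K1 = n - 3"
    using c by (intro that) auto
  obtain A1 where A1: "A1 \<subseteq> R1" "card A1 = alpha 2" using ex_sub[OF D(12), of "alpha 2"] D(5) alpha[OF t] by auto
  obtain A3 where A3: "A3 \<subseteq> R3" "card A3 = 2" using ex_sub[OF D(14), of 2] D(7) t by auto
  have fK: "finite K1" using K1 D(13) finite_subset by blast
  have nK: "i \<notin> K1" "j \<notin> K1" using K1(1) by auto
  have ci: "card (insert i K1) = n - 2" "card (insert j K1) = n - 2" using K1(2) nK fK n3 by auto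
  have dd: "int n dvd int (card A1) + int (card A3) * x" "int n dvd int (n - 2) + int (card A3)"
    and A3n: "A3 \<noteq> {}"
    using alpha[OF t] A1 A3 n3 by (auto simp: of_nat_diff)
  have cc: "card A1 + (n - 2) + card A3 \<le> 3 * n - 1 - k"
    using triple_card[OF t, of "alpha 2"] alpha[OF t] A1 A3 by simp
  have sub: "insert i K1 \<subseteq> R2" "insert j K1 \<subseteq> R2" using K1(1) i by auto
  have "[sum q A1 + sum q (insert i K1) + sum q A3 = int n * \<gamma>] (mod int (m * n))"
    by (rule triple_q[OF A1(1) sub(1) A3(1) A3n dd(1)]) (use dd cc ci in simp_all)
  moreover have "[sum q A1 + sum q (insert j K1) + sum q A3 = int n * \<gamma>] (mod int (m * n))"
    by (rule triple_q[OF A1(1) sub(2) A3(1) A3n dd(1)]) (use dd cc ci in simp_all)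
  ultimately have "[q i + (sum q K1 + sum q A1 + sum q A3) = q j + (sum q K1 + sum q A1 + sum q A3)] (mod int (m * n))"
    using nK fK by (simp add: cong_def add_ac)
  then show ?thesis by (rule cong_add_rcancel[THEN iffD1])
qed simp

lemma R3_const:
  assumes i: "i \<in> R3" "j \<in> R3"
  shows "[q i = q j] (mod int (m * n))"
proof -
  note D = threeD[OF R]
  have t: "1 \<le> (1::nat)" "1 \<le> k" using k1 by auto
  obtain A1 where A1: "A1 \<subseteq> R1" "card A1 = alpha 1" using ex_sub[OF D(12), of "alpha 1"] D(5) alpha[OF t] by auto
  have s: "[sum q A1 + sum q R2 + sum q {l} = int n * \<gamma>] (mod int (m * n))" if "l \<in> R3" for l
    using that A1 alpha[OF t] D(6) n2 triple_card[OF t, of "alpha 1"]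
    by (intro triple_q) (auto simp: of_nat_diff)
  have "[(sum q A1 + sum q R2) + q i = (sum q A1 + sum q R2) + q j] (mod int (m * n))"
    using s[OF i(1)] s[OF i(2)] by (simp add: cong_def)
  then show ?thesis by (rule cong_add_lcancel[THEN iffD1])
qed

lemma triple_eq:
  assumes r: "r1 \<in> R1" "r2 \<in> R2" "r3 \<in> R3" and j: "1 \<le> j" "j \<le> k"
  shows "[int (alpha j) * q r1 + int (n - j) * q r2 + int j * q r3 = int n * \<gamma>] (mod int (m * n))"
proof -
  note D = threeD[OF R]
  obtain A1 where A1: "A1 \<subseteq> R1" "card A1 = alpha j" using ex_sub[OF D(12), of "alpha j"] D(5) alpha[OF j] by auto
  obtain A2 where A2: "A2 \<subseteq> R2" "card A2 = n - j" using ex_sub[OF D(13), of "n - j"] D(6) diff_le_mono2[OF j(1), of n] by auto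
  obtain A3 where A3: "A3 \<subseteq> R3" "card A3 = j" using ex_sub[OF D(14), of j] D(7) j by auto
  have "[sum q A1 + sum q A2 + sum q A3 = int n * \<gamma>] (mod int (m * n))"
    using A1 A2 A3 j kn n2 alpha[OF j] triple_card[OF j, of "alpha j"]
    by (intro triple_q) (auto simp: of_nat_diff)
  moreover have "[sum q A1 = int (alpha j) * q r1] (mod int (m * n))"
    unfolding A1(2)[symmetric] using A1 R1_const r by (intro sum_cong_const) auto
  moreover have "[sum q A2 = int (n - j) * q r2] (mod int (m * n))"
    unfolding A2(2)[symmetric] using A2 R2_const r by (intro sum_cong_const) auto
  moreover have "[sum q A3 = int j * q r3] (mod int (m * n))"
    unfolding A3(2)[symmetric] using A3 R3_const r by (intro sum_cong_const) auto
  ultimately show ?thesis by (meson cong_add cong_sym cong_trans)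
qed

text \<open>Blocks being constant, a whole class is its part in the rest and some complete blocks.
  Such a block of \<open>n\<close> copies of \<open>r\<close> has sum \<open>n * q r\<close>, which
  pins \<open>q r\<close> to \<open>\<gamma>\<close> modulo \<open>m\<close>.\<close>

lemma class_card:
  assumes r: "r \<in> Rs" and Rs: "Rs \<subseteq> R" "\<And>i. i \<in> R \<Longrightarrow> eqv i r \<longleftrightarrow> i \<in> Rs"
    and c: "\<And>i j. i \<in> Rs \<Longrightarrow> j \<in> Rs \<Longrightarrow> [q i = q j] (mod int (m * n))"
    and pure: "\<And>l. l < m - 1 \<Longrightarrow> (\<exists>i\<in>B l. eqv i r) \<Longrightarrow> \<forall>i\<in>B l. eqv i r"
    and I: "I = {l. l < m - 1 \<and> (\<forall>i\<in>B l. eqv i r)}"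
  shows "{i\<in>L. eqv i r} = Rs \<union> (\<Union>l\<in>I. B l)" "card {i\<in>L. eqv i r} = card Rs + card I * n"
    "i \<in> L \<Longrightarrow> eqv i r \<Longrightarrow> HH i r" "I \<noteq> {} \<Longrightarrow> [q r = \<gamma>] (mod int m)"
proof -
  show eq: "{i\<in>L. eqv i r} = Rs \<union> (\<Union>l\<in>I. B l)"
  proof
    show "{i\<in>L. eqv i r} \<subseteq> Rs \<union> (\<Union>l\<in>I. B l)" 
    proof
      fix i assume "i \<in> {i\<in>L. eqv i r}"
      then have i: "i \<in> L" "eqv i r" by auto
      then have "i \<in> R \<or> (\<exists>l<m - 1. i \<in> B l)" using L_cover by auto
      then show "i \<in> Rs \<union> (\<Union>l\<in>I. B l)"
      proof
        assume "\<exists>l<m - 1. i \<in> B l"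
        then obtain l where l: "l < m - 1" "i \<in> B l" by blast
        then have "l \<in> I" using pure[OF l(1)] i(2) I by blast
        then show ?thesis using l by blast
      qed (use Rs(2) i in auto)
    qed
    show "Rs \<union> (\<Union>l\<in>I. B l) \<subseteq> {i\<in>L. eqv i r}" using Rs RL BL(1) I by blast
  qed
  have fI: "finite I" "\<And>l. l \<in> I \<Longrightarrow> l < m - 1" unfolding I by auto
  have "card (\<Union>l\<in>I. B l) = (\<Sum>l\<in>I. card (B l))"
  proof (rule card_UN_disjoint[OF fI(1)])
    show "\<forall>l\<in>I. finite (B l)" using fI(2) BL(1) finL' by blast
    show "\<forall>l\<in>I. \<forall>l'\<in>I. l \<noteq> l' \<longrightarrow> B l \<inter> B l' = {}" using fI(2) BB by blast
  qed
  also have "\<dots> = (\<Sum>l\<in>I. n)" using fI(2) cardB by (intro sum.cong) auto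
  finally have "card (\<Union>l\<in>I. B l) = card I * n" by simp
  moreover have "Rs \<inter> (\<Union>l\<in>I. B l) = {}" using Rs(1) BR fI(2) by blast
  moreover have "finite Rs" using Rs(1) RL finL' by (meson subset_trans)
  moreover have "finite (\<Union>l\<in>I. B l)" using fI BL(1) finL' by blast
  ultimately show "card {i\<in>L. eqv i r} = card Rs + card I * n"
    unfolding eq by (simp add: card_Un_disjoint)
  have rR: "r \<in> R" using r Rs(1) by auto
  have qB: "[q i = q r] (mod int (m * n))" if "l \<in> I" "i \<in> B l" for l i
    using block_rest_swap[OF fI(2) _ rR] that I by auto
  show "HH i r" if i: "i \<in> L" "eqv i r"
  proof -
    have "i \<in> Rs \<union> (\<Union>l\<in>I. B l)" using i eq by blast
    then have "[q i = q r] (mod int (m * n))" using c r qB by blast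
    then show ?thesis using i by (simp add: HH_def eqv_def)
  qed
  show "[q r = \<gamma>] (mod int m)" if "I \<noteq> {}"
  proof -
    obtain l where l: "l \<in> I" using \<open>I \<noteq> {}\<close> by blast
    have l': "l < m - 1" using l fI by auto
    have "[sum q (B l) = int n * q r] (mod int (m * n))"
      using sum_cong_const[of "B l" q "q r" "int (m * n)"] qB[OF l] cardB[OF l'] by simp
    moreover have "[sum q (B l) = int n * \<gamma>] (mod int (m * n))"
      using l' BL(2) cardB kn n2 by (intro sum_q_block[OF l']) auto
    ultimately have "[int n * q r = int n * \<gamma>] (mod int (m * n))" by (meson cong_sym cong_trans)
    then show ?thesis using cong_scale_iff[of n] n2 by simp
  qed
qed

lemma sum_formI:
  assumes P: "part3 U V W u v w"
    and c: "card U = a * n - 1" "card V = b * n - 1" "card W = c * n + k" "1 \<le> a" "1 \<le> b" "a + b + c = m + 1"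
    and e: "[p w = p u + p v] (mod int n)" "[q w = q u + q v] (mod int (m * n))" "[q u + q v = \<gamma>] (mod int m)"
    and ab: "2 \<le> a \<Longrightarrow> [q u = \<gamma>] (mod int m)" "2 \<le> b \<Longrightarrow> [q v = \<gamma>] (mod int m)"
  shows sum_form
proof -
  have "coprime (q u + q v) (int m)" using cop_\<gamma> e(3) cong_imp_coprime cong_sym by blast
  moreover have "int m dvd q v" if "2 \<le> a"
  proof -
    have "int m dvd (q u + q v - \<gamma>) - (q u - \<gamma>)"
      using ab(1)[OF that] e(3) unfolding cong_iff_dvd_diff by (rule dvd_diff[rotated])
    then show ?thesis by simp
  qed
  moreover have "int m dvd q u" if "2 \<le> b"
  proof -
    have "int m dvd (q u + q v - \<gamma>) - (q v - \<gamma>)"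
      using ab(2)[OF that] e(3) unfolding cong_iff_dvd_diff by (rule dvd_diff[rotated])
    then show ?thesis by simp
  qed
  ultimately show ?thesis unfolding sum_form_def using P c e(1,2) by blast
qed

text \<open>\<open>s j\<close> is the ceiling of \<open>j x / n\<close>: it grows by 0 or 1 from 1
  at \<open>j = 1\<close> to \<open>x\<close> at \<open>j = n-1\<close>. These \<open>n-2\<close>
  steps add up to \<open>x-1\<close>, so some step is 1 if \<open>x \<ge> 2\<close>, and some step
  is 0 if \<open>x \<le> n-2\<close>.\<close>

lemma carry_steps:
  fixes s :: "nat \<Rightarrow> int"
  assumes s: "\<And>j. 1 \<le> j \<Longrightarrow> j \<le> n - 1 \<Longrightarrow> int n * s j = int (alpha j) + int j * x" and kn1: "k = n - 1" and n3: "n \<ge> 3"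
  shows "s 1 = 1" "x \<ge> 2 \<Longrightarrow> \<exists>j. 1 \<le> j \<and> j < n - 1 \<and> s (Suc j) = s j + 1"
    "x \<le> int n - 2 \<Longrightarrow> \<exists>j. 1 \<le> j \<and> j < n - 1 \<and> s (Suc j) = s j"
proof -
  note D = threeD[OF R]
  have al: "1 \<le> int (alpha j)" "int (alpha j) \<le> int n - 1" if "1 \<le> j" "j \<le> n - 1" for j
    using alpha[of j] that kn1 n2 by auto
  have step: "s (Suc j) = s j \<or> s (Suc j) = s j + 1" if j: "1 \<le> j" "j < n - 1" for j
  proof -
    have "int n * (s (Suc j) - s j) = int (alpha (Suc j)) - int (alpha j) + x"
      using s[of j] s[of "Suc j"] j by (simp add: algebra_simps)
    then have "int n * (s (Suc j) - s j) < int n * 2" "int n * (- 1) < int n * (s (Suc j) - s j)"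
      using al[of j] al[of "Suc j"] j D(9,10) by linarith+
    then have "s (Suc j) - s j < 2" "- 1 < s (Suc j) - s j" using n2
      by (metis mult_less_cancel_left_pos of_nat_0_less_iff pos2 order_less_le_trans)+
    then show ?thesis by linarith
  qed
  show s1: "s 1 = 1"
  proof -
    have "int n * s 1 = int (alpha 1) + x" using s[of 1] n2 by simp
    moreover have "1 \<le> int (alpha 1)" "int (alpha 1) \<le> int n - 1" using al[of 1] n2 by auto
    ultimately have "int n * s 1 < int n * 2" "int n * 0 < int n * s 1" using D(9,10) by linarith+
    then have "s 1 < 2" "0 < s 1" using n2
      by (metis mult_less_cancel_left_pos of_nat_0_less_iff pos2 order_less_le_trans)+
    then show ?thesis by linarith
  qed
  have sn: "s (n - 1) = x"
  proof -
    have "int n * (s (n - 1) - x) = int (alpha (n - 1)) - x"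
      using s[of "n - 1"] n2 by (simp add: of_nat_diff algebra_simps)
    then have "int n * (s (n - 1) - x) < int n * 1" "int n * (- 1) < int n * (s (n - 1) - x)"
      using al[of "n - 1"] n2 D(9,10) by linarith+
    then have "s (n - 1) - x < 1" "- 1 < s (n - 1) - x" using n2
      by (metis mult_less_cancel_left_pos of_nat_0_less_iff pos2 order_less_le_trans)+
    then show ?thesis by linarith
  qed
  show "\<exists>j. 1 \<le> j \<and> j < n - 1 \<and> s (Suc j) = s j + 1" if "x \<ge> 2"
  proof (rule ccontr)
    assume neg: "\<not> ?thesis"
    have "j \<le> n - 1 \<longrightarrow> s j = 1" if "1 \<le> j" for j
      using that
    proof (induction j rule: nat_induct_at_least)
      case (Suc j)
      have "\<not> (1 \<le> j \<and> j < n - 1 \<and> s (Suc j) = s j + 1)" using neg by blast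
      then show ?case using step[of j] Suc by auto
    qed (use s1 in auto)
    then have "x = 1" using sn n3 by auto
    then show False using that by simp
  qed
  show "\<exists>j. 1 \<le> j \<and> j < n - 1 \<and> s (Suc j) = s j" if "x \<le> int n - 2"
  proof (rule ccontr)
    assume neg: "\<not> ?thesis"
    have "j \<le> n - 1 \<longrightarrow> s j = int j" if "1 \<le> j" for j
      using that
    proof (induction j rule: nat_induct_at_least)
      case (Suc j)
      have "\<not> (1 \<le> j \<and> j < n - 1 \<and> s (Suc j) = s j)" using neg by blast
      then show ?case using step[of j] Suc by auto
    qed (use s1 in auto)
    then have "x = int (n - 1)" using sn n3 by auto
    then show False using that n2 by (simp add: of_nat_diff)
  qed
qed

text \<open>Writing \<open>q r3 = x * q r1 + q r2 + n * t\<close>, the zero-sum with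
  \<open>j\<close> terms of \<open>R3\<close> says
  \<open>j * t + s j * q r1 + q r2 = \<gamma>\<close> modulo \<open>m\<close>, with
  \<open>s j\<close> the ceiling of \<open>j x / n\<close>. For \<open>k \<ge> 2\<close>,
  consecutive \<open>j\<close> give \<open>t = 0\<close> or \<open>t + q r1 = 0\<close> modulo
  \<open>m\<close>, according to the step of \<open>s\<close>. Which of these hold decides how the
  three values are related in the full group.\<close>

lemma outcome: "sum_form \<or> twist_form"
proof -
  note D = threeD[OF R]
  obtain r1 r2 r3 where r: "r1 \<in> R1" "r2 \<in> R2" "r3 \<in> R3" using D(15,16,17) by blast
  note ne = three_not_eqv[OF R r]
  have rR: "r1 \<in> R" "r2 \<in> R" "r3 \<in> R" using r R_sub by auto
  have ne2: "\<not> (eqv i r1 \<and> eqv i r2)" "\<not> (eqv i r1 \<and> eqv i r3)" "\<not> (eqv i r2 \<and> eqv i r3)" for i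
    using ne eqv_trans[OF eqv_sym, of i] by auto
  have inR: "i \<in> R \<Longrightarrow> eqv i r1 \<longleftrightarrow> i \<in> R1" "i \<in> R \<Longrightarrow> eqv i r2 \<longleftrightarrow> i \<in> R2" "i \<in> R \<Longrightarrow> eqv i r3 \<longleftrightarrow> i \<in> R3" for i
    using three_class(1)[OF R rR(1) r(1)] three_class(2)[OF R rR(2) r(2)] three_class(3)[OF R rR(3) r(3)] by auto
  define I1 where "I1 = {l. l < m - 1 \<and> (\<forall>i\<in>B l. eqv i r1)}"
  define I2 where "I2 = {l. l < m - 1 \<and> (\<forall>i\<in>B l. eqv i r2)}"
  define I3 where "I3 = {l. l < m - 1 \<and> (\<forall>i\<in>B l. eqv i r3)}"
  have Bne: "B l \<noteq> {}" if "l < m - 1" for l using BL(2)[OF that] by (simp add: zs_def)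
  have pb: "(\<forall>i\<in>B l. eqv i r1) \<or> (\<forall>i\<in>B l. eqv i r2) \<or> (\<forall>i\<in>B l. eqv i r3)" if "l < m - 1" for l
    using pure_block[OF that r] .
  have pure1: "\<forall>i\<in>B l. eqv i r1" if "l < m - 1" "\<exists>i\<in>B l. eqv i r1" for l using pb[OF that(1)] that(2) ne2 by blast
  have pure2: "\<forall>i\<in>B l. eqv i r2" if "l < m - 1" "\<exists>i\<in>B l. eqv i r2" for l using pb[OF that(1)] that(2) ne2 by blast
  have pure3: "\<forall>i\<in>B l. eqv i r3" if "l < m - 1" "\<exists>i\<in>B l. eqv i r3" for l using pb[OF that(1)] that(2) ne2 by blast
  have Iz: "card Is \<noteq> 0 \<Longrightarrow> Is \<noteq> {}" for Is :: "nat set" by auto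
  have C1: "card {i\<in>L. eqv i r1} = card R1 + card I1 * n" "\<And>i. i \<in> L \<Longrightarrow> eqv i r1 \<Longrightarrow> HH i r1"
    "card I1 \<noteq> 0 \<Longrightarrow> [q r1 = \<gamma>] (mod int m)"
    using class_card(2-4)[of r1 R1 I1, OF r(1) R_sub(1) inR(1) R1_const pure1 I1_def] Iz[of I1] by blast+
  have C2: "card {i\<in>L. eqv i r2} = card R2 + card I2 * n" "\<And>i. i \<in> L \<Longrightarrow> eqv i r2 \<Longrightarrow> HH i r2"
    "card I2 \<noteq> 0 \<Longrightarrow> [q r2 = \<gamma>] (mod int m)"
    using class_card(2-4)[of r2 R2 I2, OF r(2) R_sub(2) inR(2) R2_const pure2 I2_def] Iz[of I2] by blast+
  have C3: "card {i\<in>L. eqv i r3} = card R3 + card I3 * n" "\<And>i. i \<in> L \<Longrightarrow> eqv i r3 \<Longrightarrow> HH i r3"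
    "card I3 \<noteq> 0 \<Longrightarrow> [q r3 = \<gamma>] (mod int m)"
    using class_card(2-4)[of r3 R3 I3, OF r(3) R_sub(3) inR(3) R3_const pure3 I3_def] Iz[of I3] by blast+
  define E1 where "E1 = {i\<in>L. eqv i r1}" define E2 where "E2 = {i\<in>L. eqv i r2}"
  define E3 where "E3 = {i\<in>L. eqv i r3}"
  have "{..<m - 1} = I1 \<union> (I2 \<union> I3)" using pb by (auto simp: I1_def I2_def I3_def)
  moreover have "I1 \<inter> (I2 \<union> I3) = {}" "I2 \<inter> I3 = {}"
    using Bne ne2 unfolding I1_def I2_def I3_def by blast+
  moreover have "finite I1" "finite I2" "finite I3" by (auto simp: I1_def I2_def I3_def)
  ultimately have "card {..<m - 1} = card I1 + (card I2 + card I3)" by (simp add: card_Un_disjoint)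
  then have cI: "card I1 + card I2 + card I3 = m - 1" by simp
  have allE: "eqv i r1 \<or> eqv i r2 \<or> eqv i r3" if "i \<in> L" for i
  proof -
    have "i \<in> R \<or> (\<exists>l<m - 1. i \<in> B l)" using that L_cover by auto
    then show ?thesis
    proof
      assume "i \<in> R"
      then show ?thesis using inR[of i] D(1) by blast
    qed (use pb in blast)
  qed
  have LE: "L = E1 \<union> E2 \<union> E3" "E1 \<inter> E2 = {}" "E1 \<inter> E3 = {}" "E2 \<inter> E3 = {}"
    using allE ne2 unfolding E1_def E2_def E3_def by blast+
  have rE: "r1 \<in> E1" "r2 \<in> E2" "r3 \<in> E3" using rR RL by (auto simp: E1_def E2_def E3_def)
  have HE: "\<forall>i\<in>E1. HH i r1" "\<forall>i\<in>E2. HH i r2" "\<forall>i\<in>E3. HH i r3"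
    using C1(2) C2(2) C3(2) unfolding E1_def E2_def E3_def by blast+
  have n0: "n - 1 + c * n = (c + 1) * n - 1" for c using n2 by simp
  have cE: "card E1 = (card I1 + 1) * n - 1" "card E2 = (card I2 + 1) * n - 1" "card E3 = card I3 * n + k"
    using C1(1) C2(1) C3(1) D(5-7) n0 unfolding E1_def E2_def E3_def by auto
  have det: "coprime (p r1 * q r2 - p r2 * q r1) (int n)" by (rule three_det[OF R r(1,2)])
  note r3 = three_eqv(4)[OF R r]
  have det13: "coprime (p r1 * q r3 - p r3 * q r1) (int n)"
  proof -
    have "[p r1 * q r3 - p r3 * q r1 = p r1 * (x * q r1 + q r2) - (x * p r1 + p r2) * q r1] (mod int n)"
      using r3 by (intro cong_diff cong_mult cong_refl) auto
    moreover have "p r1 * (x * q r1 + q r2) - (x * p r1 + p r2) * q r1 = p r1 * q r2 - p r2 * q r1"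
      by (simp add: algebra_simps)
    ultimately show ?thesis using det cong_imp_coprime cong_sym by metis
  qed
  have det23: "coprime (p r2 * q r3 - p r3 * q r2) (int n)"
  proof -
    have "[p r2 * q r3 - p r3 * q r2 = p r2 * (x * q r1 + q r2) - (x * p r1 + p r2) * q r2] (mod int n)"
      using r3 by (intro cong_diff cong_mult cong_refl) auto
    moreover have "p r2 * (x * q r1 + q r2) - (x * p r1 + p r2) * q r2 = (- x) * (p r1 * q r2 - p r2 * q r1)"
      by (simp add: algebra_simps)
    moreover have "coprime ((- x) * (p r1 * q r2 - p r2 * q r1)) (int n)" using det D(8) by simp
    ultimately show ?thesis using cong_imp_coprime cong_sym by metis
  qed
  have part123: "part3 E1 E2 E3 r1 r2 r3" unfolding part3_def using LE rE HE det by blast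
  have part132: "part3 E1 E3 E2 r1 r3 r2" unfolding part3_def using LE rE HE det13 by blast
  have part231: "part3 E2 E3 E1 r2 r3 r1" unfolding part3_def using LE rE HE det23 by blast
  have "int n dvd q r3 - (x * q r1 + q r2)" using r3 by (simp add: cong_iff_dvd_diff)
  then obtain t where t: "q r3 = x * q r1 + q r2 + int n * t" by (auto simp: dvd_def algebra_simps)
  define s where "s j = (int (alpha j) + int j * x) div int n" for j
  have s: "int n * s j = int (alpha j) + int j * x" if "1 \<le> j" "j \<le> k" for j
    using alpha(1)[OF that] by (simp add: s_def)
  have eq: "[int j * t + s j * q r1 + q r2 = \<gamma>] (mod int m)" if j: "1 \<le> j" "j \<le> k" for j
  proof -
    have "int (alpha j) * q r1 + int (n - j) * q r2 + int j * q r3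
        = (int (alpha j) + int j * x) * q r1 + int n * q r2 + int n * (int j * t)"
      using j kn n2 by (simp add: t of_nat_diff algebra_simps)
    also have "\<dots> = int n * (int j * t + s j * q r1 + q r2)"
      unfolding s[OF j, symmetric] by (simp add: algebra_simps)
    finally show ?thesis using triple_eq[OF r j] cong_scale_iff[of n] n2 by simp
  qed
  have s1: "s 1 = 1"
  proof -
    have "int n * s 1 = int (alpha 1) + x" using s[of 1] k1 by simp
    moreover have "1 \<le> int (alpha 1)" "int (alpha 1) \<le> int n - 1" using alpha[of 1] k1 n2 by auto
    ultimately have "int n * s 1 < int n * 2" "int n * 0 < int n * s 1" using D(9,10) by linarith+
    then have "s 1 < 2" "0 < s 1" using n2
      by (metis mult_less_cancel_left_pos of_nat_0_less_iff pos2 order_less_le_trans)+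
    then show ?thesis by linarith
  qed
  have eq1: "[t + q r1 + q r2 = \<gamma>] (mod int m)" using eq[of 1] s1 k1 by simp
  have caseA: sum_form if x1: "x = 1" and mt: "int m dvd t"
  proof (rule sum_formI[OF part123 cE])
    obtain t' where "t = int m * t'" using mt by (auto simp: dvd_def)
    then have "q r3 - (q r1 + q r2) = int (m * n) * t'" using t x1 by simp
    then show "[q r3 = q r1 + q r2] (mod int (m * n))" by (simp add: cong_iff_dvd_diff)
    show "[p r3 = p r1 + p r2] (mod int n)" using r3 x1 by simp
    have "int m dvd (t + q r1 + q r2 - \<gamma>) - t" using eq1 mt unfolding cong_iff_dvd_diff by (rule dvd_diff)
    then show "[q r1 + q r2 = \<gamma>] (mod int m)" by (simp add: cong_iff_dvd_diff algebra_simps)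
    show "2 \<le> card I1 + 1 \<Longrightarrow> [q r1 = \<gamma>] (mod int m)" using C1(3) by simp
    show "2 \<le> card I2 + 1 \<Longrightarrow> [q r2 = \<gamma>] (mod int m)" using C2(3) by simp
  qed (use cI m2 in auto)
  \<comment> \<open>Here \<open>r2 = r1 + r3\<close>, so second and third value change roles; this
    is possible because both classes have size -1 modulo \<open>n\<close> when
    \<open>k = n-1\<close>.\<close>
  have caseB: sum_form if xn: "x = int n - 1" and kn1: "k = n - 1" and mt: "int m dvd t + q r1"
  proof (rule sum_formI[OF part132, of "card I1 + 1" "card I3 + 1" "card I2"])
    obtain t' where t': "t + q r1 = int m * t'" using mt by (auto simp: dvd_def)
    have "q r2 - (q r1 + q r3) = - (int n * (t + q r1))" using t xn by (simp add: algebra_simps)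
    then have "q r2 - (q r1 + q r3) = int (m * n) * (- t')" unfolding t' by simp
    then show Q: "[q r2 = q r1 + q r3] (mod int (m * n))" by (simp add: cong_iff_dvd_diff)
    have "int n dvd p r3 - ((int n - 1) * p r1 + p r2)" using r3 xn by (simp add: cong_iff_dvd_diff)
    then obtain z where "p r3 - ((int n - 1) * p r1 + p r2) = int n * z" by (auto elim: dvdE)
    then have "p r2 - (p r1 + p r3) = int n * (- z - p r1)" by (simp add: algebra_simps)
    then show "[p r2 = p r1 + p r3] (mod int n)" by (simp add: cong_iff_dvd_diff)
    have "int m dvd (t + q r1 + q r2 - \<gamma>) - (t + q r1)" using eq1 mt unfolding cong_iff_dvd_diff by (rule dvd_diff)
    then have "[q r2 = \<gamma>] (mod int m)" by (simp add: cong_iff_dvd_diff algebra_simps)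
    moreover have "[q r2 = q r1 + q r3] (mod int m)" using Q by (rule cong_dvd_modulus) simp
    ultimately show "[q r1 + q r3 = \<gamma>] (mod int m)" by (meson cong_sym cong_trans)
    show "card E1 = (card I1 + 1) * n - 1" by (rule cE)
    show "card E3 = (card I3 + 1) * n - 1" using cE(3) kn1 n2 by simp
    show "card E2 = card I2 * n + k" using cE(2) kn1 n2 by simp
    show "2 \<le> card I1 + 1 \<Longrightarrow> [q r1 = \<gamma>] (mod int m)" using C1(3) by simp
    show "2 \<le> card I3 + 1 \<Longrightarrow> [q r3 = \<gamma>] (mod int m)" using C3(3) by simp
  qed (use cI m2 in auto)
  \<comment> \<open>Only for \<open>n = 2\<close>, where the three values are interchangeable: now
    \<open>r1 = r2 + r3\<close>.\<close>
  have caseC: sum_form if n2': "n = 2" and x1: "x = 1" and k1': "k = 1" and mt: "int m dvd t + q r2"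
  proof (rule sum_formI[OF part231, of "card I2 + 1" "card I3 + 1" "card I1"])
    obtain t' where t': "t + q r2 = int m * t'" using mt by (auto simp: dvd_def)
    have "q r1 - (q r2 + q r3) = - (int n * (t + q r2))" using t n2' x1 by (simp add: algebra_simps)
    then have "q r1 - (q r2 + q r3) = int (m * n) * (- t')" unfolding t' by simp
    then show Q: "[q r1 = q r2 + q r3] (mod int (m * n))" by (simp add: cong_iff_dvd_diff)
    have "int n dvd p r3 - (p r1 + p r2)" using r3 x1 by (simp add: cong_iff_dvd_diff)
    then obtain z where "p r3 - (p r1 + p r2) = int n * z" by (auto elim: dvdE)
    then have "p r1 - (p r2 + p r3) = int n * (- z - p r2)" using n2' by (simp add: algebra_simps)
    then show "[p r1 = p r2 + p r3] (mod int n)" by (simp add: cong_iff_dvd_diff)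
    have "int m dvd (t + q r1 + q r2 - \<gamma>) - (t + q r2)" using eq1 mt unfolding cong_iff_dvd_diff by (rule dvd_diff)
    then have "[q r1 = \<gamma>] (mod int m)" by (simp add: cong_iff_dvd_diff algebra_simps)
    moreover have "[q r1 = q r2 + q r3] (mod int m)" using Q by (rule cong_dvd_modulus) simp
    ultimately show "[q r2 + q r3 = \<gamma>] (mod int m)" by (meson cong_sym cong_trans)
    show "card E2 = (card I2 + 1) * n - 1" by (rule cE)
    show "card E3 = (card I3 + 1) * n - 1" using cE(3) n2' k1' by simp
    show "card E1 = card I1 * n + k" using cE(1) n2' k1' by simp
    show "2 \<le> card I2 + 1 \<Longrightarrow> [q r2 = \<gamma>] (mod int m)" using C2(3) by simp
    show "2 \<le> card I3 + 1 \<Longrightarrow> [q r3 = \<gamma>] (mod int m)" using C3(3) by simp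
  qed (use cI m2 in auto)
  show ?thesis
  proof (cases "k \<ge> 2")
    case k2: True
    show ?thesis
    proof (cases "x = 1")
      case True
      have "s 2 = 1"
      proof -
        have "(- 2) mod int n = int n - 2" using k2 kn by (simp add: zmod_zminus1_eq_if)
        then have "int (alpha 2) = int n - 2" unfolding alpha_def using True n2 by simp
        then have "int n * s 2 = int n * 1" using s[of 2] k2 True by simp
        then show ?thesis using n2 by simp
      qed
      then have "[2 * t + q r1 + q r2 = \<gamma>] (mod int m)" using eq[of 2] k2 by simp
      then have "int m dvd (2 * t + q r1 + q r2 - \<gamma>) - (t + q r1 + q r2 - \<gamma>)"
        using eq1 unfolding cong_iff_dvd_diff by (rule dvd_diff)
      then show ?thesis using caseA True by (simp add: algebra_simps)
    next
      case False
      then have x2: "x \<ge> 2" and kn1: "k = n - 1" using D(9,11) by auto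
      have n3: "n \<ge> 3" using x2 D(10) by linarith
      have s': "int n * s j = int (alpha j) + int j * x" if "1 \<le> j" "j \<le> n - 1" for j using s that kn1 by auto
      have cs2: "\<exists>j. 1 \<le> j \<and> j < n - 1 \<and> s (Suc j) = s j + 1"
        by (rule carry_steps(2)[of s]) (use s' kn1 n3 x2 in auto)
      have cs3: "\<exists>j. 1 \<le> j \<and> j < n - 1 \<and> s (Suc j) = s j" if "x \<le> int n - 2"
        by (rule carry_steps(3)[of s]) (use s' kn1 n3 that in auto)
      have diff: "int m dvd t + (s (Suc j) - s j) * q r1" if "1 \<le> j" "j < n - 1" for j
      proof -
        have j: "1 \<le> Suc j" "Suc j \<le> k" "j \<le> k" using that kn1 by auto
        have "int m dvd (int (Suc j) * t + s (Suc j) * q r1 + q r2 - \<gamma>) - (int j * t + s j * q r1 + q r2 - \<gamma>)"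
          using eq[OF j(1,2)] eq[OF that(1) j(3)] unfolding cong_iff_dvd_diff by (rule dvd_diff)
        then show ?thesis by (simp add: algebra_simps)
      qed
      obtain j where "1 \<le> j" "j < n - 1" "s (Suc j) = s j + 1" using cs2 by blast
      then have tq: "int m dvd t + q r1" using diff[of j] by simp
      show ?thesis
      proof (cases "x = int n - 1")
        case True
        then show ?thesis using caseB kn1 tq by blast
      next
        case False
        then have "x \<le> int n - 2" using D(10) by simp
        then obtain j where "1 \<le> j" "j < n - 1" "s (Suc j) = s j" using cs3 by blast
        then have t0: "int m dvd t" using diff[of j] by simp
        then have q1: "int m dvd q r1" using tq by (simp add: dvd_add_right_iff)
        have "int m dvd (t + q r1 + q r2 - \<gamma>) - (t + q r1)" using eq1 tq unfolding cong_iff_dvd_diff by (rule dvd_diff)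
        then have q2: "[q r2 = \<gamma>] (mod int m)" by (simp add: cong_iff_dvd_diff algebra_simps)
        have I1: "card I1 = 0"
        proof (rule ccontr)
          assume "card I1 \<noteq> 0"
          then have "[q r1 = \<gamma>] (mod int m)" using C1(3) by simp
          then show False using q1 not_dvd_\<gamma> cong_dvd_iff by blast
        qed
        obtain t' where t': "t = int m * t'" using t0 by (auto simp: dvd_def)
        have "q r3 - (x * q r1 + q r2) = int (m * n) * t'" unfolding t t' by simp
        then have "[q r3 = x * q r1 + q r2] (mod int (m * n))" by (simp add: cong_iff_dvd_diff)
        moreover have "coprime (q r2) (int m)" using cop_\<gamma> q2 cong_imp_coprime cong_sym by blast
        moreover have "card E1 = n - 1" "card E3 = card I3 * n + n - 1" "card I2 + 1 + card I3 = m"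
          using cE I1 kn1 n2 cI m2 by auto
        ultimately have twist_form
          unfolding twist_form_def using part123 cE(2) kn1 D(8,9,10) r3 q1 le_add2[of 1 "card I2"] by blast
        then show ?thesis by blast
      qed
    qed
  next
    case False
    then have n2': "n = 2" and kk1: "k = 1" using kk kn k1 by auto
    then have x1: "x = 1" using D(9,10) by auto
    \<comment> \<open>For \<open>n = 2\<close> there is only the equation for \<open>j = 1\<close>.
      The missing information comes from a block: its value \<open>r\<close> satisfies
      \<open>q r = \<gamma>\<close> modulo \<open>m\<close>, and this makes \<open>r\<close> the sum
      of the other two values.\<close>
    have "card I1 \<noteq> 0 \<or> card I2 \<noteq> 0 \<or> card I3 \<noteq> 0" using cI m2 by auto
    then consider "card I1 \<noteq> 0" | "card I2 \<noteq> 0" | "card I3 \<noteq> 0" by blast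
    then show ?thesis
    proof cases
      case 1
      then have "[q r1 = \<gamma>] (mod int m)" using C1(3) by simp
      with eq1 have "int m dvd (t + q r1 + q r2 - \<gamma>) - (q r1 - \<gamma>)"
        unfolding cong_iff_dvd_diff by (rule dvd_diff)
      then show ?thesis using caseC n2' x1 kk1 by (simp add: algebra_simps)
    next
      case 2
      then have "[q r2 = \<gamma>] (mod int m)" using C2(3) by simp
      with eq1 have "int m dvd (t + q r1 + q r2 - \<gamma>) - (q r2 - \<gamma>)"
        unfolding cong_iff_dvd_diff by (rule dvd_diff)
      then show ?thesis using caseB n2' x1 kk1 by (simp add: algebra_simps)
    next
      case 3
      then have "[q r3 = \<gamma>] (mod int m)" using C3(3) by simp
      then have "int m dvd (q r3 - \<gamma>) - (t + q r1 + q r2 - \<gamma>)"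
        using eq1 unfolding cong_iff_dvd_diff by (rule dvd_diff)
      then show ?thesis using caseA x1 n2' t by (simp add: algebra_simps)
    qed
  qed
qed

end

section \<open>Translation between multisets and indexed families\<close>

lemma red_eq_iff:
  "red n m v = red n m w \<longleftrightarrow> int n dvd fst v - fst w \<and> int (m * n) dvd snd v - snd w"
  unfolding red_def by (simp add: mod_eq_dvd_iff)

lemma red_grp: "x \<in> grp n m \<Longrightarrow> red n m x = x"
  by (auto simp: red_def grp_def)

lemma red_in_grp: "n \<ge> 1 \<Longrightarrow> m \<ge> 1 \<Longrightarrow> red n m v \<in> grp n m"
  by (auto simp: red_def grp_def)

lemma gcomb: "gadd n m (gsmul n m a x) (gsmul n m b y) = red n m (a * fst x + b * fst y, a * snd x + b * snd y)"
  unfolding gadd_def gsmul_def red_def by (simp add: mod_add_eq)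

lemma gcomb1: "gadd n m (gsmul n m a x) y = red n m (a * fst x + fst y, a * snd x + snd y)"
  unfolding gadd_def gsmul_def red_def by (simp add: mod_add_left_eq)

lemma gadd_red: "gadd n m x y = red n m (fst x + fst y, snd x + snd y)"
  by (simp add: gadd_def)

lemma gord_eqI:
  assumes "N > 0" "\<And>k::nat. gsmul n m (int k) g = (0, 0) \<longleftrightarrow> N dvd k"
  shows "gord n m g = N"
  unfolding gord_def
proof (rule Least_equality)
  show "0 < N \<and> gsmul n m (int N) g = (0, 0)" using assms by simp
next
  fix k :: nat assume "0 < k \<and> gsmul n m (int k) g = (0, 0)"
  then show "N \<le> k" using assms dvd_imp_le by blast
qed

lemma gsmul_zero_iff: "gsmul n m a g = (0, 0) \<longleftrightarrow> int n dvd a * fst g \<and> int (m * n) dvd a * snd g"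
  by (simp add: gsmul_def red_def dvd_eq_mod_eq_0)

text \<open>The determinant condition settles independence modulo \<open>n\<close>; a relation with
  both coefficients divisible by \<open>n\<close> is then decided in the kernel, where
  \<open>n e1\<close> vanishes and \<open>n e2\<close> is a generator. Injectivity of the coordinate
  map suffices, by counting.\<close>

lemma basis_okI:
  assumes n: "n \<ge> 1" and m: "m \<ge> 1" and e: "e1 \<in> grp n m" "e2 \<in> grp n m"
    and det: "coprime (fst e1 * snd e2 - fst e2 * snd e1) (int n)"
    and e1: "int m dvd snd e1" and e2: "coprime (snd e2) (int m)"
  shows "basis_ok n m e1 e2"
proof -
  have key: "int n dvd a \<and> int (m * n) dvd b"
    if "int n dvd a * fst e1 + b * fst e2" "int (m * n) dvd a * snd e1 + b * snd e2" for a b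
  proof -
    have "int n dvd a * snd e1 + b * snd e2" using that(2) by (metis dvd_mult_right of_nat_mult)
    then have ab: "int n dvd a" "int n dvd b" using unimodular_indep[OF det] that(1) by blast+
    then obtain a' b' where a': "a = int n * a'" and b': "b = int n * b'" by (auto elim!: dvdE)
    have "int n * int m dvd int n * (a' * snd e1 + b' * snd e2)"
      using that(2) unfolding a' b' by (simp add: algebra_simps)
    then have "int m dvd a' * snd e1 + b' * snd e2" using n by simp
    then have "int m dvd b' * snd e2" using e1 by (simp add: dvd_add_right_iff)
    then have "int m dvd b'" using e2 by (simp add: coprime_commute coprime_dvd_mult_left_iff)
    then show ?thesis using ab b' by (simp add: mult.commute mult_dvd_mono)
  qed
  have o1: "gord n m e1 = n"
  proof (rule gord_eqI)
    fix k :: nat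
    show "gsmul n m (int k) e1 = (0, 0) \<longleftrightarrow> n dvd k"
    proof
      assume "gsmul n m (int k) e1 = (0, 0)"
      then show "n dvd k" using key[of "int k" 0] by (simp add: gsmul_zero_iff int_dvd_int_iff)
    next
      assume "n dvd k"
      then have "int n dvd int k" by (simp add: int_dvd_int_iff)
      then show "gsmul n m (int k) e1 = (0, 0)" using e1
        by (simp add: gsmul_zero_iff mult.commute[of "int m"] mult_dvd_mono)
    qed
  qed (use n in auto)
  have o2: "gord n m e2 = m * n"
  proof (rule gord_eqI)
    fix k :: nat
    show "gsmul n m (int k) e2 = (0, 0) \<longleftrightarrow> m * n dvd k"
    proof
      assume "gsmul n m (int k) e2 = (0, 0)"
      then have "int (m * n) dvd int k" using key[of 0 "int k"] by (simp add: gsmul_zero_iff)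
      then show "m * n dvd k" by (simp only: int_dvd_int_iff)
    next
      assume "m * n dvd k"
      then have "int (m * n) dvd int k" by (simp only: int_dvd_int_iff)
      moreover from this have "int n dvd int k" by (metis dvd_mult_right of_nat_mult)
      ultimately show "gsmul n m (int k) e2 = (0, 0)" by (simp add: gsmul_zero_iff)
    qed
  qed (use n m in auto)
  let ?f = "\<lambda>(a, b). gadd n m (gsmul n m a e1) (gsmul n m b e2)"
  let ?D = "{0..<int n} \<times> {0..<int (m * n)}"
  have small: "a = b" if "a \<in> {0..<N}" "b \<in> {0..<N}" "N dvd a - b" for a b N :: int
    using that by (metis atLeastLessThan_iff mod_eq_dvd_iff mod_pos_pos_trivial)
  have inj: "inj_on ?f ?D"
  proof (rule inj_onI)
    fix u v assume u: "u \<in> ?D" and v: "v \<in> ?D" and eq: "?f u = ?f v"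
    obtain a b a' b' where ab: "u = (a, b)" "v = (a', b')" by (metis surj_pair)
    have "int n dvd (a - a') * fst e1 + (b - b') * fst e2" "int (m * n) dvd (a - a') * snd e1 + (b - b') * snd e2"
      using eq unfolding ab by (simp_all add: gcomb red_eq_iff algebra_simps)
    then have "int n dvd a - a'" "int (m * n) dvd b - b'" using key by blast+
    then show "u = v" using u v small unfolding ab by blast
  qed
  have sub: "?f ` ?D \<subseteq> grp n m" using n m red_in_grp by (auto simp: gcomb)
  have "card (?f ` ?D) = card (grp n m)" using card_image[OF inj] by (simp add: grp_def)
  moreover have "finite (grp n m)" by (simp add: grp_def)
  ultimately have "?f ` ?D = grp n m" using sub card_subset_eq by blast
  then show ?thesis unfolding basis_ok_def is_basis_def o1 o2 using e inj by (simp add: bij_betw_def)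
qed

text \<open>Modulo \<open>n\<close> the coefficients come from Cramer's rule. The error lies in the
  kernel, which is generated by \<open>n (g1 + g2)\<close>, so adding the same multiple of
  \<open>n\<close> to both coefficients removes it.\<close>

lemma genset_okI:
  assumes n: "n \<ge> 1" and m: "m \<ge> 1" and g: "g1 \<in> grp n m" "g2 \<in> grp n m"
    and det: "coprime (fst g1 * snd g2 - fst g2 * snd g1) (int n)"
    and s: "coprime (snd g1 + snd g2) (int m)"
  shows "genset_ok n m g1 g2"
proof -
  let ?d = "fst g1 * snd g2 - fst g2 * snd g1"
  obtain u where u: "[?d * u = 1] (mod int n)" using det cong_solve_coprime_int by blast
  obtain w where w: "[(snd g1 + snd g2) * w = 1] (mod int m)" using s cong_solve_coprime_int by blast
  have gen: "\<exists>a b. x = gadd n m (gsmul n m a g1) (gsmul n m b g2)" if x: "x \<in> grp n m" for x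
  proof -
    define a0 where "a0 = u * (fst x * snd g2 - snd x * fst g2)"
    define b0 where "b0 = u * (snd x * fst g1 - fst x * snd g1)"
    have "fst x - (a0 * fst g1 + b0 * fst g2) = - ((?d * u - 1) * fst x)"
      "snd x - (a0 * snd g1 + b0 * snd g2) = - ((?d * u - 1) * snd x)"
      by (simp_all add: a0_def b0_def algebra_simps)
    moreover have "int n dvd ?d * u - 1" using u by (simp add: cong_iff_dvd_diff)
    ultimately have "int n dvd fst x - (a0 * fst g1 + b0 * fst g2)" "int n dvd snd x - (a0 * snd g1 + b0 * snd g2)"
      by simp_all
    then obtain y1 y2 where y: "fst x - (a0 * fst g1 + b0 * fst g2) = int n * y1"
      "snd x - (a0 * snd g1 + b0 * snd g2) = int n * y2" by (auto elim!: dvdE)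
    define c where "c = w * y2"
    have "y2 - c * (snd g1 + snd g2) = - (((snd g1 + snd g2) * w - 1) * y2)"
      by (simp add: c_def algebra_simps)
    then have "int m dvd y2 - c * (snd g1 + snd g2)" using w by (simp add: cong_iff_dvd_diff)
    then have "int n * int m dvd int n * (y2 - c * (snd g1 + snd g2))" by (rule mult_dvd_mono[OF dvd_refl])
    moreover have "snd x - ((a0 + int n * c) * snd g1 + (b0 + int n * c) * snd g2) = int n * (y2 - c * (snd g1 + snd g2))"
      using y(2) by (simp add: algebra_simps)
    ultimately have 2: "int (m * n) dvd snd x - ((a0 + int n * c) * snd g1 + (b0 + int n * c) * snd g2)"
      by (simp add: mult.commute)
    have "fst x - ((a0 + int n * c) * fst g1 + (b0 + int n * c) * fst g2) = int n * (y1 - c * (fst g1 + fst g2))"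
      using y(1) by (simp add: algebra_simps)
    then have "int n dvd fst x - ((a0 + int n * c) * fst g1 + (b0 + int n * c) * fst g2)" by simp
    with 2 have "red n m x = gadd n m (gsmul n m (a0 + int n * c) g1) (gsmul n m (b0 + int n * c) g2)"
      by (simp add: gcomb red_eq_iff)
    then show ?thesis using red_grp[OF x] by metis
  qed
  have "gord n m (gadd n m g1 g2) = m * n"
  proof (rule gord_eqI)
    fix k :: nat
    have sm: "gsmul n m (int k) (gadd n m g1 g2) = gadd n m (gsmul n m (int k) g1) (gsmul n m (int k) g2)"
      unfolding gcomb gadd_def gsmul_def red_def by (simp add: mod_mult_right_eq distrib_left mod_add_eq)
    show "gsmul n m (int k) (gadd n m g1 g2) = (0, 0) \<longleftrightarrow> m * n dvd k"
    proof
      assume "gsmul n m (int k) (gadd n m g1 g2) = (0, 0)"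
      then have d: "int n dvd int k * fst g1 + int k * fst g2" "int (m * n) dvd int k * snd g1 + int k * snd g2"
        unfolding sm gcomb by (simp_all add: red_def dvd_eq_mod_eq_0)
      have "int n dvd int k * snd g1 + int k * snd g2" using d(2) by (metis dvd_mult_right of_nat_mult)
      then have "int n dvd int k" using unimodular_indep[OF det] d(1) by blast
      then obtain k' where k': "int k = int n * k'" by (rule dvdE)
      have "int n * int m dvd int n * (k' * (snd g1 + snd g2))" using d(2) unfolding k' by (simp add: algebra_simps)
      then have "int m dvd k' * (snd g1 + snd g2)" using n by simp
      then have "int m dvd k'" using s by (simp add: coprime_commute coprime_dvd_mult_left_iff)
      then have "int (m * n) dvd int k" unfolding k' by (simp add: mult.commute mult_dvd_mono)
      then show "m * n dvd k" by (simp only: int_dvd_int_iff)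
    next
      assume "m * n dvd k"
      then have "int (m * n) dvd int k" by (simp only: int_dvd_int_iff)
      moreover from this have "int n dvd int k" by (metis dvd_mult_right of_nat_mult)
      ultimately show "gsmul n m (int k) (gadd n m g1 g2) = (0, 0)" by (simp add: gsmul_zero_iff)
    qed
  qed (use n m in auto)
  then show ?thesis unfolding genset_ok_def is_genset_def using g gen by blast
qed

text \<open>Expressing the unit vectors in the basis gives an inverse matrix modulo
  \<open>n\<close>, and determinants multiply.\<close>

lemma is_basis_det:
  assumes n: "n \<ge> 2" and m: "m \<ge> 1" and b: "is_basis n m e1 e2"
  shows "coprime (fst e1 * snd e2 - fst e2 * snd e1) (int n)"
proof -
  have surj: "\<exists>a b. x = gadd n m (gsmul n m a e1) (gsmul n m b e2)" if "x \<in> grp n m" for x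
  proof -
    have "x \<in> (\<lambda>(a, b). gadd n m (gsmul n m a e1) (gsmul n m b e2)) `
        ({0..<int (gord n m e1)} \<times> {0..<int (gord n m e2)})"
      using b that unfolding is_basis_def bij_betw_def by simp
    then show ?thesis by auto
  qed
  have mn: "m * n \<ge> 2" using n m by (metis mult_le_mono mult_1 one_le_mult_iff)
  have "(1, 0) \<in> grp n m" "(0, 1) \<in> grp n m" using n m mn by (auto simp: grp_def simp flip: of_nat_mult)
  then obtain a b c d where "(1, 0) = gadd n m (gsmul n m a e1) (gsmul n m b e2)"
    "(0, 1) = gadd n m (gsmul n m c e1) (gsmul n m d e2)" using surj by metis
  then have E: "(a * fst e1 + b * fst e2) mod int n = 1" "(a * snd e1 + b * snd e2) mod int (m * n) = 0"
    "(c * fst e1 + d * fst e2) mod int n = 0" "(c * snd e1 + d * snd e2) mod int (m * n) = 1"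
    by (auto simp: gcomb red_def)
  have nd: "int n dvd int (m * n)" by simp
  have 1: "[a * fst e1 + b * fst e2 = 1] (mod int n)" using E(1) n by (simp add: cong_def)
  have 2: "[a * snd e1 + b * snd e2 = 0] (mod int n)"
    by (rule cong_dvd_modulus[OF _ nd]) (use E(2) in \<open>simp add: cong_def\<close>)
  have 3: "[c * fst e1 + d * fst e2 = 0] (mod int n)" using E(3) by (simp add: cong_def)
  have 4: "[c * snd e1 + d * snd e2 = 1] (mod int n)"
    by (rule cong_dvd_modulus[OF _ nd]) (use E(4) mn in \<open>simp add: cong_def flip: of_nat_mult\<close>)
  have "[(a * fst e1 + b * fst e2) * (c * snd e1 + d * snd e2) - (a * snd e1 + b * snd e2) * (c * fst e1 + d * fst e2)
      = 1 * 1 - 0 * 0] (mod int n)"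
    by (intro cong_diff cong_mult 1 2 3 4)
  moreover have "(a * fst e1 + b * fst e2) * (c * snd e1 + d * snd e2) - (a * snd e1 + b * snd e2) * (c * fst e1 + d * fst e2)
      = (fst e1 * snd e2 - fst e2 * snd e1) * (a * d - b * c)" by (simp add: algebra_simps)
  ultimately have "[(fst e1 * snd e2 - fst e2 * snd e1) * (a * d - b * c) = 1] (mod int n)" by simp
  then show ?thesis by (metis coprime_iff_invertible_int)
qed

section \<open>Sequences as indexed families\<close>

lemma submset_image:
  assumes "finite R" "T \<subseteq># image_mset f (mset_set R)"
  shows "\<exists>A\<subseteq>R. T = image_mset f (mset_set A)"
  using assms
proof (induction R arbitrary: T rule: finite_induct)
  case (insert r R)
  show ?case
  proof (cases "f r \<in># T")
    case True
    then obtain T' where T': "T = add_mset (f r) T'" by (metis insert_DiffM)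
    then have "T' \<subseteq># image_mset f (mset_set R)" using insert by simp
    then obtain A where "A \<subseteq> R" "T' = image_mset f (mset_set A)" using insert by blast
    then have "T = image_mset f (mset_set (insert r A))"
      using T' insert.hyps finite_subset[of A R] by (subst mset_set.insert) auto
    then show ?thesis using \<open>A \<subseteq> R\<close> by blast
  next
    case False
    have "T \<subseteq># add_mset (f r) (image_mset f (mset_set R))" using insert by simp
    then have c: "count T y \<le> count (add_mset (f r) (image_mset f (mset_set R))) y" for y
      by (rule mset_subset_eq_count)
    have "T \<subseteq># image_mset f (mset_set R)"
    proof (rule mset_subset_eqI)
      fix y
      show "count T y \<le> count (image_mset f (mset_set R)) y"
        using c[of y] False by (cases "y = f r") (auto simp: not_in_iff)
    qed
    then show ?thesis using insert by blast
  qed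
qed auto

lemma gsum_image:
  assumes "finite A"
  shows "gsum n m (image_mset (\<lambda>i. (p i, q i)) (mset_set A)) = red n m (sum p A, sum q A)"
  unfolding gsum_def by (simp add: image_mset.compositionality o_def sum_unfold_sum_mset)

lemma gsum_image_red:
  assumes "finite A"
  shows "gsum n m (image_mset (\<lambda>i. red n m (p i, q i)) (mset_set A)) = red n m (sum p A, sum q A)"
proof -
  have "gsum n m (image_mset (\<lambda>i. red n m (p i, q i)) (mset_set A))
      = red n m (\<Sum>i\<in>A. p i mod int n, \<Sum>i\<in>A. q i mod int (m * n))"
    unfolding gsum_def red_def by (simp add: image_mset.compositionality o_def sum_unfold_sum_mset)
  also have "\<dots> = red n m (sum p A, sum q A)" unfolding red_def by (simp add: mod_sum_eq)
  finally show ?thesis .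
qed

lemma count_image_card:
  assumes "finite R"
  shows "count (image_mset f (mset_set R)) y = card {i\<in>R. f i = y}"
proof -
  have "count (image_mset f (mset_set R)) y = (\<Sum>i\<in>{i\<in>R. f i = y}. 1)"
    unfolding count_image_mset' using assms by (intro sum.cong) auto
  then show ?thesis by simp
qed

lemma image_mset_const:
  assumes "finite A" "\<And>i. i \<in> A \<Longrightarrow> f i = c"
  shows "image_mset f (mset_set A) = replicate_mset (card A) c"
  using assms by (induction A rule: finite_induct) auto

lemma multiset_family:
  fixes S :: "(int \<times> int) multiset"
  shows "\<exists>p q. S = image_mset (\<lambda>i. (p i, q i)) (mset_set {..<size S})"
proof -
  obtain xs where xs: "mset xs = S" using ex_mset by blast
  have "image_mset ((!) xs) (mset_set {0..<length xs}) = mset (map ((!) xs) [0..<length xs])"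
    by (simp only: mset_map mset_upt)
  also have "\<dots> = S" unfolding map_nth xs ..
  finally have "S = image_mset (\<lambda>i. (fst (xs ! i), snd (xs ! i))) (mset_set {..<size S})"
    using xs by (auto simp: lessThan_atLeast0)
  then show ?thesis by (intro exI[of _ "\<lambda>i. fst (xs ! i)"] exI[of _ "\<lambda>i. snd (xs ! i)"])
qed

lemma sums_le_family:
  assumes fin: "finite L" and S: "S = image_mset (\<lambda>i. (p i, q i)) (mset_set L)"
    and z: "(0, 0) \<notin> sums_le n m N S"
    and A: "A \<subseteq> L" "A \<noteq> {}" "card A \<le> N" "int n dvd sum p A"
  shows "\<not> int (m * n) dvd sum q A"
proof
  assume d: "int (m * n) dvd sum q A"
  have fA: "finite A" using A(1) fin finite_subset by blast
  let ?T = "image_mset (\<lambda>i. (p i, q i)) (mset_set A)"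
  have "?T \<subseteq># S" unfolding S using A(1) fin by (intro image_mset_subseteq_mono) (simp add: subset_imp_msubset_mset_set)
  moreover have "1 \<le> size ?T" "size ?T \<le> N" using A fA by (auto simp: Suc_le_eq card_gt_0_iff)
  moreover have "gsum n m ?T = (0, 0)" unfolding gsum_image[OF fA] red_def using A(4) d
    by (simp add: dvd_eq_mod_eq_0)
  ultimately show False using z unfolding sums_le_def by force
qed

text \<open>For \<open>m = 1\<close> only the alternatives (a) are left. The terms are arbitrary
  integer pairs, reduced on entry, so that the hypothesis can be applied to the reduction of any
  good set.\<close>

lemma structural_square:
  assumes sp: "structural_property n 1 k" and n: "n \<ge> 2" and k: "k \<le> n - 1"
    and fin: "finite R" and card: "card R = 2 * n - 2 + k"
    and short: "\<And>A. A \<subseteq> R \<Longrightarrow> zs n p q A \<Longrightarrow> 2 * n - 1 - k < card A"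
    and S: "S = image_mset (\<lambda>i. red n 1 (p i, q i)) (mset_set R)"
  shows "\<exists>a b. (k = 0 \<longrightarrow> form2a n 1 (S + {# gneg n 1 (gsum n 1 S) #}) a b) \<and> (k = 1 \<longrightarrow> form2a n 1 S a b) \<and>
    (2 \<le> k \<and> k \<le> n - 2 \<longrightarrow> form3a n 1 k S a b) \<and> (k = n - 1 \<longrightarrow> form4a n 1 S a b)"
proof -
  have "is_seq n 1 S" unfolding is_seq_def S using red_in_grp[of n 1] n by auto
  moreover have "size S = 1 * n + n - 2 + k" unfolding S using fin card n by simp
  moreover have "(0, 0) \<notin> sums_le n 1 (1 * n + n - 1 - k) S"
  proof
    assume "(0, 0) \<in> sums_le n 1 (1 * n + n - 1 - k) S"
    then obtain T where T: "T \<subseteq># S" "gsum n 1 T = (0, 0)" "1 \<le> size T" "size T \<le> 1 * n + n - 1 - k"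
      unfolding sums_le_def by force
    then obtain A where A: "A \<subseteq> R" "T = image_mset (\<lambda>i. red n 1 (p i, q i)) (mset_set A)"
      using submset_image[OF fin] S by blast
    have fA: "finite A" using A(1) fin finite_subset by blast
    have "red n 1 (sum p A, sum q A) = (0, 0)" using T(2) A(2) gsum_image_red[OF fA] by metis
    then have "int n dvd sum p A" "int n dvd sum q A" by (auto simp: red_def dvd_eq_mod_eq_0)
    moreover have "A \<noteq> {}" "card A \<le> 2 * n - 1 - k" using T(3,4) A(2) fA by (auto simp: mult_2)
    ultimately show False using short[OF A(1)] by (simp add: zs_def)
  qed
  ultimately show ?thesis using sp unfolding structural_property_def item2_def by blast
qed

lemma unimodular_solve:
  fixes a b c d x y N :: int
  assumes "coprime (a * d - b * c) N"
  shows "\<exists>s t. [x = s * a + t * b] (mod N) \<and> [y = s * c + t * d] (mod N)"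
proof -
  obtain u where u: "[(a * d - b * c) * u = 1] (mod N)" using assms cong_solve_coprime_int by blast
  then have d: "N dvd (a * d - b * c) * u - 1" by (simp add: cong_iff_dvd_diff)
  have "x - ((u * (x * d - y * b)) * a + (u * (y * a - x * c)) * b) = - (((a * d - b * c) * u - 1) * x)"
    "y - ((u * (x * d - y * b)) * c + (u * (y * a - x * c)) * d) = - (((a * d - b * c) * u - 1) * y)"
    by (simp_all add: algebra_simps)
  then have "N dvd x - ((u * (x * d - y * b)) * a + (u * (y * a - x * c)) * b)"
    "N dvd y - ((u * (x * d - y * b)) * c + (u * (y * a - x * c)) * d)"
    using d by simp_all
  then show ?thesis unfolding cong_iff_dvd_diff by blast
qed

text \<open>The predicate \<open>three\<close> outside the locale: for
  \<open>2 \<le> k \<le> n-2\<close> this shape is already needed to establish the locale assumption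
  \<open>short_bound\<close>.\<close>

definition three_classes where
  "three_classes n k p q Q P1 P2 P3 x \<longleftrightarrow> Q = P1 \<union> P2 \<union> P3 \<and> P1 \<inter> P2 = {} \<and> P1 \<inter> P3 = {} \<and> P2 \<inter> P3 = {} \<and>
     card P1 = n - 1 \<and> card P2 = n - 1 \<and> card P3 = k \<and>
     coprime x (int n) \<and> 1 \<le> x \<and> x \<le> int n - 1 \<and> (k \<noteq> n - 1 \<longrightarrow> x = 1) \<and>
     (\<exists>a b c d. coprime (a * d - b * c) (int n) \<and>
        (\<forall>i\<in>P1. [p i = a] (mod int n) \<and> [q i = c] (mod int n)) \<and>
        (\<forall>i\<in>P2. [p i = b] (mod int n) \<and> [q i = d] (mod int n)) \<and>
        (\<forall>i\<in>P3. [p i = x * a + b] (mod int n) \<and> [q i = x * c + d] (mod int n)))"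

lemma three_classes_of_multiset:
  fixes p q :: "nat \<Rightarrow> int"
  assumes n: "n \<ge> 2" and fin: "finite R" and b: "basis_ok n 1 e1 e2"
    and x: "coprime x (int n)" "1 \<le> x" "x \<le> int n - 1" "k \<noteq> n - 1 \<longrightarrow> x = 1"
    and S: "image_mset (\<lambda>i. red n 1 (p i, q i)) (mset_set R) = replicate_mset (n - 1) e1 +
      replicate_mset (n - 1) e2 + replicate_mset k (gadd n 1 (gsmul n 1 x e1) e2)"
  shows "\<exists>P1 P2 P3. three_classes n k p q R P1 P2 P3 x"
proof -
  let ?f = "\<lambda>i. red n 1 (p i, q i)" let ?w = "gadd n 1 (gsmul n 1 x e1) e2"
  have bas: "is_basis n 1 e1 e2" using b by (simp add: basis_ok_def)
  have det: "coprime (fst e1 * snd e2 - fst e2 * snd e1) (int n)" using is_basis_det[OF n _ bas] by simp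
  have gr: "e1 \<in> grp n 1" "e2 \<in> grp n 1" using bas by (auto simp: is_basis_def)
  have n1: "\<not> int n dvd 1" using n by auto
  have w: "?w = red n 1 (x * fst e1 + fst e2, x * snd e1 + snd e2)" by (rule gcomb1)
  have "e1 \<noteq> e2"
  proof
    assume "e1 = e2"
    then have "int n dvd 1" using unimodular_indep(1)[OF det, of 1 "-1"] by simp
    then show False using n1 by blast
  qed
  moreover have "e1 \<noteq> ?w"
  proof
    assume "e1 = ?w"
    then have "red n 1 e1 = red n 1 (x * fst e1 + fst e2, x * snd e1 + snd e2)" using w red_grp[OF gr(1)] by simp
    then have "int n dvd (1 - x) * fst e1 + (-1) * fst e2" "int n dvd (1 - x) * snd e1 + (-1) * snd e2"
      unfolding red_eq_iff by (simp_all add: algebra_simps)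
    then have "int n dvd - 1" using unimodular_indep(2)[OF det] by blast
    then show False using n1 by simp
  qed
  moreover have "e2 \<noteq> ?w"
  proof
    assume "e2 = ?w"
    then have "red n 1 e2 = red n 1 (x * fst e1 + fst e2, x * snd e1 + snd e2)" using w red_grp[OF gr(2)] by simp
    then have "int n dvd x * fst e1 + 0 * fst e2" "int n dvd x * snd e1 + 0 * snd e2"
      unfolding red_eq_iff by (simp_all add: algebra_simps)
    then have "int n dvd x" using unimodular_indep(1)[OF det] by blast
    then show False using x(2,3) by (auto dest: zdvd_imp_le)
  qed
  ultimately have ne: "e1 \<noteq> e2" "e1 \<noteq> ?w" "e2 \<noteq> ?w" by auto
  define P1 where "P1 = {i\<in>R. ?f i = e1}" define P2 where "P2 = {i\<in>R. ?f i = e2}"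
  define P3 where "P3 = {i\<in>R. ?f i = ?w}"
  have c: "card P1 = n - 1" "card P2 = n - 1" "card P3 = k"
    unfolding P1_def P2_def P3_def count_image_card[OF fin, symmetric] S using ne by auto
  have "?f i \<in> {e1, e2, ?w}" if "i \<in> R" for i
  proof -
    have "?f i \<in># image_mset ?f (mset_set R)" using that fin by simp
    then show ?thesis unfolding S by (auto split: if_splits)
  qed
  then have R: "R = P1 \<union> P2 \<union> P3" by (auto simp: P1_def P2_def P3_def)
  have dis: "P1 \<inter> P2 = {}" "P1 \<inter> P3 = {}" "P2 \<inter> P3 = {}" using ne by (auto simp: P1_def P2_def P3_def)
  have cg: "[p i = fst v] (mod int n) \<and> [q i = snd v] (mod int n)" if "?f i = red n 1 v" for i v
    using that unfolding red_eq_iff by (simp add: cong_iff_dvd_diff)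
  have 1: "\<forall>i\<in>P1. [p i = fst e1] (mod int n) \<and> [q i = snd e1] (mod int n)"
    using cg[of _ e1] red_grp[OF gr(1)] by (auto simp: P1_def)
  have 2: "\<forall>i\<in>P2. [p i = fst e2] (mod int n) \<and> [q i = snd e2] (mod int n)"
    using cg[of _ e2] red_grp[OF gr(2)] by (auto simp: P2_def)
  have 3: "\<forall>i\<in>P3. [p i = x * fst e1 + fst e2] (mod int n) \<and> [q i = x * snd e1 + snd e2] (mod int n)"
    using cg[of _ "(x * fst e1 + fst e2, x * snd e1 + snd e2)"] w by (auto simp: P3_def)
  have body: "\<exists>a b c d. coprime (a * d - b * c) (int n) \<and>
        (\<forall>i\<in>P1. [p i = a] (mod int n) \<and> [q i = c] (mod int n)) \<and>
        (\<forall>i\<in>P2. [p i = b] (mod int n) \<and> [q i = d] (mod int n)) \<and>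
        (\<forall>i\<in>P3. [p i = x * a + b] (mod int n) \<and> [q i = x * c + d] (mod int n))"
    using det 1 2 3
    by (intro exI[of _ "fst e1"] exI[of _ "fst e2"] exI[of _ "snd e1"] exI[of _ "snd e2"] conjI) assumption+
  have "three_classes n k p q R P1 P2 P3 x"
    unfolding three_classes_def using R dis c x body by (intro conjI) assumption+
  then show ?thesis by (intro exI)
qed

lemma three_classes_square:
  fixes p q :: "nat \<Rightarrow> int"
  assumes sp: "structural_property n 1 k" and n: "n \<ge> 2" and k: "(2 \<le> k \<and> k \<le> n - 2) \<or> k = n - 1"
    and fin: "finite R" and card: "card R = 2 * n - 2 + k"
    and short: "\<And>A. A \<subseteq> R \<Longrightarrow> zs n p q A \<Longrightarrow> 2 * n - 1 - k < card A"
  shows "\<exists>P1 P2 P3 x. three_classes n k p q R P1 P2 P3 x"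
proof -
  let ?S = "image_mset (\<lambda>i. red n 1 (p i, q i)) (mset_set R)"
  have "k \<le> n - 1" using k by auto
  then obtain a b where F: "2 \<le> k \<and> k \<le> n - 2 \<longrightarrow> form3a n 1 k ?S a b" "k = n - 1 \<longrightarrow> form4a n 1 ?S a b"
    using structural_square[OF sp n _ fin card short refl] by blast
  show ?thesis
  proof (cases "k = n - 1")
    case True
    then have "form4a n 1 ?S a b" using F by blast
    then obtain s x where b: "basis_ok n 1 a b" and s: "1 \<le> s" "s \<le> 1" and x: "1 \<le> x" "x \<le> int n - 1" "gcd x (int n) = 1"
      and S: "?S = replicate_mset (n - 1) a + replicate_mset (s * n - 1) b +
           replicate_mset ((1 - s) * n + n - 1) (gadd n 1 (gsmul n 1 x a) b)"
      unfolding form4a_def by (elim conjE exE, intro that) assumption+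
    have "s = 1" using s by simp
    then have S': "?S = replicate_mset (n - 1) a + replicate_mset (n - 1) b + replicate_mset k (gadd n 1 (gsmul n 1 x a) b)"
      using S True by simp
    have cop: "coprime x (int n)" using x(3) by (simp add: coprime_iff_gcd_eq_1)
    have "\<exists>P1 P2 P3. three_classes n k p q R P1 P2 P3 x"
      by (rule three_classes_of_multiset[OF n fin b cop x(1,2) _ S']) (simp add: True)
    then show ?thesis by blast
  next
    case False
    then have "form3a n 1 k ?S a b" using F k by blast
    then obtain s where b: "basis_ok n 1 a b" and s: "1 \<le> s" "s \<le> 1"
      and S: "?S = replicate_mset (n - 1) a + replicate_mset (s * n - 1) b + replicate_mset ((1 - s) * n + k) (gadd n 1 a b)"
      unfolding form3a_def by (elim conjE exE, intro that) assumption+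
    have "s = 1" using s by simp
    moreover have "gadd n 1 a b = gadd n 1 (gsmul n 1 1 a) b" unfolding gcomb1 by (simp add: gadd_red)
    ultimately have S': "?S = replicate_mset (n - 1) a + replicate_mset (n - 1) b + replicate_mset k (gadd n 1 (gsmul n 1 1 a) b)"
      using S by simp
    have "\<exists>P1 P2 P3. three_classes n k p q R P1 P2 P3 1"
      by (rule three_classes_of_multiset[OF n fin b _ _ _ _ S']) (use n in simp_all)
    then show ?thesis by blast
  qed
qed

text \<open>Representatives run from 1 to \<open>n\<close> rather than from 0: the number
  \<open>n - a\<close> of copies still missing is then at most \<open>n-1\<close>, which is what a
  class of \<open>n-1\<close> terms offers.\<close>

lemma cong_rep_pos:
  fixes s :: int
  assumes "n \<ge> 1"
  shows "\<exists>a::nat. 1 \<le> a \<and> a \<le> n \<and> [s = int a] (mod int n)"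
proof -
  define r where "r = s mod int n"
  have r: "0 \<le> r" "r < int n" "[s = r] (mod int n)" using assms by (auto simp: r_def cong_def)
  show ?thesis
  proof (cases "r = 0")
    case True
    then have "[s = int n] (mod int n)" using r(3) by (simp add: cong_def)
    then show ?thesis using assms by (intro exI[of _ n]) auto
  next
    case False
    then have "int (nat r) = r" using r by simp
    then show ?thesis using r False by (intro exI[of _ "nat r"]) (auto simp: le_nat_iff)
  qed
qed

lemma subset_of_card: "c \<le> card S \<Longrightarrow> \<exists>A\<subseteq>S. card A = c"
  by (metis obtain_subset_with_card_n)

text \<open>Otherwise \<open>2n-2+k\<close> of the terms form the extremal sequence with values
  \<open>e1\<close>, \<open>e2\<close>, \<open>e1 + e2\<close>, and one more term
  \<open>h = al e1 + be e2\<close> is present. Completing \<open>h\<close> with as many copies of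
  \<open>e1 + e2\<close> as possible gives length \<open>1 + 2n - al - be - g\<close>, which is at
  most \<open>2n-1-k\<close>.\<close>

lemma short_bound_middle:
  fixes p q :: "nat \<Rightarrow> int"
  assumes n: "n \<ge> 2" and k: "2 \<le> k" "k \<le> n - 2" and fin: "finite I" and card: "2 * n - 1 + k \<le> card I"
    and str: "\<And>R. R \<subseteq> I \<Longrightarrow> card R = 2 * n - 2 + k \<Longrightarrow> (\<And>A. A \<subseteq> R \<Longrightarrow> zs n p q A \<Longrightarrow> 2 * n - 1 - k < card A) \<Longrightarrow>
      \<exists>P1 P2 P3 x. three_classes n k p q R P1 P2 P3 x"
  shows "\<exists>J\<subseteq>I. zs n p q J \<and> card J \<le> 2 * n - 1 - k"
proof (rule ccontr)
  assume neg: "\<not> ?thesis"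
  have "2 * n - 2 + k \<le> card I" using card by linarith
  then obtain R where R: "R \<subseteq> I" "card R = 2 * n - 2 + k" by (metis obtain_subset_with_card_n)
  have "R \<noteq> I" using R card n by auto
  then obtain h where h: "h \<in> I" "h \<notin> R" using R(1) by blast
  have "2 * n - 1 - k < card A" if "A \<subseteq> R" "zs n p q A" for A
    using neg that R(1) by (meson leI subset_trans)
  then obtain P1 P2 P3 x where T: "three_classes n k p q R P1 P2 P3 x" using str[OF R] by blast
  have x: "x = 1" using T k unfolding three_classes_def by auto
  have P: "R = P1 \<union> P2 \<union> P3" "P1 \<inter> P2 = {}" "P1 \<inter> P3 = {}" "P2 \<inter> P3 = {}"
    "card P1 = n - 1" "card P2 = n - 1" "card P3 = k"
    using T unfolding three_classes_def by blast+
  obtain a b c d where cop: "coprime (a * d - b * c) (int n)"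
    and 1: "\<forall>i\<in>P1. [p i = a] (mod int n) \<and> [q i = c] (mod int n)"
    and 2: "\<forall>i\<in>P2. [p i = b] (mod int n) \<and> [q i = d] (mod int n)"
    and 3: "\<forall>i\<in>P3. [p i = x * a + b] (mod int n) \<and> [q i = x * c + d] (mod int n)"
    using T unfolding three_classes_def by blast
  obtain s t where st: "[p h = s * a + t * b] (mod int n)" "[q h = s * c + t * d] (mod int n)"
    using unimodular_solve[OF cop] by blast
  have n1: "n \<ge> 1" using n by simp
  obtain al where al: "1 \<le> al" "al \<le> n" "[s = int al] (mod int n)" using cong_rep_pos[OF n1] by blast
  obtain be where be: "1 \<le> be" "be \<le> n" "[t = int be] (mod int n)" using cong_rep_pos[OF n1] by blast
  have hp: "[p h = int al * a + int be * b] (mod int n)" "[q h = int al * c + int be * d] (mod int n)"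
    using cong_trans[OF st(1) cong_add[OF cong_scalar_right[OF al(3)] cong_scalar_right[OF be(3)]]]
      cong_trans[OF st(2) cong_add[OF cong_scalar_right[OF al(3)] cong_scalar_right[OF be(3)]]] by auto
  \<comment> \<open>Each copy of \<open>e1 + e2\<close> replaces a copy of \<open>e1\<close> and one
    of \<open>e2\<close>, so \<open>g\<close> is limited by the supply \<open>k\<close> and by both
    missing numbers.\<close>
  define g where "g = min k (min (n - al) (n - be))"
  have g: "g \<le> k" "g \<le> n - al" "g \<le> n - be" "g = k \<or> g = n - al \<or> g = n - be" by (auto simp: g_def)
  have le: "n - al - g \<le> card P1" "n - be - g \<le> card P2" "g \<le> card P3" using P(5-7) al(1) be(1) g(1) by linarith+
  obtain A1 where A1: "A1 \<subseteq> P1" "card A1 = n - al - g" using subset_of_card[OF le(1)] by blast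
  obtain A2 where A2: "A2 \<subseteq> P2" "card A2 = n - be - g" using subset_of_card[OF le(2)] by blast
  obtain A3 where A3: "A3 \<subseteq> P3" "card A3 = g" using subset_of_card[OF le(3)] by blast
  have fR: "finite R" using R fin finite_subset by blast
  then have fin': "finite A1" "finite A2" "finite A3" using A1 A2 A3 P(1) by (auto intro: finite_subset[of _ R])
  define J where "J = insert h (A1 \<union> (A2 \<union> A3))"
  have dis: "A1 \<inter> (A2 \<union> A3) = {}" "A2 \<inter> A3 = {}" using A1(1) A2(1) A3(1) P(2-4) by blast+
  have hn: "h \<notin> A1 \<union> (A2 \<union> A3)" using h A1(1) A2(1) A3(1) P(1) by blast
  have sJ: "sum f J = f h + (sum f A1 + (sum f A2 + sum f A3))" for f :: "nat \<Rightarrow> int"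
    unfolding J_def using hn dis fin' by (simp add: sum.union_disjoint)
  have tot: "int n dvd sum f J"
    if f: "[f h = int al * u + int be * v] (mod int n)" "\<And>i. i \<in> P1 \<Longrightarrow> [f i = u] (mod int n)"
      "\<And>i. i \<in> P2 \<Longrightarrow> [f i = v] (mod int n)" "\<And>i. i \<in> P3 \<Longrightarrow> [f i = u + v] (mod int n)" for f u v
  proof -
    have "[sum f A1 = int (card A1) * u] (mod int n)" using f(2) A1(1) by (intro sum_cong_const) auto
    moreover have "[sum f A2 = int (card A2) * v] (mod int n)" using f(3) A2(1) by (intro sum_cong_const) auto
    moreover have "[sum f A3 = int (card A3) * (u + v)] (mod int n)" using f(4) A3(1) by (intro sum_cong_const) auto
    ultimately have "[sum f J = (int al * u + int be * v) + (int (card A1) * u + (int (card A2) * v + int (card A3) * (u + v)))] (mod int n)"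
      unfolding sJ using f(1) by (intro cong_add)
    moreover have "(int al * u + int be * v) + (int (card A1) * u + (int (card A2) * v + int (card A3) * (u + v))) = int n * (u + v)"
    proof -
      have c: "int (card A1) = int n - int al - int g" "int (card A2) = int n - int be - int g" "int (card A3) = int g"
        using A1(2) A2(2) A3(2) g al be by auto
      show ?thesis unfolding c by (simp add: algebra_simps)
    qed
    ultimately show ?thesis by (simp add: cong_dvd_iff)
  qed
  have "int n dvd sum p J" using tot[of p a b] hp 1 2 3 x by auto
  moreover have "int n dvd sum q J" using tot[of q c d] hp 1 2 3 x by auto
  ultimately have zsJ: "zs n p q J" by (simp add: zs_def J_def)
  have "card J = 1 + (n - al - g) + (n - be - g) + g"
    unfolding J_def using hn dis fin' A1 A2 A3 by (simp add: card_Un_disjoint)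
  moreover have "k + 2 \<le> al + be + g" using g(4) al be k by linarith
  ultimately have "card J \<le> 2 * n - 1 - k" using g al be k by linarith
  moreover have "J \<subseteq> I" unfolding J_def using h(1) R(1) A1(1) A2(1) A3(1) P(1) by blast
  ultimately show False using neg zsJ by blast
qed

text \<open>If \<open>2n\<close> terms have no zero-sum of length at most \<open>2n-2\<close>, the
  Davenport bound makes every choice of \<open>2n-1\<close> of them a zero-sum. Then all terms are
  congruent, and \<open>n\<close> of them are a zero-sum of length
  \<open>n \<le> 2n-2\<close>.\<close>

lemma short_bound_one:
  fixes p q :: "nat \<Rightarrow> int"
  assumes n: "n \<ge> 2" and fin: "finite I" and card: "2 * n \<le> card I"
  shows "\<exists>J\<subseteq>I. zs n p q J \<and> card J \<le> 2 * n - 2"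
proof (rule ccontr)
  assume neg: "\<not> ?thesis"
  obtain I0 where I0: "I0 \<subseteq> I" "card I0 = 2 * n" using card by (metis obtain_subset_with_card_n)
  have fI: "finite I0" using I0 fin finite_subset by blast
  have dav: "davenport_bound n" using eta_davenport_bound[of n] n by simp
  have all: "zs n p q (I0 - {i})" if i: "i \<in> I0" for i
  proof -
    have c: "card (I0 - {i}) = 2 * n - 1" using i I0 fI by simp
    have f: "finite (I0 - {i})" using fI by simp
    have c': "2 * n - 1 \<le> card (I0 - {i})" using c by simp
    obtain J where J: "J \<subseteq> I0 - {i}" "zs n p q J" by (rule davenport_boundD[OF dav f c'])
    have "\<not> card J \<le> 2 * n - 2" using neg J I0 by blast
    then have "card (I0 - {i}) \<le> card J" using c by linarith
    then have "J = I0 - {i}" using card_seteq[OF f J(1)] by blast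
    then show ?thesis using J by simp
  qed
  obtain j where j: "j \<in> I0" using I0 n by fastforce
  have eq: "[f i = f j] (mod int n)" if "i \<in> I0" "f = p \<or> f = q" for i f
  proof -
    have "int n dvd sum f (I0 - {i})" "int n dvd sum f (I0 - {j})"
      using all[OF that(1)] all[OF j] that(2) by (auto simp: zs_def)
    then have "int n dvd sum f (I0 - {j}) - sum f (I0 - {i})" by (rule dvd_diff[rotated])
    moreover have "sum f (I0 - {j}) - sum f (I0 - {i}) = f i - f j"
      using fI j that(1) by (simp add: sum_diff1)
    ultimately show ?thesis by (simp add: cong_iff_dvd_diff)
  qed
  obtain A where A: "A \<subseteq> I0" "card A = n" using subset_of_card[of n I0] I0 by auto
  have "[sum f A = int n * f j] (mod int n)" if "f = p \<or> f = q" for f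
    using sum_cong_const[of A f "f j" "int n"] eq[OF _ that] A by auto
  from this[of p] this[of q] have "int n dvd sum p A" "int n dvd sum q A" by (simp_all add: cong_dvd_iff)
  then have "zs n p q A" using A n by (auto simp: zs_def)
  moreover have "card A \<le> 2 * n - 2" using A n by simp
  ultimately show False using neg A(1) I0(1) by blast
qed

context short_zs_free
begin

lemma part3_multiset:
  assumes P: "part3 U V W u v w"
    and rng: "\<forall>i\<in>L. (p i, q i) \<in> grp n m"
  shows "image_mset (\<lambda>i. (p i, q i)) (mset_set L) = replicate_mset (card U) (p u, q u)
    + replicate_mset (card V) (p v, q v) + replicate_mset (card W) (p w, q w)"
    and "(p u, q u) \<in> grp n m" "(p v, q v) \<in> grp n m" "(p w, q w) \<in> grp n m"
proof -
  have P': "L = U \<union> V \<union> W" "U \<inter> V = {}" "U \<inter> W = {}" "V \<inter> W = {}" "u \<in> U" "v \<in> V" "w \<in> W"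
    "\<forall>i\<in>U. HH i u" "\<forall>i\<in>V. HH i v" "\<forall>i\<in>W. HH i w"
    using P unfolding part3_def by blast+
  show g: "(p u, q u) \<in> grp n m" "(p v, q v) \<in> grp n m" "(p w, q w) \<in> grp n m"
    using rng P' by blast+
  have eq: "(p i, q i) = (p j, q j)" if "HH i j" "i \<in> L" "j \<in> L" for i j
  proof -
    have "red n m (p i, q i) = red n m (p j, q j)"
      using that(1) unfolding HH_def red_eq_iff by (simp add: cong_iff_dvd_diff)
    then show ?thesis using red_grp rng that by metis
  qed
  have fin: "finite U" "finite V" "finite W" using P'(1) finL by auto
  have "mset_set L = mset_set U + mset_set V + mset_set W"
    unfolding P'(1) using P'(2-4) fin by (simp add: mset_set_Union Int_Un_distrib2)
  moreover have "image_mset (\<lambda>i. (p i, q i)) (mset_set U) = replicate_mset (card U) (p u, q u)"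
    using eq P' by (intro image_mset_const[OF fin(1)]) blast
  moreover have "image_mset (\<lambda>i. (p i, q i)) (mset_set V) = replicate_mset (card V) (p v, q v)"
    using eq P' by (intro image_mset_const[OF fin(2)]) blast
  moreover have "image_mset (\<lambda>i. (p i, q i)) (mset_set W) = replicate_mset (card W) (p w, q w)"
    using eq P' by (intro image_mset_const[OF fin(3)]) blast
  ultimately show "image_mset (\<lambda>i. (p i, q i)) (mset_set L) = replicate_mset (card U) (p u, q u)
    + replicate_mset (card V) (p v, q v) + replicate_mset (card W) (p w, q w)" by simp
qed

text \<open>\<open>a\<close> and \<open>b\<close> cannot both exceed 1, since \<open>m\<close> would
  divide \<open>q u + q v\<close>. If one of them does, its value is \<open>e2\<close> and the other
  value, of order \<open>n\<close>, is \<open>e1\<close>; if neither does, the criterion for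
  generating sets applies.\<close>

lemma sum_form_forms:
  assumes sum_form and rng: "\<forall>i\<in>L. (p i, q i) \<in> grp n m"
    and S: "S = image_mset (\<lambda>i. (p i, q i)) (mset_set L)"
  shows "\<exists>a b. form3a n m k S a b \<or> form3b n m k S a b"
proof -
  obtain U V W u v w a b c where P: "part3 U V W u v w"
    and c: "card U = a * n - 1" "card V = b * n - 1" "card W = c * n + k" "1 \<le> a" "1 \<le> b" "a + b + c = m + 1"
    and e: "[p w = p u + p v] (mod int n)" "[q w = q u + q v] (mod int (m * n))"
    and cop: "coprime (q u + q v) (int m)" and ab: "2 \<le> a \<longrightarrow> int m dvd q v" "2 \<le> b \<longrightarrow> int m dvd q u"
    using assms(1) unfolding sum_form_def by (elim conjE exE, intro that) assumption+
  note M = part3_multiset[OF P rng]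
  have det: "coprime (p u * q v - p v * q u) (int n)" using P by (simp add: part3_def)
  have det': "coprime (p v * q u - p u * q v) (int n)"
    using det by (metis coprime_minus_left_iff minus_diff_eq)
  have n1: "n \<ge> 1" "m \<ge> 1" using n2 m2 by auto
  have "red n m (p w, q w) = gadd n m (p u, q u) (p v, q v)"
    unfolding gadd_red red_eq_iff using e by (simp add: cong_iff_dvd_diff)
  then have w: "(p w, q w) = gadd n m (p u, q u) (p v, q v)" using red_grp[OF M(4)] by simp
  then have w': "(p w, q w) = gadd n m (p v, q v) (p u, q u)" by (simp add: gadd_red add.commute)
  have S': "S = replicate_mset (a * n - 1) (p u, q u) + replicate_mset (b * n - 1) (p v, q v) + replicate_mset (c * n + k) (p w, q w)"
    unfolding S M(1) c ..
  have mu: "\<not> int m dvd q u + q v"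
  proof
    assume "int m dvd q u + q v"
    then have "is_unit (int m)" using coprime_common_divisor[OF cop, of "int m"] by simp
    then show False using m2 by simp
  qed
  consider "2 \<le> a" | "a = 1" "2 \<le> b" | "a = 1" "b = 1" using c by linarith
  then show ?thesis
  proof cases
    case 1
    then have qv: "int m dvd q v" using ab by blast
    have "b = 1"
    proof (rule ccontr)
      assume "b \<noteq> 1"
      then have "int m dvd q u" using ab c(5) by simp
      then show False using mu qv by simp
    qed
    have "coprime (q u) (int m)"
    proof -
      have "[q u + q v = q u] (mod int m)" using qv by (simp add: cong_iff_dvd_diff)
      then show ?thesis using cop cong_imp_coprime by blast
    qed
    then have bas: "basis_ok n m (p v, q v) (p u, q u)" using basis_okI[OF n1 M(3,2)] det' qv by simp
    have "c = m - a" "a \<le> m" using c(6) \<open>b = 1\<close> by auto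
    then have "form3a n m k S (p v, q v) (p u, q u)"
      unfolding form3a_def using bas S' w' \<open>b = 1\<close> c(4) by (intro conjI exI[of _ a]) (simp_all add: add_ac)
    then show ?thesis by blast
  next
    case 2
    then have qu: "int m dvd q u" using ab by blast
    have "coprime (q v) (int m)"
    proof -
      have "[q u + q v = q v] (mod int m)" using qu by (simp add: cong_iff_dvd_diff)
      then show ?thesis using cop cong_imp_coprime by blast
    qed
    then have bas: "basis_ok n m (p u, q u) (p v, q v)" using basis_okI[OF n1 M(2,3)] det qu by simp
    have "c = m - b" "b \<le> m" using c(6) 2 by auto
    then have "form3a n m k S (p u, q u) (p v, q v)"
      unfolding form3a_def using bas S' w 2 c(5) by (intro conjI exI[of _ b]) (simp_all add: add_ac)
    then show ?thesis by blast
  next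
    case 3
    then have gen: "genset_ok n m (p u, q u) (p v, q v)" using genset_okI[OF n1 M(2,3)] det cop by simp
    have "c = m - 1" using c(6) 3 by auto
    then have "form3b n m k S (p u, q u) (p v, q v)"
      unfolding form3b_def using gen S' w 3 by simp
    then show ?thesis by blast
  qed
qed

lemma twist_form_forms:
  assumes twist_form and rng: "\<forall>i\<in>L. (p i, q i) \<in> grp n m"
    and S: "S = image_mset (\<lambda>i. (p i, q i)) (mset_set L)"
  shows "\<exists>a b. form4a n m S a b"
proof -
  obtain U V W u v w b c x where P: "part3 U V W u v w"
    and c: "card U = n - 1" "card V = b * n - 1" "card W = c * n + n - 1" "1 \<le> b" "b + c = m"
    and x: "1 \<le> x" "x \<le> int n - 1" "coprime x (int n)"
    and e: "[p w = x * p u + p v] (mod int n)" "[q w = x * q u + q v] (mod int (m * n))"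
    and ab: "int m dvd q u" "coprime (q v) (int m)"
    using assms(1) unfolding twist_form_def by (elim conjE exE, intro that) assumption+
  note M = part3_multiset[OF P rng]
  have det: "coprime (p u * q v - p v * q u) (int n)" using P by (simp add: part3_def)
  have n1: "n \<ge> 1" "m \<ge> 1" using n2 m2 by auto
  have "red n m (p w, q w) = gadd n m (gsmul n m x (p u, q u)) (p v, q v)"
    unfolding gcomb1 red_eq_iff using e by (simp add: cong_iff_dvd_diff)
  then have w: "(p w, q w) = gadd n m (gsmul n m x (p u, q u)) (p v, q v)" using red_grp[OF M(4)] by simp
  have S': "S = replicate_mset (n - 1) (p u, q u) + replicate_mset (b * n - 1) (p v, q v) + replicate_mset (c * n + n - 1) (p w, q w)"
    unfolding S M(1) c ..
  have bas: "basis_ok n m (p u, q u) (p v, q v)" using basis_okI[OF n1 M(2,3)] det ab by simp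
  have "c = m - b" "b \<le> m" using c(5) by auto
  then have "form4a n m S (p u, q u) (p v, q v)"
    unfolding form4a_def using bas S' w c(4) x
    by (intro conjI exI[of _ b] exI[of _ x]) (simp_all add: coprime_iff_gcd_eq_1)
  then show ?thesis by blast
qed

lemma three_iff: "three Q P1 P2 P3 x \<longleftrightarrow> three_classes n k p q Q P1 P2 P3 x"
  unfolding three_def three_classes_def ..

end

lemma basis_ok_grp: "basis_ok n m a b \<Longrightarrow> a \<in> grp n m \<and> b \<in> grp n m"
  by (simp add: basis_ok_def is_basis_def)

lemma form4a_of_form3a:
  assumes "n \<ge> 2" "form3a n m (n - 1) S a b" shows "form4a n m S a b"
proof -
  obtain s where b: "basis_ok n m a b" and s: "1 \<le> s" "s \<le> m"
    and S: "S = replicate_mset (n - 1) a + replicate_mset (s * n - 1) b + replicate_mset ((m - s) * n + (n - 1)) (gadd n m a b)"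
    using assms(2) unfolding form3a_def by (elim conjE exE, intro that) assumption+
  have g: "gadd n m (gsmul n m 1 a) b = gadd n m a b" unfolding gcomb1 by (simp add: gadd_red)
  have "(m - s) * n + (n - 1) = (m - s) * n + n - 1" using assms(1) by simp
  then show ?thesis unfolding form4a_def using b s S g assms(1)
    by (intro conjI exI[of _ s] exI[of _ 1]) simp_all
qed

lemma form4b_of_form3b:
  assumes "n \<ge> 2" "form3b n m (n - 1) S a b" shows "form4b n m S a b"
proof -
  have "(m - 1) * n + (n - 1) = (m - 1) * n + n - 1" using assms(1) by simp
  then show ?thesis using assms(2) unfolding form3b_def form4b_def by simp
qed

text \<open>For \<open>n = 2\<close> the value \<open>k = 1\<close> is also \<open>n - 1\<close>,
  and one pair has to satisfy both items at once. Here \<open>x = 1\<close>, and the coefficient sum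
  of form (a) is the odd number of terms \<open>a + b\<close>.\<close>

lemma form2a_of_form4a:
  assumes m: "m \<ge> 2" and "form4a 2 m S a b" shows "form2a 2 m S a b"
proof -
  obtain s x where b: "basis_ok 2 m a b" and s: "1 \<le> s" "s \<le> m" and x: "1 \<le> x" "x \<le> int 2 - 1"
    and S: "S = replicate_mset (2 - 1) a + replicate_mset (s * 2 - 1) b + replicate_mset ((m - s) * 2 + 2 - 1) (gadd 2 m (gsmul 2 m x a) b)"
    using assms(2) unfolding form4a_def by (elim conjE exE, intro that) assumption+
  have x1: "x = 1" using x by simp
  let ?t = "(m - s) * 2 + 1"
  define y where "y i = (if i \<le> ?t then 1 else 0 :: int)" for i :: nat
  have sp: "{1..m * 2} = {1..?t} \<union> {Suc ?t..m * 2}" "{1..?t} \<inter> {Suc ?t..m * 2} = {}" using s by auto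
  have b0: "gadd 2 m (gsmul 2 m 0 a) b = b"
    using red_grp[of b 2 m] basis_ok_grp[OF b] by (simp add: gcomb1)
  have "image_mset (\<lambda>i. gadd 2 m (gsmul 2 m (y i) a) b) (mset_set {1..m * 2})
      = image_mset (\<lambda>i. gadd 2 m (gsmul 2 m (y i) a) b) (mset_set {1..?t})
      + image_mset (\<lambda>i. gadd 2 m (gsmul 2 m (y i) a) b) (mset_set {Suc ?t..m * 2})"
    unfolding sp(1) using sp(2) by (subst mset_set_Union) auto
  also have "image_mset (\<lambda>i. gadd 2 m (gsmul 2 m (y i) a) b) (mset_set {1..?t}) = replicate_mset (card {1..?t}) (gadd 2 m (gsmul 2 m 1 a) b)"
    by (rule image_mset_const) (auto simp: y_def)
  also have "image_mset (\<lambda>i. gadd 2 m (gsmul 2 m (y i) a) b) (mset_set {Suc ?t..m * 2}) = replicate_mset (card {Suc ?t..m * 2}) (gadd 2 m (gsmul 2 m 0 a) b)"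
    by (rule image_mset_const) (auto simp: y_def)
  also have "card {1..?t} = (m - s) * 2 + 2 - 1" by simp
  also have "card {Suc ?t..m * 2} = s * 2 - 1" using s by simp
  finally have im: "S = replicate_mset (2 - 1) a + image_mset (\<lambda>i. gadd 2 m (gsmul 2 m (y i) a) b) (mset_set {1..m * 2})"
    using S x1 b0 by (simp add: add_ac)
  have "(\<Sum>i = 1..m * 2. y i) = (\<Sum>i = 1..?t. y i) + (\<Sum>i = Suc ?t..m * 2. y i)"
    unfolding sp(1) using sp(2) by (subst sum.union_disjoint) auto
  also have "(\<Sum>i = 1..?t. y i) = (\<Sum>i = 1..?t. 1)" by (intro sum.cong) (auto simp: y_def)
  also have "(\<Sum>i = Suc ?t..m * 2. y i) = 0" by (intro sum.neutral) (auto simp: y_def)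
  finally have "(\<Sum>i = 1..m * 2. y i) mod int 2 = 1 mod int 2" by simp
  then show ?thesis unfolding form2a_def using b im
    by (intro conjI exI[of _ y]) (auto simp: y_def)
qed

lemma form2d_of_form4b:
  assumes "form4b 2 m S a b" shows "form2d 2 m S a b"
proof -
  have g: "genset_ok 2 m a b" and S: "S = replicate_mset (2 - 1) a + replicate_mset (2 - 1) b + replicate_mset ((m - 1) * 2 + 2 - 1) (gadd 2 m a b)"
    using assms unfolding form4b_def by auto
  have "gadd 2 m (gsmul 2 m (- 0) a) b = b"
    using g red_grp[of b 2 m] by (simp add: gcomb1 genset_ok_def is_genset_def)
  then show ?thesis unfolding form2d_def using g S
    by (intro conjI exI[of _ "\<lambda>_. 0"]) (auto simp: add_ac)
qed

lemma forms_large_k: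
  assumes n: "n \<ge> 2" and m: "m \<ge> 2" and k: "(2 \<le> k \<and> k \<le> n - 2) \<or> k = n - 1"
    and sp: "structural_property n 1 k" and seq: "is_seq n m S" and sz: "size S = m * n + n - 2 + k"
    and z: "(0, 0) \<notin> sums_le n m (m * n + n - 1 - k) S"
  shows "\<exists>a b. form3a n m k S a b \<or> form3b n m k S a b \<or> (k = n - 1 \<and> form4a n m S a b)"
proof -
  obtain p q where S: "S = image_mset (\<lambda>i. (p i, q i)) (mset_set {..<size S})"
    using multiset_family by blast
  let ?L = "{..<size S}"
  have rng: "\<forall>i\<in>?L. (p i, q i) \<in> grp n m"
  proof
    fix i assume that: "i \<in> ?L"
    have "(p i, q i) \<in># S" using that by (subst S) simp
    then show "(p i, q i) \<in> grp n m" using seq by (auto simp: is_seq_def)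
  qed
  have str: "\<exists>P1 P2 P3 x. three_classes n k p q R P1 P2 P3 x"
    if "R \<subseteq> ?L" "card R = 2 * n - 2 + k" "\<And>A. A \<subseteq> R \<Longrightarrow> zs n p q A \<Longrightarrow> 2 * n - 1 - k < card A" for R
    using three_classes_square[OF sp n k _ that(2,3)] finite_subset[OF that(1)] by blast
  interpret short_zs_free n m k p q ?L
  proof
    show "1 \<le> k" "k \<le> n - 1" using k n by auto
    show "\<not> int (m * n) dvd sum q A" if "A \<subseteq> ?L" "A \<noteq> {}" "card A \<le> m * n + n - 1 - k" "int n dvd sum p A" for A
      by (rule sums_le_family[OF _ S z that]) simp
    show "\<exists>J\<subseteq>I. zs n p q J \<and> card J \<le> 2 * n - 1 - k" if I: "I \<subseteq> ?L" "2 * n - 1 + k \<le> card I" for I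
    \<comment> \<open>For \<open>k = n - 1\<close> the assumption is the bound on eta, as
      \<open>2n-1+k\<close> is \<open>3n-2\<close> and \<open>2n-1-k\<close> is
      \<open>n\<close>.\<close>
    proof (cases "k = n - 1")
      case True
      have fI: "finite I" using I(1) finite_subset by blast
      have c: "3 * n - 2 \<le> card I" using I(2) True n by linarith
      have "eta_bound n" using eta_davenport_bound[of n] n by simp
      then obtain J where "J \<subseteq> I" "zs n p q J" "card J \<le> n" by (rule eta_boundD[OF _ fI c])
      moreover have "n \<le> 2 * n - 1 - k" using True n by simp
      ultimately show ?thesis by (meson order_trans)
    next
      case False
      then have k': "2 \<le> k" "k \<le> n - 2" using k by auto
      have fI: "finite I" using I(1) finite_subset by blast
      show ?thesis
      proof (rule short_bound_middle[OF n k' fI I(2)])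
        fix R assume R: "R \<subseteq> I" "card R = 2 * n - 2 + k" "\<And>A. A \<subseteq> R \<Longrightarrow> zs n p q A \<Longrightarrow> 2 * n - 1 - k < card A"
        show "\<exists>P1 P2 P3 x. three_classes n k p q R P1 P2 P3 x"
          by (rule str) (use R I(1) in auto)
      qed
    qed
  qed (use n m sz in auto)
  obtain B where B: "fam B (m - 1)" "\<forall>i<m - 1. card (B i) \<le> n" using ex_fam by blast
  interpret decomposition n m k p q ?L B by unfold_locales (use B in auto)
  have str': "\<exists>P1 P2 P3 y. three Q P1 P2 P3 y" if "good Q" for Q
    unfolding three_iff using str[of Q] that unfolding good_def by blast
  obtain R1 R2 R3 x where R: "three R R1 R2 R3 x" using str'[OF goodR] by blast
  interpret triple n m k p q ?L B R1 R2 R3 x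
    by unfold_locales (use k str' R n in auto)
  from outcome show ?thesis
  proof
    assume sum_form
    then show ?thesis using sum_form_forms[OF _ rng S] by blast
  next
    assume t: twist_form
    then have "k = n - 1" by (simp add: twist_form_def)
    then show ?thesis using twist_form_forms[OF t rng S] by blast
  qed
qed

section \<open>Centers: the case \<open>k = 1\<close>\<close>

text \<open>\<open>rr n s\<close> is the least number that completes \<open>s\<close> to a multiple of \<open>n\<close>, and \<open>cc n s\<close> is the ceiling of \<open>s / n\<close>.\<close>

definition rr :: "nat \<Rightarrow> nat \<Rightarrow> nat" where "rr n s = (n - s mod n) mod n"
definition cc :: "nat \<Rightarrow> nat \<Rightarrow> nat" where "cc n s = (s + rr n s) div n"

lemma rr_less: "n \<ge> 1 \<Longrightarrow> rr n s < n" by (simp add: rr_def)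

lemma rr_dvd: "n \<ge> 1 \<Longrightarrow> n dvd s + rr n s"
proof -
  assume n: "n \<ge> 1"
  have "(s + rr n s) mod n = (s mod n + (n - s mod n)) mod n"
    by (simp add: rr_def mod_add_left_eq mod_add_right_eq)
  also have "\<dots> = 0" using n by (simp add: less_imp_le)
  finally show ?thesis by auto
qed

lemma rr_eqI:
  assumes "r < n" "n dvd s + r" shows "rr n s = r"
proof -
  have n: "n \<ge> 1" using assms by simp
  have "n dvd r - rr n s" "n dvd rr n s - r"
    using dvd_diff_nat[OF assms(2) rr_dvd[OF n, of s]] dvd_diff_nat[OF rr_dvd[OF n, of s] assms(2)] by simp_all
  moreover have "r - rr n s < n" "rr n s - r < n" using assms(1) rr_less[OF n, of s] by auto
  ultimately have "r - rr n s = 0" "rr n s - r = 0" by (auto dest: dvd_imp_le)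
  then show ?thesis by simp
qed

lemma cc_mult: "n \<ge> 1 \<Longrightarrow> n * cc n s = s + rr n s"
  using rr_dvd by (simp add: cc_def)

lemma cc_one: "1 \<le> a \<Longrightarrow> a \<le> n \<Longrightarrow> rr n a = n - a \<and> cc n a = 1"
proof -
  assume a: "1 \<le> a" "a \<le> n"
  have "rr n a = n - a" using a by (intro rr_eqI) auto
  then show ?thesis using a by (simp add: cc_def)
qed

lemma cc_step:
  assumes "1 \<le> a" "a \<le> n"
  shows "cc n (s + a) = cc n s \<or> cc n (s + a) = cc n s + 1"
proof -
  have n: "n \<ge> 1" using assms by simp
  have e: "n * cc n s = s + rr n s" "n * cc n (s + a) = s + a + rr n (s + a)" using cc_mult[OF n] by auto
  have l: "rr n s < n" "rr n (s + a) < n" using rr_less[OF n] by auto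
  have "n * cc n (s + a) < n * (cc n s + 2)" using e l assms by (simp add: algebra_simps)
  moreover have "n * cc n s < n * (cc n (s + a) + 1)" using e l assms by (simp add: algebra_simps)
  ultimately have "cc n (s + a) < cc n s + 2" "cc n s < cc n (s + a) + 1" by (simp_all only: mult_less_cancel1)
  then show ?thesis by linarith
qed

lemma nat_cong_range: "1 \<le> a \<Longrightarrow> a \<le> n \<Longrightarrow> 1 \<le> b \<Longrightarrow> b \<le> n \<Longrightarrow> [int a = int b] (mod int n) \<Longrightarrow> a = b"
proof -
  assume h: "1 \<le> a" "a \<le> n" "1 \<le> b" "b \<le> n" "[int a = int b] (mod int n)"
  have d: "int n dvd int a - int b" using h(5) by (simp add: cong_iff_dvd_diff)
  have "\<bar>int a - int b\<bar> < int n" using h by linarith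
  then have "int a - int b = 0" using d zdvd_not_zless[of "\<bar>int a - int b\<bar>" "int n"] by fastforce
  then show ?thesis by simp
qed

text \<open>The configuration in which both \<open>n e\<close> and \<open>n f\<close> equal the common block sum: writing the
  remaining terms as \<open>\<alpha> e + \<beta> f\<close>, the quantity \<open>c = n + 1 - \<alpha> - \<beta>\<close> measures by how much the shortest
  zero-sum through a term exceeds length \<open>n\<close>.\<close>

locale carry =
  fixes n :: nat and Q :: "nat set" and al be c :: "nat \<Rightarrow> nat"
  assumes n2: "n \<ge> 2" and finQ: "finite Q" and cardQ: "card Q = n + 1"
    and al: "\<And>i. i \<in> Q \<Longrightarrow> 1 \<le> al i \<and> al i \<le> n" and be: "\<And>i. i \<in> Q \<Longrightarrow> 1 \<le> be i \<and> be i \<le> n"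
    and c: "\<And>i. i \<in> Q \<Longrightarrow> al i + be i + c i = n + 1"
    and sal: "n dvd sum al Q + (n - 1)" and sbe: "n dvd sum be Q + (n - 1)"
    and Yc: "\<And>X. X \<subseteq> Q \<Longrightarrow> X \<noteq> {} \<Longrightarrow> X \<noteq> Q \<Longrightarrow> rr n (sum al X) + rr n (sum be X) + card X = n + sum c X"
begin

lemma swap: "carry n Q be al c"
  by unfold_locales (use n2 finQ cardQ al be c sal sbe Yc in \<open>auto simp: add_ac\<close>)

lemma finsub: "X \<subseteq> Q \<Longrightarrow> finite X" using finQ finite_subset by blast

lemma rr_Diff:
  assumes f: "\<And>i. i \<in> Q \<Longrightarrow> 1 \<le> f i \<and> f i \<le> n" "n dvd sum f Q + (n - 1)" and i: "i \<in> Q"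
  shows "rr n (sum f (Q - {i})) = f i - 1"
proof (rule rr_eqI)
  show "f i - 1 < n" using f(1)[OF i] by linarith
  have "sum f Q + (n - 1) = (sum f (Q - {i}) + (f i - 1)) + n"
    using sum.remove[OF finQ i, of f] f(1)[OF i] n2 by simp
  then show "n dvd sum f (Q - {i}) + (f i - 1)" using f(2) by (metis dvd_add_left_iff dvd_refl)
qed

text \<open>Without one term \<open>i\<close>, the sums of \<open>al\<close> and \<open>be\<close>
  fall short of a multiple of \<open>n\<close> by \<open>al i - 1\<close> and
  \<open>be i - 1\<close>; the relation for \<open>Q - {i}\<close> then gives the total.\<close>

lemma sum_c: "sum c Q = n - 1"
proof -
  have "card Q > 0" using cardQ by simp
  then obtain i where i: "i \<in> Q" by (metis card_gt_0_iff ex_in_conv)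
  have "card (Q - {i}) = n" using i cardQ finQ by simp
  moreover have "Q - {i} \<noteq> {}"
  proof
    assume "Q - {i} = {}"
    then show False using \<open>card (Q - {i}) = n\<close> n2 by (simp only: card.empty)
  qed
  moreover have "Q - {i} \<noteq> Q" using i by auto
  ultimately have "(al i - 1) + (be i - 1) + n = n + sum c (Q - {i})"
    using Yc[of "Q - {i}"] rr_Diff[OF al sal i] rr_Diff[OF be sbe i] \<open>card (Q - {i}) = n\<close> by auto
  moreover have "sum c Q = c i + sum c (Q - {i})" using sum.remove[OF finQ i] .
  ultimately show ?thesis using c[OF i] al[OF i] be[OF i] by linarith
qed

text \<open>With all \<open>c\<close> at most 1, exactly \<open>n-1\<close> terms have
  \<open>c = 1\<close>. If their \<open>al\<close> values had a zero-sum \<open>A\<close>, the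
  relation for \<open>A\<close> would require \<open>rr n (sum be A) = n\<close>, which is out of
  range. So these values are zero-sum free modulo \<open>n\<close> of maximal length.\<close>

lemma ones_const:
  assumes "\<And>i. i \<in> Q \<Longrightarrow> c i \<le> 1"
  shows "\<exists>a. coprime a (int n) \<and> (\<forall>i\<in>Q. c i = 1 \<longrightarrow> [int (al i) = a] (mod int n))"
proof -
  define P where "P = {i\<in>Q. c i = 1}"
  have fP: "finite P" "P \<subseteq> Q" using finQ by (auto simp: P_def)
  have "sum c Q = sum c P"
  proof (intro sum.mono_neutral_right)
    show "\<forall>i\<in>Q - P. c i = 0"
    proof
      fix i assume "i \<in> Q - P"
      then have "c i \<noteq> 1" "c i \<le> 1" using assms by (auto simp: P_def)
      then show "c i = 0" by linarith
    qed
  qed (use fP finQ in auto)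
  also have "\<dots> = card P" by (simp add: P_def)
  finally have cP: "card P = n - 1" using sum_c by simp
  have nz: "\<not> int n dvd (\<Sum>i\<in>A. int (al i))" if A: "A \<subseteq> P" "A \<noteq> {}" for A
  proof
    assume "int n dvd (\<Sum>i\<in>A. int (al i))"
    then have "n dvd sum al A + 0" by (simp add: int_dvd_int_iff flip: of_nat_sum)
    then have "rr n (sum al A) = 0" using n2 by (intro rr_eqI) auto
    moreover have "A \<noteq> Q" using A(1) cP cardQ n2 card_mono[OF fP(1) A(1)] by auto
    moreover have "sum c A = card A" using A(1) by (simp add: P_def subset_iff)
    ultimately have "rr n (sum be A) = n" using Yc[of A] A fP(2) by simp
    then show False using rr_less[of n "sum be A"] n2 by simp
  qed
  have n1: "n \<ge> 1" using n2 by simp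
  have "card P > 0" using cP n2 by simp
  then obtain j where j: "j \<in> P" by (metis card_gt_0_iff ex_in_conv)
  have "coprime (int (al j)) (int n)" by (rule zero_sum_free_coprime[OF n1 fP(1) cP nz j])
  moreover have "[int (al i) = int (al j)] (mod int n)" if "i \<in> P" for i
    by (rule zero_sum_free_const[OF n1 fP(1) cP nz that j])
  ultimately show ?thesis unfolding P_def by blast
qed

text \<open>\<open>q1\<close> is a further copy of \<open>e\<close>. With \<open>q1\<close> and
  another term left out, the \<open>n-1\<close> remaining \<open>al\<close> values are zero-sum
  free: for a zero-sum \<open>A\<close>, comparing the relations for \<open>A\<close> and for
  \<open>insert q1 A\<close> pushes \<open>rr n (sum be A)\<close> up to \<open>n\<close>. Hence
  they all equal \<open>al q2 = 1\<close>.\<close>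

lemma two_e_all_one:
  assumes n3: "n \<ge> 3" and q: "q1 \<in> Q" "q2 \<in> Q" "q1 \<noteq> q2" "al q1 = 1" "be q1 = n" "al q2 = 1" and i: "i \<in> Q"
  shows "al i = 1"
proof (cases "i = q1 \<or> i = q2")
  case False
  have "card (Q - {q1, q2, i}) = n - 2" using q i False cardQ finQ by (simp add: card_Diff_subset)
  then have "card (Q - {q1, q2, i}) > 0" using n3 by simp
  then obtain o' where o: "o' \<in> Q - {q1, q2, i}" by (metis card_gt_0_iff ex_in_conv)
  let ?B = "Q - {q1, o'}"
  have cB: "card ?B = n - 1" using q o cardQ finQ by (simp add: card_Diff_subset)
  have fB: "finite ?B" using finQ by simp
  have c1: "c q1 = 0" using c[OF q(1)] q by simp
  have nz: "\<not> int n dvd (\<Sum>i\<in>A. int (al i))" if A: "A \<subseteq> ?B" "A \<noteq> {}" for A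
  proof
    assume "int n dvd (\<Sum>i\<in>A. int (al i))"
    then have d: "n dvd sum al A" by (simp add: int_dvd_int_iff flip: of_nat_sum)
    then have "rr n (sum al A) = 0" using n2 by (intro rr_eqI) auto
    moreover have AQ: "A \<subseteq> Q" "A \<noteq> Q" using A q by auto
    ultimately have 1: "rr n (sum be A) + card A = n + sum c A" using Yc[OF AQ(1) A(2) AQ(2)] by simp
    have fA: "finite A" "q1 \<notin> A" using A finsub[OF AQ(1)] by auto
    have AQ': "insert q1 A \<subseteq> Q" "insert q1 A \<noteq> {}" "insert q1 A \<noteq> Q" using A q o by auto
    have "sum al (insert q1 A) = 1 + sum al A" using fA q by simp
    moreover have "rr n (1 + sum al A) = n - 1"
      using d n2 by (intro rr_eqI) auto
    ultimately have "n - 1 + rr n (sum be (insert q1 A)) + (1 + card A) = n + sum c A"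
      using Yc[OF AQ'] fA c1 by simp
    then have "card A \<le> sum c A" using n2 by linarith
    then show False using 1 rr_less[of n "sum be A"] n2 by linarith
  qed
  have n1: "n \<ge> 1" using n2 by simp
  have "[int (al i) = int (al q2)] (mod int n)"
    by (rule zero_sum_free_const[OF n1 fB cB nz]) (use i q o False in auto)
  then show ?thesis using nat_cong_range[of "al i" n "al q2"] al[OF i] al[OF q(2)] q by simp
qed (use q in auto)

text \<open>A copy of \<open>e\<close> and one of \<open>f\<close> together would need
  \<open>n-1\<close> further copies of each, so the completed length would be \<open>2n\<close>
  instead of \<open>n\<close>.\<close>

lemma not_e_and_f:
  assumes "q1 \<in> Q" "q2 \<in> Q" "al q1 = 1" "be q1 = n" "al q2 = n" "be q2 = 1" shows False
proof -
  have ne: "q1 \<noteq> q2" using assms n2 by auto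
  have "card {q1, q2} = 2" using ne by simp
  then have "{q1, q2} \<noteq> Q" using cardQ n2 by auto
  moreover have "c q1 = 0" "c q2 = 0" using c[OF assms(1)] c[OF assms(2)] assms by auto
  moreover have "rr n (1 + n) = n - 1" "rr n (n + 1) = n - 1" using n2 by (auto intro!: rr_eqI)
  ultimately show False using Yc[of "{q1, q2}"] assms ne n2 by auto
qed

text \<open>The \<open>e\<close>-coordinate of \<open>t\<close> equal terms with
  \<open>c = 0\<close> would be 1 modulo \<open>n\<close>, so their completion takes
  \<open>n-1\<close> copies of \<open>e\<close>; with \<open>t \<ge> 2\<close> its length exceeds
  the value \<open>n\<close> prescribed by \<open>Yc\<close>.\<close>

lemma no_third_value:
  assumes G: "G \<subseteq> Q" "card G = n - 1" "\<And>i. i \<in> G \<Longrightarrow> al i = a \<and> c i = 0" and t: "2 \<le> t" "t \<le> n - 1"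
    and ta: "[int t * int a = 1] (mod int n)"
  shows False
proof -
  obtain X where X: "X \<subseteq> G" "card X = t" using subset_of_card[of t G] G(2) t by auto
  have XQ: "X \<subseteq> Q" "X \<noteq> {}" using X G t by auto
  have "X \<noteq> Q" using X t cardQ by auto
  have "sum al X = t * a" using X G(3) by (simp add: subset_iff)
  moreover have "rr n (t * a) = n - 1"
  proof (rule rr_eqI)
    have "int n dvd int t * int a - 1" using ta by (simp add: cong_iff_dvd_diff)
    then have "int n dvd (int t * int a - 1) + int n" by simp
    moreover have "(int t * int a - 1) + int n = int (t * a + (n - 1))" using n2 by simp
    ultimately show "n dvd t * a + (n - 1)" by (simp only: int_dvd_int_iff)
  qed (use n2 in auto)
  moreover have "sum c X = 0" using X G(3) by (simp add: subset_iff)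
  ultimately show False using Yc[OF XQ \<open>X \<noteq> Q\<close>] X t n2 by simp
qed

end

lemma cong_tri:
  fixes a b x y N :: int
  shows "[a = x] (mod N) \<Longrightarrow> [b = y] (mod N) \<Longrightarrow> [a = b] (mod N) \<Longrightarrow> [x = y] (mod N)"
  by (simp add: cong_def)

section \<open>Coordinates modulo n with respect to two terms\<close>

context short_zs_free
begin

definition lin :: "nat \<Rightarrow> int \<Rightarrow> nat \<Rightarrow> int \<Rightarrow> nat \<Rightarrow> bool" where
  "lin i s w t z \<longleftrightarrow> [p i = s * p w + t * p z] (mod int n) \<and> [q i = s * q w + t * q z] (mod int n)"

definition det :: "nat \<Rightarrow> nat \<Rightarrow> bool" where
  "det w z \<longleftrightarrow> coprime (p w * q z - p z * q w) (int n)"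

text \<open>\<open>cen M w z\<close>: the term \<open>w\<close> is a center of \<open>M\<close>, the other terms lying in \<open>z + \<langle>w\<rangle>\<close> after reduction.\<close>

definition cen :: "nat set \<Rightarrow> nat \<Rightarrow> nat \<Rightarrow> bool" where
  "cen M w z \<longleftrightarrow> det w z \<and> (\<forall>i\<in>M. eqv i w \<or> (\<exists>x. lin i x w 1 z))"

lemma det_sym: "det w z \<Longrightarrow> det z w"
  unfolding det_def by (metis coprime_minus_left_iff minus_diff_eq)

lemma lin_ex: "det w z \<Longrightarrow> \<exists>s t. lin i s w t z"
  using unimodular_solve[of "p w" "q z" "p z" "q w" "int n" "p i" "q i"] by (simp add: det_def lin_def)

lemma lin_indep:
  assumes "det w z" "int n dvd s * p w + t * p z" "int n dvd s * q w + t * q z"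
  shows "int n dvd s" "int n dvd t"
  using assms unfolding det_def by (rule unimodular_indep)+

lemma lin_unique:
  assumes d: "det w z" and "lin i s w t z" "lin j s' w t' z" "eqv i j"
  shows "[s = s'] (mod int n)" "[t = t'] (mod int n)"
proof -
  have a: "[p i = s * p w + t * p z] (mod int n)" "[q i = s * q w + t * q z] (mod int n)"
    using assms(2) by (auto simp: lin_def)
  have b: "[p j = s' * p w + t' * p z] (mod int n)" "[q j = s' * q w + t' * q z] (mod int n)"
    using assms(3) by (auto simp: lin_def)
  have c: "[p i = p j] (mod int n)" "[q i = q j] (mod int n)" using assms(4) by (auto simp: eqv_def)
  have e: "int n dvd (s - s') * p w + (t - t') * p z" "int n dvd (s - s') * q w + (t - t') * q z"
    using cong_tri[OF a(1) b(1) c(1)] cong_tri[OF a(2) b(2) c(2)]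
    by (simp_all add: cong_iff_dvd_diff algebra_simps)
  show "[s = s'] (mod int n)" "[t = t'] (mod int n)"
    unfolding cong_iff_dvd_diff by (rule lin_indep[OF d e])+
qed

lemma lin_cong: "lin i s w t z \<Longrightarrow> [s = s'] (mod int n) \<Longrightarrow> [t = t'] (mod int n) \<Longrightarrow> lin i s' w t' z"
  unfolding lin_def by (auto elim!: cong_trans intro!: cong_add cong_scalar_right)

lemma lin_eqv_left: "lin i s w t z \<Longrightarrow> eqv i j \<Longrightarrow> lin j s w t z"
  unfolding lin_def eqv_def by (simp add: cong_def)

lemma lin_eqv_right: "lin i s w t z \<Longrightarrow> eqv w w' \<Longrightarrow> eqv z z' \<Longrightarrow> lin i s w' t z'"
  unfolding lin_def eqv_def by (auto elim!: cong_trans intro!: cong_add cong_scalar_left)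

lemma lin_eqv: "lin i s w t z \<Longrightarrow> lin j s w t z \<Longrightarrow> eqv i j"
  unfolding lin_def eqv_def by (simp add: cong_def)

lemma lin_self: "lin w 1 w 0 z" "lin z 0 w 1 z" by (auto simp: lin_def)

lemma lin_comm: "lin i s w t z \<longleftrightarrow> lin i t z s w" by (simp add: lin_def add.commute)

lemma det_eqv: "det w z \<Longrightarrow> eqv w w' \<Longrightarrow> eqv z z' \<Longrightarrow> det w' z'"
proof -
  assume d: "det w z" and e: "eqv w w'" "eqv z z'"
  have "[p w * q z - p z * q w = p w' * q z' - p z' * q w'] (mod int n)"
    using e unfolding eqv_def by (intro cong_diff cong_mult) auto
  then show "det w' z'" using d cong_imp_coprime unfolding det_def by blast
qed

text \<open>Passing from \<open>z\<close> to \<open>i\<close> multiplies the determinant by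
  \<open>t\<close>.\<close>

lemma det_lin:
  assumes "det w z" "lin i s w t z"
  shows "det w i \<longleftrightarrow> coprime t (int n)"
proof -
  have "[p w * q i - p i * q w = p w * (s * q w + t * q z) - (s * p w + t * p z) * q w] (mod int n)"
    using assms(2) unfolding lin_def by (intro cong_diff cong_mult cong_refl) auto
  moreover have "p w * (s * q w + t * q z) - (s * p w + t * p z) * q w = t * (p w * q z - p z * q w)"
    by (simp add: algebra_simps)
  ultimately have "[p w * q i - p i * q w = t * (p w * q z - p z * q w)] (mod int n)" by simp
  then have "coprime (p w * q i - p i * q w) (int n) \<longleftrightarrow> coprime (t * (p w * q z - p z * q w)) (int n)"
    using cong_imp_coprime cong_sym by blast
  then show ?thesis using assms(1) unfolding det_def by simp
qed

lemma det_not_eqv: assumes "det w z" shows "\<not> eqv w z"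
proof
  assume "eqv w z"
  then have "[(1::int) = 0] (mod int n)" using lin_unique(1)[OF assms lin_self(1) lin_self(2)] by simp
  then have "int n dvd 1" by (simp add: cong_iff_dvd_diff)
  then show False using n2 by simp
qed

lemma coset_shift:
  assumes "lin i x w 1 z" "lin j y w 1 z"
  shows "lin i (x - y) w 1 j"
proof -
  have "[(x - y) * f w + 1 * f j = (x - y) * f w + 1 * (y * f w + 1 * f z)] (mod int n)"
    if "f = p \<or> f = q" for f
    using assms(2) that unfolding lin_def by (intro cong_add cong_refl cong_scalar_left) auto
  then have "[(x - y) * f w + 1 * f j = x * f w + 1 * f z] (mod int n)" if "f = p \<or> f = q" for f
    using that by (simp add: algebra_simps)
  from this[of p] this[of q] show ?thesis using assms(1) unfolding lin_def by (simp add: cong_def)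
qed

lemma sum_lin:
  assumes "f = p \<or> f = q" "\<And>i. i \<in> X \<Longrightarrow> lin i (s i) w (t i) z"
  shows "[sum f X = sum s X * f w + sum t X * f z] (mod int n)"
proof -
  have "[sum f X = (\<Sum>i\<in>X. s i * f w + t i * f z)] (mod int n)"
    using assms unfolding lin_def by (intro cong_sum) auto
  then show ?thesis by (simp add: sum.distrib sum_distrib_right)
qed

lemma zs_lin:
  assumes "X \<noteq> {}" "\<And>i. i \<in> X \<Longrightarrow> lin i (s i) w (t i) z" "int n dvd sum s X" "int n dvd sum t X"
  shows "zs n p q X"
proof -
  have "int n dvd sum f X" if f: "f = p \<or> f = q" for f
  proof -
    have "[sum f X = sum s X * f w + sum t X * f z] (mod int n)" by (rule sum_lin[OF f assms(2)])
    moreover have "int n dvd sum s X * f w + sum t X * f z" using assms(3,4) by simp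
    ultimately show ?thesis by (simp add: cong_dvd_iff)
  qed
  then show ?thesis using assms(1) by (auto simp: zs_def)
qed

lemma zs_lin_dest:
  assumes d: "det w z" and z: "zs n p q X" and l: "\<And>i. i \<in> X \<Longrightarrow> lin i (s i) w (t i) z"
  shows "int n dvd sum s X" "int n dvd sum t X"
proof -
  have *: "int n dvd sum s X * f w + sum t X * f z" if f: "f = p \<or> f = q" for f
  proof -
    have "[sum f X = sum s X * f w + sum t X * f z] (mod int n)" by (rule sum_lin[OF f l])
    moreover have "int n dvd sum f X" using z f by (auto simp: zs_def)
    ultimately show ?thesis using cong_dvd_iff by blast
  qed
  have "int n dvd sum s X * p w + sum t X * p z" "int n dvd sum s X * q w + sum t X * q z"
    by (rule *; simp)+
  then show "int n dvd sum s X" "int n dvd sum t X" by (rule lin_indep[OF d])+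
qed

text \<open>The sum of \<open>n-1\<close> copies of \<open>u\<close> is \<open>-u\<close> modulo
  \<open>n\<close>, which leaves only \<open>u\<close> for the last term.\<close>

lemma last_term_eqv:
  assumes z: "zs n p q W" and W: "card W = n" and E: "E \<subseteq> W" "card E = n - 1" "\<And>i. i \<in> E \<Longrightarrow> eqv i u"
  shows "\<exists>w. w \<in> W - E \<and> W = insert w E \<and> eqv w u"
proof -
  have fW: "finite W" using W n2 by (metis card.infinite not_numeral_le_zero)
  have fE: "finite E" using E fW finite_subset by blast
  have "card (W - E) = 1" using W E card_Diff_subset[OF fE E(1)] n2 by simp
  then obtain w where w: "W - E = {w}" by (auto simp: card_1_singleton_iff)
  have W': "W = insert w E" "w \<notin> E" using w E(1) by auto
  have "[f w = f u] (mod int n)" if f: "f = p \<or> f = q" for f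
  proof -
    have "[f w + sum f E = f w + int (card E) * f u] (mod int n)"
      using E(3) f by (intro cong_add cong_refl sum_cong_const) (auto simp: eqv_def)
    moreover have "int n dvd f w + sum f E" using z W' fE f by (auto simp: zs_def)
    ultimately have "int n dvd f w + int (card E) * f u" using cong_dvd_iff by blast
    moreover have "int (card E) = int n - 1" using E(2) n2 by simp
    ultimately have "int n dvd f w + (int n - 1) * f u - int n * f u" using dvd_diff dvd_triv_left by metis
    then show ?thesis by (simp add: cong_iff_dvd_diff algebra_simps)
  qed
  then have "eqv w u" by (simp add: eqv_def)
  then show ?thesis using w W' by blast
qed

end

text \<open>The hypothesis for \<open>k \<le> 1\<close>, brought into index form: an extremal set
  has \<open>2n-1\<close> terms, is a minimal zero-sum and has a center of multiplicity
  \<open>n-1\<close>.\<close>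

locale minimal_zs = short_zs_free n m "1::nat" p q L for n m p q L +
  assumes str: "good X \<Longrightarrow> zs n p q X \<and> (\<exists>w\<in>X. \<exists>z\<in>X. cen X w z \<and> card {i\<in>X. eqv i w} = n - 1)"

section \<open>A block and the rest with two classes of n-1 terms\<close>

locale minimal_dec = minimal_zs n m p q L + decomposition n m "1::nat" p q L B for n m p q L B

text \<open>The situation left over when a block exchange produces two different centers
  \<open>u\<close> and \<open>v\<close>: each occurs \<open>n-1\<close> times, and the other
  \<open>n+1\<close> terms of block and rest have coordinates with respect to them. The aim is
  \<open>center_exists\<close>.\<close>

locale equal_pair = minimal_dec n m p q L B for n m p q L B +
  fixes l :: nat and E F :: "nat set" and u v :: nat and al be :: "nat \<Rightarrow> nat"
  assumes l: "l < m - 1" and EV: "E \<subseteq> B l \<union> R" and FV: "F \<subseteq> B l \<union> R" and EF: "E \<inter> F = {}"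
    and cE: "card E = n - 1" and cF: "card F = n - 1" and uE: "u \<in> E" and vF: "v \<in> F"
    and eE: "\<And>i. i \<in> E \<Longrightarrow> eqv i u" and eF: "\<And>i. i \<in> F \<Longrightarrow> eqv i v" and duv: "det u v"
    and al: "\<And>i. i \<in> B l \<union> R - (E \<union> F) \<Longrightarrow> 1 \<le> al i \<and> al i \<le> n"
    and be: "\<And>i. i \<in> B l \<union> R - (E \<union> F) \<Longrightarrow> 1 \<le> be i \<and> be i \<le> n"
    and ab: "\<And>i. i \<in> B l \<union> R - (E \<union> F) \<Longrightarrow> lin i (int (al i)) u (int (be i)) v"
begin

lemma swapped: "equal_pair n m p q L B l F E v u be al"
  by unfold_locales (use l EV FV EF cE cF uE vF eE eF det_sym[OF duv] al be ab lin_comm in \<open>auto simp: Un_commute\<close>)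

abbreviation "V \<equiv> B l \<union> R"
abbreviation "Q \<equiv> B l \<union> R - (E \<union> F)"

lemma n1: "n \<ge> 1" using n2 by simp

lemma finV: "finite V" using BL(1)[OF l] RL finL' by auto

lemma cardV: "card V = 3 * n - 1" using cardBR[OF l] n2 by simp

lemma fins: "finite E" "finite F" "finite Q" using EV FV finV finite_subset by auto

lemma cardQ: "card Q = n + 1"
proof -
  have "card (E \<union> F) = 2 * n - 2" using EF fins cE cF by (simp add: card_Un_disjoint)
  moreover have "card Q = card V - card (E \<union> F)" using EV FV fins by (intro card_Diff_subset) auto
  ultimately show ?thesis using cardV n2 by simp
qed

lemma zsV: "zs n p q V"
  using zs_Un[OF BL(2)[OF l] conjunct1[OF str[OF goodR]] BR[OF l]] BL(1)[OF l] RL finL' by auto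

lemma linE: "i \<in> E \<Longrightarrow> lin i 1 u 0 v" and linF: "i \<in> F \<Longrightarrow> lin i 0 u 1 v"
  using lin_eqv_left[OF lin_self(1)] lin_eqv_left[OF lin_self(2)] eE eF eqv_sym by blast+

definition sc :: "nat \<Rightarrow> int" where "sc i = (if i \<in> E then 1 else if i \<in> F then 0 else int (al i))"
definition tc :: "nat \<Rightarrow> int" where "tc i = (if i \<in> E then 0 else if i \<in> F then 1 else int (be i))"

lemma lin_st: "i \<in> V \<Longrightarrow> lin i (sc i) u (tc i) v"
  using linE[of i] linF[of i] ab[of i] EF by (auto simp: sc_def tc_def)

lemma sum_parts:
  fixes f :: "nat \<Rightarrow> int"
  assumes "X \<subseteq> Q" "E' \<subseteq> E" "F' \<subseteq> F"
  shows "sum f (X \<union> (E' \<union> F')) = sum f X + (sum f E' + sum f F')"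
    and "card (X \<union> (E' \<union> F')) = card X + (card E' + card F')"
proof -
  have f: "finite X" "finite E'" "finite F'" using assms fins finite_subset by blast+
  have d: "X \<inter> (E' \<union> F') = {}" "E' \<inter> F' = {}" using assms EF by blast+
  show "sum f (X \<union> (E' \<union> F')) = sum f X + (sum f E' + sum f F')" using f d by (simp add: sum.union_disjoint)
  show "card (X \<union> (E' \<union> F')) = card X + (card E' + card F')" using f d by (simp add: card_Un_disjoint)
qed

lemma sum_st:
  assumes "X \<subseteq> Q" "E' \<subseteq> E" "F' \<subseteq> F"
  shows "sum sc (X \<union> (E' \<union> F')) = int (sum al X + card E')" "sum tc (X \<union> (E' \<union> F')) = int (sum be X + card F')"
proof -
  have "sum sc X = int (sum al X)" "sum tc X = int (sum be X)" unfolding of_nat_sum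
    using assms(1) by (intro sum.cong; auto simp: sc_def tc_def)+
  moreover have "sum sc E' = (\<Sum>i\<in>E'. 1)" "sum tc E' = (\<Sum>i\<in>E'. 0)"
    using assms(2) by (intro sum.cong; auto simp: sc_def tc_def)+
  moreover have "sum sc F' = (\<Sum>i\<in>F'. 0)" "sum tc F' = (\<Sum>i\<in>F'. 1)"
    using assms(3) EF by (intro sum.cong; auto simp: sc_def tc_def)+
  ultimately show "sum sc (X \<union> (E' \<union> F')) = int (sum al X + card E')" "sum tc (X \<union> (E' \<union> F')) = int (sum be X + card F')"
    unfolding sum_parts(1)[OF assms] by simp_all
qed

lemma zs_parts:
  assumes X: "X \<subseteq> Q" "X \<noteq> {}" "E' \<subseteq> E" "F' \<subseteq> F" "n dvd sum al X + card E'" "n dvd sum be X + card F'"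
  shows "zs n p q (X \<union> (E' \<union> F'))"
proof (rule zs_lin)
  show "int n dvd sum sc (X \<union> (E' \<union> F'))" "int n dvd sum tc (X \<union> (E' \<union> F'))"
    unfolding sum_st[OF X(1,3,4)] using X(5,6) by (simp_all only: int_dvd_int_iff)
  show "lin i (sc i) u (tc i) v" if "i \<in> X \<union> (E' \<union> F')" for i
    using that X(1,3,4) EV FV by (intro lin_st) blast
qed (use X in auto)

lemma total: "n dvd sum al Q + (n - 1)" "n dvd sum be Q + (n - 1)"
proof -
  have V: "V = Q \<union> (E \<union> F)" using EV FV by blast
  have "int n dvd sum sc V" "int n dvd sum tc V" using zs_lin_dest[OF duv zsV lin_st] by auto
  then have "int n dvd int (sum al Q + card E)" "int n dvd int (sum be Q + card F)"
    using sum_st[of Q E F] V by simp_all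
  then show "n dvd sum al Q + (n - 1)" "n dvd sum be Q + (n - 1)" unfolding cE cF by (simp_all only: int_dvd_int_iff)
qed

lemma complete:
  assumes X: "X \<subseteq> Q" "X \<noteq> {}"
  shows "\<exists>E' F'. E' \<subseteq> E \<and> F' \<subseteq> F \<and> card E' = rr n (sum al X) \<and> card F' = rr n (sum be X) \<and> zs n p q (X \<union> (E' \<union> F'))"
proof -
  have le: "rr n (sum al X) \<le> card E" "rr n (sum be X) \<le> card F"
    using rr_less[OF n1, of "sum al X"] rr_less[OF n1, of "sum be X"] cE cF by linarith+
  obtain E' F' where EF': "E' \<subseteq> E" "card E' = rr n (sum al X)" "F' \<subseteq> F" "card F' = rr n (sum be X)"
    using subset_of_card[OF le(1)] subset_of_card[OF le(2)] by blast
  then have "zs n p q (X \<union> (E' \<union> F'))" using X rr_dvd[OF n1] by (intro zs_parts) auto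
  then show ?thesis using EF' by blast
qed

lemma length_ge:
  assumes X: "X \<subseteq> Q" "X \<noteq> {}"
  shows "n \<le> card X + (rr n (sum al X) + rr n (sum be X))"
proof -
  obtain E' F' where EF': "E' \<subseteq> E" "F' \<subseteq> F" "card E' = rr n (sum al X)" "card F' = rr n (sum be X)"
    "zs n p q (X \<union> (E' \<union> F'))" using complete[OF X] by blast
  have "X \<union> (E' \<union> F') \<subseteq> V" using X EF' EV FV by blast
  then have "n \<le> card (X \<union> (E' \<union> F'))" using zs_card_ge[OF l] EF'(5) by blast
  then show ?thesis using sum_parts(2)[OF X(1) EF'(1,2)] EF'(3,4) by simp
qed

text \<open>A proper subset \<open>X\<close> has at most \<open>n\<close> terms and is completed by
  at most \<open>2(n-1)\<close> copies of \<open>u\<close> and \<open>v\<close>; the total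
  \<open>3n-2\<close> is just the length up to which the sum is prescribed.\<close>

lemma sum_q_parts:
  assumes X: "X \<subseteq> Q" "X \<noteq> {}" "X \<noteq> Q" and EF': "E' \<subseteq> E" "F' \<subseteq> F" "card E' = rr n (sum al X)" "card F' = rr n (sum be X)"
  shows "[sum q X + (sum q E' + sum q F') = int n * \<gamma>] (mod int (m * n))"
proof -
  have z: "zs n p q (X \<union> (E' \<union> F'))" using X EF' rr_dvd[OF n1] by (intro zs_parts) auto
  have "card X < n + 1" using psubset_card_mono[OF fins(3), of X] X(1,3) cardQ by auto
  then have "card (X \<union> (E' \<union> F')) \<le> 3 * n - 1 - 1"
    using sum_parts(2)[OF X(1) EF'(1,2)] EF'(3,4) rr_less[OF n1, of "sum al X"] rr_less[OF n1, of "sum be X"] n2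
    by linarith
  moreover have "X \<union> (E' \<union> F') \<subseteq> V" using X EF' EV FV by blast
  ultimately show ?thesis using sum_q_block[OF l _ z] sum_parts(1)[OF X(1) EF'(1,2)] by simp
qed

text \<open>A single term is completed to length \<open>2n + 1 - al i - be i\<close>, and no
  zero-sum here is shorter than \<open>n\<close>.\<close>

lemma al_be_le: assumes "i \<in> Q" shows "al i + be i \<le> n + 1"
  using length_ge[of "{i}"] assms cc_one[of "al i" n] cc_one[of "be i" n] al[OF assms] be[OF assms] by auto

lemma eqv_v_iff: "i \<in> Q \<Longrightarrow> al i = n \<Longrightarrow> be i = 1 \<Longrightarrow> eqv i v"
proof -
  assume i: "i \<in> Q" "al i = n" "be i = 1"
  have "lin i 0 u 1 v" using lin_cong[OF ab[OF i(1)], of 0 1] i by (simp add: cong_def)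
  then show "eqv i v" using lin_eqv lin_self(2) by blast
qed

lemma eqv_v_dest: assumes i: "i \<in> Q" "eqv i v" shows "al i = n \<and> be i = 1"
proof -
  have "[int (al i) = 0] (mod int n)" "[int (be i) = 1] (mod int n)"
    using lin_unique[OF duv ab[OF i(1)] lin_self(2) i(2)] by auto
  then have "[int (al i) = int n] (mod int n)" "[int (be i) = int 1] (mod int n)" by (simp_all add: cong_def)
  then show ?thesis using nat_cong_range[of "al i" n n] nat_cong_range[of "be i" n 1] al[OF i(1)] be[OF i(1)] n1 by simp
qed

lemma al_eq_one: assumes i: "i \<in> Q" "lin i x v 1 u" shows "al i = 1"
proof -
  have "lin i 1 u x v" by (rule lin_comm[THEN iffD1, OF i(2)])
  then have "[int (al i) = int 1] (mod int n)" using lin_unique(1)[OF duv ab[OF i(1)] _ eqv_refl] by simp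
  then show ?thesis using nat_cong_range[of "al i" n 1] al[OF i(1)] n1 by simp
qed

text \<open>\<open>al i = 1\<close> places the term in \<open>u + <v>\<close>;
  \<open>al i = n\<close> forces \<open>be i = 1\<close>, so that the term is a copy of
  \<open>v\<close>.\<close>

lemma cen_v: assumes "\<And>i. i \<in> Q \<Longrightarrow> al i = 1 \<or> al i = n" shows "cen V v u"
  unfolding cen_def
proof (intro conjI ballI)
  show "det v u" by (rule det_sym[OF duv])
  fix i assume i: "i \<in> V"
  consider "i \<in> E" | "i \<in> F" | "i \<in> Q" using i by blast
  then show "eqv i v \<or> (\<exists>x. lin i x v 1 u)"
  proof cases
    case 1
    then show ?thesis using lin_comm[THEN iffD1, OF linE[OF 1]] by blast
  next
    case 2
    then show ?thesis using eF by blast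
  next
    case 3
    show ?thesis
    proof (cases "al i = 1")
      case True
      then show ?thesis using lin_comm[THEN iffD1, OF ab[OF 3]] by auto
    next
      case False
      then have "al i = n" using assms[OF 3] by blast
      then have "be i = 1" using al_be_le[OF 3] be[OF 3] by linarith
      then show ?thesis using eqv_v_iff[OF 3 \<open>al i = n\<close>] by blast
    qed
  qed
qed

text \<open>The completion of \<open>i\<close> uses \<open>n - al i\<close> terms of
  \<open>E\<close>, at least one and not all, so terms of \<open>E\<close> can be exchanged in
  it.\<close>

lemma E_const:
  assumes i: "i \<in> Q" "al i \<noteq> 1" "al i \<noteq> n" and j: "j \<in> E" "j' \<in> E"
  shows "[q j = q j'] (mod int (m * n))"
proof (cases "j = j'")
  case False
  have a: "2 \<le> al i" "al i \<le> n - 1" using al[OF i(1)] i(2,3) by auto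
  have iQ: "{i} \<subseteq> Q" "{i} \<noteq> {}" using i by auto
  have "{i} \<noteq> Q"
  proof
    assume "{i} = Q"
    then have "card {i} = n + 1" using cardQ by simp
    then show False using n1 by simp
  qed
  have r: "rr n (sum al {i}) = n - al i" using cc_one[of "al i" n] al[OF i(1)] by simp
  have "card (E - {j, j'}) = n - 3" using j False fins cE by (simp add: card_Diff_subset)
  then have "n - al i - 1 \<le> card (E - {j, j'})" using a by linarith
  from subset_of_card[OF this] obtain K where K: "K \<subseteq> E - {j, j'}" "card K = n - al i - 1" by blast
  have fK: "finite K" "j \<notin> K" "j' \<notin> K" using K(1) fins(1) finite_subset[of K E] by auto
  have "rr n (sum be {i}) \<le> card F" using rr_less[OF n1, of "sum be {i}"] cF by linarith
  from subset_of_card[OF this] obtain F' where F': "F' \<subseteq> F" "card F' = rr n (sum be {i})" by blast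
  have c: "card (insert j K) = rr n (sum al {i})" "card (insert j' K) = rr n (sum al {i})"
    using K fK r a by auto
  have "[sum q {i} + (sum q (insert j K) + sum q F') = int n * \<gamma>] (mod int (m * n))"
    by (rule sum_q_parts[OF iQ \<open>{i} \<noteq> Q\<close> _ F'(1) c(1) F'(2)]) (use K j in auto)
  moreover have "[sum q {i} + (sum q (insert j' K) + sum q F') = int n * \<gamma>] (mod int (m * n))"
    by (rule sum_q_parts[OF iQ \<open>{i} \<noteq> Q\<close> _ F'(1) c(2) F'(2)]) (use K j in auto)
  ultimately have "[q j + (q i + sum q K + sum q F') = q j' + (q i + sum q K + sum q F')] (mod int (m * n))"
    using fK by (simp add: cong_def add_ac)
  then show ?thesis by (rule cong_add_rcancel[THEN iffD1])
qed simp

end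

lemma (in short_zs_free) coset_of_center:
  assumes c: "cen M w z" and i: "i \<in> M" "\<not> eqv i w" and j: "j \<in> M" "\<not> eqv j w"
  shows "\<exists>x. lin i x w 1 j"
  using c i j coset_shift unfolding cen_def by blast

context equal_pair
begin

lemma Qsw: "B l \<union> R - (F \<union> E) = Q" by blast

lemma eqv_u_iff: "i \<in> Q \<Longrightarrow> be i = n \<Longrightarrow> al i = 1 \<Longrightarrow> eqv i u"
  using equal_pair.eqv_v_iff[OF swapped, unfolded Qsw] .

lemma eqv_u_dest: "i \<in> Q \<Longrightarrow> eqv i u \<Longrightarrow> be i = n \<and> al i = 1"
  using equal_pair.eqv_v_dest[OF swapped, unfolded Qsw] .

lemma be_eq_one: "i \<in> Q \<Longrightarrow> lin i x u 1 v \<Longrightarrow> be i = 1"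
  using equal_pair.al_eq_one[OF swapped, unfolded Qsw] .

lemma cen_u: "(\<And>i. i \<in> Q \<Longrightarrow> be i = 1 \<or> be i = n) \<Longrightarrow> cen V u v"
  using equal_pair.cen_v[OF swapped, unfolded Qsw] by blast

lemma F_const: "i \<in> Q \<Longrightarrow> be i \<noteq> 1 \<Longrightarrow> be i \<noteq> n \<Longrightarrow> j \<in> F \<Longrightarrow> j' \<in> F \<Longrightarrow> [q j = q j'] (mod int (m * n))"
  using equal_pair.E_const[OF swapped, unfolded Qsw] .

definition tt :: "nat \<Rightarrow> int" where "tt i = (q i - int (al i) * q u - int (be i) * q v) div int n"

lemma tt: "i \<in> Q \<Longrightarrow> q i = int (al i) * q u + int (be i) * q v + int n * tt i"
proof -
  assume "i \<in> Q"
  then have "int n dvd q i - (int (al i) * q u + int (be i) * q v)"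
    using ab unfolding lin_def cong_iff_dvd_diff by blast
  then have "int n dvd q i - int (al i) * q u - int (be i) * q v" by (simp add: algebra_simps)
  then have "int n * tt i = q i - int (al i) * q u - int (be i) * q v" by (simp add: tt_def)
  then show ?thesis by linarith
qed

text \<open>The completed sum of \<open>X\<close> divided by \<open>n\<close>: the two ceilings
  count how often \<open>n u\<close> and \<open>n v\<close> occur, and \<open>tt\<close> collects
  the deviations of the terms from their linear representation.\<close>

lemma star0:
  assumes kE: "\<And>j. j \<in> E \<Longrightarrow> [q j = q u] (mod int (m * n))" and kF: "\<And>j. j \<in> F \<Longrightarrow> [q j = q v] (mod int (m * n))"
    and X: "X \<subseteq> Q" "X \<noteq> {}" "X \<noteq> Q"
  shows "[int (cc n (sum al X)) * q u + int (cc n (sum be X)) * q v + sum tt X = \<gamma>] (mod int m)"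
proof -
  obtain E' F' where EF': "E' \<subseteq> E" "F' \<subseteq> F" "card E' = rr n (sum al X)" "card F' = rr n (sum be X)"
    using complete[OF X(1,2)] by blast
  have 1: "[sum q X + (sum q E' + sum q F') = int n * \<gamma>] (mod int (m * n))" by (rule sum_q_parts[OF X EF'])
  have 2: "[sum q E' = int (card E') * q u] (mod int (m * n))" using kE EF'(1) by (intro sum_cong_const) auto
  have 3: "[sum q F' = int (card F') * q v] (mod int (m * n))" using kF EF'(2) by (intro sum_cong_const) auto
  have "sum q X = (\<Sum>i\<in>X. int (al i) * q u + int (be i) * q v + int n * tt i)"
    using X(1) tt by (intro sum.cong) auto
  then have 4: "sum q X = int (sum al X) * q u + int (sum be X) * q v + int n * sum tt X"
    by (simp add: sum.distrib sum_distrib_left sum_distrib_right)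
  have "[sum q X + (sum q E' + sum q F') = sum q X + (int (card E') * q u + int (card F') * q v)] (mod int (m * n))"
    by (intro cong_add cong_refl 2 3)
  then have 5: "[sum q X + (int (card E') * q u + int (card F') * q v) = int n * \<gamma>] (mod int (m * n))"
    using 1 cong_sym cong_trans by blast
  have c1: "int n * int (cc n (sum al X)) = int (sum al X) + int (card E')"
    "int n * int (cc n (sum be X)) = int (sum be X) + int (card F')"
    unfolding EF'(3,4) of_nat_mult[symmetric] of_nat_add[symmetric] cc_mult[OF n1] by (rule refl)+
  have "sum q X + (int (card E') * q u + int (card F') * q v)
      = (int (sum al X) + int (card E')) * q u + (int (sum be X) + int (card F')) * q v + int n * sum tt X"
    unfolding 4 by (simp add: algebra_simps)
  also have "\<dots> = int n * (int (cc n (sum al X)) * q u + int (cc n (sum be X)) * q v + sum tt X)"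
    unfolding c1[symmetric] by (simp add: algebra_simps)
  finally show ?thesis using 5 cong_scale_iff[of n] n1 by simp
qed

lemma singleton_proper: "{i} \<noteq> Q"
proof
  assume "{i} = Q"
  then have "card {i} = n + 1" using cardQ by simp
  then show False using n1 by simp
qed

text \<open>Difference of the relations for \<open>insert i X\<close> and for \<open>X\<close>, from
  which the relation for the single term \<open>i\<close> eliminates \<open>tt i\<close>. Only the
  increments of the two ceilings remain, each 0 or 1.\<close>

lemma step:
  assumes kE: "\<And>j. j \<in> E \<Longrightarrow> [q j = q u] (mod int (m * n))" and kF: "\<And>j. j \<in> F \<Longrightarrow> [q j = q v] (mod int (m * n))"
    and X: "X \<subseteq> Q" "X \<noteq> {}" and i: "i \<in> Q" "i \<notin> X" "insert i X \<noteq> Q"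
  shows "[(int (cc n (sum al (insert i X))) - int (cc n (sum al X))) * q u
      + (int (cc n (sum be (insert i X))) - int (cc n (sum be X))) * q v + \<gamma> = q u + q v] (mod int m)"
proof -
  have fX: "finite X" using X(1) fins(3) finite_subset by blast
  have "X \<noteq> Q" using i by auto
  note a = star0[OF kE kF X(1,2) this]
  have b: "[int (cc n (sum al (insert i X))) * q u + int (cc n (sum be (insert i X))) * q v + sum tt (insert i X) = \<gamma>] (mod int m)"
    by (rule star0[OF kE kF _ _ i(3)]) (use X i in auto)
  have c0: "[int (cc n (sum al {i})) * q u + int (cc n (sum be {i})) * q v + sum tt {i} = \<gamma>] (mod int m)"
    by (rule star0[OF kE kF _ _ singleton_proper]) (use i in auto)
  then have c: "[q u + q v + tt i = \<gamma>] (mod int m)"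
    using cc_one[of "al i" n] cc_one[of "be i" n] al[OF i(1)] be[OF i(1)] by simp
  define A where "A = int (cc n (sum al (insert i X))) * q u + int (cc n (sum be (insert i X))) * q v + sum tt (insert i X)"
  define A' where "A' = int (cc n (sum al X)) * q u + int (cc n (sum be X)) * q v + sum tt X"
  have "int m dvd (A - \<gamma>) - (A' - \<gamma>)"
    using b a unfolding cong_iff_dvd_diff A_def[symmetric] A'_def[symmetric] by (rule dvd_diff)
  moreover have "int m dvd q u + q v + tt i - \<gamma>" using c by (simp add: cong_iff_dvd_diff)
  ultimately have "int m dvd ((A - \<gamma>) - (A' - \<gamma>)) - (q u + q v + tt i - \<gamma>)" by (rule dvd_diff)
  moreover have "((A - \<gamma>) - (A' - \<gamma>)) - (q u + q v + tt i - \<gamma>)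
    = ((int (cc n (sum al (insert i X))) - int (cc n (sum al X))) * q u
      + (int (cc n (sum be (insert i X))) - int (cc n (sum be X))) * q v + \<gamma>) - (q u + q v)"
    unfolding A_def A'_def using fX i(2) by (simp add: algebra_simps)
  ultimately show ?thesis unfolding cong_iff_dvd_diff by (simp only:)
qed

lemma step_cases:
  assumes "X \<subseteq> Q" "finite X" "i \<in> Q" "i \<notin> X"
  shows "cc n (sum al (insert i X)) = cc n (sum al X) \<or> cc n (sum al (insert i X)) = cc n (sum al X) + 1"
    "cc n (sum be (insert i X)) = cc n (sum be X) \<or> cc n (sum be (insert i X)) = cc n (sum be X) + 1"
  using cc_step[of "al i" n "sum al X"] cc_step[of "be i" n "sum be X"] al[OF assms(3)] be[OF assms(3)] assms(2,4)
  by (simp_all add: add.commute)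

text \<open>An increment 1 of the first ceiling would give \<open>\<gamma> = q v\<close> or
  \<open>\<gamma> = 0\<close> modulo \<open>m\<close>, depending on the other increment. So the
  ceiling stays 1, that is, \<open>n\<close> positive values \<open>al\<close> have sum at most
  \<open>n\<close>.\<close>

lemma all_al_one:
  assumes kE: "\<And>j. j \<in> E \<Longrightarrow> [q j = q u] (mod int (m * n))" and kF: "\<And>j. j \<in> F \<Longrightarrow> [q j = q v] (mod int (m * n))"
    and ne: "\<not> [\<gamma> = q v] (mod int m)" and i: "i \<in> Q"
  shows "al i = 1"
proof -
  have one: "X \<subseteq> Q \<Longrightarrow> X \<noteq> Q \<Longrightarrow> cc n (sum al X) = 1" if "finite X" "X \<noteq> {}" for X
    using that
  proof (induction X rule: finite_ne_induct)
    case (singleton j)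
    then show ?case using cc_one[of "al j" n] al[of j] by simp
  next
    case (insert j X)
    have X: "X \<subseteq> Q" "X \<noteq> Q" "j \<in> Q" using insert by auto
    have S: "[(int (cc n (sum al (insert j X))) - int (cc n (sum al X))) * q u
      + (int (cc n (sum be (insert j X))) - int (cc n (sum be X))) * q v + \<gamma> = q u + q v] (mod int m)"
      using step[OF kE kF X(1) insert.hyps(2) X(3) insert.hyps(3) insert.prems(2)] .
    note sc = step_cases[OF X(1) insert.hyps(1) X(3) insert.hyps(3)]
    have IH: "cc n (sum al X) = 1" using insert.IH X by blast
    show ?case
    proof (rule ccontr)
      assume "cc n (sum al (insert j X)) \<noteq> 1"
      then have a: "cc n (sum al (insert j X)) = cc n (sum al X) + 1" using sc(1) IH by auto
      from sc(2) show False
      proof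
        assume "cc n (sum be (insert j X)) = cc n (sum be X)"
        then have "int m dvd (q u + \<gamma>) - (q u + q v)" using S a by (simp add: cong_iff_dvd_diff)
        then show False using ne by (simp add: cong_iff_dvd_diff)
      next
        assume "cc n (sum be (insert j X)) = cc n (sum be X) + 1"
        then have "int m dvd (q u + q v + \<gamma>) - (q u + q v)" using S a by (simp add: cong_iff_dvd_diff)
        then show False using not_dvd_\<gamma> by simp
      qed
    qed
  qed
  have "card (Q - {i}) > 0" using i cardQ fins(3) n2 by simp
  then obtain o' where o: "o' \<in> Q - {i}" by (metis card_gt_0_iff ex_in_conv)
  let ?X = "Q - {o'}"
  have fX: "finite ?X" "?X \<noteq> {}" "?X \<noteq> Q" using fins(3) o i by auto
  have cX: "card ?X = n" using o cardQ fins(3) by simp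
  have "n * 1 = sum al ?X + rr n (sum al ?X)" using cc_mult[OF n1, of "sum al ?X"] one[OF fX(1,2) _ fX(3)] by auto
  then have le: "sum al ?X \<le> n" by simp
  have iX: "i \<in> ?X" using i o by auto
  have "card (?X - {i}) \<le> sum al (?X - {i})"
  proof -
    have "(\<Sum>j\<in>?X - {i}. 1) \<le> sum al (?X - {i})" using al by (intro sum_mono) auto
    then show ?thesis by simp
  qed
  moreover have "card (?X - {i}) = n - 1" using cX iX fX(1) by simp
  moreover have "sum al ?X = al i + sum al (?X - {i})" by (rule sum.remove[OF fX(1) iX])
  ultimately show ?thesis using le al[OF i] by linarith
qed

text \<open>If \<open>q u\<close> and \<open>q v\<close> both agree with the generator
  \<open>\<gamma>\<close>, the relation of \<open>step\<close> reads
  \<open>(da + db - 1) * \<gamma> = 0\<close>, so exactly one ceiling grows with each term.\<close>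

lemma carry_sum:
  assumes kE: "\<And>j. j \<in> E \<Longrightarrow> [q j = q u] (mod int (m * n))" and kF: "\<And>j. j \<in> F \<Longrightarrow> [q j = q v] (mod int (m * n))"
    and eq: "[\<gamma> = q u] (mod int m)" "[\<gamma> = q v] (mod int m)" and X: "X \<subseteq> Q" "X \<noteq> {}" "X \<noteq> Q"
  shows "cc n (sum al X) + cc n (sum be X) = card X + 1"
proof -
  have "X \<subseteq> Q \<Longrightarrow> X \<noteq> Q \<Longrightarrow> cc n (sum al X) + cc n (sum be X) = card X + 1" if "finite X" "X \<noteq> {}" for X
    using that
  proof (induction X rule: finite_ne_induct)
    case (singleton j)
    then show ?case using cc_one[of "al j" n] al[of j] cc_one[of "be j" n] be[of j] by simp
  next
    case (insert j X)
    have X: "X \<subseteq> Q" "X \<noteq> Q" "j \<in> Q" using insert by auto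
    define da where "da = int (cc n (sum al (insert j X))) - int (cc n (sum al X))"
    define db where "db = int (cc n (sum be (insert j X))) - int (cc n (sum be X))"
    have S: "[da * q u + db * q v + \<gamma> = q u + q v] (mod int m)"
      unfolding da_def db_def using step[OF kE kF X(1) insert.hyps(2) X(3) insert.hyps(3) insert.prems(2)] .
    have d: "da = 0 \<or> da = 1" "db = 0 \<or> db = 1"
      using step_cases[OF X(1) insert.hyps(1) X(3) insert.hyps(3)] by (auto simp: da_def db_def)
    have "[da * q u + db * q v + \<gamma> = da * \<gamma> + db * \<gamma> + \<gamma>] (mod int m)" "[q u + q v = \<gamma> + \<gamma>] (mod int m)"
      by (intro cong_add cong_scalar_left cong_refl cong_sym[OF eq(1)] cong_sym[OF eq(2)])+
    then have "[da * \<gamma> + db * \<gamma> + \<gamma> = \<gamma> + \<gamma>] (mod int m)" by (rule cong_tri[OF _ _ S])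
    then have "int m dvd (da + db - 1) * \<gamma>" by (simp add: cong_iff_dvd_diff algebra_simps)
    then have "int m dvd da + db - 1" using cop_\<gamma> by (simp add: coprime_commute coprime_dvd_mult_left_iff)
    then have "da + db - 1 = 0"
    proof -
      have "\<not> int m dvd 1" "\<not> int m dvd - 1" using m2 by auto
      then show ?thesis using d \<open>int m dvd da + db - 1\<close> by auto
    qed
    then show ?case using insert.IH[OF X(1,2)] insert.hyps(1,3) unfolding da_def db_def by simp
  qed
  moreover have "finite X" using X(1) fins(3) finite_subset by blast
  ultimately show ?thesis using X by blast
qed

abbreviation "cdef i \<equiv> n + 1 - al i - be i"

lemma carry_locale:
  assumes kE: "\<And>j. j \<in> E \<Longrightarrow> [q j = q u] (mod int (m * n))" and kF: "\<And>j. j \<in> F \<Longrightarrow> [q j = q v] (mod int (m * n))"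
    and eq: "[\<gamma> = q u] (mod int m)" "[\<gamma> = q v] (mod int m)"
  shows "carry n Q al be cdef"
proof
  show "rr n (sum al X) + rr n (sum be X) + card X = n + sum cdef X"
    if X: "X \<subseteq> Q" "X \<noteq> {}" "X \<noteq> Q" for X
  proof -
    have 1: "cc n (sum al X) + cc n (sum be X) = card X + 1" by (rule carry_sum[OF kE kF eq X])
    have 2: "n * cc n (sum al X) = sum al X + rr n (sum al X)" "n * cc n (sum be X) = sum be X + rr n (sum be X)"
      using cc_mult[OF n1] by auto
    have "(\<Sum>i\<in>X. al i + be i + cdef i) = (\<Sum>i\<in>X. n + 1)"
    proof (intro sum.cong refl)
      fix i assume "i \<in> X"
      then have "al i + be i \<le> n + 1" using X(1) by (intro al_be_le) blast
      then show "al i + be i + cdef i = n + 1" by simp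
    qed
    then have 3: "sum al X + sum be X + sum cdef X = card X * (n + 1)" by (simp add: sum.distrib)
    have "n * (cc n (sum al X) + cc n (sum be X)) = n * (card X + 1)" using 1 by simp
    then show ?thesis using 2 3 by (simp add: algebra_simps)
  qed
  show "al i + be i + cdef i = n + 1" if "i \<in> Q" for i using al_be_le[OF that] by simp
qed (use n2 fins(3) cardQ al be total in auto)

text \<open>\<open>cdef i = 0\<close> means \<open>al i + be i = n + 1\<close>: modulo
  \<open>n\<close> the term lies on the affine line through \<open>u\<close> and
  \<open>v\<close>.\<close>

lemma cdef_zero_coord: "i \<in> Q \<Longrightarrow> cdef i = 0 \<Longrightarrow> lin i (int (al i)) u (1 - int (al i)) v"
proof -
  assume i: "i \<in> Q" "cdef i = 0"
  then have "int (be i) = int n + (1 - int (al i))" using al_be_le[OF i(1)] by linarith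
  then have "[int (be i) = 1 - int (al i)] (mod int n)" by (simp add: cong_def)
  then show "lin i (int (al i)) u (1 - int (al i)) v" using lin_cong[OF ab[OF i(1)]] by simp
qed

text \<open>\<open>E\<close>, \<open>F\<close> and the terms with \<open>cdef i = 0\<close> lie on
  one affine line, so \<open>n\<close> of them form a zero-sum as soon as their first coordinates
  do. The theorem of Erdos, Ginzburg and Ziv finds these among \<open>2n-1\<close> terms, and that
  many remain when two are forbidden.\<close>

lemma avoiding_block:
  assumes z: "3 \<le> card {i\<in>Q. cdef i = 0}" and s: "s1 \<in> Q" "s2 \<in> Q"
  shows "\<exists>W. W \<subseteq> E \<union> F \<union> {i\<in>Q. cdef i = 0} - {s1, s2} \<and> zs n p q W \<and> card W = n"
proof -
  let ?Q0 = "{i\<in>Q. cdef i = 0}" let ?X = "E \<union> F \<union> ?Q0 - {s1, s2}"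
  have fQ0: "finite ?Q0" using fins(3) by (rule finite_subset[rotated]) auto
  have "card (E \<union> F \<union> ?Q0) = 2 * n - 2 + card ?Q0"
    using fins(1,2) fQ0 EF cE cF by (subst card_Un_disjoint) (auto simp: card_Un_disjoint)
  moreover have "card {s1, s2} \<le> 2" by (simp add: card_insert_if)
  moreover have "card (E \<union> F \<union> ?Q0) - card {s1, s2} \<le> card ?X" by (rule diff_card_le_card_Diff) simp
  ultimately have c: "2 * n - 1 \<le> card ?X" using z n2 by linarith
  have fX: "finite ?X" using fins fQ0 by auto
  obtain W where W: "W \<subseteq> ?X" "card W = n" "int n dvd sum sc W"
    using erdos_ginzburg_ziv[OF n1 fX c, of sc] by blast
  have lin: "lin i (sc i) u (1 - sc i) v" if "i \<in> W" for i
  proof -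
    have "i \<in> E \<or> i \<in> F \<or> (i \<in> Q \<and> cdef i = 0)" using that W(1) by blast
    then show ?thesis using linE[of i] linF[of i] cdef_zero_coord[of i] EF by (auto simp: sc_def)
  qed
  have "sum (\<lambda>i. 1 - sc i) W = int n - sum sc W" using W(2) by (simp add: sum_subtractf)
  then have "int n dvd sum (\<lambda>i. 1 - sc i) W" using W(3) by simp
  moreover have "W \<noteq> {}" using W(2) n2 by auto
  ultimately have "zs n p q W" using zs_lin[OF _ lin W(3)] by blast
  then show ?thesis using W by blast
qed

text \<open>A block of length \<open>n\<close> containing all of \<open>F\<close> would need a
  further copy of \<open>v\<close>, and \<open>Q\<close> contains none.\<close>

lemma F_survives:
  assumes W: "W \<subseteq> E \<union> F \<union> {i\<in>Q. cdef i = 0}" "zs n p q W" "card W = n"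
    and nf: "\<not> (\<exists>i\<in>Q. al i = n \<and> be i = 1)"
  shows "\<exists>j\<in>V - W. eqv j v"
proof (rule ccontr)
  assume neg: "\<not> ?thesis"
  then have "F \<subseteq> W" using eF FV by blast
  then obtain w where w: "w \<in> W - F" "eqv w v" using last_term_eqv[OF W(2,3) _ cF eF] by blast
  have "\<not> eqv u v" by (rule det_not_eqv[OF duv])
  then have "w \<notin> E" using eE[of w] w(2) eqv_trans[OF eqv_sym[of w u]] by blast
  then have "w \<in> Q" using w(1) W(1) by blast
  then show False using eqv_v_dest[OF _ w(2)] nf by blast
qed

lemma E_survives:
  assumes W: "W \<subseteq> E \<union> F \<union> {i\<in>Q. cdef i = 0}" "zs n p q W" "card W = n"
    and nf: "\<not> (\<exists>i\<in>Q. al i = 1 \<and> be i = n)"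
  shows "\<exists>j\<in>V - W. eqv j u"
proof (rule ccontr)
  assume neg: "\<not> ?thesis"
  then have "E \<subseteq> W" using eE EV by blast
  then obtain w where w: "w \<in> W - E" "eqv w u" using last_term_eqv[OF W(2,3) _ cE eE] by blast
  have "\<not> eqv v u" by (rule det_not_eqv[OF det_sym[OF duv]])
  then have "w \<notin> F" using eF[of w] w(2) eqv_trans[OF eqv_sym[of w v]] by blast
  then have "w \<in> Q" using w(1) W(1) by blast
  then show False using eqv_u_dest[OF _ w(2)] nf by blast
qed

text \<open>A zero-sum of length \<open>n\<close> on the affine line is made the block so that
  \<open>q0\<close>, \<open>b\<close> and copies of \<open>u\<close> and \<open>v\<close> stay in
  the rest, which has a center \<open>w\<close>. If \<open>w\<close> is \<open>u\<close> or
  \<open>v\<close>, the position of \<open>q0\<close> follows. Otherwise the class of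
  \<open>w\<close> lies in \<open>Q\<close>, and the weight of \<open>b\<close> leaves only
  \<open>cdef w = 0\<close>, which \<open>no_third_value\<close> excludes.\<close>

lemma zero_types:
  assumes Y: "carry n Q al be cdef" and big: "b \<in> Q" "2 \<le> cdef b" and q0: "q0 \<in> Q" "cdef q0 = 0"
  shows "(al q0 = 1 \<and> be q0 = n) \<or> (al q0 = n \<and> be q0 = 1)"
proof -
  interpret Y: carry n Q al be cdef by (rule Y)
  let ?Q0 = "{i\<in>Q. cdef i = 0}"
  \<comment> \<open>The \<open>cdef\<close> values sum to \<open>n-1\<close> and \<open>b\<close>
    takes at least 2 of it, so at most \<open>n-2\<close> of the \<open>n+1\<close> terms have a
    nonzero value.\<close>
  have z: "3 \<le> card ?Q0"
  proof -
    have "(\<Sum>i\<in>Q - ?Q0. 1) + 1 \<le> sum cdef (Q - ?Q0)"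
    proof -
      have bQ: "b \<in> Q - ?Q0" using big by auto
      have fQ: "finite (Q - ?Q0)" using fins(3) by simp
      have "(\<Sum>i\<in>Q - ?Q0. 1) = 1 + (\<Sum>i\<in>Q - ?Q0 - {b}. 1::nat)" using sum.remove[OF fQ bQ, of "\<lambda>_. 1::nat"] by simp
      moreover have "sum cdef (Q - ?Q0) = cdef b + sum cdef (Q - ?Q0 - {b})" using sum.remove[OF fQ bQ] .
      moreover have "(\<Sum>i\<in>Q - ?Q0 - {b}. 1::nat) \<le> sum cdef (Q - ?Q0 - {b})" by (intro sum_mono) auto
      ultimately show ?thesis using big(2) by linarith
    qed
    moreover have "sum cdef (Q - ?Q0) \<le> sum cdef Q" using fins(3) by (intro sum_mono2) auto
    moreover have "sum cdef Q = n - 1" by (rule Y.sum_c)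
    moreover have "card (Q - ?Q0) = card Q - card ?Q0" using fins(3) finite_subset[of ?Q0 Q] by (intro card_Diff_subset) auto
    ultimately have "card Q - card ?Q0 + 1 \<le> n - 1" by simp
    then show ?thesis using cardQ n2 by linarith
  qed
  define et where "et i \<longleftrightarrow> i \<in> Q \<and> al i = 1 \<and> be i = n" for i
  define ft where "ft i \<longleftrightarrow> i \<in> Q \<and> al i = n \<and> be i = 1" for i
  have noef: "\<not> (et i \<and> ft j)" for i j using Y.not_e_and_f[of i j] by (auto simp: et_def ft_def)
  \<comment> \<open>The second forbidden term is a copy of \<open>u\<close> or of \<open>v\<close>
    in \<open>Q\<close>, if there is one; by \<open>noef\<close> both kinds cannot occur. Kept out
    of the block, it represents its value in the new rest; a value without a copy in
    \<open>Q\<close> survives anyway.\<close>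
  obtain s where s: "s \<in> Q" "(\<exists>i. et i) \<Longrightarrow> et s" "(\<exists>i. ft i) \<Longrightarrow> ft s"
  proof (cases "\<exists>i. et i")
    case True
    then obtain i where "et i" by blast
    then show ?thesis using that[of i] noef by (auto simp: et_def)
  next
    case False
    show ?thesis
    proof (cases "\<exists>i. ft i")
      case True
      then obtain i where "ft i" by blast
      then show ?thesis using that[of i] False by (auto simp: ft_def)
    next
      case F: False
      then show ?thesis using that[of q0] False q0 by blast
    qed
  qed
  obtain W where W: "W \<subseteq> E \<union> F \<union> ?Q0 - {q0, s}" "zs n p q W" "card W = n"
    using avoiding_block[OF z q0(1) s(1)] by blast
  have W': "W \<subseteq> E \<union> F \<union> ?Q0" "W \<subseteq> V" using W(1) EV FV by blast+
  let ?R = "V - W"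
  have gR: "good ?R" using replace_block(2)[OF l W'(2) W(2)] W(3) by simp
  have sR: "s \<in> ?R" "q0 \<in> ?R" "b \<in> ?R" using s(1) q0(1) big W(1) by auto
  obtain ju where ju: "ju \<in> ?R" "eqv ju u"
  proof (cases "\<exists>i. et i")
    case True
    then have "eqv s u" using s(2) eqv_u_iff by (auto simp: et_def)
    then show ?thesis using that sR by blast
  next
    case False
    then show ?thesis using that E_survives[OF W'(1) W(2,3)] by (auto simp: et_def)
  qed
  obtain jv where jv: "jv \<in> ?R" "eqv jv v"
  proof (cases "\<exists>i. ft i")
    case True
    then have "eqv s v" using s(3) eqv_v_iff by (auto simp: ft_def)
    then show ?thesis using that sR by blast
  next
    case False
    then show ?thesis using that F_survives[OF W'(1) W(2,3)] by (auto simp: ft_def)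
  qed
  obtain w z where wz: "w \<in> ?R" "z \<in> ?R" "cen ?R w z" "card {i\<in>?R. eqv i w} = n - 1" using str[OF gR] by blast
  have nuv: "\<not> eqv u v" "\<not> eqv v u" using det_not_eqv[OF duv] det_not_eqv[OF det_sym[OF duv]] by auto
  show ?thesis
  proof (cases "eqv w v")
    case wv: True
    show ?thesis
    proof (cases "eqv q0 w")
      case True
      then show ?thesis using eqv_v_dest[OF q0(1) eqv_trans[OF True wv]] by blast
    next
      case False
      have "\<not> eqv ju w" using ju(2) wv nuv eqv_trans[OF eqv_sym[OF ju(2)]] eqv_trans[of u w v] by blast
      then obtain x where "lin q0 x w 1 ju" using coset_of_center[OF wz(3) sR(2) False ju(1)] by blast
      then have "lin q0 x v 1 u" using lin_eqv_right[OF _ wv ju(2)] by blast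
      then have "al q0 = 1" by (rule al_eq_one[OF q0(1)])
      then show ?thesis using q0 al_be_le[OF q0(1)] by simp
    qed
  next
    case nwv: False
    show ?thesis
    proof (cases "eqv w u")
      case wu: True
      show ?thesis
      proof (cases "eqv q0 w")
        case True
        then show ?thesis using eqv_u_dest[OF q0(1) eqv_trans[OF True wu]] by blast
      next
        case False
        have "\<not> eqv jv w" using jv(2) wu nuv eqv_trans[OF eqv_sym[OF jv(2)]] eqv_trans[of v w u] by blast
        then obtain x where "lin q0 x w 1 jv" using coset_of_center[OF wz(3) sR(2) False jv(1)] by blast
        then have "lin q0 x u 1 v" using lin_eqv_right[OF _ wu jv(2)] by blast
        then have "be q0 = 1" by (rule be_eq_one[OF q0(1)])
        then show ?thesis using q0 al_be_le[OF q0(1)] by simp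
      qed
    next
      case nwu: False
      define G where "G = {i\<in>?R. eqv i w}"
      have GQ: "G \<subseteq> Q"
      proof
        fix i assume "i \<in> G"
        then have i: "i \<in> ?R" "eqv i w" by (auto simp: G_def)
        have "i \<notin> E" using nwu eqv_trans[OF eqv_sym[OF i(2)]] eE by blast
        moreover have "i \<notin> F" using nwv eqv_trans[OF eqv_sym[OF i(2)]] eF by blast
        ultimately show "i \<in> Q" using i by blast
      qed
      have cG: "card G = n - 1" using wz(4) by (simp add: G_def)
      have wG: "w \<in> G" using wz(1) by (simp add: G_def)
      have wQ: "w \<in> Q" using wG GQ by blast
      have same: "al i = al w \<and> be i = be w" if "i \<in> G" for i
      proof -
        have iQ: "i \<in> Q" "eqv i w" using that GQ by (auto simp: G_def)
        have "[int (al i) = int (al w)] (mod int n)" "[int (be i) = int (be w)] (mod int n)"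
          using lin_unique[OF duv ab[OF iQ(1)] ab[OF wQ] iQ(2)] by auto
        then show ?thesis using nat_cong_range al[OF iQ(1)] al[OF wQ] be[OF iQ(1)] be[OF wQ] by blast
      qed
      have fG: "finite G" using GQ fins(3) finite_subset by blast
      have sG: "sum cdef G = (n - 1) * cdef w" using same cG by simp
      have "b \<notin> G"
      proof
        assume "b \<in> G"
        then have "2 \<le> cdef w" using same[of b] big by simp
        then have "(n - 1) * 2 \<le> sum cdef G" using sG by simp
        also have "\<dots> \<le> sum cdef Q" using GQ fins(3) by (intro sum_mono2) auto
        finally show False using Y.sum_c n2 by simp
      qed
      then have "cdef b + sum cdef G = sum cdef (insert b G)" using fG by simp
      also have "\<dots> \<le> sum cdef Q" using GQ big fins(3) by (intro sum_mono2) auto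
      finally have "cdef b + (n - 1) * cdef w \<le> n - 1" using Y.sum_c sG by simp
      then have cw: "cdef w = 0" using big(2) by (cases "cdef w") auto
      have nju: "\<not> eqv ju w" using nwu eqv_trans[OF eqv_sym[of ju w] ju(2)] by blast
      have njv: "\<not> eqv jv w" using nwv eqv_trans[OF eqv_sym[of jv w] jv(2)] by blast
      obtain x where "lin ju x w 1 jv" using coset_of_center[OF wz(3) ju(1) nju jv(1) njv] by blast
      then have "lin u x w 1 v" using lin_eqv_right[OF _ eqv_refl jv(2)] lin_eqv_left[OF _ ju(2)] by blast
      moreover have lw: "lin w (int (al w)) u (1 - int (al w)) v" by (rule cdef_zero_coord[OF wQ cw])
      ultimately have "lin u (x * int (al w)) u (x * (1 - int (al w)) + 1) v"
      proof -
        assume lu: "lin u x w 1 v" and lw: "lin w (int (al w)) u (1 - int (al w)) v"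
        have "[f u = (x * int (al w)) * f u + (x * (1 - int (al w)) + 1) * f v] (mod int n)"
          if f: "f = p \<or> f = q" for f
        proof -
          have "[f u = x * f w + 1 * f v] (mod int n)" using lu f by (auto simp: lin_def)
          moreover have "[x * f w + 1 * f v = x * (int (al w) * f u + (1 - int (al w)) * f v) + 1 * f v] (mod int n)"
            using lw f by (intro cong_add cong_refl cong_scalar_left) (auto simp: lin_def)
          ultimately have "[f u = x * (int (al w) * f u + (1 - int (al w)) * f v) + 1 * f v] (mod int n)" by (rule cong_trans)
          then show ?thesis by (simp add: algebra_simps)
        qed
        then show ?thesis by (simp add: lin_def)
      qed
      \<comment> \<open>\<open>u\<close> lies in \<open>v + <w>\<close> and \<open>w\<close> on the
        line through \<open>u\<close> and \<open>v\<close>; comparing coordinates makes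
        \<open>al w\<close> a unit with inverse \<open>x\<close>.\<close>
      then have xa: "[x * int (al w) = 1] (mod int n)"
        using lin_unique(1)[OF duv _ lin_self(1)[of u v] eqv_refl] by blast
      obtain t where t: "1 \<le> t" "t \<le> n" "[x = int t] (mod int n)" using cong_rep_pos[OF n1] by blast
      have ta: "[int t * int (al w) = 1] (mod int n)"
        using xa cong_scalar_right[OF t(3), of "int (al w)"] cong_sym cong_trans by blast
      have nn: "\<not> int n dvd 1" using n2 by auto
      have "t \<noteq> n"
      proof
        assume "t = n"
        then have "int n dvd 1 - int n * int (al w)" using ta by (simp add: cong_iff_dvd_diff dvd_diff_commute)
        then have "int n dvd (1 - int n * int (al w)) + int n * int (al w)" by (rule dvd_add) simp
        then show False using nn by simp
      qed
      moreover have "t \<noteq> 1"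
      proof
        assume "t = 1"
        then have "al w = 1" using ta nat_cong_range[of "al w" n 1] al[OF wQ] n1 by simp
        moreover have "be w = n" using cw al_be_le[OF wQ] \<open>al w = 1\<close> by simp
        ultimately show False using eqv_u_iff[OF wQ] nwu by blast
      qed
      ultimately have t2: "2 \<le> t" "t \<le> n - 1" using t(1,2) by linarith+
      have "al i = al w \<and> cdef i = 0" if "i \<in> G" for i using same[OF that] cw by simp
      then have False by (rule Y.no_third_value[OF GQ cG _ t2 ta])
      then show ?thesis ..
    qed
  qed
qed

text \<open>If neither \<open>u\<close> nor \<open>v\<close> is visibly a center, \<open>E\<close>
  and \<open>F\<close> are constant in the full group and the carries decide. When
  \<open>\<gamma>\<close> differs from \<open>q v\<close> modulo \<open>m\<close>, \<open>v\<close>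
  is a center, and likewise \<open>u\<close>. When both agree with \<open>\<gamma>\<close>, a term
  with \<open>cdef \<ge> 2\<close> forces two further copies of \<open>u\<close> or two of
  \<open>v\<close>, and this again gives a center. If all \<open>cdef\<close> are at most 1, the
  terms with value 1 are all equal and are the center.\<close>

lemma center_exists: "\<exists>w z. cen V w z"
proof (cases "(\<forall>i\<in>Q. al i = 1 \<or> al i = n) \<or> (\<forall>i\<in>Q. be i = 1 \<or> be i = n)")
  case True
  then show ?thesis using cen_v cen_u by blast
next
  case False
  then have kE: "[q j = q u] (mod int (m * n))" if "j \<in> E" for j using E_const[OF _ _ _ that uE] by blast
  have kF: "[q j = q v] (mod int (m * n))" if "j \<in> F" for j using False F_const[OF _ _ _ that vF] by blast
  interpret S: equal_pair n m p q L B l F E v u be al by (rule swapped)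
  show ?thesis
  proof (cases "[\<gamma> = q v] (mod int m)")
    case False
    then have "al i = 1" if "i \<in> Q" for i using all_al_one[OF kE kF _ that] by blast
    then show ?thesis using cen_v by blast
  next
    case v: True
    show ?thesis
    proof (cases "[\<gamma> = q u] (mod int m)")
      case False
      then have "be i = 1" if "i \<in> Q" for i using S.all_al_one[OF kF kE, unfolded Qsw, OF _ _ _ that] by blast
      then show ?thesis using cen_u by blast
    next
      case u: True
      have Yl: "carry n Q al be cdef" by (rule carry_locale[OF kE kF u v])
      interpret Y: carry n Q al be cdef by (rule Yl)
      show ?thesis
      proof (cases "\<exists>b\<in>Q. 2 \<le> cdef b")
        case True
        then obtain b where b: "b \<in> Q" "2 \<le> cdef b" by blast
        note zt = zero_types[OF Yl b]
        define Q0 where "Q0 = {i\<in>Q. cdef i = 0}"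
        have "sum cdef Q = n - 1" by (rule Y.sum_c)
        have n3: "n \<ge> 3"
        proof -
          have "cdef b \<le> sum cdef Q" using b fins(3) by (intro member_le_sum) auto
          then show ?thesis using b Y.sum_c by linarith
        qed
        have fQ0: "finite Q0" using fins(3) unfolding Q0_def by (rule finite_subset[rotated]) auto
        have "2 \<le> card Q0"
        proof (rule ccontr)
          assume "\<not> 2 \<le> card Q0"
          moreover have "card (Q - Q0) = card Q - card Q0" using fQ0 by (intro card_Diff_subset) (auto simp: Q0_def)
          ultimately have "n \<le> card (Q - Q0)" using cardQ by linarith
          also have "\<dots> = (\<Sum>i\<in>Q - Q0. 1)" by simp
          also have "\<dots> \<le> sum cdef (Q - Q0)" by (intro sum_mono) (auto simp: Q0_def)
          also have "\<dots> \<le> sum cdef Q" using fins(3) by (intro sum_mono2) auto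
          finally show False using Y.sum_c n2 by linarith
        qed
        from subset_of_card[OF this] obtain P where P: "P \<subseteq> Q0" "card P = 2" by blast
        then obtain q1 q2 where q: "q1 \<in> Q0" "q2 \<in> Q0" "q1 \<noteq> q2" by (auto simp: card_2_iff)
        then have qQ: "q1 \<in> Q" "q2 \<in> Q" "cdef q1 = 0" "cdef q2 = 0" by (auto simp: Q0_def)
        show ?thesis
        proof (cases "al q1 = 1 \<and> be q1 = n")
          case True
          then have "al q2 = 1" using zt[OF qQ(2,4)] Y.not_e_and_f[OF qQ(1,2)] by blast
          then have "al i = 1" if "i \<in> Q" for i
            using Y.two_e_all_one[OF n3 qQ(1,2) q(3) _ _ _ that] True by blast
          then show ?thesis using cen_v by blast
        next
          case False
          then have f: "al q1 = n" "be q1 = 1" using zt[OF qQ(1,3)] by auto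
          then have "be q2 = 1" using zt[OF qQ(2,4)] Y.not_e_and_f[OF qQ(2,1)] by blast
          interpret Z: carry n Q be al cdef by (rule Y.swap)
          have "be i = 1" if "i \<in> Q" for i
            using Z.two_e_all_one[OF n3 qQ(1,2) q(3) _ _ _ that] f \<open>be q2 = 1\<close> by blast
          then show ?thesis using cen_u by blast
        qed
      next
        case False
        then have c1: "cdef i \<le> 1" if "i \<in> Q" for i using that not_less_eq_eq[of "cdef i" 1] by (auto simp: numeral_2_eq_2)
        obtain a where a: "coprime a (int n)" "\<forall>i\<in>Q. cdef i = 1 \<longrightarrow> [int (al i) = a] (mod int n)"
          using Y.ones_const[OF c1] by blast
        have "\<exists>g\<in>Q. cdef g = 1"
        proof (rule ccontr)
          assume "\<not> ?thesis"
          then have "cdef i = 0" if "i \<in> Q" for i using c1[OF that] that by (meson le_less less_one)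
          then have "sum cdef Q = 0" by simp
          then show False using Y.sum_c n2 by simp
        qed
        then obtain g where g: "g \<in> Q" "cdef g = 1" by blast
        \<comment> \<open>A term with \<open>cdef i = 1\<close> is \<open>a (u - v)\<close>, the
          same for all of them; since \<open>a\<close> is a unit, the affine line through
          \<open>u\<close> and \<open>v\<close> is the coset \<open>v + <g>\<close>.\<close>
        have lg1: "lin i a u (- a) v" if i: "i \<in> Q" "cdef i = 1" for i
        proof -
          have "int (be i) = int n - int (al i)" using i al_be_le[OF i(1)] by linarith
          then have "[int (be i) = - int (al i)] (mod int n)" by (simp add: cong_def)
          moreover have A: "[int (al i) = a] (mod int n)" using a(2) i by blast
          ultimately have "[int (be i) = - a] (mod int n)" using cong_trans cong_minus_minus_iff by blast
          then show ?thesis using lin_cong[OF ab[OF i(1)] A] by blast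
        qed
        have lg: "lin g a u (- a) v" by (rule lg1[OF g])
        obtain a' where a': "[a * a' = 1] (mod int n)" using a(1) cong_solve_coprime_int by blast
        have coset: "lin i (s * a') g 1 v" if i: "lin i s u (1 - s) v" for i s
        proof -
          have "[f i = (s * a') * f g + 1 * f v] (mod int n)" if f: "f = p \<or> f = q" for f
          proof -
            have 1: "[f i = s * f u + (1 - s) * f v] (mod int n)" using i f by (auto simp: lin_def)
            have "[f g = a * f u + (- a) * f v] (mod int n)" using lg f by (auto simp: lin_def)
            then have "[(s * a') * f g + 1 * f v = (s * a') * (a * f u + (- a) * f v) + 1 * f v] (mod int n)"
              by (intro cong_add cong_refl cong_scalar_left)
            also have "(s * a') * (a * f u + (- a) * f v) + 1 * f v = (a * a') * (s * f u - s * f v) + f v"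
              by (simp add: algebra_simps)
            also have "[(a * a') * (s * f u - s * f v) + f v = 1 * (s * f u - s * f v) + f v] (mod int n)"
              by (intro cong_add cong_refl cong_scalar_right a')
            also have "1 * (s * f u - s * f v) + f v = s * f u + (1 - s) * f v" by (simp add: algebra_simps)
            finally show ?thesis using 1 cong_sym cong_trans by blast
          qed
          then show ?thesis by (simp add: lin_def)
        qed
        have "cen V g v"
          unfolding cen_def
        proof (intro conjI ballI)
          have "det v g" using det_lin[OF det_sym[OF duv] lin_comm[THEN iffD1, OF lg]] a(1) by simp
          then show "det g v" by (rule det_sym)
          fix i assume i: "i \<in> V"
          consider "i \<in> E" | "i \<in> F" | "i \<in> Q" using i by blast
          then show "eqv i g \<or> (\<exists>x. lin i x g 1 v)"
          proof cases
            case 1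
            then show ?thesis using coset[of i 1] linE[OF 1] by auto
          next
            case 2
            then show ?thesis using coset[of i 0] linF[OF 2] by auto
          next
            case 3
            show ?thesis
            proof (cases "cdef i = 0")
              case True
              then show ?thesis using coset cdef_zero_coord[OF 3] by blast
            next
              case False
              then have "cdef i = 1" using c1[OF 3] by linarith
              then show ?thesis using lin_eqv[OF lg1[OF 3] lg] by blast
            qed
          qed
        qed
        then show ?thesis by blast
      qed
    qed
  qed
qed

end

section \<open>General properties of centers\<close>

context short_zs_free
begin

lemma lin_comp:
  assumes "lin i a w b z" "lin w s u t v" "lin z s' u t' v"
  shows "lin i (a * s + b * s') u (a * t + b * t') v"
proof -
  have "[f i = (a * s + b * s') * f u + (a * t + b * t') * f v] (mod int n)" if f: "f = p \<or> f = q" for f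
  proof -
    have "[f i = a * f w + b * f z] (mod int n)" using assms(1) f by (auto simp: lin_def)
    moreover have "[a * f w + b * f z = a * (s * f u + t * f v) + b * (s' * f u + t' * f v)] (mod int n)"
      using assms(2,3) f by (intro cong_add cong_scalar_left) (auto simp: lin_def)
    ultimately have "[f i = a * (s * f u + t * f v) + b * (s' * f u + t' * f v)] (mod int n)" by (rule cong_trans)
    then show ?thesis by (simp add: algebra_simps)
  qed
  then show ?thesis by (simp add: lin_def)
qed

lemma cen_coset: "cen M w z \<Longrightarrow> i \<in> M \<Longrightarrow> \<not> eqv i w \<Longrightarrow> \<exists>x. lin i x w 1 z"
  by (auto simp: cen_def)

lemma cen_det:
  assumes "cen M w z" "i \<in> M" "\<not> eqv i w"
  shows "det w i"
proof -
  obtain x where "lin i x w 1 z" using cen_coset[OF assms] by blast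
  moreover have "det w z" using assms(1) by (simp add: cen_def)
  ultimately show ?thesis using det_lin by simp
qed

lemma cen_rebase:
  assumes c: "cen M w z" and j: "j \<in> M" "\<not> eqv j w"
  shows "cen M w j"
  unfolding cen_def
proof (intro conjI ballI)
  show "det w j" by (rule cen_det[OF c j])
  fix i assume "i \<in> M"
  then show "eqv i w \<or> (\<exists>x. lin i x w 1 j)" using coset_of_center[OF c _ _ j] by blast
qed

lemma cen_mono: "cen M w z \<Longrightarrow> N \<subseteq> M \<Longrightarrow> cen N w z"
  unfolding cen_def by blast

lemma cen_eqv:
  assumes c: "cen M w z" and e: "eqv w w'"
  shows "cen M w' z"
  unfolding cen_def
proof (intro conjI ballI)
  show "det w' z" using c e unfolding cen_def using det_eqv[OF _ e eqv_refl] by blast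
  fix i assume i: "i \<in> M"
  show "eqv i w' \<or> (\<exists>x. lin i x w' 1 z)"
  proof (cases "eqv i w")
    case True
    then show ?thesis using eqv_trans[OF True e] by blast
  next
    case False
    then obtain x where "lin i x w 1 z" using cen_coset[OF c i] by blast
    then show ?thesis using lin_eqv_right[OF _ e eqv_refl] by blast
  qed
qed

text \<open>Every non-center term contributes 1 to the coefficient of \<open>z\<close> and every
  copy of the center 0, so the total coefficient is the number of non-center terms.\<close>

lemma noncenter_dvd:
  assumes c: "cen M w z" and M: "zs n p q M" "finite M"
  shows "n dvd card {i\<in>M. \<not> eqv i w}"
proof -
  have d: "det w z" using c by (simp add: cen_def)
  obtain x where x: "lin i (x i) w 1 z" if "i \<in> M" "\<not> eqv i w" for i using cen_coset[OF c] by metis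
  define s where "s i = (if eqv i w then 1 else x i)" for i
  define t where "t i = (if eqv i w then 0 else 1 :: int)" for i
  have "lin i (s i) w (t i) z" if i: "i \<in> M" for i
    using x[OF i] lin_eqv_left[OF lin_self(1) eqv_sym[of i w]] by (simp add: s_def t_def)
  then have "int n dvd sum t M" by (rule zs_lin_dest(2)[OF d M(1)])
  also have "sum t M = (\<Sum>i\<in>{i\<in>M. \<not> eqv i w}. 1)"
    by (rule sum.mono_neutral_cong_right) (auto simp: t_def M)
  finally have "int n dvd int (card {i\<in>M. \<not> eqv i w})" by simp
  then show ?thesis by (simp only: int_dvd_int_iff)
qed

lemma zs_mixed:
  assumes fin: "finite T" "finite E'" "finite F'" and dis: "T \<inter> E' = {}" "T \<inter> F' = {}" "E' \<inter> F' = {}" and T: "T \<noteq> {}"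
    and lT: "\<And>i. i \<in> T \<Longrightarrow> lin i (s i) u (t i) v" and lE: "\<And>i. i \<in> E' \<Longrightarrow> eqv i u" and lF: "\<And>i. i \<in> F' \<Longrightarrow> eqv i v"
    and ds: "int n dvd sum s T + int (card E')" and dt: "int n dvd sum t T + int (card F')"
  shows "zs n p q (T \<union> (E' \<union> F'))"
proof -
  define s' where "s' i = (if i \<in> E' then 1 else if i \<in> F' then 0 else s i)" for i
  define t' where "t' i = (if i \<in> E' then 0 else if i \<in> F' then 1 else t i)" for i
  have U: "sum f (T \<union> (E' \<union> F')) = sum f T + (sum f E' + sum f F')" for f :: "nat \<Rightarrow> int"
    using fin dis by (subst sum.union_disjoint; auto simp: sum.union_disjoint)
  have T': "sum s' T = sum s T" "sum t' T = sum t T" using dis by (intro sum.cong; auto simp: s'_def t'_def)+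
  have E': "sum s' E' = (\<Sum>i\<in>E'. 1)" "sum t' E' = (\<Sum>i\<in>E'. 0)" by (intro sum.cong; auto simp: s'_def t'_def)+
  have F': "sum s' F' = (\<Sum>i\<in>F'. 0)" "sum t' F' = (\<Sum>i\<in>F'. 1)" using dis by (intro sum.cong; auto simp: s'_def t'_def)+
  show ?thesis
  proof (rule zs_lin)
    show "T \<union> (E' \<union> F') \<noteq> {}" using T by blast
    show "int n dvd sum s' (T \<union> (E' \<union> F'))" "int n dvd sum t' (T \<union> (E' \<union> F'))"
      unfolding U T' E' F' using ds dt by simp_all
    fix i assume "i \<in> T \<union> (E' \<union> F')"
    then consider "i \<in> E'" | "i \<in> F'" "i \<notin> E'" | "i \<in> T" "i \<notin> E'" "i \<notin> F'" by blast
    then show "lin i (s' i) u (t' i) v"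
    proof cases
      case 1
      then show ?thesis using lin_eqv_left[OF lin_self(1) eqv_sym[OF lE[OF 1]]] by (simp add: s'_def t'_def)
    next
      case 2
      then show ?thesis using lin_eqv_left[OF lin_self(2) eqv_sym[OF lF[OF 2(1)]]] by (simp add: s'_def t'_def)
    next
      case 3
      then show ?thesis using lT by (simp add: s'_def t'_def)
    qed
  qed
qed

end

section \<open>A center for one block and the rest\<close>

context minimal_dec
begin

lemma finR: "finite R" and finB: "l < m - 1 \<Longrightarrow> finite (B l)"
  using RL BL(1) finL' by auto

lemma zsR: "zs n p q R" using str[OF goodR] by blast

lemma pair_center:
  assumes l: "l < m - 1" and E: "E \<subseteq> B l \<union> R" and F: "F \<subseteq> B l \<union> R" and EF: "E \<inter> F = {}"
    and c: "card E = n - 1" "card F = n - 1" and uv: "u \<in> E" "v \<in> F"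
    and eE: "\<And>i. i \<in> E \<Longrightarrow> eqv i u" and eF: "\<And>i. i \<in> F \<Longrightarrow> eqv i v" and d: "det u v"
  shows "\<exists>w z. cen (B l \<union> R) w z"
proof -
  have n1: "n \<ge> 1" using n2 by simp
  have "\<exists>ab. 1 \<le> fst ab \<and> fst ab \<le> n \<and> 1 \<le> snd ab \<and> snd ab \<le> n \<and> lin i (int (fst ab)) u (int (snd ab)) v" for i
  proof -
    obtain s t where st: "lin i s u t v" using lin_ex[OF d] by blast
    obtain a where a: "1 \<le> a" "a \<le> n" "[s = int a] (mod int n)" using cong_rep_pos[OF n1] by blast
    obtain b where b: "1 \<le> b" "b \<le> n" "[t = int b] (mod int n)" using cong_rep_pos[OF n1] by blast
    show ?thesis using lin_cong[OF st a(3) b(3)] a b by (intro exI[of _ "(a, b)"]) simp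
  qed
  then obtain ab where ab: "\<And>i. 1 \<le> fst (ab i) \<and> fst (ab i) \<le> n \<and> 1 \<le> snd (ab i) \<and> snd (ab i) \<le> n \<and>
    lin i (int (fst (ab i))) u (int (snd (ab i))) v" by metis
  interpret P: equal_pair n m p q L B l E F u v "\<lambda>i. fst (ab i)" "\<lambda>i. snd (ab i)"
    by unfold_locales (use l E F EF c uv eE eF d ab in auto)
  show ?thesis by (rule P.center_exists)
qed

text \<open>Let \<open>w\<close> be the center of the rest and \<open>h\<close> a term of the block
  that does not fit. Exchanging the block for a zero-sum that avoids \<open>h\<close> yields a rest
  containing \<open>h\<close>, with center \<open>w'\<close>. If \<open>w'\<close> were
  \<open>w\<close>, a non-center term common to both rests would put \<open>h\<close> into the coset
  after all. So \<open>w'\<close> is different, and two independent classes of \<open>n-1\<close>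
  terms are at hand.\<close>

lemma block_center:
  assumes l: "l < m - 1"
  shows "\<exists>w z. cen (B l \<union> R) w z"
proof (rule ccontr)
  assume no: "\<not> ?thesis"
  let ?V = "B l \<union> R"
  have n1: "n \<ge> 1" using n2 by simp
  obtain w z where wz: "w \<in> R" "z \<in> R" "cen R w z" "card {i\<in>R. eqv i w} = n - 1" using str[OF goodR] by blast
  define E where "E = {i\<in>R. eqv i w}"
  have cE: "card E = n - 1" and wE: "w \<in> E" and ER: "E \<subseteq> R" using wz by (auto simp: E_def)
  have eE: "eqv i w" if "i \<in> E" for i using that by (simp add: E_def)
  have fE: "finite E" using ER finR finite_subset by blast
  have dwz: "det w z" using wz(3) by (simp add: cen_def)
  have "\<not> cen ?V w z" using no by blast
  then obtain h where h: "h \<in> B l" "\<not> eqv h w" "\<not> (\<exists>x. lin h x w 1 z)" using wz(3) unfolding cen_def by blast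
  have fV: "finite ?V" using finB[OF l] finR by simp
  have "card (?V - {h}) = 3 * n - 2" using cardBR[OF l] h(1) fV n2 by simp
  then have cV: "3 * n - 2 \<le> card (?V - {h})" by simp
  have fVh: "finite (?V - {h})" using fV by simp
  obtain W where W: "W \<subseteq> ?V - {h}" "zs n p q W" "card W \<le> n"
    by (rule eta_boundD[OF conjunct1[OF eta_davenport_bound[OF n1]] fVh cV])
  have WV: "W \<subseteq> ?V" using W(1) by blast
  have cW: "card W = n" and gR': "good (?V - W)" using replace_block[OF l WV W(2,3)] by auto
  have fW: "finite W" using WV fV finite_subset by blast
  obtain w' z' where w': "w' \<in> ?V - W" "z' \<in> ?V - W" "cen (?V - W) w' z'" "card {i\<in>?V - W. eqv i w'} = n - 1"
    using str[OF gR'] by blast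
  define F where "F = {i\<in>?V - W. eqv i w'}"
  have cF: "card F = n - 1" and wF: "w' \<in> F" and FV: "F \<subseteq> ?V - W" using w' by (auto simp: F_def)
  have eF: "eqv i w'" if "i \<in> F" for i using that by (simp add: F_def)
  have hV: "h \<in> ?V - W" using h(1) W(1) by blast
  \<comment> \<open>Some non-center term of \<open>R\<close> stays in the rest: \<open>R - E\<close>
    has \<open>n\<close> terms, so otherwise it would be \<open>W\<close>, and \<open>E\<close>
    would be a zero-sum of \<open>n-1\<close> copies of \<open>w\<close>.\<close>
  have "\<not> R - E \<subseteq> W"
  proof
    assume s: "R - E \<subseteq> W"
    have cRE: "card (R - E) = n" using card_Diff_subset[OF fE ER] cardR cE n2 by simp
    have "R - E = W" by (rule card_subset_eq[OF fW s]) (use cRE cW in simp)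
    then have z: "zs n p q (R - E)" using W(2) by simp
    have "zs n p q (R - (R - E))" by (rule zs_Diff[OF zsR z]) (use finR wE ER in auto)
    then have zE: "zs n p q E" using ER by (simp add: double_diff)
    have "lin i 1 w 0 z" if "i \<in> E" for i using lin_eqv_left[OF lin_self(1) eqv_sym[OF eE[OF that]]] .
    then have "int n dvd (\<Sum>i\<in>E. 1)" by (rule zs_lin_dest(1)[OF dwz zE])
    then have "int n dvd int (n - 1)" using cE by simp
    then have "n dvd n - 1" by (simp only: int_dvd_int_iff)
    then show False using n2 by (auto dest: dvd_imp_le)
  qed
  then obtain j where j: "j \<in> R" "j \<notin> E" "j \<notin> W" by blast
  have jV: "j \<in> ?V - W" using j by blast
  have nj: "\<not> eqv j w" using j by (simp add: E_def)
  obtain y where y: "lin j y w 1 z" using cen_coset[OF wz(3) j(1) nj] by blast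
  show False
  proof (cases "eqv w' w")
    case True
    have a: "\<not> eqv h w'" "\<not> eqv j w'" using eqv_trans[OF _ True] h(2) nj by blast+
    obtain x where "lin h x w' 1 j" using coset_of_center[OF w'(3) hV a(1) jV a(2)] by blast
    then have "lin h x w 1 j" using lin_eqv_right[OF _ True eqv_refl] by blast
    from lin_comp[OF this lin_self(1) y] have "lin h (x * 1 + 1 * y) w 1 z" by simp
    then show False using h(3) by blast
  next
    case nw: False
    have EF: "E \<inter> F = {}"
    proof (rule ccontr)
      assume "E \<inter> F \<noteq> {}"
      then obtain i where "i \<in> E" "i \<in> F" by blast
      then show False using nw eqv_trans[OF eqv_sym[OF eF] eE] by blast
    qed
    have "det w w'"
    proof (cases "F \<inter> R = {}")
      case False
      then obtain i where i: "i \<in> F" "i \<in> R" by blast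
      then have "\<not> eqv i w" using EF by (auto simp: E_def)
      then have "det w i" by (rule cen_det[OF wz(3) i(2)])
      then show ?thesis by (rule det_eqv[OF _ eqv_refl eF[OF i(1)]])
    next
      case True
      then have FB: "F \<subseteq> B l" using FV by blast
      obtain b where b: "B l = insert b F" "eqv b w'"
        using last_term_eqv[OF BL(2)[OF l] cardB[OF l] FB cF eF] by blast
      have Bw: "eqv i w'" if i: "i \<in> B l" for i
      proof -
        have "i = b \<or> i \<in> F" using i unfolding b(1) by simp
        then show ?thesis using b(2) eF by blast
      qed
      have "\<not> E \<subseteq> W"
      proof
        assume s: "E \<subseteq> W"
        obtain i where i: "i \<in> W - E" "eqv i w" using last_term_eqv[OF W(2) cW s cE eE] by blast
        then have "i \<in> B l" using WV by (auto simp: E_def)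
        then show False using nw eqv_trans[OF eqv_sym[OF Bw] i(2)] by blast
      qed
      then obtain e where e: "e \<in> E" "e \<notin> W" by blast
      have eV: "e \<in> ?V - W" using e ER by blast
      have ne: "\<not> eqv e w'" using e EF eV by (auto simp: F_def)
      have nj': "\<not> eqv j w'" using True jV j(1) by (auto simp: F_def)
      obtain x where x: "lin e x w' 1 j" using coset_of_center[OF w'(3) eV ne jV nj'] by blast
      obtain s t where st: "lin w' s w t z" using lin_ex[OF dwz] by blast
      \<comment> \<open>The copy \<open>e\<close> of \<open>w\<close> lies in
        \<open>j + <w'>\<close>. Its coefficient at \<open>z\<close> is 0 and that of
        \<open>j\<close> is 1, so the coefficient \<open>t\<close> of \<open>w'\<close> at
        \<open>z\<close> is a unit.\<close>
      have "[x * t + 1 * 1 = 0] (mod int n)"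
        by (rule lin_unique(2)[OF dwz lin_comp[OF x st y] lin_self(1) eE[OF e(1)]])
      then have dv: "int n dvd x * t + 1" by (simp add: cong_iff_dvd_diff)
      have "coprime t (int n)"
      proof (rule coprimeI)
        fix c assume c: "c dvd t" "c dvd int n"
        then have "c dvd x * t + 1" using dv dvd_trans by blast
        moreover have "c dvd x * t" using c by simp
        ultimately show "is_unit c" by (simp add: dvd_add_right_iff)
      qed
      then show ?thesis using det_lin[OF dwz st] by simp
    qed
    then have "\<exists>w z. cen ?V w z"
      by (intro pair_center[OF l _ _ EF cE cF wE wF eE eF]) (use ER FV in auto)
    then show False using no by blast
  qed
qed

text \<open>The number of non-center terms is a multiple of \<open>n\<close> among
  \<open>2n-1\<close> terms; it is not 0 because \<open>n\<close> copies of the center would be a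
  zero-sum that is too short.\<close>

lemma rest_center_card:
  assumes c: "cen R w z"
  shows "card {i\<in>R. eqv i w} = n - 1"
proof -
  let ?E = "{i\<in>R. eqv i w}" let ?N = "{i\<in>R. \<not> eqv i w}"
  have "card (?E \<union> ?N) = card ?E + card ?N" using finR by (intro card_Un_disjoint) auto
  moreover have "?E \<union> ?N = R" by blast
  ultimately have s: "card ?E + card ?N = 2 * n - 1" using cardR n2 by simp
  have dv: "n dvd card ?N" by (rule noncenter_dvd[OF c zsR finR])
  have "card ?E < n"
  proof (rule ccontr)
    assume "\<not> ?thesis"
    then have "n \<le> card ?E" by simp
    from subset_of_card[OF this] obtain A where A: "A \<subseteq> ?E" "card A = n" by blast
    have "A \<noteq> {}" using A n2 by auto
    then have "zs n p q A" using A by (intro zs_const[of A w]) auto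
    then have "2 * n - 1 - 1 < card A" using goodR A(1) unfolding good_def by blast
    then show False using A(2) n2 by simp
  qed
  then have ge: "n \<le> card ?N" using s by linarith
  obtain k where k: "card ?N = n * k" using dv by (elim dvdE)
  have "k < 2"
  proof (rule ccontr)
    assume "\<not> k < 2"
    then have "n * 2 \<le> n * k" by simp
    then show False using k s n2 by linarith
  qed
  moreover have "k \<noteq> 0" using k ge n2 by auto
  ultimately have "k = 1" by linarith
  then show ?thesis using k s n2 by simp
qed

lemma rest_center:
  assumes c: "cen R w z"
  shows "\<exists>u\<in>R. eqv w u" and "\<exists>v\<in>R. \<not> eqv v w"
proof -
  have "{i\<in>R. eqv i w} \<noteq> {}" using rest_center_card[OF c] n2 by (metis card.empty One_nat_def Suc_1 diff_is_0_eq not_less_eq_eq)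
  then obtain u where "u \<in> R" "eqv u w" by blast
  then show "\<exists>u\<in>R. eqv w u" using eqv_sym by blast
  have "{i\<in>R. eqv i w} \<noteq> R" using rest_center_card[OF c] cardR n2 by auto
  then show "\<exists>v\<in>R. \<not> eqv v w" by blast
qed

lemma common_center:
  assumes "\<And>l. l < m - 1 \<Longrightarrow> \<exists>z. cen (B l \<union> R) u z"
  shows "\<exists>z. cen L u z"
proof -
  have m0: "0 < m - 1" using m2 by simp
  obtain z where "cen (B 0 \<union> R) u z" using assms[OF m0] by blast
  then have "cen R u z" by (rule cen_mono) simp
  from rest_center(2)[OF this] obtain v where v: "v \<in> R" "\<not> eqv v u" by blast
  have c: "cen (B l \<union> R) u v" if l: "l < m - 1" for l
  proof -
    obtain z where "cen (B l \<union> R) u z" using assms[OF l] by blast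
    then show ?thesis by (rule cen_rebase) (use v in auto)
  qed
  have "cen L u v"
    unfolding cen_def
  proof (intro conjI ballI)
    show "det u v" using c[OF m0] by (simp add: cen_def)
    fix i assume "i \<in> L"
    then obtain l where "l < m - 1" "i \<in> B l \<union> R" using L_cover m0 by blast
    then show "eqv i u \<or> (\<exists>x. lin i x u 1 v)" using c unfolding cen_def by blast
  qed
  then show ?thesis by blast
qed

end

section \<open>A common center\<close>

text \<open>Models a rest with two centers \<open>u\<close> and \<open>v\<close>, the situation in
  which different blocks may have different centers. Only one term of the rest is left besides
  \<open>E\<close> and \<open>F\<close>.\<close>

locale rest_pair = minimal_dec n m p q L B for n m p q L B +
  fixes E F :: "nat set" and u v :: nat
  assumes ER: "E \<subseteq> R" and FR: "F \<subseteq> R" and EF: "E \<inter> F = {}"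
    and cE: "card E = n - 1" and cF: "card F = n - 1" and uE: "u \<in> E" and vF: "v \<in> F"
    and eE: "\<And>i. i \<in> E \<Longrightarrow> eqv i u" and eF: "\<And>i. i \<in> F \<Longrightarrow> eqv i v" and duv: "det u v"
begin

lemma swapped: "rest_pair n m p q L B F E v u"
  by unfold_locales (use ER FR EF cE cF uE vF eE eF det_sym[OF duv] in auto)

lemma fins: "finite E" "finite F" using ER FR finR finite_subset by auto

lemma mixed:
  assumes l: "l < m - 1" and T: "T \<subseteq> B l \<union> R - (E \<union> F)" "T \<noteq> {}" and lT: "\<And>i. i \<in> T \<Longrightarrow> lin i (s i) u (t i) v"
    and EF': "E' \<subseteq> E" "F' \<subseteq> F"
    and d: "int n dvd sum s T + int (card E')" "int n dvd sum t T + int (card F')"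
    and c: "card T + card E' + card F' \<le> 3 * n - 2"
  shows "[sum q T + (sum q E' + sum q F') = int n * \<gamma>] (mod int (m * n))"
proof -
  have f: "finite T" "finite E'" "finite F'"
    using T(1) EF' fins finB[OF l] finR finite_subset[of T "B l \<union> R"] finite_subset[of E' E] finite_subset[of F' F] by auto
  have dis: "T \<inter> E' = {}" "T \<inter> F' = {}" "E' \<inter> F' = {}" using T(1) EF' EF by blast+
  have e: "eqv i u" if "i \<in> E'" for i using that EF' eE by blast
  have e': "eqv i v" if "i \<in> F'" for i using that EF' eF by blast
  have z: "zs n p q (T \<union> (E' \<union> F'))" by (rule zs_mixed[OF f dis T(2) lT e e' d])
  have "card (T \<union> (E' \<union> F')) \<le> card T + card (E' \<union> F')" by (rule card_Un_le)
  moreover have "card (E' \<union> F') \<le> card E' + card F'" by (rule card_Un_le)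
  ultimately have "card (T \<union> (E' \<union> F')) \<le> 3 * n - 1 - 1" using c by linarith
  moreover have "T \<union> (E' \<union> F') \<subseteq> B l \<union> R" using T(1) EF' ER FR by blast
  ultimately have "[sum q (T \<union> (E' \<union> F')) = int n * \<gamma>] (mod int (m * n))" using sum_q_block[OF l _ z] by blast
  moreover have "sum q (T \<union> (E' \<union> F')) = sum q T + (sum q E' + sum q F')"
    using f dis by (subst sum.union_disjoint; auto simp: sum.union_disjoint)
  ultimately show ?thesis by simp
qed

text \<open>The term \<open>h = x u + v\<close> is completed by all of \<open>F\<close> and
  \<open>n - x\<close> terms of \<open>E\<close>, at least one and not all, which permits an
  exchange.\<close>

lemma E_const:
  assumes l: "l < m - 1" and h: "h \<in> B l" "lin h (int x) u 1 v" "2 \<le> x" "x \<le> n - 1" and j: "j \<in> E"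
  shows "[q j = q u] (mod int (m * n))"
proof (cases "j = u")
  case False
  have hR: "{h} \<subseteq> B l \<union> R - (E \<union> F)" "{h} \<noteq> {}" using h(1) BR[OF l] ER FR by auto
  have "card (E - {j, u}) = n - 3" using j uE False fins cE by (simp add: card_Diff_subset)
  then have "n - x - 1 \<le> card (E - {j, u})" using h by linarith
  from subset_of_card[OF this] obtain K where K: "K \<subseteq> E - {j, u}" "card K = n - x - 1" by blast
  have fK: "finite K" "j \<notin> K" "u \<notin> K" using K(1) fins(1) finite_subset[of K E] by auto
  have *: "[q h + (q i + sum q K + sum q F) = int n * \<gamma>] (mod int (m * n))" if i: "i \<in> E" "i \<notin> K" for i
  proof -
    have ci: "card (insert i K) = n - x" using fK i K h by simp
    have ci': "int (card (insert i K)) = int n - int x" "int (card F) = int n - 1" unfolding ci cF using h by auto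
    have "[sum q {h} + (sum q (insert i K) + sum q F) = int n * \<gamma>] (mod int (m * n))"
    proof (rule mixed[OF l hR, where s = "\<lambda>_. int x" and t = "\<lambda>_. 1"])
      show "card {h} + card (insert i K) + card F \<le> 3 * n - 2" unfolding ci cF using h n2 by simp
    qed (use K i h in \<open>auto simp only: ci', auto\<close>)
    then show ?thesis using fK i by (simp add: add.assoc)
  qed
  have "[q j + (q h + sum q K + sum q F) = q u + (q h + sum q K + sum q F)] (mod int (m * n))"
    using *[OF j fK(2)] *[OF uE fK(3)] by (simp add: cong_def add_ac)
  then show ?thesis by (rule cong_add_rcancel[THEN iffD1])
qed simp

text \<open>With \<open>q u + q v = \<gamma>\<close> the deviations \<open>t i\<close> vanish modulo
  \<open>m\<close>, and the relation for \<open>J\<close> becomes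
  \<open>(cc n (sum x J) - 1) * q u = 0\<close>. If \<open>m\<close> did not divide
  \<open>q u\<close>, the ceiling could never step from 1 to 2; then the \<open>n\<close> positive
  values \<open>x i\<close> would have sum at most \<open>n\<close>, against
  \<open>2 \<le> x h\<close>.\<close>

lemma coset_block_carry:
  assumes l: "l < m - 1"
    and kE: "\<And>j. j \<in> E \<Longrightarrow> [q j = q u] (mod int (m * n))" and kF: "\<And>j. j \<in> F \<Longrightarrow> [q j = q v] (mod int (m * n))"
    and x: "\<And>i. i \<in> B l \<Longrightarrow> 1 \<le> x i \<and> x i \<le> n \<and> lin i (int (x i)) u 1 v"
    and K: "[q u + q v = \<gamma>] (mod int m)" and h: "h \<in> B l" "2 \<le> x h"
  shows "int m dvd q u"
proof (rule ccontr)
  assume nd: "\<not> int m dvd q u"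
  have n1: "n \<ge> 1" using n2 by simp
  define t where "t i = (q i - int (x i) * q u - q v) div int n" for i
  have t: "q i = int (x i) * q u + q v + int n * t i" if "i \<in> B l" for i
  proof -
    have "int n dvd q i - (int (x i) * q u + 1 * q v)" using x[OF that] unfolding lin_def cong_iff_dvd_diff by blast
    then have "int n dvd q i - int (x i) * q u - q v" by (simp add: algebra_simps)
    then have "int n * t i = q i - int (x i) * q u - q v" by (simp add: t_def)
    then show ?thesis by linarith
  qed
  have star: "[int (cc n (sum x J)) * q u + q v + sum t J = \<gamma>] (mod int m)" if J: "J \<subseteq> B l" "J \<noteq> {}" for J
  proof -
    have fJ: "finite J" using J(1) finB[OF l] finite_subset by blast
    have cJ: "1 \<le> card J" "card J \<le> n" using J fJ card_mono[OF finB[OF l] J(1)] cardB[OF l] by (auto simp: Suc_le_eq card_gt_0_iff)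
    have r: "rr n (sum x J) \<le> card E" "n - card J \<le> card F" using rr_less[OF n1, of "sum x J"] cE cF cJ by linarith+
    obtain E' where E': "E' \<subseteq> E" "card E' = rr n (sum x J)" using subset_of_card[OF r(1)] by blast
    obtain F' where F': "F' \<subseteq> F" "card F' = n - card J" using subset_of_card[OF r(2)] by blast
    have e1: "int (sum x J) + int (card E') = int n * int (cc n (sum x J))"
      unfolding E'(2) of_nat_add[symmetric] cc_mult[OF n1, symmetric] by simp
    have e2: "int (card F') = int n - int (card J)" using F'(2) cJ by simp
    have 1: "[sum q J + (sum q E' + sum q F') = int n * \<gamma>] (mod int (m * n))"
    proof (rule mixed[OF l _ J(2), where s = "\<lambda>i. int (x i)" and t = "\<lambda>_. 1"])
      show "J \<subseteq> B l \<union> R - (E \<union> F)" using J(1) BR[OF l] ER FR by blast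
      show "lin i (int (x i)) u 1 v" if "i \<in> J" for i using x that J(1) by blast
      show "int n dvd (\<Sum>i\<in>J. int (x i)) + int (card E')" using e1 by simp
      show "int n dvd (\<Sum>i\<in>J. 1) + int (card F')" using e2 by simp
      show "card J + card E' + card F' \<le> 3 * n - 2" using r cE E'(2) F'(2) cJ n2 by linarith
    qed (use E' F' in auto)
    have 2: "[sum q E' = int (card E') * q u] (mod int (m * n))" using kE E'(1) by (intro sum_cong_const) auto
    have 3: "[sum q F' = int (card F') * q v] (mod int (m * n))" using kF F'(1) by (intro sum_cong_const) auto
    have "sum q J = (\<Sum>i\<in>J. int (x i) * q u + q v + int n * t i)" using J(1) t by (intro sum.cong) auto
    then have 4: "sum q J = int (sum x J) * q u + int (card J) * q v + int n * sum t J"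
      by (simp add: sum.distrib sum_distrib_left sum_distrib_right)
    have 5: "[sum q J + (sum q E' + sum q F') = sum q J + (int (card E') * q u + int (card F') * q v)] (mod int (m * n))"
      by (intro cong_add cong_refl 2 3)
    have 6: "[sum q J + (int (card E') * q u + int (card F') * q v) = int n * \<gamma>] (mod int (m * n))"
      by (rule cong_trans[OF cong_sym[OF 5] 1])
    have "sum q J + (int (card E') * q u + int (card F') * q v)
       = (int (sum x J) + int (card E')) * q u + (int (card J) + int (card F')) * q v + int n * sum t J"
      unfolding 4 by (simp add: algebra_simps)
    also have "\<dots> = int n * (int (cc n (sum x J)) * q u + q v + sum t J)"
      unfolding e1 e2 by (simp add: algebra_simps)
    finally show ?thesis using 6 cong_scale_iff[of n] n1 by simp
  qed
  have t0: "int m dvd t i" if i: "i \<in> B l" for i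
  proof -
    have "[int (cc n (sum x {i})) * q u + q v + sum t {i} = \<gamma>] (mod int m)" using i by (intro star) auto
    moreover have "cc n (x i) = 1" using cc_one[of "x i" n] x[OF i] by blast
    ultimately have "[q u + q v + t i = \<gamma>] (mod int m)" by simp
    then have "int m dvd (q u + q v + t i - \<gamma>) - (q u + q v - \<gamma>)"
      using K unfolding cong_iff_dvd_diff by (rule dvd_diff)
    then show ?thesis by simp
  qed
  have cK: "int m dvd (int (cc n (sum x J)) - 1) * q u" if J: "J \<subseteq> B l" "J \<noteq> {}" for J
  proof -
    have "int m dvd (int (cc n (sum x J)) * q u + q v + sum t J - \<gamma>) - (q u + q v - \<gamma>)"
      using star[OF J] K unfolding cong_iff_dvd_diff by (rule dvd_diff)
    moreover have "int m dvd sum t J" using t0 J(1) by (intro dvd_sum) blast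
    ultimately have "int m dvd (int (cc n (sum x J)) * q u + q v + sum t J - \<gamma>) - (q u + q v - \<gamma>) - sum t J"
      by (rule dvd_diff)
    then show ?thesis by (simp add: algebra_simps)
  qed
  have one: "J \<subseteq> B l \<Longrightarrow> cc n (sum x J) = 1" if "finite J" "J \<noteq> {}" for J
    using that
  proof (induction J rule: finite_ne_induct)
    case (singleton j)
    then show ?case using cc_one[of "x j" n] x[of j] by simp
  next
    case (insert j J)
    have IH: "cc n (sum x J) = 1" using insert by blast
    have jx: "1 \<le> x j" "x j \<le> n" using x[of j] insert.prems by auto
    have "cc n (sum x (insert j J)) = 1 \<or> cc n (sum x (insert j J)) = 2"
      using cc_step[OF jx, of "sum x J"] IH insert.hyps by (simp add: add.commute numeral_2_eq_2)
    moreover have "cc n (sum x (insert j J)) \<noteq> 2"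
    proof
      assume "cc n (sum x (insert j J)) = 2"
      then show False using cK[OF insert.prems] nd by simp
    qed
    ultimately show ?case by blast
  qed
  have "B l \<noteq> {}" using h by blast
  then have "n * 1 = sum x (B l) + rr n (sum x (B l))" using one[OF finB[OF l]] cc_mult[OF n1, of "sum x (B l)"] by simp
  then have le: "sum x (B l) \<le> n" by simp
  have "(\<Sum>i\<in>B l - {h}. 1) \<le> sum x (B l - {h})" using x by (intro sum_mono) auto
  then have "n - 1 \<le> sum x (B l - {h})" using h(1) cardB[OF l] finB[OF l] by simp
  moreover have "sum x (B l) = x h + sum x (B l - {h})" by (rule sum.remove[OF finB[OF l] h(1)])
  ultimately show False using le h(2) n2 by linarith
qed

end

context rest_pair
begin

text \<open>The number of terms of the block that are not copies of \<open>u\<close> is a multiple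
  of \<open>n\<close> and not 0, since a block of copies of \<open>u\<close> would be compatible
  with the center \<open>v\<close> as well. So the block lies in \<open>v + <u>\<close>, and some
  coordinate is neither 1 nor \<open>n\<close>.\<close>

lemma coset_coords:
  assumes l: "l < m - 1" and c: "cen (B l \<union> R) u z" and no: "\<not> (\<exists>z. cen (B l \<union> R) v z)" and cR: "cen R v u"
  shows "\<exists>x. (\<forall>i\<in>B l. 1 \<le> x i \<and> x i \<le> n \<and> lin i (int (x i)) u 1 v) \<and> (\<exists>h\<in>B l. 2 \<le> x h \<and> x h \<le> n - 1)"
proof -
  have n1: "n \<ge> 1" using n2 by simp
  have ncv: "\<exists>i\<in>B l. \<not> eqv i v \<and> \<not> (\<exists>y. lin i y v 1 u)"
  proof (rule ccontr)
    assume "\<not> ?thesis"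
    then have "cen (B l \<union> R) v u" using cR unfolding cen_def by blast
    then show False using no by blast
  qed
  have nuv: "\<not> eqv v u" by (rule det_not_eqv[OF det_sym[OF duv]])
  have cv: "cen (B l \<union> R) u v" by (rule cen_rebase[OF c _ nuv]) (use vF FR in auto)
  have cB: "cen (B l) u v" by (rule cen_mono[OF cv]) simp
  let ?N = "{i\<in>B l. \<not> eqv i u}"
  have "?N \<noteq> {}"
  proof
    assume "?N = {}"
    then have all: "eqv i u" if "i \<in> B l" for i using that by blast
    obtain i where i: "i \<in> B l" "\<not> (\<exists>y. lin i y v 1 u)" using ncv by blast
    have "lin i 0 v 1 u" by (rule lin_eqv_left[OF lin_self(2) eqv_sym[OF all[OF i(1)]]])
    then show False using i(2) by blast
  qed
  moreover have fN: "finite ?N" using finB[OF l] by simp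
  ultimately have "0 < card ?N" by (simp add: card_gt_0_iff)
  then have "n \<le> card ?N" using dvd_imp_le[OF noncenter_dvd[OF cB BL(2)[OF l] finB[OF l]]] by blast
  then have "?N = B l" using card_subset_eq[OF finB[OF l], of ?N] card_mono[OF finB[OF l], of ?N] cardB[OF l] by auto
  then have nu: "\<not> eqv i u" if "i \<in> B l" for i using that by blast
  have "\<exists>a. 1 \<le> a \<and> a \<le> n \<and> (i \<in> B l \<longrightarrow> lin i (int a) u 1 v)" for i
  proof (cases "i \<in> B l")
    case True
    obtain s where s: "lin i s u 1 v" using cen_coset[OF cB True nu[OF True]] by blast
    obtain a where a: "1 \<le> a" "a \<le> n" "[s = int a] (mod int n)" using cong_rep_pos[OF n1] by blast
    then show ?thesis using lin_cong[OF s a(3) cong_refl] by blast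
  qed (use n1 in auto)
  then obtain x where x: "\<And>i. 1 \<le> x i \<and> x i \<le> n \<and> (i \<in> B l \<longrightarrow> lin i (int (x i)) u 1 v)" by metis
  obtain h where h: "h \<in> B l" "\<not> eqv h v" "\<not> (\<exists>y. lin h y v 1 u)" using ncv by blast
  have lh: "lin h (int (x h)) u 1 v" using x h(1) by blast
  have "x h \<noteq> 1" using h(3) lin_comm[THEN iffD1, OF lh] by auto
  moreover have "x h \<noteq> n"
  proof
    assume "x h = n"
    then have "lin h 0 u 1 v" using lin_cong[OF lh, of 0 1] by (simp add: cong_def)
    then show False using h(2) lin_eqv[OF _ lin_self(2)] by blast
  qed
  moreover have "1 \<le> x h" "x h \<le> n" using x by blast+
  ultimately have "2 \<le> x h" "x h \<le> n - 1" by linarith+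
  then show ?thesis using x h(1) by blast
qed

text \<open>\<open>h = X u + v\<close> and \<open>h' = u + Y v\<close> can be put into one zero-sum
  \<open>A\<close>, while \<open>g = u + v\<close> takes the place of \<open>h\<close> in its block,
  giving \<open>C\<close>. Replacing both blocks by \<open>C\<close> and \<open>A\<close> respects
  the bound, so their sums agree, and this forces \<open>q u + q v = \<gamma>\<close> modulo
  \<open>m\<close>. Then both carry arguments apply, and \<open>m\<close> divides \<open>q u\<close>
  and \<open>q v\<close>, hence \<open>\<gamma>\<close>.\<close>

lemma conflict:
  assumes l: "l1 < m - 1" "l2 < m - 1" "l1 \<noteq> l2" and g: "g \<in> R - (E \<union> F)" "lin g 1 u 1 v"
    and x: "\<forall>i\<in>B l1. 1 \<le> x i \<and> x i \<le> n \<and> lin i (int (x i)) u 1 v" and h: "h \<in> B l1" "2 \<le> x h" "x h \<le> n - 1"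
    and y: "\<forall>i\<in>B l2. 1 \<le> y i \<and> y i \<le> n \<and> lin i (int (y i)) v 1 u" and h': "h' \<in> B l2" "2 \<le> y h'" "y h' \<le> n - 1"
  shows False
proof -
  interpret S: rest_pair n m p q L B F E v u by (rule swapped)
  define X where "X = int (x h)" define Y where "Y = int (y h')" define N where "N = int n"
  have lh: "lin h X u 1 v" using x h(1) by (auto simp: X_def)
  have lh'': "lin h' Y v 1 u" using y h'(1) by (auto simp: Y_def)
  have lh': "lin h' 1 u Y v" by (rule lin_comm[THEN iffD1, OF lh''])
  have kE: "[q j = q u] (mod int (m * n))" if "j \<in> E" for j
    by (rule E_const[OF l(1) h(1) lh[unfolded X_def] h(2,3) that])
  have kF: "[q j = q v] (mod int (m * n))" if "j \<in> F" for j
    by (rule S.E_const[OF l(2) h'(1) lh''[unfolded Y_def] h'(2,3) that])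
  have sE: "int (m * n) dvd sum q E' - int (card E') * q u" if "E' \<subseteq> E" for E'
    unfolding cong_iff_dvd_diff[symmetric] using that kE by (intro sum_cong_const) auto
  have sF: "int (m * n) dvd sum q F' - int (card F') * q v" if "F' \<subseteq> F" for F'
    unfolding cong_iff_dvd_diff[symmetric] using that kF by (intro sum_cong_const) auto
  have single: "int (m * n) dvd q i + int a * q u + int b * q v - N * \<gamma>"
    if i: "i \<in> B l \<union> R - (E \<union> F)" "l < m - 1" "lin i s u t v" and ab: "a \<le> n - 1" "b \<le> n - 1" "N dvd s + int a" "N dvd t + int b"
    for i l s t a b
  proof -
    obtain E' where E': "E' \<subseteq> E" "card E' = a" using subset_of_card[of a E] cE ab(1) by auto
    obtain F' where F': "F' \<subseteq> F" "card F' = b" using subset_of_card[of b F] cF ab(2) by auto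
    have "[sum q {i} + (sum q E' + sum q F') = int n * \<gamma>] (mod int (m * n))"
    proof (rule mixed[OF i(2), where s = "\<lambda>_. s" and t = "\<lambda>_. t"])
      show "card {i} + card E' + card F' \<le> 3 * n - 2" using E' F' ab(1,2) n2 by simp
    qed (use i E' F' ab in \<open>auto simp: N_def\<close>)
    then have "int (m * n) dvd q i + (sum q E' + sum q F') - N * \<gamma>" by (simp add: cong_iff_dvd_diff N_def)
    from dvd_diff[OF dvd_diff[OF this sE[OF E'(1)]] sF[OF F'(1)]]
    show ?thesis by (simp add: E' F' algebra_simps)
  qed
  have iV: "h \<in> B l1 \<union> R - (E \<union> F)" "h' \<in> B l2 \<union> R - (E \<union> F)" "g \<in> B l1 \<union> R - (E \<union> F)"
    using h(1) h'(1) g BR[OF l(1)] BR[OF l(2)] ER FR by blast+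
  have ar1: "int (n - x h) = N - X" "int (n - y h') = N - Y" "int (n - 1) = N - 1"
    "int (n - x h - 1) = N - X - 1" "int (n - y h' - 1) = N - Y - 1" "int (x h - 1) = X - 1"
    using h h' n2 by (auto simp: N_def X_def Y_def)
  have b: "int (m * n) dvd q h + (N - X) * q u + (N - 1) * q v - N * \<gamma>"
    using single[OF iV(1) l(1) lh, of "n - x h" "n - 1"] h n2 unfolding ar1 by simp
  have b': "int (m * n) dvd q h' + (N - 1) * q u + (N - Y) * q v - N * \<gamma>"
    using single[OF iV(2) l(2) lh', of "n - 1" "n - y h'"] h' n2 unfolding ar1 by simp
  have d: "int (m * n) dvd q g + (N - 1) * q u + (N - 1) * q v - N * \<gamma>"
    using single[OF iV(3) l(1) g(2), of "n - 1" "n - 1"] n2 unfolding ar1 by simp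
  have a: "int (m * n) dvd sum q (B l1) - N * \<gamma>"
    using sum_q_block[OF l(1) _ BL(2)[OF l(1)]] cardB[OF l(1)] n2 by (simp add: cong_iff_dvd_diff N_def)
  have "n - x h - 1 \<le> card E" "n - y h' - 1 \<le> card F" using cE cF h h' by linarith+
  note le = subset_of_card[OF this(1)] subset_of_card[OF this(2)]
  obtain E1 where E1: "E1 \<subseteq> E" "card E1 = n - x h - 1" using le(1) by blast
  have fE1: "finite E1" using E1 fins finite_subset by blast
  have "card (E - E1) = x h" using card_Diff_subset[OF fE1 E1(1)] cE E1(2) h by simp
  then obtain E2 where E2: "E2 \<subseteq> E - E1" "card E2 = x h - 1" using subset_of_card[of "x h - 1" "E - E1"] by auto
  obtain F1 where F1: "F1 \<subseteq> F" "card F1 = n - y h' - 1" using le(2) by blast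
  have E2E: "E2 \<subseteq> E" using E2 by blast
  have fE2: "finite E2" "finite F1" using E2E F1 fins finite_subset by blast+
  have hh': "h \<noteq> h'" using h(1) h'(1) BB[OF l] by blast
  \<comment> \<open>\<open>A\<close> is \<open>h\<close>, \<open>h'\<close>, \<open>n-X-1\<close>
    copies of \<open>u\<close> and \<open>n-Y-1\<close> of \<open>v\<close>; in \<open>C\<close> the
    exchange of \<open>h\<close> for \<open>g\<close> is compensated by \<open>X-1\<close> copies of
    \<open>u\<close>. The lengths \<open>2n-X-Y\<close> and \<open>n+X-1\<close> add up to less than
    \<open>3n\<close>.\<close>
  define A where "A = {h, h'} \<union> (E1 \<union> F1)"
  define T where "T = insert g (B l1 - {h})"
  define C where "C = T \<union> (E2 \<union> {})"
  have gB: "g \<notin> B l1" using g BR[OF l(1)] by blast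
  have fT: "finite T" using finB[OF l(1)] by (simp add: T_def)
  have hn: "h \<notin> R" "h' \<notin> R" using h(1) h'(1) BR[OF l(1)] BR[OF l(2)] by blast+
  have zA: "zs n p q A" unfolding A_def
  proof (rule zs_mixed[where s = "\<lambda>i. if i = h then X else 1" and t = "\<lambda>i. if i = h then 1 else Y"])
    show "{h, h'} \<inter> E1 = {}" "{h, h'} \<inter> F1 = {}" using hn E1(1) F1(1) ER FR by auto
    show "E1 \<inter> F1 = {}" using E1(1) F1(1) EF by blast
    show "eqv i u" if "i \<in> E1" for i using that E1(1) eE by blast
    show "eqv i v" if "i \<in> F1" for i using that F1(1) eF by blast
    show "lin i (if i = h then X else 1) u (if i = h then 1 else Y) v" if "i \<in> {h, h'}" for i
      using that lh lh' hh' by auto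
    show "int n dvd (\<Sum>i\<in>{h, h'}. if i = h then X else 1) + int (card E1)"
      using hh' unfolding E1(2) ar1 by (simp add: N_def)
    show "int n dvd (\<Sum>i\<in>{h, h'}. if i = h then 1 else Y) + int (card F1)"
      using hh' unfolding F1(2) ar1 by (simp add: N_def)
  qed (use fE1 fE2 in auto)
  have zC: "zs n p q C" unfolding C_def
  proof (rule zs_mixed[where s = "\<lambda>i. if i = g then 1 else int (x i)" and t = "\<lambda>i. 1"])
    show "T \<inter> E2 = {}" using E2E g ER BR[OF l(1)] by (auto simp: T_def)
    show "eqv i u" if "i \<in> E2" for i using that E2E eE by blast
    show "lin i (if i = g then 1 else int (x i)) u 1 v" if "i \<in> T" for i
      using that g(2) x by (auto simp: T_def)
    have "int n dvd (\<Sum>i\<in>B l1. int (x i))"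
      by (rule zs_lin_dest(1)[OF duv BL(2)[OF l(1)], where t = "\<lambda>_. 1"]) (use x in auto)
    moreover have "(\<Sum>i\<in>B l1. int (x i)) = X + (\<Sum>i\<in>B l1 - {h}. int (x i))"
      unfolding X_def by (rule sum.remove[OF finB[OF l(1)] h(1)])
    moreover have "(\<Sum>i\<in>B l1 - {h}. if i = g then 1 else int (x i)) = (\<Sum>i\<in>B l1 - {h}. int (x i))"
      using gB by (intro sum.cong) auto
    ultimately show "int n dvd (\<Sum>i\<in>T. if i = g then 1 else int (x i)) + int (card E2)"
      unfolding E2(2) ar1 T_def using gB finB[OF l(1)] by (simp add: add.commute)
    have "card T = n" using gB finB[OF l(1)] h(1) cardB[OF l(1)] n2 by (simp add: T_def)
    then show "int n dvd (\<Sum>i\<in>T. 1) + int (card {})" by simp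
  qed (use fT fE2 T_def in auto)
  have CV: "C \<subseteq> B l1 \<union> R" using E2E ER g by (auto simp: C_def T_def)
  have CL: "C \<subseteq> L" using CV BL(1)[OF l(1)] RL by blast
  have AL: "A \<subseteq> L" using h(1) h'(1) BL(1)[OF l(1)] BL(1)[OF l(2)] E1(1) F1(1) ER FR RL by (auto simp: A_def)
  have AC: "A \<inter> C = {}"
  proof -
    have "h \<notin> C" using hn g E2E ER by (auto simp: C_def T_def)
    moreover have "h' \<notin> C" using hn h'(1) g E2E ER BB[OF l] by (auto simp: C_def T_def)
    moreover have "E1 \<inter> C = {}" using E1(1) E2(1) ER BR[OF l(1)] g by (auto simp: C_def T_def)
    moreover have "F1 \<inter> C = {}" using F1(1) E2E FR BR[OF l(1)] g EF by (auto simp: C_def T_def)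
    ultimately show ?thesis by (auto simp: A_def)
  qed
  let ?B1 = "B(l1 := C)" let ?B2 = "?B1(l2 := A)"
  have F1': "fam ?B1 (m - 1)" using disj_other[OF l(1) CV] by (intro fam_upd[OF fB l(1) CL zC]) auto
  have F2: "fam ?B2 (m - 1)"
  proof (rule fam_upd[OF F1' l(2) AL zA])
    fix i assume i: "i < m - 1" "i \<noteq> l2"
    show "A \<inter> ?B1 i = {}"
    proof (cases "i = l1")
      case True
      then show ?thesis using AC by simp
    next
      case False
      have "h \<notin> B i" using h(1) BB[OF l(1) i(1)] False by blast
      moreover have "h' \<notin> B i" using h'(1) BB[OF l(2) i(1)] i(2) by blast
      moreover have "(E1 \<union> F1) \<inter> B i = {}" using E1(1) F1(1) ER FR BR[OF i(1)] by blast
      ultimately show ?thesis using False by (auto simp: A_def)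
    qed
  qed
  have c: "card (\<Union>i<m - 1. ?B2 i) \<le> m * n + n - 1 - 1"
  proof -
    let ?J = "{..<m - 1} - {l1, l2}"
    have "(\<Union>i<m - 1. ?B2 i) \<subseteq> (A \<union> C) \<union> (\<Union>i\<in>?J. B i)" by (auto split: if_splits)
    moreover have "finite ((A \<union> C) \<union> (\<Union>i\<in>?J. B i))" using finB finL'[OF AL] finL'[OF CL] by auto
    ultimately have "card (\<Union>i<m - 1. ?B2 i) \<le> card ((A \<union> C) \<union> (\<Union>i\<in>?J. B i))" by (intro card_mono)
    also have "\<dots> \<le> card (A \<union> C) + card (\<Union>i\<in>?J. B i)" by (rule card_Un_le)
    also have "card (\<Union>i\<in>?J. B i) \<le> card ?J * n" using cB by (intro card_UN_bound) auto
    also have "card ?J = m - 3" using l by (simp add: card_Diff_subset)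
    finally have c1: "card (\<Union>i<m - 1. ?B2 i) \<le> card (A \<union> C) + (m - 3) * n" by simp
    have "card (A \<union> C) \<le> card A + card C" by (rule card_Un_le)
    moreover have "card A \<le> card {h, h'} + card (E1 \<union> F1)" unfolding A_def by (rule card_Un_le)
    moreover have "card {h, h'} \<le> 2" by (simp add: card_insert_if)
    moreover have "card (E1 \<union> F1) \<le> card E1 + card F1" by (rule card_Un_le)
    moreover have "card C \<le> card T + card E2" unfolding C_def using card_Un_le[of T E2] by simp
    moreover have "card T = n" using gB finB[OF l(1)] h(1) cardB[OF l(1)] n2 by (simp add: T_def)
    ultimately have c2: "card (A \<union> C) \<le> 3 * n" using E1(2) E2(2) F1(2) h h' by linarith
    have "m \<ge> 3" using l by linarith
    then obtain m' where "m = m' + 3" by (metis le_add_diff_inverse2)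
    then have "3 * n + (m - 3) * n \<le> m * n + n - 1 - 1" using n2 by (simp add: algebra_simps)
    then show ?thesis using c1 c2 by linarith
  qed
  have "[kap (?B2 l1) = kap (?B2 l2)] (mod int m)" by (rule fam_const(1)[OF F2 c l(1,2)])
  then have "[kap C = kap A] (mod int m)" using l(3) by simp
  then have "[int n * kap C = int n * kap A] (mod int (m * n))" using cong_scale_iff[of n] n2 by simp
  then have cc0: "int (m * n) dvd sum q C - sum q A" using kap_mult[OF zC] kap_mult[OF zA] by (simp add: cong_iff_dvd_diff)
  have sT: "sum q T = q g + (sum q (B l1) - q h)"
    using gB finB[OF l(1)] h(1) by (simp add: T_def sum_diff1)
  have sC: "sum q C = (q g + (sum q (B l1) - q h)) + sum q E2"
    unfolding C_def sT[symmetric] using fT fE2 E2E g ER BR[OF l(1)] by (simp, intro sum.union_disjoint) (auto simp: T_def)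
  have "sum q A = sum q {h, h'} + sum q (E1 \<union> F1)"
    unfolding A_def using fE1 fE2 hn E1(1) F1(1) ER FR by (intro sum.union_disjoint) auto
  moreover have "sum q (E1 \<union> F1) = sum q E1 + sum q F1" using fE1 fE2 E1(1) F1(1) EF by (intro sum.union_disjoint) auto
  ultimately have sA: "sum q A = q h + q h' + (sum q E1 + sum q F1)" using hh' by simp
  have e2: "int (m * n) dvd sum q E2 - (X - 1) * q u" using sE[OF E2E] unfolding E2(2) ar1 .
  have e1: "int (m * n) dvd sum q E1 - (N - X - 1) * q u" using sE[OF E1(1)] unfolding E1(2) ar1 .
  have f1: "int (m * n) dvd sum q F1 - (N - Y - 1) * q v" using sF[OF F1(1)] unfolding F1(2) ar1 .
  \<comment> \<open>The one-term relations for \<open>h\<close> (twice), \<open>h'\<close> and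
    \<open>g\<close>, combined with the equality of the two new sums so that only multiples of
    \<open>q u\<close>, \<open>q v\<close> and \<open>\<gamma>\<close> survive.\<close>
  have id: "N * (q u + q v) - N * \<gamma> = (sum q C - sum q A) - (sum q (B l1) - N * \<gamma>)
      + (q h + (N - X) * q u + (N - 1) * q v - N * \<gamma>) + (q h + (N - X) * q u + (N - 1) * q v - N * \<gamma>)
      - (q g + (N - 1) * q u + (N - 1) * q v - N * \<gamma>) - (sum q E2 - (X - 1) * q u)
      + (q h' + (N - 1) * q u + (N - Y) * q v - N * \<gamma>) + (sum q E1 - (N - X - 1) * q u) + (sum q F1 - (N - Y - 1) * q v)"
    unfolding sA sC by (simp add: algebra_simps)
  have "int (m * n) dvd N * (q u + q v) - N * \<gamma>" unfolding id
    by (rule dvd_add[OF dvd_add[OF dvd_add[OF dvd_diff[OF dvd_diff[OF dvd_add[OF dvd_add[OF dvd_diff[OF cc0 a] b] b] d] e2] b'] e1] f1])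
  then have K: "[q u + q v = \<gamma>] (mod int m)"
    unfolding N_def cong_iff_dvd_diff[symmetric] using cong_scale_iff[of n] n2 by simp
  then have K': "[q v + q u = \<gamma>] (mod int m)" by (simp add: add.commute)
  have 1: "int m dvd q u" by (rule coset_block_carry[where x = x, OF l(1) kE kF _ K h(1,2)]) (use x in auto)
  have 2: "int m dvd q v" by (rule S.coset_block_carry[where x = y, OF l(2) kF kE _ K' h'(1,2)]) (use y in auto)
  have "int m dvd (q u + q v) - (q u + q v - \<gamma>)"
    using K unfolding cong_iff_dvd_diff by (rule dvd_diff[OF dvd_add[OF 1 2]])
  then show False using not_dvd_\<gamma> by simp
qed

end

context minimal_dec
begin

text \<open>Three pairwise inequivalent centers of the rest would need \<open>3(n-1) > 2n-1\<close>
  terms, which is where \<open>n \<ge> 3\<close> enters. So if no center serves all blocks, two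
  centers \<open>u\<close> and \<open>v\<close> remain, with one block rejecting \<open>v\<close>
  and another rejecting \<open>u\<close>; this is the excluded conflict.\<close>

lemma center_all:
  assumes n3: "n \<ge> 3"
  shows "\<exists>w z. cen L w z"
proof (rule ccontr)
  assume no: "\<not> ?thesis"
  have ex: "\<exists>u\<in>R. \<exists>z. cen (B l \<union> R) u z" if l: "l < m - 1" for l
  proof -
    obtain w z where wz: "cen (B l \<union> R) w z" using block_center[OF l] by blast
    have "cen R w z" by (rule cen_mono[OF wz]) simp
    from rest_center(1)[OF this] obtain u where "u \<in> R" "eqv w u" by blast
    then show ?thesis using cen_eqv[OF wz] by blast
  qed
  have no': "\<exists>l<m - 1. \<not> (\<exists>z. cen (B l \<union> R) u z)" for u
    using common_center[of u] no by blast
  have m0: "0 < m - 1" using m2 by simp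
  obtain u z where u: "u \<in> R" "cen (B 0 \<union> R) u z" using ex[OF m0] by blast
  obtain l2 where l2: "l2 < m - 1" "\<not> (\<exists>z. cen (B l2 \<union> R) u z)" using no' by blast
  obtain v zv where v: "v \<in> R" "cen (B l2 \<union> R) v zv" using ex[OF l2(1)] by blast
  obtain l1 where l1: "l1 < m - 1" "\<not> (\<exists>z. cen (B l1 \<union> R) v z)" using no' by blast
  obtain u' zu where u': "u' \<in> R" "cen (B l1 \<union> R) u' zu" using ex[OF l1(1)] by blast
  have cu: "cen R u z" by (rule cen_mono[OF u(2)]) simp
  have cv: "cen R v zv" by (rule cen_mono[OF v(2)]) simp
  have cu': "cen R u' zu" by (rule cen_mono[OF u'(2)]) simp
  have nvu: "\<not> eqv v u" using cen_eqv[OF v(2), of u] l2(2) by blast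
  have nuv: "\<not> eqv u v" using nvu eqv_sym[of u v] by blast
  have nu'v: "\<not> eqv u' v" using cen_eqv[OF u'(2), of v] l1(2) by blast
  define cl where "cl w = {i\<in>R. eqv i w}" for w
  have ccl: "card (cl u) = n - 1" "card (cl v) = n - 1" "card (cl u') = n - 1"
    unfolding cl_def by (rule rest_center_card[OF cu] rest_center_card[OF cv] rest_center_card[OF cu'])+
  have fcl: "finite (cl w)" "cl w \<subseteq> R" for w using finR by (auto simp: cl_def)
  have dcl: "cl w \<inter> cl w' = {}" if "\<not> eqv w w'" for w w'
  proof (rule ccontr)
    assume "cl w \<inter> cl w' \<noteq> {}"
    then obtain i where "eqv i w" "eqv i w'" by (auto simp: cl_def)
    then show False using that eqv_trans[OF eqv_sym[of i w]] by blast
  qed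
  have "eqv u' u"
  proof (rule ccontr)
    assume nu: "\<not> eqv u' u"
    have "card (cl u' \<union> cl u \<union> cl v) = card (cl u') + card (cl u) + card (cl v)"
      using dcl[OF nu] dcl[OF nu'v] dcl[OF nuv] fcl(1) by (subst card_Un_disjoint; auto simp: card_Un_disjoint)
    moreover have "card (cl u' \<union> cl u \<union> cl v) \<le> card R" using fcl(2) finR by (intro card_mono) auto
    ultimately show False using ccl cardR n3 by linarith
  qed
  then have c1: "cen (B l1 \<union> R) u zu" using cen_eqv[OF u'(2)] by blast
  have ll: "l1 \<noteq> l2" using c1 l2(2) by blast
  have duv: "det u v" by (rule cen_det[OF cu v(1) nvu])
  have cuv: "cen R u v" by (rule cen_rebase[OF cu v(1) nvu])
  have cvu: "cen R v u" by (rule cen_rebase[OF cv u(1) nuv])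
  interpret P: rest_pair n m p q L B "cl u" "cl v" u v
    by unfold_locales (use fcl dcl[OF nuv] ccl u(1) v(1) duv in \<open>auto simp: cl_def\<close>)
  interpret S: rest_pair n m p q L B "cl v" "cl u" v u by (rule P.swapped)
  have "card (cl u \<union> cl v) = 2 * n - 2" using dcl[OF nuv] fcl(1) ccl by (simp add: card_Un_disjoint)
  then have "cl u \<union> cl v \<noteq> R" using cardR n2 by auto
  then obtain g where g: "g \<in> R - (cl u \<union> cl v)" using fcl(2) by blast
  then have ng: "g \<in> R" "\<not> eqv g u" "\<not> eqv g v" by (auto simp: cl_def)
  obtain a where a: "lin g a u 1 v" using cen_coset[OF cuv ng(1,2)] by blast
  obtain b where b: "lin g b v 1 u" using cen_coset[OF cvu ng(1,3)] by blast
  have "[a = 1] (mod int n)" by (rule lin_unique(1)[OF duv a lin_comm[THEN iffD1, OF b] eqv_refl])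
  then have g1: "lin g 1 u 1 v" using lin_cong[OF a _ cong_refl] by blast
  obtain x h where x: "\<forall>i\<in>B l1. 1 \<le> x i \<and> x i \<le> n \<and> lin i (int (x i)) u 1 v" "h \<in> B l1" "2 \<le> x h" "x h \<le> n - 1"
    using P.coset_coords[OF l1(1) c1 l1(2) cvu] by blast
  obtain y h' where y: "\<forall>i\<in>B l2. 1 \<le> y i \<and> y i \<le> n \<and> lin i (int (y i)) v 1 u" "h' \<in> B l2" "2 \<le> y h'" "y h' \<le> n - 1"
    using S.coset_coords[OF l2(1) v(2) l2(2) cuv] by blast
  show False by (rule P.conflict[OF l1(1) l2(1) ll g g1 x y])
qed

end

section \<open>Zero-sums and exchanges in the whole sequence\<close>

context minimal_zs
begin

lemma dec_of_fam: "fam B (m - 1) \<Longrightarrow> (\<And>i. i < m - 1 \<Longrightarrow> card (B i) \<le> n) \<Longrightarrow> minimal_dec n m p q L B"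
  by unfold_locales auto

lemma ex_dec: "\<exists>B. minimal_dec n m p q L B"
  using ex_fam dec_of_fam by blast

lemma cardL': "card L = m * n + n - 1" using cardL n2 by simp

lemma cardL_eq: "card L = (m - 2) * n + (3 * n - 1)"
  using cardL n2 ar(2) by linarith

lemma Suc_m: "Suc (m - 2) = m - 1" using m2 by linarith

text \<open>Each of the \<open>m-1\<close> blocks and also the rest, a zero-sum of length
  \<open>2n-1\<close>, has sum \<open>n \<gamma>\<close>; together this is
  \<open>m n \<gamma>\<close>.\<close>

lemma zsL: "zs n p q L" and dvd_sum_q: "int (m * n) dvd sum q L"
proof -
  obtain B where "minimal_dec n m p q L B" using ex_dec by blast
  then interpret D: minimal_dec n m p q L B .
  have LU: "L = (\<Union>i<m - 1. B i) \<union> D.R" by (rule D.L_cover)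
  have dis: "(\<Union>i<m - 1. B i) \<inter> D.R = {}" using D.BR by blast
  have fU: "finite (\<Union>i<m - 1. B i)" using D.finB by auto
  have sumL: "sum f L = (\<Sum>i<m - 1. sum f (B i)) + sum f D.R" for f :: "nat \<Rightarrow> int"
  proof -
    have "sum f L = sum f ((\<Union>i<m - 1. B i) \<union> D.R)" using LU by (rule arg_cong)
    then show ?thesis unfolding sum.union_disjoint[OF fU D.finR dis] fam_sum[OF D.fB subset_refl] .
  qed
  have "int n dvd sum f L" if f: "f = p \<or> f = q" for f
  proof -
    have "int n dvd sum f (B i)" if "i < m - 1" for i using D.BL(2)[OF that] f by (auto simp: zs_def)
    then have "int n dvd (\<Sum>i<m - 1. sum f (B i))" by (rule dvd_sum) simp
    moreover have "int n dvd sum f D.R" using D.zsR f by (auto simp: zs_def)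
    ultimately show ?thesis unfolding sumL by (rule dvd_add)
  qed
  then show "zs n p q L" using D.zsR D.RL by (auto simp: zs_def)
  have "[sum q (B i) = int n * D.\<gamma>] (mod int (m * n))" if "i < m - 1" for i
    by (rule D.sum_q_block[OF that _ D.BL(2)[OF that]]) (use D.cardB[OF that] n2 in auto)
  then have "[(\<Sum>i<m - 1. sum q (B i)) = int (card {..<m - 1}) * (int n * D.\<gamma>)] (mod int (m * n))"
    by (intro sum_cong_const) auto
  moreover have "[sum q D.R = int n * D.\<gamma>] (mod int (m * n))"
    by (rule D.sum_q_block[of 0]) (use m2 n2 D.zsR D.cardR in auto)
  ultimately have "[sum q L = int (card {..<m - 1}) * (int n * D.\<gamma>) + int n * D.\<gamma>] (mod int (m * n))"
    unfolding sumL by (rule cong_add)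
  moreover have "int (card {..<m - 1}) = int m - 1" using m2 by simp
  ultimately have "[sum q L = (int m - 1) * (int n * D.\<gamma>) + int n * D.\<gamma>] (mod int (m * n))" by simp
  moreover have "(int m - 1) * (int n * D.\<gamma>) + int n * D.\<gamma> = int (m * n) * D.\<gamma>" by (simp add: algebra_simps)
  ultimately show "int (m * n) dvd sum q L" by (simp add: cong_dvd_iff)
qed

text \<open>A decomposition with \<open>W\<close> as a block and \<open>e'\<close> in the rest can
  be arranged: outside \<open>W\<close> and \<open>e'\<close> there remain
  \<open>(m-2)n + 2n-2\<close> terms, exactly enough for the other blocks.\<close>

lemma swap_eq:
  assumes W: "W \<subseteq> L" "zs n p q W" "card W = n" and e: "e \<in> W" "e' \<in> L - W" "eqv e e'"
  shows "[q e = q e'] (mod int (m * n))"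
proof -
  let ?U = "L - W - {e'}"
  have fW: "finite W" using W(1) finL' by blast
  have "card (L - W) = card L - n" using card_Diff_subset[OF fW W(1)] W(3) by simp
  then have "card ?U = card L - n - 1" using e(2) finL by simp
  then have "(m - 2) * n + (2 * n - 2) \<le> card ?U" using cardL_eq n2 by linarith
  moreover have "finite ?U" using finL by simp
  ultimately obtain B where B: "disjoint_family_on B {..<m - 2}" "\<forall>i<m - 2. B i \<subseteq> ?U \<and> zs n p q (B i) \<and> card (B i) \<le> n"
    using extract_blocks[of n ?U "m - 2" p q] eta_davenport_bound[of n] n2 by auto
  have f: "fam B (m - 2)" using B by (auto simp: fam_def)
  have "fam (B(m - 2 := W)) (Suc (m - 2))" using B(2) by (intro fam_Suc[OF f W(1,2)]) blast
  then have F: "fam (B(m - 2 := W)) (m - 1)" unfolding Suc_m .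
  interpret D: minimal_dec n m p q L "B(m - 2 := W)"
    by (rule dec_of_fam[OF F]) (use B(2) W(3) in auto)
  have "e' \<notin> B i" if "i < m - 2" for i using B(2) that by blast
  moreover have "i < m - 1 \<Longrightarrow> i \<noteq> m - 2 \<Longrightarrow> i < m - 2" for i by linarith
  ultimately have "e' \<in> D.R" using e(2) by (auto simp: D.R_def)
  then show ?thesis using e m2 by (intro D.block_rest_swap[of "m - 2"]) auto
qed

end

section \<open>Lifting a centered sequence\<close>

locale centered = minimal_zs n m p q L for n m p q L +
  fixes c d :: nat
  assumes n3: "n \<ge> 3" and cL: "c \<in> L" and cenL: "cen L c d"
begin

definition "E = {i\<in>L. eqv i c}"
definition "X = {i\<in>L. \<not> eqv i c}"

lemma EX: "E \<inter> X = {}" "E \<union> X = L" "E \<subseteq> L" "X \<subseteq> L" "finite E" "finite X"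
  using finL by (auto simp: E_def X_def)

lemma dcd: "det c d" using cenL by (simp add: cen_def)

lemma n1: "n \<ge> 1" using n3 by simp

lemma eE: "i \<in> E \<Longrightarrow> eqv i c" by (simp add: E_def)

lemma cE: "c \<in> E" using cL by (simp add: E_def)

definition x :: "nat \<Rightarrow> nat" where "x i = (SOME a. 1 \<le> a \<and> a \<le> n \<and> lin i (int a) c 1 d)"

lemma x: assumes "i \<in> X" shows "1 \<le> x i" "x i \<le> n" "lin i (int (x i)) c 1 d"
proof -
  obtain s where s: "lin i s c 1 d" using cen_coset[OF cenL] assms by (auto simp: X_def)
  obtain a where a: "1 \<le> a" "a \<le> n" "[s = int a] (mod int n)" using cong_rep_pos[OF n1] by blast
  have "\<exists>a. 1 \<le> a \<and> a \<le> n \<and> lin i (int a) c 1 d" using a lin_cong[OF s a(3) cong_refl] by blast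
  from someI_ex[OF this] show "1 \<le> x i" "x i \<le> n" "lin i (int (x i)) c 1 d" unfolding x_def by blast+
qed

lemma zs_IE:
  assumes I: "I \<subseteq> X" "I \<noteq> {}" "n dvd card I" and E': "E' \<subseteq> E" "n dvd sum x I + card E'"
  shows "zs n p q (I \<union> E')"
proof -
  have "zs n p q (I \<union> (E' \<union> {}))"
  proof (rule zs_mixed[where s = "\<lambda>i. int (x i)" and t = "\<lambda>_. 1"])
    show "I \<inter> E' = {}" using I E' EX by blast
    show "finite I" "finite E'" using I(1) E'(1) EX finite_subset by blast+
    show "lin i (int (x i)) c 1 d" if "i \<in> I" for i using that I(1) x by blast
    show "eqv i c" if "i \<in> E'" for i using that E'(1) eE by blast
    have "int n dvd int (sum x I + card E')" using E'(2) by (simp only: int_dvd_int_iff)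
    then show "int n dvd (\<Sum>i\<in>I. int (x i)) + int (card E')" by simp
    have "int n dvd int (card I)" using I(3) by (simp only: int_dvd_int_iff)
    then show "int n dvd (\<Sum>i\<in>I. 1) + int (card {})" by simp
  qed (use I in auto)
  then show ?thesis by simp
qed

text \<open>\<open>card X\<close> is a multiple of \<open>n\<close> by \<open>noncenter_dvd\<close>,
  and it is not 0 because a rest, having \<open>2n-1\<close> terms, contains only \<open>n-1\<close>
  copies of the center.\<close>

lemma sizes: "\<exists>j. 1 \<le> j \<and> j \<le> m \<and> card X = j * n \<and> card E = (m + 1 - j) * n - 1"
proof -
  have "n dvd card X" using noncenter_dvd[OF cenL zsL finL] by (simp add: X_def)
  then obtain j where j: "card X = n * j" by (elim dvdE)
  have s: "card E + card X = m * n + n - 1" using card_Un_disjoint[OF EX(5,6,1)] EX(2) cardL' by simp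
  have "1 \<le> card E" using cE EX(5) by (auto simp: Suc_le_eq card_gt_0_iff)
  then have "n * j < n * (m + 1)" using s j n3 by (simp add: algebra_simps)
  then have "j < m + 1" by (rule mult_less_cancel1[THEN iffD1, THEN conjunct2])
  then have jm: "j \<le> m" by simp
  have "j \<noteq> 0"
  proof
    assume "j = 0"
    then have "X = {}" using j EX(6) by simp
    then have LE: "L = E" using EX(2) by blast
    obtain B where "minimal_dec n m p q L B" using ex_dec by blast
    then interpret D: minimal_dec n m p q L B .
    have "cen D.R c d" by (rule cen_mono[OF cenL D.RL])
    then have "card {i\<in>D.R. eqv i c} = n - 1" by (rule D.rest_center_card)
    moreover have "{i\<in>D.R. eqv i c} = D.R" using D.RL LE eE by blast
    ultimately show False using D.cardR n3 by simp
  qed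
  moreover have "card E = (m + 1 - j) * n - 1" using s j jm by (simp add: algebra_simps diff_mult_distrib2)
  ultimately show ?thesis using j jm by (intro exI[of _ j]) (simp add: mult.commute)
qed

lemma total_x: "n dvd sum x X + card E"
proof -
  define s where "s i = (if i \<in> E then 1 else int (x i))" for i
  define t where "t i = (if i \<in> E then 0 else 1 :: int)" for i
  have "lin i (s i) c (t i) d" if "i \<in> L" for i
  proof (cases "i \<in> E")
    case True
    then show ?thesis using lin_eqv_left[OF lin_self(1) eqv_sym[OF eE[OF True]]] by (simp add: s_def t_def)
  next
    case False
    then show ?thesis using x(3)[of i] that EX(2) by (auto simp: s_def t_def)
  qed
  then have "int n dvd sum s L" by (rule zs_lin_dest(1)[OF dcd zsL])
  also have "sum s L = sum s E + sum s X" using sum.union_disjoint[OF EX(5,6,1)] EX(2) by metis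
  also have "sum s E = int (card E)" by (simp add: s_def)
  also have "sum s X = int (sum x X)" unfolding of_nat_sum using EX(1) by (intro sum.cong) (auto simp: s_def)
  finally have "int n dvd int (sum x X + card E)" by (simp add: add.commute)
  then show ?thesis by (simp only: int_dvd_int_iff)
qed

lemma X_blocks:
  assumes "C \<subseteq> X" "b * n + (n - 1) \<le> card C"
  shows "\<exists>B. fam B b \<and> (\<forall>i<b. card (B i) = n \<and> B i \<subseteq> C)"
  using assms
proof (induction b arbitrary: C)
  case 0
  then show ?case by (auto simp: fam_def disjoint_family_on_def)
next
  case (Suc b)
  have fC: "finite C" using Suc.prems(1) EX(6) finite_subset by blast
  have "2 * n - 1 \<le> card C" using Suc.prems(2) n1 by (simp add: algebra_simps)
  then obtain W where W: "W \<subseteq> C" "card W = n" "int n dvd (\<Sum>i\<in>W. int (x i))"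
    using erdos_ginzburg_ziv[OF n1 fC, of "\<lambda>i. int (x i)"] by blast
  have "int n dvd int (sum x W)" using W(3) by simp
  then have "n dvd sum x W" by (simp only: int_dvd_int_iff)
  then have "zs n p q (W \<union> {})" using W Suc.prems(1) n3 by (intro zs_IE) auto
  then have zW: "zs n p q W" by simp
  have WL: "W \<subseteq> L" using W(1) Suc.prems(1) EX by blast
  have "card (C - W) = card C - n" using card_Diff_subset[OF finL'[OF WL] W(1)] W(2) by simp
  then have "b * n + (n - 1) \<le> card (C - W)" using Suc.prems(2) by simp
  moreover have "C - W \<subseteq> X" using Suc.prems(1) by blast
  ultimately have "\<exists>B. fam B b \<and> (\<forall>i<b. card (B i) = n \<and> B i \<subseteq> C - W)" by (intro Suc.IH)
  then obtain B where B: "fam B b" "\<forall>i<b. card (B i) = n \<and> B i \<subseteq> C - W" by blast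
  have "fam (B(b := W)) (Suc b)" using B(2) by (intro fam_Suc[OF B(1) WL zW]) blast
  moreover have "\<forall>i<Suc b. card ((B(b := W)) i) = n \<and> (B(b := W)) i \<subseteq> C" using B(2) W by (auto simp: less_Suc_eq)
  ultimately show ?case by blast
qed

text \<open>Copies of the center yield blocks in groups of \<open>n\<close>, and \<open>X\<close>
  does by the theorem of Erdos, Ginzburg and Ziv applied to the coordinates. The last clause keeps
  one block of copies of \<open>c\<close> identifiable, because its sum relates \<open>q c\<close>
  to the common value of all blocks.\<close>

lemma EX_blocks:
  assumes "A \<subseteq> E" "a * n \<le> card A" "C \<subseteq> X" "b * n + (n - 1) \<le> card C"
  shows "\<exists>B. fam B (a + b) \<and> (\<forall>i<a + b. card (B i) = n \<and> B i \<subseteq> A \<union> C) \<and> (1 \<le> a \<longrightarrow> B (a + b - 1) \<subseteq> A)"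
  using assms(1,2)
proof (induction a arbitrary: A)
  case 0
  obtain B where B: "fam B b" "\<forall>i<b. card (B i) = n \<and> B i \<subseteq> C" using X_blocks[OF assms(3,4)] by blast
  then show ?case by (intro exI[of _ B]) auto
next
  case (Suc a)
  have "n \<le> card A" using Suc.prems(2) by simp
  from subset_of_card[OF this] obtain W where W: "W \<subseteq> A" "card W = n" by blast
  have WL: "W \<subseteq> L" using W(1) Suc.prems(1) EX by blast
  have "W \<noteq> {}" using W(2) n3 by auto
  then have zW: "zs n p q W" by (rule zs_const[OF _ _ W(2), where j = c]) (use W(1) Suc.prems(1) eE in blast)
  have "card (A - W) = card A - n" using card_Diff_subset[OF finL'[OF WL] W(1)] W(2) by simp
  then have "a * n \<le> card (A - W)" using Suc.prems(2) by simp
  moreover have "A - W \<subseteq> E" using Suc.prems(1) by blast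
  ultimately have "\<exists>B. fam B (a + b) \<and> (\<forall>i<a + b. card (B i) = n \<and> B i \<subseteq> (A - W) \<union> C) \<and> (1 \<le> a \<longrightarrow> B (a + b - 1) \<subseteq> A - W)"
    by (intro Suc.IH)
  then obtain B where B: "fam B (a + b)" "\<forall>i<a + b. card (B i) = n \<and> B i \<subseteq> (A - W) \<union> C" by blast
  have "W \<inter> C = {}" using W(1) Suc.prems(1) assms(3) EX(1) by blast
  then have "W \<inter> B i = {}" if "i < a + b" for i using B(2) that by blast
  then have "fam (B(a + b := W)) (Suc (a + b))" by (intro fam_Suc[OF B(1) WL zW])
  moreover have "\<forall>i<Suc (a + b). card ((B(a + b := W)) i) = n \<and> (B(a + b := W)) i \<subseteq> A \<union> C"
    using B(2) W by (auto simp: less_Suc_eq)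
  moreover have "(B(a + b := W)) (Suc a + b - 1) \<subseteq> A" using W(1) by simp
  ultimately show ?case unfolding add_Suc by blast
qed

text \<open>Among \<open>2n-1\<close> copies, \<open>n\<close> form a zero-sum containing
  \<open>e\<close> but not \<open>e'\<close>, so the two can be exchanged.\<close>

lemma E_const_large:
  assumes "2 * n - 1 \<le> card E" "e \<in> E" "e' \<in> E"
  shows "[q e = q e'] (mod int (m * n))"
proof (cases "e = e'")
  case False
  have "card (E - {e, e'}) = card E - 2" using assms EX(5) False by (simp add: card_Diff_subset)
  then have "n - 1 \<le> card (E - {e, e'})" using assms(1) n3 by linarith
  from subset_of_card[OF this] obtain K where K: "K \<subseteq> E - {e, e'}" "card K = n - 1" by blast
  let ?W = "insert e K"
  have fK: "finite K" "e \<notin> K" using K(1) EX(5) finite_subset[of K E] by auto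
  have WE: "?W \<subseteq> E" using K assms by blast
  have cW: "card ?W = n" using K fK n3 by simp
  have "zs n p q ?W" by (rule zs_const[OF _ _ cW, where j = c]) (use WE eE in auto)
  show ?thesis
    by (rule swap_eq[OF _ \<open>zs n p q ?W\<close> cW]) (use WE EX(3) K assms False eqv_trans[OF eE eqv_sym[OF eE]] in auto)
qed simp

text \<open>Removing \<open>n - 1\<close> terms from \<open>E\<close> and \<open>n + 1\<close> from \<open>X\<close> leaves exactly enough to split off \<open>m - 2\<close> zero-sums
  of length \<open>n\<close> from \<open>E\<close> and \<open>X\<close> separately.\<close>

lemma loc:
  assumes E0: "E0 \<subseteq> E" "card E0 = n - 1" and X1: "X1 \<subseteq> X" "card X1 = n + 1" and big: "2 * n \<le> card X"
  shows "\<exists>g. coprime g (int m) \<and> (2 * n - 1 \<le> card E \<longrightarrow> [g = q c] (mod int m)) \<and>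
    (\<forall>A\<subseteq>E0 \<union> X1. zs n p q A \<longrightarrow> [sum q A = int n * g] (mod int (m * n)))"
proof -
  obtain j where j: "1 \<le> j" "j \<le> m" "card X = j * n" "card E = (m + 1 - j) * n - 1" using sizes by blast
  have j2: "2 \<le> j"
  proof (rule ccontr)
    assume "\<not> 2 \<le> j"
    then have "j = 1" using j by linarith
    then show False using big j(3) n3 by simp
  qed
  have fE0: "finite E0" "finite X1" using E0(1) X1(1) EX finite_subset by blast+
  have "card (E - E0) = (m + 1 - j) * n - 1 - (n - 1)" using card_Diff_subset[OF fE0(1) E0(1)] E0(2) j(4) by simp
  moreover have "(m + 1 - j) * n = (m - j) * n + n" using j(2) by (simp add: Suc_diff_le)
  ultimately have cA: "(m - j) * n \<le> card (E - E0)" using n1 by linarith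
  have "card (X - X1) = j * n - (n + 1)" using card_Diff_subset[OF fE0(2) X1(1)] X1(2) j(3) by simp
  moreover obtain j' where j': "j = j' + 2" using j2 by (metis le_add_diff_inverse2)
  ultimately have cC: "(j - 2) * n + (n - 1) \<le> card (X - X1)" using n1 by simp
  have mj: "m - j + (j - 2) = m - 2" using j j2 by linarith
  obtain B where B: "fam B (m - 2)" "\<forall>i<m - 2. card (B i) = n \<and> B i \<subseteq> (E - E0) \<union> (X - X1)"
    "1 \<le> m - j \<longrightarrow> B (m - 2 - 1) \<subseteq> E - E0"
    using EX_blocks[OF Diff_subset cA Diff_subset cC] unfolding mj by blast
  let ?V = "L - (\<Union>i<m - 2. B i)"
  have UL: "(\<Union>i<m - 2. B i) \<subseteq> L" using famD(1)[OF B(1)] by blast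
  have "card (\<Union>i<m - 2. B i) \<le> card {..<m - 2} * n" using B(2) by (intro card_UN_bound) auto
  then have "card (\<Union>i<m - 2. B i) \<le> (m - 2) * n" by simp
  then have "3 * n - 1 \<le> card ?V" using card_Diff_subset[OF finL'[OF UL] UL] cardL_eq by linarith
  then have cV: "3 * n - 2 \<le> card ?V" by simp
  have fV: "finite ?V" using finL by simp
  \<comment> \<open>The last block may lie anywhere in the remaining terms: \<open>E0\<close> and
    \<open>X1\<close> stay inside the union of this block and the rest, where all zero-sums up to
    length \<open>3n-2\<close> have the same sum.\<close>
  obtain W where W: "W \<subseteq> ?V" "zs n p q W" "card W \<le> n"
    by (rule eta_boundD[OF conjunct1[OF eta_davenport_bound[OF n1]] fV cV])
  have "fam (B(m - 2 := W)) (Suc (m - 2))" using W by (intro fam_Suc[OF B(1) _ W(2)]) auto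
  then have F: "fam (B(m - 2 := W)) (m - 1)" unfolding Suc_m .
  interpret D: minimal_dec n m p q L "B(m - 2 := W)"
    by (rule dec_of_fam[OF F]) (use B(2) W(3) in auto)
  have l: "m - 2 < m - 1" using m2 by linarith
  have V: "E0 \<union> X1 \<subseteq> (B(m - 2 := W)) (m - 2) \<union> D.R"
  proof
    fix i assume i: "i \<in> E0 \<union> X1"
    have iL: "i \<in> L" using i E0(1) X1(1) EX by blast
    have "i \<notin> B k" if "k < m - 2" for k
    proof -
      have "B k \<subseteq> (E - E0) \<union> (X - X1)" using B(2) that by blast
      then show ?thesis using i E0(1) X1(1) EX(1) by blast
    qed
    then show "i \<in> (B(m - 2 := W)) (m - 2) \<union> D.R" using iL by (auto simp: D.R_def split: if_splits)
  qed
  have c2: "card (E0 \<union> X1) \<le> 2 * n" using card_Un_le[of E0 X1] E0(2) X1(2) n1 by linarith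
  have S: "[sum q A = int n * D.\<gamma>] (mod int (m * n))" if A: "A \<subseteq> E0 \<union> X1" "zs n p q A" for A
  proof (rule D.sum_q_block[OF l _ A(2)])
    show "A \<subseteq> (B(m - 2 := W)) (m - 2) \<union> D.R" using A(1) V by blast
    have "card A \<le> card (E0 \<union> X1)" using A(1) fE0 by (intro card_mono) auto
    then show "card A \<le> 3 * n - 1 - 1" using c2 n3 by linarith
  qed
  have K: "[D.\<gamma> = q c] (mod int m)" if sE: "2 * n - 1 \<le> card E"
  proof -
    have "m - j \<noteq> 0" using sE j n3 by (auto simp: Suc_diff_le)
    then have mm: "1 \<le> m - j" "m - 2 - 1 < m - 2" using j j2 by linarith+
    then have Bl: "B (m - 2 - 1) \<subseteq> E" "card (B (m - 2 - 1)) = n" using B(2,3) by blast+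
    have "[sum q (B (m - 2 - 1)) = int (card (B (m - 2 - 1))) * q c] (mod int (m * n))"
      using E_const_large[OF sE _ cE] Bl(1) by (intro sum_cong_const) blast
    then have 1: "[sum q (B (m - 2 - 1)) = int n * q c] (mod int (m * n))" unfolding Bl(2) .
    have z: "zs n p q (B (m - 2 - 1))" by (rule famD(2)[OF B(1) mm(2)])
    have "[kap ((B(m - 2 := W)) (m - 2 - 1)) = D.\<gamma>] (mod int m)" using mm by (intro D.kap_B) linarith
    then have "[kap (B (m - 2 - 1)) = D.\<gamma>] (mod int m)" using mm by simp
    then have "[int n * kap (B (m - 2 - 1)) = int n * D.\<gamma>] (mod int (m * n))" using cong_scale_iff[of n] n1 by simp
    then have "[sum q (B (m - 2 - 1)) = int n * D.\<gamma>] (mod int (m * n))" unfolding kap_mult[OF z] .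
    then have "[int n * D.\<gamma> = int n * q c] (mod int (m * n))" using 1 by (rule cong_trans[OF cong_sym])
    then show ?thesis using cong_scale_iff[of n] n1 by simp
  qed
  show ?thesis using S K D.cop_\<gamma> by blast
qed

abbreviation "r I \<equiv> rr n (sum x I)"

lemma ex_E0: "\<exists>E0\<subseteq>E. card E0 = n - 1"
proof -
  obtain j where j: "1 \<le> j" "j \<le> m" "card E = (m + 1 - j) * n - 1" using sizes by blast
  have "1 * n \<le> (m + 1 - j) * n" using j by (intro mult_le_mono1) linarith
  then have "n - 1 \<le> card E" using j(3) by linarith
  then show ?thesis by (rule subset_of_card)
qed

text \<open>With only \<open>n-1\<close> copies of the center, no block consists of them; instead a
  set \<open>I\<close> with \<open>0 < r I < n-1\<close> is completed by some but not all of
  them.\<close>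

lemma E_const_small:
  assumes big: "2 * n \<le> card X" and sE: "card E = n - 1" and I: "I \<subseteq> X" "card I = n" "1 \<le> r I" "r I \<le> n - 2"
    and e: "e \<in> E" "e' \<in> E"
  shows "[q e = q e'] (mod int (m * n))"
proof (cases "e = e'")
  case False
  have fI: "finite I" using I(1) EX(6) finite_subset by blast
  have "card (X - I) = card X - n" using card_Diff_subset[OF fI I(1)] I(2) by simp
  then have "card (X - I) > 0" using big n3 by linarith
  then have "X - I \<noteq> {}" by (auto simp: card_gt_0_iff)
  then obtain y where y: "y \<in> X - I" by blast
  let ?X1 = "insert y I"
  have X1: "?X1 \<subseteq> X" "card ?X1 = n + 1" using y I fI by auto
  obtain g where g: "\<forall>A\<subseteq>E \<union> ?X1. zs n p q A \<longrightarrow> [sum q A = int n * g] (mod int (m * n))"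
    using loc[OF subset_refl sE X1 big] by blast
  have "card (E - {e, e'}) = n - 3" using e EX(5) False sE by (simp add: card_Diff_subset)
  then have "r I - 1 \<le> card (E - {e, e'})" using I by linarith
  from subset_of_card[OF this] obtain K where K: "K \<subseteq> E - {e, e'}" "card K = r I - 1" by blast
  have fK: "finite K" "e \<notin> K" "e' \<notin> K" using K(1) EX(5) finite_subset[of K E] by auto
  have *: "[sum q I + (q i + sum q K) = int n * g] (mod int (m * n))" if i: "i \<in> E" "i \<notin> K" for i
  proof -
    have ci: "card (insert i K) = r I" using i fK K I by simp
    have z: "zs n p q (I \<union> insert i K)"
    proof (rule zs_IE[OF I(1)])
      show "n dvd sum x I + card (insert i K)" unfolding ci by (rule rr_dvd[OF n1])
    qed (use I n3 K i in auto)
    moreover have "I \<union> insert i K \<subseteq> E \<union> ?X1" using K i by blast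
    ultimately have "[sum q (I \<union> insert i K) = int n * g] (mod int (m * n))" using g by blast
    moreover have "sum q (I \<union> insert i K) = sum q I + sum q (insert i K)"
      using fI fK I(1) K(1) i EX(1) by (intro sum.union_disjoint) auto
    ultimately show ?thesis using fK i by simp
  qed
  have "[q e + (sum q I + sum q K) = q e' + (sum q I + sum q K)] (mod int (m * n))"
    using *[OF e(1) fK(2)] *[OF e(2) fK(3)] by (simp add: cong_def add_ac)
  then show ?thesis by (rule cong_add_rcancel[THEN iffD1])
qed simp

end

section \<open>Exchanging single terms of X\<close>

context centered
begin

abbreviation "sw I i y \<equiv> insert y (I - {i})"

definition sel :: "nat \<Rightarrow> nat \<Rightarrow> nat set \<Rightarrow> bool" where
  "sel i y I \<longleftrightarrow> I \<subseteq> X \<and> card I = n \<and> i \<in> I \<and> y \<in> X \<and> y \<notin> I"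

lemma finX: "I \<subseteq> X \<Longrightarrow> finite I" using EX(6) finite_subset by blast

lemma sel_sw:
  assumes "sel i y I"
  shows "sel y i (sw I i y)" "sw (sw I i y) y i = I"
proof -
  have f: "finite I" using assms finX by (simp add: sel_def)
  have "card (sw I i y) = n" using assms f n1 by (simp add: sel_def)
  then show "sel y i (sw I i y)" using assms by (auto simp: sel_def)
  show "sw (sw I i y) y i = I" using assms by (auto simp: sel_def)
qed

lemma sel_ex:
  assumes big: "2 * n \<le> card X" and "i \<in> X" "y \<in> X" "z \<in> X" "i \<noteq> y" "i \<noteq> z"
  shows "\<exists>I. sel i y I \<and> z \<notin> I"
proof -
  have "card X - card {i, y, z} \<le> card (X - {i, y, z})" by (rule diff_card_le_card_Diff) simp
  moreover have "card {i, y, z} \<le> 3" by (simp add: card_insert_if)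
  ultimately have "n - 1 \<le> card (X - {i, y, z})" using big n3 by linarith
  from subset_of_card[OF this] obtain K where K: "K \<subseteq> X - {i, y, z}" "card K = n - 1" by blast
  have f: "finite K" using K(1) finX[of K] by blast
  have "card (insert i K) = n" using K f n1 by (subst card_insert_disjoint) auto
  then have "sel i y (insert i K)" "z \<notin> insert i K" using K assms by (auto simp: sel_def)
  then show ?thesis by blast
qed

lemma rr_int: "int n dvd int (sum x I) + int (r I)"
proof -
  have "int n dvd int (sum x I + r I)" using rr_dvd[OF n1, of "sum x I"] by (simp only: int_dvd_int_iff)
  then show ?thesis by simp
qed

lemma r_lt: "r I < n" by (rule rr_less[OF n1])

lemma sum_sw:
  fixes f :: "nat \<Rightarrow> int"
  assumes "sel i y I"
  shows "sum f (sw I i y) + f i = sum f I + f y"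
proof -
  have f: "finite I" "i \<in> I" "y \<notin> I" using assms finX by (auto simp: sel_def)
  then show ?thesis using sum.remove[OF f(1,2), of f] by simp
qed

lemma r_sw_cong:
  assumes "sel i y I"
  shows "[int (r (sw I i y)) - int (r I) = int (x i) - int (x y)] (mod int n)"
proof -
  define u where "u = int (sum x I)" define v where "v = int (sum x (sw I i y))"
  have "int n dvd (v + int (r (sw I i y))) - (u + int (r I))"
    unfolding u_def v_def by (rule dvd_diff[OF rr_int rr_int])
  moreover have "v + int (x i) = u + int (x y)"
    unfolding u_def v_def using sum_sw[OF assms, of "\<lambda>i. int (x i)"] by simp
  then have "(v + int (r (sw I i y))) - (u + int (r I)) = (int (r (sw I i y)) - int (r I)) - (int (x i) - int (x y))"
    by linarith
  ultimately show ?thesis unfolding cong_iff_dvd_diff by simp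
qed

text \<open>All \<open>n\<close>-subsets of \<open>insert y I\<close> can be completed by copies of
  \<open>c\<close> from one fixed \<open>E0\<close>, so a single \<open>g\<close> serves all of
  them.\<close>

lemma T_swap:
  assumes kE: "\<And>e. e \<in> E \<Longrightarrow> [q e = q c] (mod int (m * n))" and big: "2 * n \<le> card X" and s: "sel i y I"
  shows "\<exists>g. coprime g (int m) \<and> (2 * n - 1 \<le> card E \<longrightarrow> [g = q c] (mod int m)) \<and>
    (\<forall>J\<subseteq>insert y I. card J = n \<longrightarrow> [sum q J + int (r J) * q c = int n * g] (mod int (m * n)))"
proof -
  obtain E0 where E0: "E0 \<subseteq> E" "card E0 = n - 1" using ex_E0 by blast
  have fI: "finite I" using s finX by (simp add: sel_def)
  have X1: "insert y I \<subseteq> X" "card (insert y I) = n + 1" using s fI by (auto simp: sel_def)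
  obtain g where g: "coprime g (int m)" "2 * n - 1 \<le> card E \<longrightarrow> [g = q c] (mod int m)"
    "\<forall>A\<subseteq>E0 \<union> insert y I. zs n p q A \<longrightarrow> [sum q A = int n * g] (mod int (m * n))"
    using loc[OF E0 X1 big] by blast
  have "[sum q J + int (r J) * q c = int n * g] (mod int (m * n))" if J: "J \<subseteq> insert y I" "card J = n" for J
  proof -
    have JX: "J \<subseteq> X" using J X1 by blast
    have fJ: "finite J" by (rule finX[OF JX])
    have "r J \<le> card E0" using r_lt[of J] E0(2) by linarith
    from subset_of_card[OF this] obtain E' where E': "E' \<subseteq> E0" "card E' = r J" by blast
    have E'E: "E' \<subseteq> E" using E' E0 by blast
    have z: "zs n p q (J \<union> E')"
    proof (rule zs_IE[OF JX _ _ E'E])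
      show "n dvd sum x J + card E'" unfolding E'(2) by (rule rr_dvd[OF n1])
    qed (use J n3 in auto)
    moreover have "J \<union> E' \<subseteq> E0 \<union> insert y I" using J(1) E'(1) by blast
    ultimately have "[sum q (J \<union> E') = int n * g] (mod int (m * n))" using g(3) by blast
    moreover have "sum q (J \<union> E') = sum q J + sum q E'"
      using fJ JX E'E EX(1,5) finite_subset[OF E'E] by (intro sum.union_disjoint) auto
    moreover have "[sum q J + sum q E' = sum q J + int (card E') * q c] (mod int (m * n))"
      using kE E'E by (intro cong_add cong_refl sum_cong_const) blast
    ultimately show ?thesis unfolding E'(2) using cong_trans[OF cong_sym] by metis
  qed
  then show ?thesis using g by blast
qed

text \<open>\<open>I\<close> and its variant with \<open>i\<close> replaced by \<open>y\<close> are
  completed to the same sum; only \<open>q i\<close>, \<open>q y\<close> and the numbers of copies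
  of \<open>c\<close> differ.\<close>

lemma swap_step:
  assumes kE: "\<And>e. e \<in> E \<Longrightarrow> [q e = q c] (mod int (m * n))" and big: "2 * n \<le> card X" and s: "sel i y I"
  shows "[q i - q y = (int (r (sw I i y)) - int (r I)) * q c] (mod int (m * n))"
proof -
  obtain g where g: "\<forall>J\<subseteq>insert y I. card J = n \<longrightarrow> [sum q J + int (r J) * q c = int n * g] (mod int (m * n))"
    using T_swap[OF kE big s] by blast
  have c: "card I = n" "card (sw I i y) = n" using s sel_sw(1)[OF s] by (auto simp: sel_def)
  have sub: "I \<subseteq> insert y I" "sw I i y \<subseteq> insert y I" by blast+
  have 1: "[sum q I + int (r I) * q c = int n * g] (mod int (m * n))" using g c(1) sub(1) by blast
  have 2: "[sum q (sw I i y) + int (r (sw I i y)) * q c = int n * g] (mod int (m * n))" using g c(2) sub(2) by blast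
  define SI where "SI = sum q I" define SJ where "SJ = sum q (sw I i y)"
  have e: "SJ + q i = SI + q y" unfolding SI_def SJ_def by (rule sum_sw[OF s])
  have "int (m * n) dvd (SI + int (r I) * q c - int n * g) - (SJ + int (r (sw I i y)) * q c - int n * g)"
    using 1 2 unfolding cong_iff_dvd_diff SI_def SJ_def by (rule dvd_diff)
  moreover have "(SI + int (r I) * q c - int n * g) - (SJ + int (r (sw I i y)) * q c - int n * g)
     = (q i - q y) - (int (r (sw I i y)) - int (r I)) * q c"
    using e by (simp add: algebra_simps)
  ultimately show ?thesis unfolding cong_iff_dvd_diff by simp
qed

text \<open>If \<open>m\<close> divides \<open>q c\<close>, then \<open>n c = 0\<close> and the
  change of \<open>r\<close> matters only modulo \<open>n\<close>, where it is
  \<open>x i - x y\<close>. So removing \<open>x i\<close> copies of \<open>c\<close> from each term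
  \<open>i\<close> of \<open>X\<close> leaves a common second coordinate.\<close>

lemma small_shape:
  assumes kE: "\<And>e. e \<in> E \<Longrightarrow> [q e = q c] (mod int (m * n))" and big: "2 * n \<le> card X" and dv: "int m dvd q c"
  shows "i \<in> X \<Longrightarrow> y \<in> X \<Longrightarrow> [q i - int (x i) * q c = q y - int (x y) * q c] (mod int (m * n))"
    and "i \<in> X \<Longrightarrow> coprime (q i) (int m)"
proof -
  have nq: "int (m * n) dvd int n * q c" using dv by (simp add: mult.commute)
  have A: "[q i - int (x i) * q c = q y - int (x y) * q c] (mod int (m * n))" if iy: "i \<in> X" "y \<in> X" for i y
  proof (cases "i = y")
    case False
    obtain I where s: "sel i y I" using sel_ex[OF big iy iy(2) False False] by blast
    have "[q i - q y = (int (r (sw I i y)) - int (r I)) * q c] (mod int (m * n))" by (rule swap_step[OF kE big s])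
    moreover have "int n dvd (int (r (sw I i y)) - int (r I)) - (int (x i) - int (x y))"
      using r_sw_cong[OF s] by (simp add: cong_iff_dvd_diff)
    then obtain t where t: "(int (r (sw I i y)) - int (r I)) - (int (x i) - int (x y)) = int n * t" by (elim dvdE)
    have "(int (r (sw I i y)) - int (r I)) * q c - (int (x i) - int (x y)) * q c = t * (int n * q c)"
      unfolding left_diff_distrib[symmetric] t by simp
    then have "int (m * n) dvd (int (r (sw I i y)) - int (r I)) * q c - (int (x i) - int (x y)) * q c"
      using nq by simp
    then have "[(int (r (sw I i y)) - int (r I)) * q c = (int (x i) - int (x y)) * q c] (mod int (m * n))"
      by (simp add: cong_iff_dvd_diff)
    ultimately have "[q i - q y = (int (x i) - int (x y)) * q c] (mod int (m * n))" by (rule cong_trans)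
    then show ?thesis by (simp add: cong_iff_dvd_diff algebra_simps)
  qed simp
  then show "i \<in> X \<Longrightarrow> y \<in> X \<Longrightarrow> [q i - int (x i) * q c = q y - int (x y) * q c] (mod int (m * n))" .
  show "coprime (q i) (int m)" if i: "i \<in> X"
  proof -
    have "card (X - {i}) > 0" using big n3 i EX(6) by simp
    then obtain y where y: "y \<in> X" "i \<noteq> y" by (metis Diff_iff card_gt_0_iff ex_in_conv singletonI)
    obtain I where s: "sel i y I" using sel_ex[OF big i y(1,1,2,2)] by blast
    obtain g where g: "coprime g (int m)" "[sum q I + int (r I) * q c = int n * g] (mod int (m * n))"
      using T_swap[OF kE big s] s unfolding sel_def by blast
    have IX: "I \<subseteq> X" "card I = n" using s by (auto simp: sel_def)
    have "[q k = int (x k) * q c + (q i - int (x i) * q c)] (mod int (m * n))" if "k \<in> I" for k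
      using A[of k i] that IX i by (auto simp: cong_iff_dvd_diff algebra_simps)
    then have "[sum q I = (\<Sum>k\<in>I. int (x k) * q c + (q i - int (x i) * q c))] (mod int (m * n))" by (intro cong_sum)
    moreover have "(\<Sum>k\<in>I. int (x k) * q c + (q i - int (x i) * q c)) = int (sum x I) * q c + int n * (q i - int (x i) * q c)"
      using IX(2) by (simp add: sum.distrib sum_distrib_right)
    ultimately have "[sum q I = int (sum x I) * q c + int n * (q i - int (x i) * q c)] (mod int (m * n))" by simp
    then have "[sum q I + int (r I) * q c = int (sum x I) * q c + int n * (q i - int (x i) * q c) + int (r I) * q c] (mod int (m * n))"
      by (intro cong_add cong_refl)
    then have 1: "[int (sum x I) * q c + int n * (q i - int (x i) * q c) + int (r I) * q c = int n * g] (mod int (m * n))"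
      by (rule cong_trans[OF cong_sym g(2)])
    obtain t where t: "int (sum x I) + int (r I) = int n * t" using rr_int[of I] by (elim dvdE)
    have "int (sum x I) * q c + int n * (q i - int (x i) * q c) + int (r I) * q c
       = (int (sum x I) + int (r I)) * q c + int n * (q i - int (x i) * q c)" by (simp add: algebra_simps)
    also have "\<dots> = int n * (q i + (t - int (x i)) * q c)" unfolding t by (simp add: algebra_simps)
    finally have "[q i + (t - int (x i)) * q c = g] (mod int m)" using 1 cong_scale_iff[of n] n1 by simp
    moreover have "[q i + (t - int (x i)) * q c = q i] (mod int m)" using dv by (simp add: cong_iff_dvd_diff)
    ultimately have "[g = q i] (mod int m)" by (rule cong_trans[OF cong_sym])
    then show ?thesis using g(1) cong_imp_coprime by blast
  qed
qed

text \<open>If \<open>m\<close> does not divide \<open>q c\<close>, the change of \<open>r\<close> when a term is exchanged is determined as an integer by the two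
  terms, because two candidates would differ by \<open>\<plusminus>n\<close> and \<open>n c \<noteq> 0\<close>. Hence it is a coboundary.\<close>

lemma weights:
  assumes kE: "\<And>e. e \<in> E \<Longrightarrow> [q e = q c] (mod int (m * n))" and big: "2 * n \<le> card X" and nd: "\<not> int m dvd q c"
  shows "\<exists>w. \<forall>i y I. sel i y I \<longrightarrow> int (r (sw I i y)) = int (r I) + w i - w y"
proof -
  have indep: "int (r (sw I i y)) - int (r I) = int (r (sw J i y)) - int (r J)" if s: "sel i y I" "sel i y J" for i y I J
  proof -
    define a where "a = int (r (sw I i y)) - int (r I)" define b where "b = int (r (sw J i y)) - int (r J)"
    have "[(int (r (sw I i y)) - int (r I)) * q c = (int (r (sw J i y)) - int (r J)) * q c] (mod int (m * n))"
      by (rule cong_trans[OF cong_sym[OF swap_step[OF kE big s(1)]] swap_step[OF kE big s(2)]])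
    then have 1: "int (m * n) dvd (a - b) * q c" by (simp add: a_def b_def cong_iff_dvd_diff left_diff_distrib)
    have "[int (r (sw I i y)) - int (r I) = int (r (sw J i y)) - int (r J)] (mod int n)"
      by (rule cong_trans[OF r_sw_cong[OF s(1)] cong_sym[OF r_sw_cong[OF s(2)]]])
    then have "int n dvd a - b" by (simp add: a_def b_def cong_iff_dvd_diff)
    then obtain t where t: "a - b = int n * t" by (elim dvdE)
    have bd: "\<bar>a - b\<bar> < int n * 2"
      using r_lt[of I] r_lt[of J] r_lt[of "sw I i y"] r_lt[of "sw J i y"] unfolding a_def b_def by linarith
    have "\<bar>t\<bar> < 2"
    proof -
      have "int n * \<bar>t\<bar> < int n * 2" using bd unfolding t abs_mult by simp
      then show ?thesis using n1 by simp
    qed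
    then have "t = -1 \<or> t = 0 \<or> t = 1" by linarith
    moreover have "t \<noteq> -1 \<and> t \<noteq> 1"
    proof -
      have "int (m * n) dvd int n * (t * q c)" using 1 unfolding t by (simp add: mult.assoc)
      then have "int m dvd t * q c" using n1 by (simp add: mult.commute[of "int m"])
      then show ?thesis using nd by auto
    qed
    ultimately show ?thesis using t by (simp add: a_def b_def)
  qed
  \<comment> \<open>By \<open>indep\<close> the increment does not depend on the chosen set, so any
    one may define it.\<close>
  define del where "del i y = (let J = (SOME J. sel i y J) in int (r (sw J i y)) - int (r J))" for i y
  have del: "int (r (sw I i y)) = int (r I) + del i y" if s: "sel i y I" for i y I
  proof -
    have "sel i y (SOME J. sel i y J)" using s by (rule someI)
    from indep[OF s this] show ?thesis by (simp add: del_def Let_def)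
  qed
  have anti: "del y i = - del i y" if iy: "i \<in> X" "y \<in> X" "i \<noteq> y" for i y
  proof -
    obtain I where s: "sel i y I" using sel_ex[OF big iy(1,2,2,3,3)] by blast
    show ?thesis using del[OF s] del[OF sel_sw(1)[OF s]] sel_sw(2)[OF s] by simp
  qed
  \<comment> \<open>Replacing \<open>i\<close> by \<open>z\<close> and then \<open>z\<close> by
    \<open>y\<close> has the same effect as replacing \<open>i\<close> by \<open>y\<close>.\<close>
  have coc: "del i y = del i z + del z y" if iyz: "i \<in> X" "y \<in> X" "z \<in> X" "i \<noteq> y" "i \<noteq> z" "z \<noteq> y" for i y z
  proof -
    obtain J where J: "sel i y J" "z \<notin> J" using sel_ex[OF big iyz(1-5)] by blast
    have iz: "sel i z J" using J iyz by (simp add: sel_def)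
    have fJ: "finite J" using J finX by (simp add: sel_def)
    have "card (sw J i z) = n" using iz fJ n1 by (simp add: sel_def)
    then have zy: "sel z y (sw J i z)" using J iyz by (auto simp: sel_def)
    have "sw (sw J i z) z y = sw J i y" using J by auto
    then show ?thesis using del[OF J(1)] del[OF iz] del[OF zy] by simp
  qed
  obtain o' where o: "o' \<in> X" using big n3 by (metis card.empty equals0I le_zero_eq mult_eq_0_iff not_numeral_le_zero zero_neq_numeral)
  define w where "w i = (if i = o' then 0 else del i o')" for i
  have "int (r (sw I i y)) = int (r I) + w i - w y" if s: "sel i y I" for i y I
  proof -
    have iy: "i \<in> X" "y \<in> X" "i \<noteq> y" using s by (auto simp: sel_def)
    consider "i = o'" | "y = o'" | "i \<noteq> o'" "y \<noteq> o'" by blast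
    then have "del i y = w i - w y"
    proof cases
      case 1
      then show ?thesis using anti[OF iy(2,1)] iy by (auto simp: w_def)
    next
      case 2
      then show ?thesis using iy by (auto simp: w_def)
    next
      case 3
      then have "del i y = del i o' + del o' y" using iy o by (intro coc) auto
      moreover have "del o' y = - del y o'" using iy o 3 by (intro anti) auto
      ultimately show ?thesis using 3 by (simp add: w_def)
    qed
    then show ?thesis using del[OF s] by simp
  qed
  then show ?thesis by blast
qed

text \<open>Subtracted from their maximum, the weights become non-negative numbers
  \<open>v i\<close> with \<open>r I = sum v I\<close> for every \<open>n\<close>-subset
  \<open>I\<close>. As \<open>r I < n\<close>, at most \<open>n-1\<close> of them are nonzero and
  their total is below \<open>n\<close>; the zero-sum of the whole sequence fixes it modulo
  \<open>n\<close>, so it is \<open>n-1\<close>.\<close>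

lemma main_shape:
  assumes kE: "\<And>e. e \<in> E \<Longrightarrow> [q e = q c] (mod int (m * n))" and big: "2 * n \<le> card X" and nd: "\<not> int m dvd q c"
  shows "\<exists>f\<in>X. \<exists>v :: nat \<Rightarrow> nat. (\<forall>i\<in>X. [q i = q f - int (v i) * q c] (mod int (m * n)) \<and> [p i = p f - int (v i) * p c] (mod int n))
    \<and> v f = 0 \<and> sum v X = n - 1 \<and> coprime (q f) (int m) \<and> (2 * n - 1 \<le> card E \<longrightarrow> [q f = q c] (mod int m))"
proof -
  obtain w where w: "\<And>i y I. sel i y I \<Longrightarrow> int (r (sw I i y)) = int (r I) + w i - w y" using weights[OF kE big nd] by blast
  have "card X > 0" using big n3 by linarith
  then have neX: "X \<noteq> {}" by (simp add: card_gt_0_iff)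
  define M where "M = Max (w ` X)"
  have Mle: "w i \<le> M" if "i \<in> X" for i using that EX(6) by (simp add: M_def)
  have "M \<in> w ` X" unfolding M_def using EX(6) neX by (intro Max_in) auto
  then obtain a where a: "a \<in> X" "w a = M" by blast
  have "2 * n - 1 \<le> card (X - {a})" using a(1) EX(6) big by simp
  moreover have "finite (X - {a})" using EX(6) by simp
  ultimately obtain I0 where I0: "I0 \<subseteq> X - {a}" "card I0 = n" "int n dvd (\<Sum>i\<in>I0. int (x i))"
    using erdos_ginzburg_ziv[OF n1, of "X - {a}" "\<lambda>i. int (x i)"] by blast
  have I0X: "I0 \<subseteq> X" using I0(1) by blast
  have fI0: "finite I0" by (rule finX[OF I0X])
  have "int n dvd int (sum x I0 + 0)" using I0(3) by simp
  then have "n dvd sum x I0 + 0" by (simp only: int_dvd_int_iff)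
  then have r0: "r I0 = 0" using n1 by (intro rr_eqI) auto
  \<comment> \<open>Exchanging \<open>i\<close> for the term \<open>a\<close> of maximal weight
    cannot make \<open>r\<close> negative, so a set with \<open>r I0 = 0\<close> avoiding
    \<open>a\<close> consists of terms of maximal weight.\<close>
  have w0: "w i = M" if i: "i \<in> I0" for i
  proof -
    have "sel i a I0" using i I0 a I0X by (auto simp: sel_def)
    from w[OF this] have "0 \<le> w i - M" using r0 a(2) by simp
    then show ?thesis using Mle[of i] i I0X by fastforce
  qed
  define v where "v i = nat (M - w i)" for i
  have v: "int (v i) = M - w i" if "i \<in> X" for i using Mle[OF that] by (simp add: v_def)
  have v0: "v i = 0" if "i \<in> I0" for i using w0[OF that] by (simp add: v_def)
  \<comment> \<open>Both sides are 0 on \<open>I0\<close>, and exchanges against terms of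
    \<open>I0\<close> reduce every other \<open>n\<close>-subset to it.\<close>
  have rv: "r I = sum v I" if "I \<subseteq> X" "card I = n" for I
    using that
  proof (induction "card (I - I0)" arbitrary: I rule: less_induct)
    case less
    have fI: "finite I" by (rule finX[OF less.prems(1)])
    show ?case
    proof (cases "I \<subseteq> I0")
      case True
      then have "I = I0" using card_subset_eq[OF fI0 True] less.prems(2) I0(2) by simp
      then show ?thesis using r0 v0 by simp
    next
      case False
      then obtain i where i: "i \<in> I" "i \<notin> I0" by blast
      have "\<not> I0 \<subseteq> I" using card_subset_eq[OF fI] less.prems(2) I0(2) False by auto
      then obtain y where y: "y \<in> I0" "y \<notin> I" by blast
      have s: "sel i y I" using less.prems i y I0X by (auto simp: sel_def)
      have "sw I i y - I0 = (I - I0) - {i}" using y i by blast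
      moreover have "card ((I - I0) - {i}) < card (I - I0)" using i fI by (intro card_Diff1_less) auto
      ultimately have "card (sw I i y - I0) < card (I - I0)" by simp
      then have IH: "r (sw I i y) = sum v (sw I i y)"
        using less.hyps[of "sw I i y"] sel_sw(1)[OF s] unfolding sel_def by blast
      have "int (r (sw I i y)) = int (r I) - int (v i)" using w[OF s] w0[OF y(1)] v[of i] less.prems(1) i(1) by auto
      moreover have "int (sum v (sw I i y)) + int (v i) = int (sum v I) + int (v y)"
        using sum_sw[OF s, of "\<lambda>i. int (v i)"] by simp
      ultimately show ?thesis using IH v0[OF y(1)] by linarith
    qed
  qed
  obtain f where f: "f \<in> I0" using I0(2) n3 by fastforce
  have fX: "f \<in> X" using f I0X by blast
  have vf: "v f = 0" by (rule v0[OF f])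
  have shape: "[q i = q f - int (v i) * q c] (mod int (m * n)) \<and> [int (x i) = int (x f) - int (v i)] (mod int n)" if i: "i \<in> X" for i
  proof (cases "i = f")
    case False
    obtain I where s: "sel i f I" using sel_ex[OF big i fX fX False False] by blast
    have e: "int (r (sw I i f)) - int (r I) = - int (v i)" using w[OF s] w0[OF f] v[OF i] by simp
    show ?thesis using swap_step[OF kE big s] r_sw_cong[OF s] unfolding e
      by (auto simp: cong_iff_dvd_diff algebra_simps dvd_diff_commute)
  qed (use vf in simp)
  have pshape: "[p i = p f - int (v i) * p c] (mod int n)" if i: "i \<in> X" for i
  proof -
    have "int n dvd p i - (int (x i) * p c + 1 * p d)" "int n dvd p f - (int (x f) * p c + 1 * p d)"
      using x(3)[OF i] x(3)[OF fX] unfolding lin_def cong_iff_dvd_diff by blast+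
    then have "int n dvd (p i - (int (x i) * p c + 1 * p d)) - (p f - (int (x f) * p c + 1 * p d))" by (rule dvd_diff)
    moreover have "int n dvd (int (x i) - (int (x f) - int (v i))) * p c"
      using shape[OF i] unfolding cong_iff_dvd_diff by (intro dvd_mult2) blast
    ultimately have "int n dvd ((p i - (int (x i) * p c + 1 * p d)) - (p f - (int (x f) * p c + 1 * p d)))
      + (int (x i) - (int (x f) - int (v i))) * p c" by (rule dvd_add)
    then show ?thesis unfolding cong_iff_dvd_diff by (simp add: algebra_simps)
  qed
  define P where "P = {i\<in>X. v i \<noteq> 0}"
  have PX: "P \<subseteq> X" by (auto simp: P_def)
  have cP: "card P \<le> n - 1"
  proof (rule ccontr)
    assume "\<not> ?thesis"
    then have "n \<le> card P" by simp
    from subset_of_card[OF this] obtain I where I: "I \<subseteq> P" "card I = n" by blast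
    have "(\<Sum>i\<in>I. 1) \<le> sum v I" using I(1) by (intro sum_mono) (auto simp: P_def)
    then have "n \<le> r I" using I PX rv[of I] by auto
    then show False using r_lt[of I] by simp
  qed
  have "card (X - P) \<ge> n - card P" using card_Diff_subset[OF finX[OF PX] PX] big by simp
  from subset_of_card[OF this] obtain Z where Z: "Z \<subseteq> X - P" "card Z = n - card P" by blast
  have fZ: "finite Z" using Z(1) finX[of Z] by blast
  have "card (P \<union> Z) = n" using card_Un_disjoint[OF finX[OF PX] fZ] Z cP by auto
  moreover have PZ: "P \<union> Z \<subseteq> X" using PX Z by blast
  ultimately have "sum v (P \<union> Z) < n" using rv[of "P \<union> Z"] r_lt[of "P \<union> Z"] by simp
  moreover have "sum v X = sum v (P \<union> Z)" using PZ EX(6) by (intro sum.mono_neutral_right) (auto simp: P_def)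
  ultimately have lt: "sum v X < n" by simp
  \<comment> \<open>Modulo \<open>n\<close> the coordinates are \<open>x f - v i\<close>; summed
    over \<open>X\<close> and added to \<open>card E\<close>, which is -1 modulo \<open>n\<close>,
    they must vanish.\<close>
  have sumv: "sum v X = n - 1"
  proof -
    obtain j where j: "1 \<le> j" "j \<le> m" "card X = j * n" "card E = (m + 1 - j) * n - 1" using sizes by blast
    have pos: "1 \<le> (m + 1 - j) * n" using j n1 by (simp add: Suc_le_eq)
    have "[(\<Sum>i\<in>X. int (x i)) = (\<Sum>i\<in>X. int (x f) - int (v i))] (mod int n)" using shape by (intro cong_sum) blast
    then have "int n dvd (\<Sum>i\<in>X. int (x i)) - (\<Sum>i\<in>X. int (x f) - int (v i))" by (simp add: cong_iff_dvd_diff)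
    moreover have "(\<Sum>i\<in>X. int (x f) - int (v i)) = int n * (int j * int (x f)) - int (sum v X)"
      using j(3) by (simp add: sum_subtractf)
    ultimately have 1: "int n dvd int (sum x X) - (int n * (int j * int (x f)) - int (sum v X))" by simp
    have "int n dvd int (sum x X + card E)" using total_x by (simp only: int_dvd_int_iff)
    moreover have "int (card E) = int n * int (m + 1 - j) - 1" using j(4) pos by (simp add: of_nat_diff mult.commute)
    ultimately have "int n dvd int (sum x X) + (int n * int (m + 1 - j) - 1)" by simp
    from dvd_diff[OF this 1] have "int n dvd (int n * int (m + 1 - j) + int n * (int j * int (x f))) - (int (sum v X) + 1)"
      by (simp add: algebra_simps)
    moreover have "int n dvd int n * int (m + 1 - j) + int n * (int j * int (x f))" by simp
    ultimately have "int n dvd (int n * int (m + 1 - j) + int n * (int j * int (x f)))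
       - ((int n * int (m + 1 - j) + int n * (int j * int (x f))) - (int (sum v X) + 1))" by (rule dvd_diff[rotated])
    then have "int n dvd int (sum v X + 1)" by (simp add: add.commute)
    then have "n dvd sum v X + 1" by (simp only: int_dvd_int_iff)
    then have "n \<le> sum v X + 1" by (intro dvd_imp_le) auto
    then show ?thesis using lt by linarith
  qed
  have g: "\<exists>g. coprime g (int m) \<and> (2 * n - 1 \<le> card E \<longrightarrow> [g = q c] (mod int m)) \<and> [q f = g] (mod int m)"
  proof -
    have "sel f a I0" using f I0 I0X a by (auto simp: sel_def)
    from T_swap[OF kE big this] obtain g where g: "coprime g (int m)" "2 * n - 1 \<le> card E \<longrightarrow> [g = q c] (mod int m)"
      "\<forall>J\<subseteq>insert a I0. card J = n \<longrightarrow> [sum q J + int (r J) * q c = int n * g] (mod int (m * n))" by blast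
    have "I0 \<subseteq> insert a I0" by blast
    then have "[sum q I0 + int (r I0) * q c = int n * g] (mod int (m * n))" using g(3) I0(2) by blast
    then have 1: "[sum q I0 = int n * g] (mod int (m * n))" using r0 by simp
    have "[q i = q f] (mod int (m * n))" if "i \<in> I0" for i using shape[of i] v0[OF that] that I0X by auto
    then have "[sum q I0 = int (card I0) * q f] (mod int (m * n))" by (intro sum_cong_const)
    then have "[int n * q f = int n * g] (mod int (m * n))" unfolding I0(2) using 1 by (rule cong_trans[OF cong_sym])
    then have "[q f = g] (mod int m)" using cong_scale_iff[of n] n1 by simp
    then show ?thesis using g(1,2) by blast
  qed
  then have "coprime (q f) (int m)" using cong_imp_coprime cong_sym by blast
  moreover have "2 * n - 1 \<le> card E \<longrightarrow> [q f = q c] (mod int m)" using g cong_trans by blast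
  ultimately show ?thesis using fX shape pshape vf sumv by blast
qed

lemma residue_of_r:
  assumes "r I = 0 \<or> r I = n - 1"
  shows "int n dvd int (sum x I) \<or> int n dvd int (sum x I) - 1"
  using assms
proof
  assume "r I = 0"
  then show ?thesis using rr_int[of I] by simp
next
  assume "r I = n - 1"
  then have "int n dvd int (sum x I) + (int n - 1)" using rr_int[of I] n1 by (simp add: of_nat_diff)
  then have "int n dvd int (sum x I) + (int n - 1) - int n" by (rule dvd_diff) simp
  then show ?thesis by simp
qed

text \<open>Adding one term to a fixed set of \<open>n-1\<close> terms gives coordinate sum 0 or 1
  modulo \<open>n\<close>, so outside that set only two coordinates are possible.\<close>

lemma residue_pigeonhole:
  assumes "K \<subseteq> X" "card K = n - 1" "{i1, i2, i3} \<subseteq> X - K"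
    and no: "\<And>I. I \<subseteq> X \<Longrightarrow> card I = n \<Longrightarrow> r I = 0 \<or> r I = n - 1"
  shows "x i1 = x i2 \<or> x i1 = x i3 \<or> x i2 = x i3"
proof -
  have fK: "finite K" by (rule finX[OF assms(1)])
  have res: "int n dvd int (sum x K) + int (x i) \<or> int n dvd int (sum x K) + int (x i) - 1" if i: "i \<in> X - K" for i
  proof -
    have "card (insert i K) = n" using i fK assms(2) n1 by simp
    then have "r (insert i K) = 0 \<or> r (insert i K) = n - 1" using i assms(1) by (intro no) auto
    note residue_of_r[OF this]
    moreover have "int (sum x (insert i K)) = int (sum x K) + int (x i)" using i fK by simp
    ultimately show ?thesis by simp
  qed
  have eq: "x i = x y" if iy: "i \<in> X - K" "y \<in> X - K" "int n dvd int (x i) - int (x y)" for i y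
    using nat_cong_range[of "x i" n "x y"] iy x by (simp add: cong_iff_dvd_diff)
  have same: "x i = x y" if iy: "i \<in> X - K" "y \<in> X - K" "int n dvd int (sum x K) + int (x i) - e" "int n dvd int (sum x K) + int (x y) - e" for i y e
    by (rule eq[OF iy(1,2)]) (use dvd_diff[OF iy(3,4)] in simp)
  show ?thesis
    using res[of i1] res[of i2] res[of i3] same[of i1 i2 0] same[of i1 i3 0] same[of i2 i3 0]
      same[of i1 i2 1] same[of i1 i3 1] same[of i2 i3 1] assms(3) by auto
qed

text \<open>Two of the four terms can be chosen so that the coordinate sums are
  \<open>k + 2 * A\<close>, \<open>k + 2 * A + D\<close> and \<open>k + 2 * A + 2 * D\<close>, all 0
  or 1 modulo \<open>n\<close>, with \<open>D\<close> nonzero. The middle one differs from both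
  neighbours, so these agree with each other, and 2 would vanish modulo \<open>n\<close>.\<close>

lemma no_quad:
  assumes "K \<subseteq> X" "card K = n - 2" "{i, i', a, b} \<subseteq> X - K" "distinct [i, i', a, b]" "x i' = x a" "x i = x b" "x a \<noteq> x b"
    and no: "\<And>I. I \<subseteq> X \<Longrightarrow> card I = n \<Longrightarrow> r I = 0 \<or> r I = n - 1"
  shows False
proof -
  have fK: "finite K" by (rule finX[OF assms(1)])
  define k where "k = int (sum x K)" define A where "A = int (x a)" define D where "D = int (x b) - int (x a)"
  have res: "int n dvd k + int (x s) + int (x t) \<or> int n dvd k + int (x s) + int (x t) - 1" if st: "s \<in> X - K" "t \<in> X - K" "s \<noteq> t" for s t
  proof -
    let ?I = "insert s (insert t K)"
    have "card ?I = n" using st fK assms(2) n3 by simp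
    then have "r ?I = 0 \<or> r ?I = n - 1" using st assms(1) by (intro no) auto
    note residue_of_r[OF this]
    moreover have "int (sum x ?I) = k + int (x s) + int (x t)" using st fK by (simp add: k_def)
    ultimately show ?thesis by simp
  qed
  have R0: "int n dvd k + 2 * A \<or> int n dvd k + 2 * A - 1" using res[of i' a] assms by (auto simp: A_def algebra_simps)
  have R1: "int n dvd k + 2 * A + D \<or> int n dvd k + 2 * A + D - 1" using res[of i a] assms by (auto simp: A_def D_def algebra_simps)
  have R2: "int n dvd k + 2 * A + 2 * D \<or> int n dvd k + 2 * A + 2 * D - 1" using res[of i b] assms by (auto simp: A_def D_def algebra_simps)
  have nD: "\<not> int n dvd D"
    using nat_cong_range[of "x b" n "x a"] x[of a] x[of b] assms by (auto simp: D_def cong_iff_dvd_diff)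
  have n2': "\<not> int n dvd 2"
  proof
    assume "int n dvd 2"
    then have "int n \<le> 2" by (rule zdvd_imp_le) simp
    then show False using n3 by simp
  qed
  from R1 show False
  proof
    assume 1: "int n dvd k + 2 * A + D"
    have "\<not> int n dvd k + 2 * A" using nD dvd_diff[OF 1, of "k + 2 * A"] by auto
    then have 0: "int n dvd k + 2 * A - 1" using R0 by blast
    have "\<not> int n dvd k + 2 * A + 2 * D"
    proof
      assume "int n dvd k + 2 * A + 2 * D"
      from dvd_diff[OF this 1] show False using nD by simp
    qed
    then have "int n dvd k + 2 * A + 2 * D - 1" using R2 by blast
    from dvd_diff[OF dvd_add[OF 1 1] dvd_add[OF 0 this]] show False using n2' by simp
  next
    assume 1: "int n dvd k + 2 * A + D - 1"
    have "\<not> int n dvd k + 2 * A - 1"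
    proof
      assume "int n dvd k + 2 * A - 1"
      from dvd_diff[OF 1 this] show False using nD by simp
    qed
    then have 0: "int n dvd k + 2 * A" using R0 by blast
    have "\<not> int n dvd k + 2 * A + 2 * D - 1"
    proof
      assume "int n dvd k + 2 * A + 2 * D - 1"
      from dvd_diff[OF this 1] show False using nD by simp
    qed
    then have "int n dvd k + 2 * A + 2 * D" using R2 by blast
    from dvd_diff[OF dvd_add[OF 0 this] dvd_add[OF 1 1]] show False using n2' by simp
  qed
qed

text \<open>If no completion uses some but not all copies of \<open>c\<close>, nothing ties these
  copies together in the full group. But then the coordinates on \<open>X\<close> are so rigid that
  all but one term \<open>b\<close> are copies of one value \<open>a\<close>, and
  \<open>b = a + c\<close>. So \<open>a\<close> is a center of multiplicity \<open>m n - 1\<close>,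
  and its copies can be exchanged.\<close>

lemma recenter:
  assumes big: "2 * n \<le> card X" and cE': "card E = n - 1"
    and no: "\<And>I. I \<subseteq> X \<Longrightarrow> card I = n \<Longrightarrow> r I = 0 \<or> r I = n - 1"
  shows "\<exists>c'\<in>L. cen L c' c \<and> card {i\<in>L. eqv i c'} = m * n - 1"
proof -
  have cX: "card X = m * n"
    using card_Un_disjoint[OF EX(5,6,1)] EX(2) cardL' cE' n1 by simp
  have pick: "\<exists>K\<subseteq>X - A. card K = t" if "finite A" "card A + t \<le> 2 * n" for A t
  proof -
    have "card X - card A \<le> card (X - A)" by (rule diff_card_le_card_Diff[OF that(1)])
    then have "t \<le> card (X - A)" using that big by linarith
    then show ?thesis by (rule subset_of_card)
  qed
  have nn: "\<not> n dvd n - 1" using n3 by (auto dest: dvd_imp_le)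
  \<comment> \<open>A constant coordinate would make the sum over \<open>X\<close> vanish modulo
    \<open>n\<close>, against \<open>total_x\<close> with \<open>card E = n-1\<close>.\<close>
  obtain a0 b0 where ab0: "a0 \<in> X" "b0 \<in> X" "x a0 \<noteq> x b0"
  proof (rule ccontr)
    assume "\<not> thesis"
    then have eq: "x i = x y" if "i \<in> X" "y \<in> X" for i y using that \<open>\<And>a0 b0. \<lbrakk>a0 \<in> X; b0 \<in> X; x a0 \<noteq> x b0\<rbrakk> \<Longrightarrow> thesis\<close> by blast
    have "card X > 0" using big n3 by linarith
    then obtain y where y: "y \<in> X" by (auto simp: card_gt_0_iff)
    have "sum x X = n * (m * x y)" using eq[OF _ y] cX by simp
    then have "n dvd n * (m * x y) + (n - 1)" using total_x cE' by simp
    then show False using nn by (simp add: dvd_add_right_iff)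
  qed
  have S: "x i = x y" if iy: "i \<in> X - {a0, b0}" "y \<in> X - {a0, b0}" for i y
  proof (rule ccontr)
    assume ne: "x i \<noteq> x y"
    have ds: "distinct [i, y, a0, b0]" "distinct [i, y, b0, a0]" using iy ne ab0 by auto
    have "card {i, y, a0, b0} + (n - 2) \<le> 2 * n" using card_length[of "[i, y, a0, b0]"] n3 by simp
    from pick[OF _ this] obtain K where K: "K \<subseteq> X - {i, y, a0, b0}" "card K = n - 2" by auto
    have KX: "K \<subseteq> X" using K by blast
    have fK: "finite K" by (rule finX[OF KX])
    have cK: "card (insert t K) = n - 1" if "t \<notin> K" for t using that K(2) fK n3 by simp
    have nK: "i \<notin> K" "y \<notin> K" "a0 \<notin> K" "b0 \<notin> K" using K by auto
    have sub: "{i, y, a0, b0} \<subseteq> X - K" "{i, y, b0, a0} \<subseteq> X - K" using nK iy ab0 by auto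
    have 1: "x a0 = x b0 \<or> x a0 = x y \<or> x b0 = x y"
      by (rule residue_pigeonhole[OF _ cK[OF nK(1)] _ no]) (use KX nK iy ab0 ds in auto)
    have 2: "x i = x y \<or> x i = x b0 \<or> x y = x b0"
      by (rule residue_pigeonhole[OF _ cK[OF nK(3)] _ no]) (use KX nK iy ab0 ds in auto)
    have 3: "x i = x y \<or> x i = x a0 \<or> x y = x a0"
      by (rule residue_pigeonhole[OF _ cK[OF nK(4)] _ no]) (use KX nK iy ab0 ds in auto)
    from 1 ab0(3) consider "x y = x a0" | "x y = x b0" by auto
    then show False
    proof cases
      case c1: 1
      have "x i = x b0" using 2 ne c1 ab0(3) by auto
      then show False by (rule no_quad[OF KX K(2) sub(1) ds(1) c1 _ ab0(3) no])
    next
      case c2: 2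
      have "x i = x a0" using 3 ne c2 ab0(3) by auto
      then show False by (rule no_quad[OF KX K(2) sub(2) ds(2) c2 _ not_sym[OF ab0(3)] no])
    qed
  qed
  \<comment> \<open>Outside \<open>a0\<close> and \<open>b0\<close> the coordinate is constant; a
    term there agrees with one of the two, so the other is the only exception.\<close>
  obtain a b where ab: "a \<in> X" "b \<in> X" "x a \<noteq> x b" "\<And>i. i \<in> X - {b} \<Longrightarrow> x i = x a"
  proof -
    have "card {a0, b0} + n \<le> 2 * n" using card_length[of "[a0, b0]"] n3 by simp
    from pick[OF _ this] obtain K0 where K0: "K0 \<subseteq> X - {a0, b0}" "card K0 = n" by auto
    obtain s where s: "s \<in> K0" using K0(2) n3 by fastforce
    have fK0: "finite K0" using K0(1) finX[of K0] by blast
    have cK: "card (K0 - {s}) = n - 1" using s fK0 K0(2) by simp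
    have "x s = x a0 \<or> x s = x b0 \<or> x a0 = x b0"
      by (rule residue_pigeonhole[OF _ cK _ no]) (use K0 s ab0 in auto)
    then consider "x s = x a0" | "x s = x b0" using ab0(3) by blast
    then show thesis
    proof cases
      case 1
      have "x i = x a0" if "i \<in> X - {b0}" for i
      proof (cases "i = a0")
        case False
        then show ?thesis using S[of i s] that s K0(1) 1 by auto
      qed simp
      then show ?thesis by (rule that[OF ab0])
    next
      case 2
      have "x i = x b0" if "i \<in> X - {a0}" for i
      proof (cases "i = b0")
        case False
        then show ?thesis using S[of i s] that s K0(1) 2 by auto
      qed simp
      then show ?thesis by (rule that[OF ab0(2,1) not_sym[OF ab0(3)]])
    qed
  qed
  \<comment> \<open>The total of the coordinates is 1 modulo \<open>n\<close>, and it is congruent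
    to \<open>x b - x a\<close> because \<open>X\<close> has \<open>m n\<close> terms.\<close>
  have xb: "[int (x b) - int (x a) = 1] (mod int n)"
  proof -
    have "sum x X = x b + sum x (X - {b})" by (rule sum.remove[OF EX(6) ab(2)])
    also have "sum x (X - {b}) = (m * n - 1) * x a" using ab(2,4) cX EX(6) by simp
    finally have sx: "sum x X = x b + (m * n - 1) * x a" .
    have "int n dvd int (x b + (m * n - 1) * x a + (n - 1))" using total_x unfolding cE' sx by (simp only: int_dvd_int_iff)
    moreover have "int (m * n - 1) = int m * int n - 1" "int (n - 1) = int n - 1" using m2 n1 by (simp_all add: of_nat_diff Suc_le_eq)
    ultimately have "int n dvd int (x b) + (int m * int n - 1) * int (x a) + (int n - 1)"
      by (simp add: add_diff_eq)
    then have "int n dvd (int (x b) + (int m * int n - 1) * int (x a) + (int n - 1)) - int n * (int m * int (x a) + 1)"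
      by (rule dvd_diff) simp
    then show ?thesis by (simp add: cong_iff_dvd_diff algebra_simps)
  qed
  have lb: "lin b 1 c 1 a" using lin_cong[OF coset_shift[OF x(3)[OF ab(2)] x(3)[OF ab(1)]] xb cong_refl] .
  have nea: "\<not> eqv a c" using ab(1) by (simp add: X_def)
  have dca: "det c a" by (rule cen_det[OF cenL _ nea]) (use ab EX in auto)
  have ea: "eqv i a" if "i \<in> X - {b}" for i
  proof -
    have "lin i (int (x a)) c 1 d" using x(3)[of i] ab(4)[OF that] that by simp
    then show ?thesis by (rule lin_eqv[OF _ x(3)[OF ab(1)]])
  qed
  have "cen L a c"
    unfolding cen_def
  proof (intro conjI ballI)
    show "det a c" by (rule det_sym[OF dca])
    fix i assume "i \<in> L"
    then consider "i \<in> E" | "i = b" | "i \<in> X - {b}" using EX(2) by blast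
    then show "eqv i a \<or> (\<exists>x. lin i x a 1 c)"
    proof cases
      case 1
      then show ?thesis using lin_eqv_left[OF lin_self(2) eqv_sym[OF eE[OF 1]]] by blast
    next
      case 2
      then show ?thesis using lin_comm[THEN iffD1, OF lb] by blast
    next
      case 3
      then show ?thesis using ea by blast
    qed
  qed
  moreover have "{i\<in>L. eqv i a} = X - {b}"
  proof -
    have "\<not> eqv i a" if "i \<in> E" for i
      using nea eqv_trans[OF eqv_sym[of i a] eE[OF that]] by blast
    moreover have "\<not> eqv b a"
    proof
      assume "eqv b a"
      then have "[int (x b) = int (x a)] (mod int n)" using lin_unique(1)[OF dcd x(3)[OF ab(2)] x(3)[OF ab(1)]] by blast
      then show False using nat_cong_range[of "x b" n "x a"] x[OF ab(1)] x[OF ab(2)] ab(3) by auto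
    qed
    ultimately show ?thesis using ea EX(2) by blast
  qed
  then have "card {i\<in>L. eqv i a} = m * n - 1" using cX ab(2) EX(6) by simp
  ultimately show ?thesis using ab(1) EX(4) by blast
qed

end

lemma reindex_mset:
  assumes "finite A"
  shows "\<exists>h. bij_betw h {1..card A} A \<and> (\<forall>g. image_mset g (mset_set A) = image_mset (\<lambda>i. g (h i)) (mset_set {1..card A}))"
proof -
  obtain h where h: "bij_betw h {1..card A} A" using ex_bij_betw_nat_finite_1[OF assms] by blast
  have "mset_set A = image_mset h (mset_set {1..card A})"
    using h image_mset_mset_set[of h "{1..card A}"] by (simp add: bij_betw_def)
  then have "image_mset g (mset_set A) = image_mset (\<lambda>i. g (h i)) (mset_set {1..card A})" for g
    by (simp add: image_mset.compositionality o_def)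
  then show ?thesis using h by blast
qed

lemma red_cong:
  "[fst (red n m (a, b)) = a] (mod int n)" "[snd (red n m (a, b)) = b] (mod int (m * n))"
  "[snd (red n m (a, b)) = b] (mod int n)" "[snd (red n m (a, b)) = b] (mod int m)"
proof -
  show 1: "[fst (red n m (a, b)) = a] (mod int n)" "[snd (red n m (a, b)) = b] (mod int (m * n))"
    by (simp_all add: red_def cong_def)
  show "[snd (red n m (a, b)) = b] (mod int n)" "[snd (red n m (a, b)) = b] (mod int m)"
    by (rule cong_dvd_modulus[OF 1(2)]; simp)+
qed

lemma det_red:
  assumes "coprime (a * y - b * x) (int n)"
  shows "coprime (a * snd (red n m (x, y)) - b * fst (red n m (x, y))) (int n)"
proof -
  have "[a * snd (red n m (x, y)) - b * fst (red n m (x, y)) = a * y - b * x] (mod int n)"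
    by (intro cong_diff cong_scalar_left red_cong)
  then show ?thesis using assms cong_imp_coprime cong_sym by blast
qed

section \<open>Reading off the forms (a) to (d)\<close>

context centered
begin

context
  fixes S
  assumes rng: "\<forall>i\<in>L. (p i, q i) \<in> grp n m" and S: "S = image_mset (\<lambda>i. (p i, q i)) (mset_set L)"
begin

lemma elt_eq:
  assumes "i \<in> L" "[p i = a] (mod int n)" "[q i = b] (mod int (m * n))"
  shows "(p i, q i) = red n m (a, b)"
proof -
  have "red n m (p i, q i) = red n m (a, b)" unfolding red_eq_iff using assms(2,3) by (simp add: cong_iff_dvd_diff)
  then show ?thesis using red_grp rng assms(1) by metis
qed

lemma S_split:
  assumes kE: "\<And>e. e \<in> E \<Longrightarrow> [q e = q c] (mod int (m * n))"
  shows "S = replicate_mset (card E) (p c, q c) + image_mset (\<lambda>i. (p i, q i)) (mset_set X)"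
proof -
  have "(p i, q i) = (p c, q c)" if i: "i \<in> E" for i
  proof -
    have "(p i, q i) = red n m (p c, q c)" using i kE[OF i] eE[OF i] EX(3) by (intro elt_eq) (auto simp: eqv_def)
    then show ?thesis using red_grp rng cL by metis
  qed
  then have "image_mset (\<lambda>i. (p i, q i)) (mset_set E) = replicate_mset (card E) (p c, q c)" by (rule image_mset_const[OF EX(5)])
  moreover have "mset_set L = mset_set E + mset_set X" using mset_set_Union[OF EX(5,6,1)] EX(2) by simp
  ultimately show ?thesis unfolding S by simp
qed

lemma m1: "m \<ge> 1" using m2 by simp

text \<open>Here \<open>c\<close> has order \<open>n\<close> and serves as \<open>e1\<close>;
  \<open>e2\<close> is any term of \<open>X\<close> with its multiple of \<open>c\<close> removed,
  and its second coordinate is a unit modulo \<open>m\<close>.\<close>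

lemma shape_form2a:
  assumes kE: "\<And>e. e \<in> E \<Longrightarrow> [q e = q c] (mod int (m * n))" and big: "2 * n \<le> card X" and dv: "int m dvd q c" and sE: "card E = n - 1"
  shows "\<exists>a b. form2a n m S a b"
proof -
  have cX: "card X = m * n" using card_Un_disjoint[OF EX(5,6,1)] EX(2) cardL' sE n1 by simp
  have "card X > 0" using big n3 by linarith
  then obtain o' where o: "o' \<in> X" by (auto simp: card_gt_0_iff)
  define P where "P = p o' - int (x o') * p c" define Q where "Q = q o' - int (x o') * q c"
  let ?D = "red n m (P, Q)"
  define y where "y i = int (x i) mod int n" for i
  have yb: "0 \<le> y i \<and> y i \<le> int n - 1" for i using n1 by (simp add: y_def)
  have elt: "(p i, q i) = gadd n m (gsmul n m (y i) (p c, q c)) ?D" if i: "i \<in> X" for i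
  proof -
    obtain t where t: "int (x i) = y i + int n * t" unfolding y_def using mod_mult_div_eq[of "int (x i)" "int n"] by (metis)
    have "[p i = int (x i) * p c + 1 * p d] (mod int n)" "[p o' = int (x o') * p c + 1 * p d] (mod int n)"
      using x(3)[OF i] x(3)[OF o] by (auto simp: lin_def)
    then have "[p i - p o' = (int (x i) * p c + 1 * p d) - (int (x o') * p c + 1 * p d)] (mod int n)" by (rule cong_diff)
    then have "int n dvd (p i - p o') - ((int (x i) * p c + 1 * p d) - (int (x o') * p c + 1 * p d))" by (simp add: cong_iff_dvd_diff)
    moreover have "int n dvd int n * (t * p c)" by simp
    ultimately have "int n dvd (p i - p o') - ((int (x i) * p c + 1 * p d) - (int (x o') * p c + 1 * p d)) + int n * (t * p c)" by (rule dvd_add)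
    then have "[p i = y i * p c + P] (mod int n)" unfolding cong_iff_dvd_diff P_def t by (simp add: algebra_simps)
    moreover have "[y i * p c + fst ?D = y i * p c + P] (mod int n)" by (intro cong_add cong_refl red_cong)
    ultimately have 1: "[p i = y i * p c + fst ?D] (mod int n)" by (rule cong_trans[OF _ cong_sym])
    have "int (m * n) dvd (q i - int (x i) * q c) - (q o' - int (x o') * q c)"
      using small_shape(1)[OF kE big dv i o] by (simp add: cong_iff_dvd_diff)
    moreover have "int (m * n) dvd t * (int n * q c)" using dv by (simp add: mult.commute)
    ultimately have "int (m * n) dvd (q i - int (x i) * q c) - (q o' - int (x o') * q c) + t * (int n * q c)" by (rule dvd_add)
    then have "[q i = y i * q c + Q] (mod int (m * n))" unfolding cong_iff_dvd_diff Q_def t by (simp add: algebra_simps)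
    moreover have "[y i * q c + snd ?D = y i * q c + Q] (mod int (m * n))" by (intro cong_add cong_refl red_cong)
    ultimately have 2: "[q i = y i * q c + snd ?D] (mod int (m * n))" by (rule cong_trans[OF _ cong_sym])
    show ?thesis unfolding gcomb1 fst_conv snd_conv by (rule elt_eq[OF _ 1 2]) (use i EX(4) in blast)
  qed
  obtain h where h: "bij_betw h {1..card X} X"
    "\<forall>g :: nat \<Rightarrow> int \<times> int. image_mset g (mset_set X) = image_mset (\<lambda>i. g (h i)) (mset_set {1..card X})"
    using reindex_mset[OF EX(6)] by blast
  have hX: "h i \<in> X" if "i \<in> {1..m * n}" for i using that h(1) cX by (auto simp: bij_betw_def)
  have "image_mset (\<lambda>i. (p i, q i)) (mset_set X)
     = image_mset (\<lambda>i. gadd n m (gsmul n m (y (h i)) (p c, q c)) ?D) (mset_set {1..m * n})"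
    unfolding h(2)[rule_format] cX by (rule image_mset_cong) (use elt hX in auto)
  then have S': "S = replicate_mset (n - 1) (p c, q c)
      + image_mset (\<lambda>i. gadd n m (gsmul n m (y (h i)) (p c, q c)) ?D) (mset_set {1..m * n})"
    using S_split[OF kE] sE by simp
  have sy: "(\<Sum>i = 1..m * n. y (h i)) mod int n = 1 mod int n"
  proof -
    have "(\<Sum>i = 1..m * n. y (h i)) = sum y X" using sum.reindex_bij_betw[OF h(1), of y] cX by simp
    moreover have "[sum y X = (\<Sum>i\<in>X. int (x i))] (mod int n)" by (intro cong_sum) (simp add: y_def)
    moreover have "[(\<Sum>i\<in>X. int (x i)) = 1] (mod int n)"
    proof -
      have "int n dvd int (sum x X + card E)" using total_x by (simp only: int_dvd_int_iff)
      then have "int n dvd int (sum x X) + (int n - 1)" unfolding sE using n1 by (simp add: of_nat_diff add_diff_eq)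
      then have "int n dvd int (sum x X) + (int n - 1) - int n" by (rule dvd_diff) simp
      then show ?thesis by (simp add: cong_iff_dvd_diff)
    qed
    ultimately show ?thesis using cong_trans unfolding cong_def by metis
  qed
  have "det c o'" by (rule cen_det[OF cenL]) (use o X_def in auto)
  then have "coprime (p c * Q - q c * P) (int n)" by (simp add: det_def P_def Q_def algebra_simps)
  then have dt: "coprime (p c * snd ?D - q c * fst ?D) (int n)" by (rule det_red)
  have "[Q = q o'] (mod int m)" using dv by (simp add: Q_def cong_iff_dvd_diff)
  then have "[snd ?D = q o'] (mod int m)" by (rule cong_trans[OF red_cong(4)])
  then have "coprime (snd ?D) (int m)" using small_shape(2)[OF kE big dv o] cong_imp_coprime cong_sym by blast
  then have "basis_ok n m (p c, q c) ?D"
    using basis_okI[OF n1 m1, of "(p c, q c)" ?D] rng cL red_in_grp[OF n1 m1] dt dv by (simp add: mult.commute)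
  then have "form2a n m S (p c, q c) ?D"
    unfolding form2a_def using yb sy S' by (intro conjI exI[of _ "\<lambda>i. y (h i)"]) auto
  then show ?thesis by blast
qed

text \<open>With \<open>g1 = c\<close> and \<open>g2 = f - c\<close>, a term \<open>f - v c\<close>
  is \<open>g2 - (v - 1) g1\<close>, so the coefficients are \<open>v - 1\<close>, and terms with
  \<open>v = 0\<close> are \<open>g1 + g2\<close>. The terms with nonzero \<open>v\<close>, filled
  up by others to \<open>n-1\<close> terms, have coefficient sum
  \<open>(n-1) - (n-1) = 0\<close>.\<close>

lemma shape_form2cd:
  assumes kE: "\<And>e. e \<in> E \<Longrightarrow> [q e = q c] (mod int (m * n))" and big: "2 * n \<le> card X" and nd: "\<not> int m dvd q c"
  shows "\<exists>a b. form2c n m S a b \<or> form2d n m S a b"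
proof -
  obtain j where j: "1 \<le> j" "j \<le> m" "card X = j * n" "card E = (m + 1 - j) * n - 1" using sizes by blast
  have j2: "2 \<le> j"
  proof (rule ccontr)
    assume "\<not> 2 \<le> j"
    then have "j = 1" using j by linarith
    then show False using big j(3) n3 by simp
  qed
  define s where "s = m + 1 - j"
  have s: "1 \<le> s" "s \<le> m - 1" "card E = s * n - 1" "m - s = j - 1" using j j2 by (auto simp: s_def)
  obtain f v where f: "f \<in> X" and v: "\<And>i. i \<in> X \<Longrightarrow> [q i = q f - int (v i) * q c] (mod int (m * n)) \<and> [p i = p f - int (v i) * p c] (mod int n)"
    and vf: "v f = 0" and sv: "sum v X = n - 1" and cf: "coprime (q f) (int m)" and cf2: "2 * n - 1 \<le> card E \<longrightarrow> [q f = q c] (mod int m)"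
    using main_shape[OF kE big nd] by blast
  define P where "P = {i\<in>X. v i \<noteq> 0}"
  have PX: "P \<subseteq> X" by (auto simp: P_def)
  have fP: "finite P" by (rule finX[OF PX])
  have "(\<Sum>i\<in>P. 1) \<le> sum v P" by (intro sum_mono) (auto simp: P_def)
  also have "sum v P \<le> sum v X" using PX EX(6) by (intro sum_mono2) auto
  finally have cP: "card P \<le> n - 1" using sv by simp
  have "card (X - P) \<ge> n - 1 - card P" using card_Diff_subset[OF fP PX] big by simp
  from subset_of_card[OF this] obtain Z where Z: "Z \<subseteq> X - P" "card Z = n - 1 - card P" by blast
  have fZ: "finite Z" using Z(1) finX[of Z] by blast
  define Y where "Y = P \<union> Z"
  have cY: "card Y = n - 1" unfolding Y_def
  proof -
    have "P \<inter> Z = {}" using Z(1) by blast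
    then show "card (P \<union> Z) = n - 1" using card_Un_disjoint[OF fP fZ] Z(2) cP by linarith
  qed
  have YX: "Y \<subseteq> X" using PX Z by (auto simp: Y_def)
  have fY: "finite Y" by (rule finX[OF YX])
  have v0: "v i = 0" if "i \<in> X - Y" for i using that by (auto simp: Y_def P_def)
  have svY: "sum v Y = n - 1" unfolding sv[symmetric] using YX EX(6) v0 by (intro sum.mono_neutral_left) auto
  let ?g1 = "(p c, q c)" let ?g2 = "red n m (p f - p c, q f - q c)"
  have g12: "(p i, q i) = gadd n m ?g1 ?g2" if i: "i \<in> X - Y" for i
  proof -
    have iX: "i \<in> X" using i by blast
    have 1: "[p i = p f] (mod int n)" "[q i = q f] (mod int (m * n))" using v[OF iX] v0[OF i] by auto
    have "[p c + fst ?g2 = p c + (p f - p c)] (mod int n)" "[q c + snd ?g2 = q c + (q f - q c)] (mod int (m * n))"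
      by (intro cong_add cong_refl red_cong)+
    then have 2: "[p c + fst ?g2 = p f] (mod int n)" "[q c + snd ?g2 = q f] (mod int (m * n))" by simp_all
    show ?thesis unfolding gadd_red fst_conv snd_conv
      by (rule elt_eq[OF _ cong_trans[OF 1(1) cong_sym[OF 2(1)]] cong_trans[OF 1(2) cong_sym[OF 2(2)]]]) (use iX EX(4) in blast)
  qed
  have gY: "(p i, q i) = gadd n m (gsmul n m (- (int (v i) - 1)) ?g1) ?g2" if i: "i \<in> X" for i
  proof -
    let ?a = "- (int (v i) - 1)"
    have "[?a * p c + fst ?g2 = ?a * p c + (p f - p c)] (mod int n)" "[?a * q c + snd ?g2 = ?a * q c + (q f - q c)] (mod int (m * n))"
      by (intro cong_add cong_refl red_cong)+
    moreover have "?a * p c + (p f - p c) = p f - int (v i) * p c" "?a * q c + (q f - q c) = q f - int (v i) * q c"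
      by (simp_all add: algebra_simps)
    ultimately have 2: "[?a * p c + fst ?g2 = p f - int (v i) * p c] (mod int n)" "[?a * q c + snd ?g2 = q f - int (v i) * q c] (mod int (m * n))"
      by metis+
    show ?thesis unfolding gcomb1 fst_conv snd_conv
      by (rule elt_eq[OF _ cong_trans[OF conjunct2[OF v[OF i]] cong_sym[OF 2(1)]] cong_trans[OF conjunct1[OF v[OF i]] cong_sym[OF 2(2)]]])
        (use i EX(4) in blast)
  qed
  obtain h where h: "bij_betw h {1..card Y} Y"
    "\<forall>g :: nat \<Rightarrow> int \<times> int. image_mset g (mset_set Y) = image_mset (\<lambda>i. g (h i)) (mset_set {1..card Y})"
    using reindex_mset[OF fY] by blast
  have hY: "h i \<in> Y" if "i \<in> {1..n - 1}" for i using that h(1) cY by (auto simp: bij_betw_def)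
  define z where "z i = int (v (h i)) - 1" for i
  have mX: "mset_set X = mset_set (X - Y) + mset_set Y"
    using mset_set_Union[of "X - Y" Y] EX(6) fY YX by (simp add: Un_absorb2 Diff_disjoint Int_commute)
  have "card (X - Y) = j * n - (n - 1)" using card_Diff_subset[OF fY YX] cY j(3) by simp
  moreover obtain j' where j': "j = Suc j'" using j2 by (cases j) auto
  ultimately have cXY: "card (X - Y) = (m - s) * n + 1" unfolding s(4) using n1 by simp
  have A: "image_mset (\<lambda>i. (p i, q i)) (mset_set (X - Y)) = replicate_mset ((m - s) * n + 1) (gadd n m ?g1 ?g2)"
    unfolding cXY[symmetric] by (rule image_mset_const) (use EX(6) g12 in auto)
  have B: "image_mset (\<lambda>i. (p i, q i)) (mset_set Y) = image_mset (\<lambda>i. gadd n m (gsmul n m (- z i) ?g1) ?g2) (mset_set {1..n - 1})"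
    unfolding h(2)[rule_format] cY z_def by (rule image_mset_cong) (use gY hY YX in auto)
  have S': "S = replicate_mset (s * n - 1) ?g1 + replicate_mset ((m - s) * n + 1) (gadd n m ?g1 ?g2)
      + image_mset (\<lambda>i. gadd n m (gsmul n m (- z i) ?g1) ?g2) (mset_set {1..n - 1})"
    using S_split[OF kE] unfolding mX image_mset_union A B s(3) by (simp add: add.assoc)
  have zb: "-1 \<le> z i \<and> z i \<le> int n - 2" if "i \<in> {1..n - 1}" for i
  proof -
    have "v (h i) \<le> sum v Y" using fY hY[OF that] by (intro member_le_sum) auto
    then show ?thesis using svY n1 by (simp add: z_def)
  qed
  have sz: "(\<Sum>i = 1..n - 1. z i) = 0"
  proof -
    have "(\<Sum>i = 1..n - 1. z i) = (\<Sum>i\<in>Y. int (v i) - 1)"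
      unfolding z_def using sum.reindex_bij_betw[OF h(1), of "\<lambda>i. int (v i) - 1"] cY by simp
    also have "\<dots> = int (sum v Y) - int (card Y)" by (simp add: sum_subtractf)
    finally show ?thesis using svY cY by simp
  qed
  have "det c f" by (rule cen_det[OF cenL]) (use f X_def in auto)
  then have "coprime (p c * (q f - q c) - q c * (p f - p c)) (int n)" by (simp add: det_def algebra_simps)
  then have dt: "coprime (p c * snd ?g2 - q c * fst ?g2) (int n)" by (rule det_red)
  have "[q c + snd ?g2 = q c + (q f - q c)] (mod int m)" by (intro cong_add cong_refl red_cong)
  then have "[q c + snd ?g2 = q f] (mod int m)" by simp
  then have "coprime (q c + snd ?g2) (int m)" using cf cong_imp_coprime cong_sym by blast
  then have gen: "genset_ok n m ?g1 ?g2"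
    using genset_okI[OF n1 m1, of ?g1 ?g2] rng cL red_in_grp[OF n1 m1] dt by (simp add: mult.commute)
  show ?thesis
  \<comment> \<open>For \<open>s \<ge> 2\<close> there are at least \<open>2n-1\<close> copies of
    \<open>c\<close>, which gives \<open>q f = q c\<close> modulo \<open>m\<close>, and hence
    \<open>n g2 = 0\<close> as form (c) demands.\<close>
  proof (cases "s = 1")
    case True
    have "form2d n m S ?g1 ?g2" unfolding form2d_def
      using gen zb sz S' True by (intro conjI exI[of _ z]) auto
    then show ?thesis by blast
  next
    case False
    then have "2 * n \<le> s * n" using s(1) by (intro mult_le_mono1) linarith
    then have "2 * n - 1 \<le> card E" using s(3) by linarith
    then have "int m dvd q f - q c" using cf2 by (simp add: cong_iff_dvd_diff)
    then have "int m dvd snd ?g2" using red_cong(4)[where n = n and m = m and a = "p f - p c" and b = "q f - q c"] cong_dvd_iff by blast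
    then have "gsmul n m (int n) ?g2 = (0, 0)" unfolding gsmul_zero_iff by (simp add: mult.commute mult_dvd_mono)
    then have "form2c n m S ?g1 ?g2" unfolding form2c_def
      using gen zb sz S' s(1,2) by (intro conjI exI[of _ s] exI[of _ z]) auto
    then show ?thesis by blast
  qed
qed

text \<open>Now \<open>c\<close> has order \<open>m n\<close> and becomes \<open>e2\<close>. Since
  \<open>q c\<close> is a unit modulo \<open>m\<close>, a suitable multiple of \<open>c\<close> can
  be removed from a term of \<open>X\<close> to leave an element \<open>e1\<close> of order
  \<open>n\<close>, and the coordinates modulo \<open>n\<close> lift to coordinates modulo
  \<open>m n\<close>.\<close>

lemma shape_form2b:
  assumes sE: "card E = m * n - 1"
  shows "\<exists>a b. form2b n m S a b"
proof -
  have mn: "2 * n \<le> m * n" using m2 by (rule mult_le_mono1)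
  then have lE: "2 * n - 1 \<le> card E" using sE by linarith
  have kE: "[q e = q c] (mod int (m * n))" if "e \<in> E" for e by (rule E_const_large[OF lE that cE])
  have "card E + card X = m * n + n - 1" using card_Un_disjoint[OF EX(5,6,1)] EX(2) cardL' by simp
  then have cX: "card X = n" using sE mn n1 by linarith
  have cc0: "coprime (q c) (int m)"
  proof -
    obtain m' where m': "m = Suc m'" using m2 by (cases m) auto
    have "(m - 1) * n \<le> card E" unfolding sE m' using n1 by simp
    moreover have "0 * n + (n - 1) \<le> card X" using cX by simp
    ultimately have "\<exists>B. fam B (m - 1 + 0) \<and> (\<forall>i<m - 1 + 0. card (B i) = n \<and> B i \<subseteq> E \<union> X) \<and> (1 \<le> m - 1 \<longrightarrow> B (m - 1 + 0 - 1) \<subseteq> E)"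
      by (intro EX_blocks subset_refl)
    moreover have "m - 1 + 0 - 1 = m - 2" "1 \<le> m - 1" using m2 by linarith+
    ultimately obtain B where F: "fam B (m - 1)" "\<forall>i<m - 1. card (B i) = n" "B (m - 2) \<subseteq> E" unfolding add_0_right by metis
    interpret D: minimal_dec n m p q L B by (rule dec_of_fam[OF F(1)]) (use F(2) in simp)
    have l: "m - 2 < m - 1" using m2 by linarith
    have "[sum q (B (m - 2)) = int (card (B (m - 2))) * q c] (mod int (m * n))" using F(3) kE by (intro sum_cong_const) blast
    then have "[int n * kap (B (m - 2)) = int n * q c] (mod int (m * n))" using kap_mult[OF D.BL(2)[OF l]] F(2) l by simp
    then have 1: "[kap (B (m - 2)) = q c] (mod int m)" using cong_scale_iff[of n] n1 by simp
    have "[D.\<gamma> = q c] (mod int m)" by (rule cong_trans[OF cong_sym[OF D.kap_B[OF l]] 1])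
    then show ?thesis using D.cop_\<gamma> cong_imp_coprime by blast
  qed
  obtain u where u: "[q c * u = 1] (mod int m)" using cc0 cong_solve_coprime_int by blast
  then have ud: "int m dvd q c * u - 1" by (simp add: cong_iff_dvd_diff)
  obtain o' where o: "o' \<in> X" using cX n3 by fastforce
  \<comment> \<open>\<open>t\<close> solves \<open>t * q c = q o'\<close> modulo \<open>m\<close>,
    so that \<open>m\<close> divides the second coordinate of \<open>o' - t c\<close>.\<close>
  define t where "t = q o' * u"
  define P where "P = p o' - t * p c" define Q where "Q = q o' - t * q c"
  let ?D = "red n m (P, Q)"
  have mQ: "int m dvd Q"
  proof -
    have "Q = - (q o' * (q c * u - 1))" by (simp add: Q_def t_def algebra_simps)
    then show ?thesis using ud by simp
  qed
  have "\<exists>y. [p i = y * p c + P] (mod int n) \<and> [q i = y * q c + Q] (mod int (m * n))" if i: "i \<in> X" for i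
  proof -
    define D where "D = int (x i) - int (x o')"
    have df: "int n dvd f i - f o' - D * f c" if f: "f = p \<or> f = q" for f
    proof -
      have "[f i = int (x i) * f c + 1 * f d] (mod int n)" "[f o' = int (x o') * f c + 1 * f d] (mod int n)"
        using x(3)[OF i] x(3)[OF o] f by (auto simp: lin_def)
      then have "int n dvd (f i - (int (x i) * f c + 1 * f d)) - (f o' - (int (x o') * f c + 1 * f d))"
        unfolding cong_iff_dvd_diff by (rule dvd_diff)
      then show ?thesis by (simp add: D_def algebra_simps)
    qed
    obtain b where b: "q i - q o' - D * q c = int n * b" using df[of q] by (auto elim: dvdE)
    \<comment> \<open>The summand \<open>n b u\<close> corrects the second coordinate: multiplied by
      \<open>q c\<close> it is \<open>n b\<close> modulo \<open>m n\<close>, and modulo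
      \<open>n\<close> it contributes nothing.\<close>
    let ?y = "t + D + int n * (b * u)"
    have "int n dvd (p i - p o' - D * p c) - int n * (b * u * p c)" using df[of p] by (rule dvd_diff[OF _ dvd_triv_left]) simp
    then have 1: "[p i = ?y * p c + P] (mod int n)" unfolding cong_iff_dvd_diff P_def by (simp add: algebra_simps)
    have "q i - (?y * q c + Q) = (q i - q o' - D * q c) - int n * (b * u * q c)" unfolding Q_def by (simp add: algebra_simps)
    also have "\<dots> = int n * (- (b * (q c * u - 1)))" unfolding b by (simp add: algebra_simps)
    finally have "q i - (?y * q c + Q) = int n * (- (b * (q c * u - 1)))" .
    moreover have "int (m * n) dvd int n * (- (b * (q c * u - 1)))"
      using ud by (simp add: mult.commute[of "int m"] mult_dvd_mono)
    ultimately have 2: "[q i = ?y * q c + Q] (mod int (m * n))" unfolding cong_iff_dvd_diff by simp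
    show ?thesis using 1 2 by blast
  qed
  then obtain y where y: "\<And>i. i \<in> X \<Longrightarrow> [p i = y i * p c + P] (mod int n) \<and> [q i = y i * q c + Q] (mod int (m * n))" by metis
  define w where "w i = y i mod int (m * n)" for i
  have mn0: "0 < int (m * n)" using n1 m1 by simp
  have wb: "0 \<le> w i \<and> w i \<le> int (m * n) - 1" for i using mn0 pos_mod_bound[OF mn0, of "y i"] by (simp add: w_def)
  have wy: "[w i = y i] (mod int (m * n))" "[w i = y i] (mod int n)" for i
  proof -
    show 1: "[w i = y i] (mod int (m * n))" by (simp add: w_def cong_def)
    show "[w i = y i] (mod int n)" by (rule cong_dvd_modulus[OF 1]) simp
  qed
  have elt: "(p i, q i) = gadd n m (gsmul n m (w i) (p c, q c)) ?D" if i: "i \<in> X" for i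
  proof -
    have 2: "[w i * p c + fst ?D = y i * p c + P] (mod int n)" "[w i * q c + snd ?D = y i * q c + Q] (mod int (m * n))"
      by (intro cong_add cong_scalar_right wy red_cong)+
    show ?thesis unfolding gcomb1 fst_conv snd_conv
      by (rule elt_eq[OF _ cong_trans[OF conjunct1[OF y[OF i]] cong_sym[OF 2(1)]] cong_trans[OF conjunct2[OF y[OF i]] cong_sym[OF 2(2)]]])
        (use i EX(4) in blast)
  qed
  obtain h where h: "bij_betw h {1..card X} X"
    "\<forall>g :: nat \<Rightarrow> int \<times> int. image_mset g (mset_set X) = image_mset (\<lambda>i. g (h i)) (mset_set {1..card X})"
    using reindex_mset[OF EX(6)] by blast
  have hX: "h i \<in> X" if "i \<in> {1..n}" for i using that h(1) cX by (auto simp: bij_betw_def)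
  have "image_mset (\<lambda>i. (p i, q i)) (mset_set X) = image_mset (\<lambda>i. gadd n m (gsmul n m (w (h i)) (p c, q c)) ?D) (mset_set {1..n})"
    unfolding h(2)[rule_format] cX by (rule image_mset_cong) (use elt hX in auto)
  then have S': "S = replicate_mset (m * n - 1) (p c, q c)
      + image_mset (\<lambda>i. gadd n m (gsmul n m (w (h i)) (p c, q c)) ?D) (mset_set {1..n})"
    using S_split[OF kE] sE by simp
  have cEi: "int (card E) = int (m * n) - 1" unfolding sE using mn n1 by (simp add: of_nat_diff)
  have fL: "sum f L = sum f E + sum f X" for f :: "nat \<Rightarrow> int" using sum.union_disjoint[OF EX(5,6,1), of f] EX(2) by simp
  \<comment> \<open>The whole sequence has sum zero; with \<open>m n - 1\<close> copies of
    \<open>c\<close> and \<open>n\<close> copies of \<open>e1\<close> this reads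
    \<open>(sum y X - 1) c = 0\<close>. The order of \<open>c\<close> turns it into the required
    congruence modulo \<open>m n\<close>.\<close>
  have Y1: "int n dvd (sum y X - 1) * p c"
  proof -
    have "[sum p E = int (card E) * p c] (mod int n)" using eE by (intro sum_cong_const) (auto simp: eqv_def)
    moreover have "[sum p X = (\<Sum>i\<in>X. y i * p c + P)] (mod int n)" using y by (intro cong_sum) blast
    ultimately have "[sum p E + sum p X = int (card E) * p c + (\<Sum>i\<in>X. y i * p c + P)] (mod int n)" by (rule cong_add)
    moreover have "int n dvd sum p E + sum p X" using zsL unfolding fL[symmetric] by (simp add: zs_def)
    ultimately have "int n dvd int (card E) * p c + (\<Sum>i\<in>X. y i * p c + P)" using cong_dvd_iff by blast
    then have "int n dvd (int (card E) * p c + (\<Sum>i\<in>X. y i * p c + P)) - int n * (int m * p c + P)" by (rule dvd_diff) simp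
    moreover have "(int (card E) * p c + (\<Sum>i\<in>X. y i * p c + P)) - int n * (int m * p c + P) = (sum y X - 1) * p c"
    proof -
      have "(\<Sum>i\<in>X. y i * p c + P) = sum y X * p c + int n * P" by (simp add: sum.distrib sum_distrib_right cX)
      then show ?thesis unfolding cEi by (simp add: algebra_simps)
    qed
    ultimately show ?thesis by simp
  qed
  have Y2: "int (m * n) dvd (sum y X - 1) * q c"
  proof -
    have "[sum q E = int (card E) * q c] (mod int (m * n))" using kE by (intro sum_cong_const)
    moreover have "[sum q X = (\<Sum>i\<in>X. y i * q c + Q)] (mod int (m * n))" using y by (intro cong_sum) blast
    ultimately have "[sum q E + sum q X = int (card E) * q c + (\<Sum>i\<in>X. y i * q c + Q)] (mod int (m * n))" by (rule cong_add)
    moreover have "int (m * n) dvd sum q E + sum q X" using dvd_sum_q unfolding fL[symmetric] .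
    ultimately have "int (m * n) dvd int (card E) * q c + (\<Sum>i\<in>X. y i * q c + Q)" using cong_dvd_iff by blast
    moreover have "int (m * n) dvd int (m * n) * q c + int n * Q" using mQ by (intro dvd_add) (auto simp: mult.commute[of "int m"] mult_dvd_mono)
    ultimately have "int (m * n) dvd (int (card E) * q c + (\<Sum>i\<in>X. y i * q c + Q)) - (int (m * n) * q c + int n * Q)" by (rule dvd_diff)
    moreover have "(int (card E) * q c + (\<Sum>i\<in>X. y i * q c + Q)) - (int (m * n) * q c + int n * Q) = (sum y X - 1) * q c"
    proof -
      have "(\<Sum>i\<in>X. y i * q c + Q) = sum y X * q c + int n * Q" by (simp add: sum.distrib sum_distrib_right cX)
      then show ?thesis unfolding cEi by (simp add: algebra_simps)
    qed
    ultimately show ?thesis by simp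
  qed
  have "int n dvd int (m * n)" by simp
  then have Y3: "int n dvd (sum y X - 1) * q c" using Y2 by (rule dvd_trans)
  have "int n dvd sum y X - 1" by (rule lin_indep(1)[OF dcd, where t = 0]) (use Y1 Y3 in auto)
  then obtain a where a: "sum y X - 1 = int n * a" by (elim dvdE)
  have "int m dvd a * q c" using Y2 n1 unfolding a by (simp add: mult.commute[of "int m"] mult.assoc)
  then have "int m dvd a" using cc0 by (simp add: coprime_commute coprime_dvd_mult_left_iff)
  then have "int (m * n) dvd sum y X - 1" unfolding a by (simp add: mult.commute[of "int m"] mult_dvd_mono)
  then have "[sum y X = 1] (mod int (m * n))" by (simp add: cong_iff_dvd_diff)
  moreover have "[sum w X = sum y X] (mod int (m * n))" by (intro cong_sum wy)
  ultimately have "[sum w X = 1] (mod int (m * n))" using cong_trans by blast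
  moreover have "(\<Sum>i = 1..n. w (h i)) = sum w X" using sum.reindex_bij_betw[OF h(1), of w] cX by simp
  ultimately have sw: "(\<Sum>i = 1..n. w (h i)) mod int (m * n) = 1 mod int (m * n)" by (simp add: cong_def)
  have "det c o'" by (rule cen_det[OF cenL]) (use o X_def in auto)
  then have "coprime (p c * Q - q c * P) (int n)" by (simp add: det_def P_def Q_def algebra_simps)
  then have "coprime (p c * snd ?D - q c * fst ?D) (int n)" by (rule det_red)
  then have dt: "coprime (fst ?D * q c - p c * snd ?D) (int n)"
    by (metis coprime_minus_left_iff minus_diff_eq mult.commute)
  have "int m dvd snd ?D" using red_cong(4)[where n = n and m = m and a = P and b = Q] mQ cong_dvd_iff by blast
  then have "basis_ok n m ?D (p c, q c)"
    using basis_okI[OF n1 m1, of ?D "(p c, q c)"] rng cL red_in_grp[OF n1 m1] dt cc0 by simp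
  then have "form2b n m S ?D (p c, q c)"
    unfolding form2b_def using wb sw S' by (intro conjI exI[of _ "\<lambda>i. w (h i)"]) auto
  then show ?thesis by blast
qed

end

text \<open>The number of copies of \<open>c\<close> decides: \<open>m n - 1\<close> copies give
  (b). Otherwise at least \<open>2n-1\<close> copies make \<open>q c\<close> a unit modulo
  \<open>m\<close> and give (c) or (d). With \<open>n-1\<close> copies, either an exchange among
  them is possible and (a), (c) or (d) results, or \<open>recenter\<close> leads back to
  (b).\<close>

lemma forms_centered:
  assumes rng: "\<forall>i\<in>L. (p i, q i) \<in> grp n m" and S: "S = image_mset (\<lambda>i. (p i, q i)) (mset_set L)"
  shows "\<exists>a b. form2a n m S a b \<or> form2b n m S a b \<or> form2c n m S a b \<or> form2d n m S a b"
proof -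
  obtain j where j: "1 \<le> j" "j \<le> m" "card X = j * n" "card E = (m + 1 - j) * n - 1" using sizes by blast
  show ?thesis
  proof (cases "j = 1")
    case True
    then have "card E = m * n - 1" using j(4) by simp
    then show ?thesis using shape_form2b[OF rng S] by blast
  next
    case False
    then have "2 * n \<le> j * n" using j(1) by (intro mult_le_mono1) linarith
    then have big: "2 * n \<le> card X" using j(3) by simp
    show ?thesis
    proof (cases "2 * n - 1 \<le> card E")
      case True
      have kE: "[q e = q c] (mod int (m * n))" if "e \<in> E" for e by (rule E_const_large[OF True that cE])
      have nd: "\<not> int m dvd q c"
      proof
        assume dv: "int m dvd q c"
        have "0 < card X" using big n3 by linarith
        then obtain i where i: "i \<in> X" by (auto simp: card_gt_0_iff)
        have "card (X - {i}) > 0" using big n3 i EX(6) by simp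
        then obtain y where y: "y \<in> X" "i \<noteq> y" by (metis Diff_iff card_gt_0_iff ex_in_conv singletonI)
        obtain I where s: "sel i y I" using sel_ex[OF big i y(1,1,2,2)] by blast
        obtain g where g: "coprime g (int m)" "[g = q c] (mod int m)" using T_swap[OF kE big s] True by blast
        then have "coprime (q c) (int m)" using cong_imp_coprime by blast
        then have "is_unit (int m)" by (rule coprime_common_divisor[OF _ dv dvd_refl])
        then show False using m2 by simp
      qed
      have "\<exists>a b. form2c n m S a b \<or> form2d n m S a b" by (rule shape_form2cd[OF rng S kE big nd])
      then show ?thesis by blast
    next
      case small: False
      have "m + 1 - j = 1"
      proof (rule ccontr)
        assume "m + 1 - j \<noteq> 1"
        then have "2 * n \<le> (m + 1 - j) * n" using j(2) by (intro mult_le_mono1) linarith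
        then show False using small j(4) by linarith
      qed
      then have sE: "card E = n - 1" using j(4) by simp
      show ?thesis
      proof (cases "\<exists>I\<subseteq>X. card I = n \<and> 1 \<le> r I \<and> r I \<le> n - 2")
        case True
        then obtain I where I: "I \<subseteq> X" "card I = n" "1 \<le> r I" "r I \<le> n - 2" by blast
        have kE: "[q e = q c] (mod int (m * n))" if "e \<in> E" for e by (rule E_const_small[OF big sE I that cE])
        show ?thesis
        proof (cases "int m dvd q c")
          case dv: True
          have "\<exists>a b. form2a n m S a b" by (rule shape_form2a[OF rng S kE big dv sE])
          then show ?thesis by blast
        next
          case nd: False
          have "\<exists>a b. form2c n m S a b \<or> form2d n m S a b" by (rule shape_form2cd[OF rng S kE big nd])
          then show ?thesis by blast
        qed
      next
        case False
        have "r I = 0 \<or> r I = n - 1" if I: "I \<subseteq> X" "card I = n" for I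
        proof -
          have "\<not> (1 \<le> r I \<and> r I \<le> n - 2)" using False I by blast
          then show ?thesis using r_lt[of I] by linarith
        qed
        from recenter[OF big sE this] obtain c' where c': "c' \<in> L" "cen L c' c" "card {i\<in>L. eqv i c'} = m * n - 1" by blast
        interpret C: centered n m p q L c' c by unfold_locales (use n3 c' in auto)
        have "card C.E = m * n - 1" using c'(3) by (simp add: C.E_def)
        then show ?thesis using C.shape_form2b[OF rng S] by blast
      qed
    qed
  qed
qed

end

section \<open>The structural property\<close>

lemma zs_short_complete:
  fixes p q :: "nat \<Rightarrow> int"
  assumes n: "n \<ge> 2" and fin: "finite R" and card: "card R = 2 * n - 1"
    and short: "\<And>A. A \<subseteq> R \<Longrightarrow> zs n p q A \<Longrightarrow> 2 * n - 2 < card A"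
  shows "zs n p q R"
proof -
  have dav: "davenport_bound n" using eta_davenport_bound[of n] n by simp
  have c: "2 * n - 1 \<le> card R" using card by simp
  obtain J where J: "J \<subseteq> R" "zs n p q J" by (rule davenport_boundD[OF dav fin c])
  have "card R \<le> card J" using short[OF J] card by linarith
  then have "J = R" using card_seteq[OF fin J(1)] by blast
  then show ?thesis using J(2) by simp
qed

text \<open>For \<open>k = 0\<close> the hypothesis speaks about \<open>2n-2\<close> terms completed
  by the negative of their sum. Removing any term from the zero-sum \<open>R\<close> and completing
  again restores it.\<close>

lemma square_form2a:
  fixes p q :: "nat \<Rightarrow> int"
  assumes sp: "structural_property n 1 k" and k: "k \<le> 1" and n: "n \<ge> 2" and fin: "finite R" and card: "card R = 2 * n - 1"
    and short: "\<And>A. A \<subseteq> R \<Longrightarrow> zs n p q A \<Longrightarrow> 2 * n - 2 < card A"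
  shows "\<exists>a b. form2a n 1 (image_mset (\<lambda>i. red n 1 (p i, q i)) (mset_set R)) a b"
proof (cases "k = 1")
  case True
  let ?S = "image_mset (\<lambda>i. red n 1 (p i, q i)) (mset_set R)"
  have "\<exists>a b. (k = 0 \<longrightarrow> form2a n 1 (?S + {# gneg n 1 (gsum n 1 ?S) #}) a b) \<and> (k = 1 \<longrightarrow> form2a n 1 ?S a b) \<and>
    (2 \<le> k \<and> k \<le> n - 2 \<longrightarrow> form3a n 1 k ?S a b) \<and> (k = n - 1 \<longrightarrow> form4a n 1 ?S a b)"
  proof (rule structural_square[OF sp n _ fin _ _ refl])
    show "2 * n - 1 - k < card A" if "A \<subseteq> R" "zs n p q A" for A using short[OF that] True by simp
  qed (use True n card in auto)
  then show ?thesis using True by blast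
next
  case False
  then have k0: "k = 0" using k by simp
  obtain i where i: "i \<in> R" using card n by fastforce
  let ?R = "R - {i}"
  let ?S = "image_mset (\<lambda>i. red n 1 (p i, q i)) (mset_set ?R)"
  have fR: "finite ?R" using fin by simp
  have "\<exists>a b. (k = 0 \<longrightarrow> form2a n 1 (?S + {# gneg n 1 (gsum n 1 ?S) #}) a b) \<and> (k = 1 \<longrightarrow> form2a n 1 ?S a b) \<and>
    (2 \<le> k \<and> k \<le> n - 2 \<longrightarrow> form3a n 1 k ?S a b) \<and> (k = n - 1 \<longrightarrow> form4a n 1 ?S a b)"
  proof (rule structural_square[OF sp n _ fR _ _ refl])
    show cR: "card ?R = 2 * n - 2 + k" using card i fin k0 by simp
    fix A assume A: "A \<subseteq> ?R" "zs n p q A"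
    have "card A \<le> 2 * n - 2" using card_mono[OF fR A(1)] cR k0 by simp
    moreover have "2 * n - 2 < card A" using A by (intro short) auto
    ultimately show "2 * n - 1 - k < card A" by simp
  qed (use k0 in simp)
  then obtain a b where ab: "form2a n 1 (?S + {# gneg n 1 (gsum n 1 ?S) #}) a b" using k0 by blast
  have z: "zs n p q R" by (rule zs_short_complete[OF n fin card short])
  have "sum f R = f i + sum f ?R" for f :: "nat \<Rightarrow> int" by (rule sum.remove[OF fin i])
  then have d: "int n dvd p i + sum p ?R" "int n dvd q i + sum q ?R" using z by (simp_all add: zs_def)
  have "gneg n 1 (gsum n 1 ?S) = gneg n 1 (red n 1 (sum p ?R, sum q ?R))"
    using gsum_image_red[OF fR] by (rule arg_cong)
  also have "\<dots> = red n 1 (- sum p ?R, - sum q ?R)"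
    unfolding gneg_def gsmul_def red_def by (simp add: mod_minus_eq)
  also have "\<dots> = red n 1 (p i, q i)"
  proof -
    have "int n dvd - (p i + sum p ?R)" "int n dvd - (q i + sum q ?R)" using d unfolding dvd_minus_iff .
    moreover have "- (p i + sum p ?R) = - sum p ?R - p i" "- (q i + sum q ?R) = - sum q ?R - q i" by simp_all
    ultimately have "int n dvd - sum p ?R - p i" "int n dvd - sum q ?R - q i" by (simp_all only:)
    then show ?thesis unfolding red_eq_iff by simp
  qed
  finally have "?S + {# gneg n 1 (gsum n 1 ?S) #} = add_mset (red n 1 (p i, q i)) ?S" by simp
  also have "\<dots> = image_mset (\<lambda>i. red n 1 (p i, q i)) (mset_set (insert i ?R))" using fR by (subst mset_set.insert) auto
  also have "insert i ?R = R" using i by blast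
  finally have e: "?S + {# gneg n 1 (gsum n 1 ?S) #} = image_mset (\<lambda>i. red n 1 (p i, q i)) (mset_set R)" .
  show ?thesis using ab unfolding e by (intro exI)
qed

text \<open>The basis element \<open>e1\<close> of form (a) is the center: the other terms lie in
  \<open>e2 + <e1>\<close>, and none of them equals \<open>e1\<close>, so its multiplicity is
  exactly \<open>n-1\<close>.\<close>

lemma (in short_zs_free) center_of_form2a:
  assumes fin: "finite R" and F: "form2a n 1 (image_mset (\<lambda>i. red n 1 (p i, q i)) (mset_set R)) a b"
  shows "\<exists>w\<in>R. \<exists>z\<in>R. cen R w z \<and> card {i\<in>R. eqv i w} = n - 1"
proof -
  let ?f = "\<lambda>i. red n 1 (p i, q i)"
  obtain x where bas: "basis_ok n 1 a b"
    and S: "image_mset ?f (mset_set R) = replicate_mset (n - 1) a + image_mset (\<lambda>i. gadd n 1 (gsmul n 1 (x i) a) b) (mset_set {1..1 * n})"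
    using F unfolding form2a_def by (elim conjE exE, intro that) assumption+
  have n1: "n \<ge> 1" using n2 by simp
  have ab: "a \<in> grp n 1" "b \<in> grp n 1" using basis_ok_grp[OF bas] by auto
  have det0: "coprime (fst a * snd b - fst b * snd a) (int n)"
    using is_basis_det[OF n2 _ , of 1 a b] bas by (simp add: basis_ok_def)
  have img: "?f ` R = set_mset (image_mset ?f (mset_set R))" using fin by simp
  have fi: "?f i = a \<or> (\<exists>t. ?f i = gadd n 1 (gsmul n 1 (x t) a) b)" if "i \<in> R" for i
  proof -
    have "?f i \<in># image_mset ?f (mset_set R)" using that fin by simp
    then have "?f i \<in># replicate_mset (n - 1) a \<or> ?f i \<in># image_mset (\<lambda>i. gadd n 1 (gsmul n 1 (x i) a) b) (mset_set {1..1 * n})"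
      unfolding S union_iff .
    then show ?thesis
    proof
      assume "?f i \<in># image_mset (\<lambda>i. gadd n 1 (gsmul n 1 (x i) a) b) (mset_set {1..1 * n})"
      then have "?f i \<in> (\<lambda>i. gadd n 1 (gsmul n 1 (x i) a) b) ` {1..1 * n}" by (simp only: in_image_mset finite_set_mset_mset_set finite_atLeastAtMost)
      then obtain t where "?f i = gadd n 1 (gsmul n 1 (x t) a) b" by (rule imageE)
      then show ?thesis by (intro disjI2 exI)
    qed (metis in_replicate_mset)
  qed
  have "a \<in> ?f ` R" unfolding img S using n2 by simp
  then obtain w where w: "w \<in> R" "?f w = a" by blast
  have "gadd n 1 (gsmul n 1 (x 1) a) b \<in># image_mset (\<lambda>i. gadd n 1 (gsmul n 1 (x i) a) b) (mset_set {1..1 * n})"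
    unfolding in_image_mset by (rule imageI) (use n2 in simp)
  then have "gadd n 1 (gsmul n 1 (x 1) a) b \<in> ?f ` R" unfolding img S union_iff by (rule disjI2)
  then obtain z where "gadd n 1 (gsmul n 1 (x 1) a) b = ?f z" "z \<in> R" by (rule imageE)
  then have z: "z \<in> R" "?f z = gadd n 1 (gsmul n 1 (x 1) a) b" by (simp_all only:)
  have wa: "[p w = fst a] (mod int n)" "[q w = snd a] (mod int n)"
  proof -
    have "?f w = red n 1 a" using w red_grp[OF ab(1)] by simp
    then show "[p w = fst a] (mod int n)" "[q w = snd a] (mod int n)" unfolding red_eq_iff by (simp_all add: cong_iff_dvd_diff)
  qed
  have el: "[p i = t * fst a + fst b] (mod int n)" "[q i = t * snd a + snd b] (mod int n)" if "?f i = gadd n 1 (gsmul n 1 t a) b" for i t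
    using that unfolding gcomb1 red_eq_iff by (simp_all add: cong_iff_dvd_diff)
  have eq: "eqv i w \<longleftrightarrow> ?f i = a" for i
    unfolding w(2)[symmetric] red_eq_iff eqv_def by (simp add: cong_iff_dvd_diff)
  have dwz: "det w z"
  proof -
    have "[p w * q z - p z * q w = fst a * (x 1 * snd a + snd b) - (x 1 * fst a + fst b) * snd a] (mod int n)"
      by (intro cong_diff cong_mult wa el[OF z(2)])
    then have "[p w * q z - p z * q w = fst a * snd b - fst b * snd a] (mod int n)" by (simp add: algebra_simps)
    then show ?thesis unfolding det_def using det0 cong_imp_coprime cong_sym by blast
  qed
  have "cen R w z"
    unfolding cen_def
  proof (intro conjI ballI dwz)
    fix i assume "i \<in> R"
    from fi[OF this] show "eqv i w \<or> (\<exists>y. lin i y w 1 z)"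
    proof
      assume "\<exists>t. ?f i = gadd n 1 (gsmul n 1 (x t) a) b"
      then obtain t where t: "?f i = gadd n 1 (gsmul n 1 (x t) a) b" by blast
      have "[(x t - x 1) * p w + 1 * p z = (x t - x 1) * fst a + 1 * (x 1 * fst a + fst b)] (mod int n)"
        "[(x t - x 1) * q w + 1 * q z = (x t - x 1) * snd a + 1 * (x 1 * snd a + snd b)] (mod int n)"
        by (intro cong_add cong_scalar_left wa el[OF z(2)])+
      then have "[(x t - x 1) * p w + 1 * p z = x t * fst a + fst b] (mod int n)"
        "[(x t - x 1) * q w + 1 * q z = x t * snd a + snd b] (mod int n)" by (simp_all add: algebra_simps)
      then have "lin i (x t - x 1) w 1 z" unfolding lin_def
        using cong_trans[OF el(1)[OF t] cong_sym] cong_trans[OF el(2)[OF t] cong_sym] by blast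
      then show ?thesis by blast
    qed (simp add: eq)
  qed
  moreover have "card {i\<in>R. eqv i w} = n - 1"
  proof -
    have ne: "gadd n 1 (gsmul n 1 t a) b \<noteq> a" for t
    proof
      assume "gadd n 1 (gsmul n 1 t a) b = a"
      then have "red n 1 (t * fst a + fst b, t * snd a + snd b) = red n 1 a" using red_grp[OF ab(1)] by (simp add: gcomb1)
      then have "int n dvd (t * fst a + fst b) - fst a" "int n dvd (t * snd a + snd b) - snd a" unfolding red_eq_iff by simp_all
      then have "int n dvd (t - 1) * fst a + 1 * fst b" "int n dvd (t - 1) * snd a + 1 * snd b" by (simp_all add: algebra_simps)
      then have "int n dvd 1" by (rule unimodular_indep(2)[OF det0])
      then show False using n2 by simp
    qed
    have "card {i\<in>R. eqv i w} = count (image_mset ?f (mset_set R)) a" unfolding eq count_image_card[OF fin] ..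
    also have "\<dots> = n - 1 + count (image_mset (\<lambda>i. gadd n 1 (gsmul n 1 (x i) a) b) (mset_set {1..1 * n})) a"
      unfolding S by simp
    also have "count (image_mset (\<lambda>i. gadd n 1 (gsmul n 1 (x i) a) b) (mset_set {1..1 * n})) a = 0"
      using ne by (auto simp: count_image_card)
    finally show ?thesis by simp
  qed
  ultimately show ?thesis using w(1) z(1) by blast
qed

text \<open>Serves \<open>k = 0\<close> and \<open>k = 1\<close> together: the sequence has length
  \<open>m n + n - 1\<close> in both cases, for \<open>k = 0\<close> after completion, and only the
  way in which \<open>str\<close> is obtained depends on \<open>k\<close>.\<close>

lemma forms_small_k:
  assumes n: "n \<ge> 3" and m: "m \<ge> 2" and k: "k \<le> 1" and sp: "structural_property n 1 k"
    and seq: "is_seq n m S" and sz: "size S = m * n + n - 1" and z: "(0, 0) \<notin> sums_le n m (m * n + n - 2) S"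
  shows "\<exists>a b. form2a n m S a b \<or> form2b n m S a b \<or> form2c n m S a b \<or> form2d n m S a b"
proof -
  obtain p q where S: "S = image_mset (\<lambda>i. (p i, q i)) (mset_set {..<size S})"
    using multiset_family by blast
  let ?L = "{..<size S}"
  have rng: "\<forall>i\<in>?L. (p i, q i) \<in> grp n m"
  proof
    fix i assume that: "i \<in> ?L"
    have "(p i, q i) \<in># S" using that by (subst S) simp
    then show "(p i, q i) \<in> grp n m" using seq by (auto simp: is_seq_def)
  qed
  have n2: "n \<ge> 2" using n by simp
  interpret short_zs_free n m 1 p q ?L
  proof
    show "\<not> int (m * n) dvd sum q A" if "A \<subseteq> ?L" "A \<noteq> {}" "card A \<le> m * n + n - 1 - 1" "int n dvd sum p A" for A
      by (rule sums_le_family[OF _ S z that(1,2) _ that(4)]) (use that(3) in auto)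
    show "\<exists>J\<subseteq>I. zs n p q J \<and> card J \<le> 2 * n - 1 - 1" if I: "I \<subseteq> ?L" "2 * n - 1 + 1 \<le> card I" for I
    proof -
      have fI: "finite I" using I(1) finite_subset by blast
      have "2 * n \<le> card I" using I(2) n by linarith
      moreover have "2 * n - 2 = 2 * n - 1 - 1" by simp
      ultimately show ?thesis using short_bound_one[OF n2 fI, of p q] by simp
    qed
  qed (use n m sz in auto)
  interpret minimal_zs n m p q ?L
  proof
    fix R assume g: "good R"
    have R: "R \<subseteq> ?L" "card R = 2 * n - 1" using g n unfolding good_def by simp_all
    have sh: "2 * n - 2 < card A" if "A \<subseteq> R" "zs n p q A" for A
    proof -
      have "2 * n - 1 - 1 < card A" using g that unfolding good_def by blast
      then show ?thesis by simp
    qed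
    have fR: "finite R" by (rule finL'[OF R(1)])
    obtain a b where "form2a n 1 (image_mset (\<lambda>i. red n 1 (p i, q i)) (mset_set R)) a b"
      using square_form2a[OF sp k n2 fR R(2) sh] by blast
    then show "zs n p q R \<and> (\<exists>w\<in>R. \<exists>z\<in>R. cen R w z \<and> card {i\<in>R. eqv i w} = n - 1)"
      using zs_short_complete[OF n2 fR R(2) sh] center_of_form2a[OF fR] by blast
  qed
  obtain B where "minimal_dec n m p q ?L B" using ex_dec by blast
  then interpret D: minimal_dec n m p q ?L B .
  obtain w d where wd: "cen ?L w d" using D.center_all[OF n] by blast
  have "cen D.R w d" by (rule cen_mono[OF wd D.RL])
  from D.rest_center(1)[OF this] obtain c where c: "c \<in> D.R" "eqv w c" by blast
  interpret centered n m p q ?L c d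
    by unfold_locales (use n c D.RL cen_eqv[OF wd c(2)] in auto)
  show ?thesis by (rule forms_centered[OF rng S])
qed

lemma gsum_zero_iff:
  "gsum n m U = (0, 0) \<longleftrightarrow> int n dvd sum_mset (image_mset fst U) \<and> int (m * n) dvd sum_mset (image_mset snd U)"
  by (simp add: gsum_def red_def dvd_eq_mod_eq_0)

text \<open>A zero-sum of the completed sequence containing the new term has a complement that is a zero-sum of \<open>S\<close>.\<close>

lemma complete_to_zero_sum:
  assumes n: "n \<ge> 2" and m: "m \<ge> 1" and seq: "is_seq n m S" and sz: "size S = N"
    and z: "(0, 0) \<notin> sums_le n m N S" and T: "T = S + {# gneg n m (gsum n m S) #}"
  shows "is_seq n m T" "size T = N + 1" "(0, 0) \<notin> sums_le n m N T"
proof -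
  define g where "g = gneg n m (gsum n m S)"
  have gg: "g \<in> grp n m" unfolding g_def gneg_def gsmul_def using n m by (intro red_in_grp) auto
  then show "is_seq n m T" using seq by (auto simp: is_seq_def T g_def)
  show "size T = N + 1" using sz by (simp add: T)
  have zS: "gsum n m V \<noteq> (0, 0)" if "V \<subseteq># S" "1 \<le> size V" for V
  proof
    assume "gsum n m V = (0, 0)"
    moreover have "size V \<le> N" using size_mset_mono[OF that(1)] sz by simp
    ultimately have "(0, 0) \<in> sums_le n m N S" unfolding sums_le_def using that by force
    then show False using z by blast
  qed
  define s1 where "s1 = sum_mset (image_mset fst S)" define s2 where "s2 = sum_mset (image_mset snd S)"
  have "g = red n m (- s1, - s2)"
    unfolding g_def gneg_def gsmul_def gsum_def red_def s1_def s2_def by (simp add: mod_minus_eq)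
  then have g12: "[fst g = - s1] (mod int n)" "[snd g = - s2] (mod int (m * n))" using red_cong(1,2) by metis+
  show "(0, 0) \<notin> sums_le n m N T"
  proof
    assume "(0, 0) \<in> sums_le n m N T"
    then obtain U where U: "U \<subseteq># T" "gsum n m U = (0, 0)" "1 \<le> size U" "size U \<le> N"
      unfolding sums_le_def by force
    have T': "T = add_mset g S" by (simp add: T g_def)
    show False
    proof (cases "U \<subseteq># S")
      case True
      then show False using zS U by blast
    next
      case False
      have "g \<in># U"
      proof (rule ccontr)
        assume ng: "g \<notin># U"
        have "U \<subseteq># S"
        proof (rule mset_subset_eqI)
          fix y
          show "count U y \<le> count S y"
            using mset_subset_eq_count[OF U(1), of y] ng unfolding T' by (cases "y = g") (auto simp: not_in_iff)
        qed
        then show False using False by blast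
      qed
      then obtain U' where U': "U = add_mset g U'" by (metis insert_DiffM)
      have U'S: "U' \<subseteq># S" using U(1) unfolding U' T' by simp
      let ?V = "S - U'"
      have SV: "S = U' + ?V" using U'S by simp
      have d: "int n dvd fst g + sum_mset (image_mset fst U')" "int (m * n) dvd snd g + sum_mset (image_mset snd U')"
        using U(2) unfolding gsum_zero_iff U' by simp_all
      have e: "s1 = sum_mset (image_mset fst U') + sum_mset (image_mset fst ?V)"
        "s2 = sum_mset (image_mset snd U') + sum_mset (image_mset snd ?V)"
        unfolding s1_def s2_def by (subst SV, simp)+
      have "int n dvd fst g + s1" "int (m * n) dvd snd g + s2" using g12 by (simp_all add: cong_iff_dvd_diff)
      from dvd_diff[OF this(1) d(1)] dvd_diff[OF this(2) d(2)] have "gsum n m ?V = (0, 0)"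
        unfolding gsum_zero_iff e by simp
      moreover have "1 \<le> size ?V"
        using U(4) sz size_Diff_submset[OF U'S] unfolding U' by simp
      ultimately show False using zS[of ?V] by simp
    qed
  qed
qed

text \<open>For \<open>n = 2\<close> the lifting goes through the three-valued case, which needs the
  property with \<open>k = 1\<close>. Form (a) with the coefficients 0 and 1 in some order consists
  of \<open>a\<close>, \<open>b\<close>, \<open>a + b\<close>, which is also the form demanded for
  \<open>k = n - 1\<close>.\<close>

lemma structural_property_two:
  assumes sp: "structural_property 2 1 0"
  shows "structural_property 2 1 1"
  unfolding structural_property_def
proof (intro allI impI)
  fix S assume "is_seq 2 1 S \<and> size S = 1 * 2 + 2 - 2 + 1 \<and> (0, 0) \<notin> sums_le 2 1 (1 * 2 + 2 - 1 - 1) S"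
  then have seq: "is_seq 2 1 S" and sz: "size S = 3" and z: "(0, 0) \<notin> sums_le 2 1 2 S" by simp_all
  obtain p q where S: "S = image_mset (\<lambda>i. (p i, q i)) (mset_set {..<size S})"
    using multiset_family by blast
  have gr: "(p i, q i) \<in> grp 2 1" if "i \<in> {..<size S}" for i
  proof -
    have "(p i, q i) \<in># S" using that by (subst S) simp
    then show ?thesis using seq by (auto simp: is_seq_def)
  qed
  have S': "S = image_mset (\<lambda>i. red 2 1 (p i, q i)) (mset_set {..<size S})"
    by (subst S, rule image_mset_cong) (use gr red_grp in auto)
  have sh: "2 * 2 - 2 < card A" if A: "A \<subseteq> {..<size S}" "zs 2 p q A" for A
  proof (rule ccontr)
    assume "\<not> ?thesis"
    then have "card A \<le> 2" by simp
    then have "\<not> int (1 * 2) dvd sum q A" using A by (intro sums_le_family[OF _ S z A(1)]) (auto simp: zs_def)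
    then show False using A(2) by (simp add: zs_def)
  qed
  have "\<exists>a b. form2a 2 1 (image_mset (\<lambda>i. red 2 1 (p i, q i)) (mset_set {..<size S})) a b"
    by (rule square_form2a[OF sp _ _ _ _ sh]) (use sz in auto)
  then obtain a b where ab: "form2a 2 1 S a b" unfolding S'[symmetric] by (elim exE)
  obtain x where bas: "basis_ok 2 1 a b" and x: "\<forall>i\<in>{1..1 * (2::nat)}. 0 \<le> x i \<and> x i \<le> int 2 - 1"
    "(\<Sum>i = 1..1 * (2::nat). x i) mod int 2 = 1 mod int 2"
    and Sx: "S = replicate_mset (2 - 1) a + image_mset (\<lambda>i. gadd 2 1 (gsmul 2 1 (x i) a) b) (mset_set {1..1 * (2::nat)})"
    using ab unfolding form2a_def by (elim conjE exE, intro that) assumption+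
  have i12: "{1..1 * 2} = {1, 2 :: nat}" by auto
  have x': "(x 1 = 0 \<and> x 2 = 1) \<or> (x 1 = 1 \<and> x 2 = 0)"
  proof -
    have "0 \<le> x 1 \<and> x 1 \<le> int 2 - 1" "0 \<le> x 2 \<and> x 2 \<le> int 2 - 1" using x(1) unfolding i12 by blast+
    then have 1: "x 1 = 0 \<or> x 1 = 1" "x 2 = 0 \<or> x 2 = 1" by simp_all linarith+
    have 2: "(x 1 + x 2) mod 2 = 1" using x(2) unfolding i12 by simp
    from 1(1) show ?thesis
    proof
      assume a: "x 1 = 0"
      then have "x 2 \<noteq> 0" using 2 by auto
      then show ?thesis using a 1(2) by blast
    next
      assume a: "x 1 = 1"
      then have "x 2 \<noteq> 1" using 2 by auto
      then show ?thesis using a 1(2) by blast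
    qed
  qed
  have "gadd 2 1 (gsmul 2 1 0 a) b = b" using basis_ok_grp[OF bas] by (simp add: gcomb1 red_grp)
  then have "S = replicate_mset (2 - 1) a + replicate_mset (1 * 2 - 1) b + replicate_mset ((1 - 1) * 2 + 2 - 1) (gadd 2 1 (gsmul 2 1 1 a) b)"
    using Sx x' unfolding i12 by (auto simp: add_ac)
  then have "form4a 2 1 S a b" unfolding form4a_def using bas by (intro conjI exI[of _ 1]) auto
  then show "\<exists>a b. (1 = (0::nat) \<longrightarrow> item2 2 1 (S + {# gneg 2 1 (gsum 2 1 S) #}) a b) \<and> (1 = (1::nat) \<longrightarrow> item2 2 1 S a b) \<and>
    (2 \<le> (1::nat) \<and> (1::nat) \<le> 2 - 2 \<longrightarrow> form3a 2 1 1 S a b \<or> (1 \<noteq> (1::nat) \<and> form3b 2 1 1 S a b)) \<and>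
    (1 = 2 - (1::nat) \<longrightarrow> form4a 2 1 S a b \<or> (1 \<noteq> (1::nat) \<and> form4b 2 1 S a b))"
    using ab by (intro exI[of _ a] exI[of _ b]) (auto simp: item2_def)
qed

lemma item2_two:
  assumes m: "m \<ge> 2" and sp: "structural_property 2 1 1" and seq: "is_seq 2 m S" and sz: "size S = m * 2 + 2 - 1"
    and z: "(0, 0) \<notin> sums_le 2 m (m * 2 + 2 - 2) S"
  shows "\<exists>a b. item2 2 m S a b \<and> (form4a 2 m S a b \<or> form4b 2 m S a b)"
proof -
  have "\<exists>a b. form3a 2 m 1 S a b \<or> form3b 2 m 1 S a b \<or> (1 = 2 - (1::nat) \<and> form4a 2 m S a b)"
    by (rule forms_large_k[OF _ m _ sp seq]) (use sz z in auto)
  then obtain a b where "form3a 2 m (2 - 1) S a b \<or> form3b 2 m (2 - 1) S a b \<or> form4a 2 m S a b" by auto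
  then have "form4a 2 m S a b \<or> form4b 2 m S a b"
    using form4a_of_form3a[of 2 m S a b] form4b_of_form3b[of 2 m S a b] by blast
  moreover have "item2 2 m S a b"
    using calculation form2a_of_form4a[OF m, of S a b] form2d_of_form4b[of m S a b] m unfolding item2_def by auto
  ultimately show ?thesis by blast
qed

theorem theorem1p2:
  fixes n m k :: nat
  assumes "n \<ge> 2" and "m \<ge> 2" and "k \<le> n - 1"
    and "structural_property n 1 k"
  shows "structural_property n m k"
  unfolding structural_property_def
proof (intro allI impI)
  note n = assms(1) and m = assms(2) and kn = assms(3) and sp = assms(4)
  fix S assume "is_seq n m S \<and> size S = m * n + n - 2 + k \<and> (0, 0) \<notin> sums_le n m (m * n + n - 1 - k) S"
  then have seq: "is_seq n m S" and sz: "size S = m * n + n - 2 + k" and z: "(0, 0) \<notin> sums_le n m (m * n + n - 1 - k) S"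
    by auto
  let ?goal = "\<lambda>a b. (k = 0 \<longrightarrow> item2 n m (S + {# gneg n m (gsum n m S) #}) a b) \<and> (k = 1 \<longrightarrow> item2 n m S a b) \<and>
    (2 \<le> k \<and> k \<le> n - 2 \<longrightarrow> form3a n m k S a b \<or> (m \<noteq> 1 \<and> form3b n m k S a b)) \<and>
    (k = n - 1 \<longrightarrow> form4a n m S a b \<or> (m \<noteq> 1 \<and> form4b n m S a b))"
  consider "k = 0" | "k = 1" | "2 \<le> k" "k \<le> n - 2" | "2 \<le> k" "k = n - 1" using kn by linarith
  then show "\<exists>a b. ?goal a b"
  proof cases
    case 1
    let ?T = "S + {# gneg n m (gsum n m S) #}"
    have m1: "m \<ge> 1" using m by simp
    have sz0: "size S = m * n + n - 2" using sz 1 by simp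
    have "(0, 0) \<notin> sums_le n m (m * n + n - 2) S"
    proof
      assume "(0, 0) \<in> sums_le n m (m * n + n - 2) S"
      then obtain U where "U \<subseteq># S" "1 \<le> size U" "size U \<le> m * n + n - 2" "gsum n m U = (0, 0)" unfolding sums_le_def by force
      moreover have "size U \<le> m * n + n - 1 - k" using \<open>size U \<le> m * n + n - 2\<close> 1 by simp
      ultimately have "(0, 0) \<in> sums_le n m (m * n + n - 1 - k) S" unfolding sums_le_def by force
      then show False using z by blast
    qed
    note T = complete_to_zero_sum[OF n m1 seq sz0 this refl]
    have szT: "size ?T = m * n + n - 1" using T(2) n by simp
    have "\<exists>a b. item2 n m ?T a b"
    proof (cases "n = 2")
      case True
      have "structural_property 2 1 1" by (rule structural_property_two) (use sp True 1 in simp)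
      from item2_two[OF m this] T(1,3) szT show ?thesis unfolding True by blast
    next
      case False
      then have n3: "n \<ge> 3" using n by simp
      have "k \<le> 1" using 1 by simp
      from forms_small_k[OF n3 m this sp T(1) szT T(3)] show ?thesis using m unfolding item2_def by auto
    qed
    then show ?thesis using 1 n by auto
  next
    case 2
    have sz1: "size S = m * n + n - 1" using sz 2 n by simp
    have z1: "(0, 0) \<notin> sums_le n m (m * n + n - 2) S" using z 2 by (simp add: numeral_2_eq_2)
    show ?thesis
    \<comment> \<open>For \<open>n = 2\<close> the clauses for \<open>k = 1\<close> and for
      \<open>k = n - 1\<close> apply simultaneously and must hold for the same pair.\<close>
    proof (cases "n = 2")
      case True
      have "structural_property 2 1 1" using sp True 2 by simp
      from item2_two[OF m this] seq sz1 z1 obtain a b where "item2 2 m S a b" "form4a 2 m S a b \<or> form4b 2 m S a b"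
        unfolding True by blast
      then show ?thesis using 2 m True by (intro exI[of _ a] exI[of _ b]) auto
    next
      case False
      then have n3: "n \<ge> 3" using n by simp
      have "k \<le> 1" using 2 by simp
      from forms_small_k[OF n3 m this sp seq sz1 z1] obtain a b where
        "form2a n m S a b \<or> form2b n m S a b \<or> form2c n m S a b \<or> form2d n m S a b" by blast
      then have "item2 n m S a b" using m unfolding item2_def by auto
      then show ?thesis using 2 n3 by (intro exI[of _ a] exI[of _ b]) auto
    qed
  next
    case 3
    then have "(2 \<le> k \<and> k \<le> n - 2) \<or> k = n - 1" by simp
    from forms_large_k[OF n m this sp seq sz z] obtain a b where
      "form3a n m k S a b \<or> form3b n m k S a b" using 3 by auto
    then show ?thesis using 3 m by (intro exI[of _ a] exI[of _ b]) auto
  next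
    case 4
    then have "(2 \<le> k \<and> k \<le> n - 2) \<or> k = n - 1" by simp
    from forms_large_k[OF n m this sp seq sz z] obtain a b where
      "form3a n m k S a b \<or> form3b n m k S a b \<or> form4a n m S a b" by blast
    then have "form4a n m S a b \<or> form4b n m S a b"
      using form4a_of_form3a[OF n] form4b_of_form3b[OF n] 4(2) by blast
    then show ?thesis using 4 m n by (intro exI[of _ a] exI[of _ b]) auto
  qed
qed

end
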